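(* Let $K>0$, $\boldsymbol\alpha=(\alpha_1,\alpha_2,\alpha_3)$ with $\alpha_1,\alpha_2,\alpha_3\ge0$, $\beta>0$ and $x\in[0,K]$, and let $\tilde{\boldsymbol\chi}(x)$ be the $d\times d$ matrix with entries $$\tilde\chi_{ij}(x)=\mathbb E_{x,i}\big(e^{-\alpha_1V(T_\beta)-\alpha_2I(T_\beta)-\alpha_3L(T_\beta)}\mathbf 1_{\{J(T_\beta)=j\}}\big).$$ Then $$\tilde{\boldsymbol\chi}(x)=\boldsymbol\delta_-(x)\,\tilde{\boldsymbol\chi}(0)+\tilde{\boldsymbol\eta}(K-x,\alpha_3,\beta)\,\tilde{\boldsymbol\chi}(K)+\boldsymbol\delta_\star(x),$$ where $\tilde{\boldsymbol\eta}(u,\alpha_3,\beta)=\boldsymbol\eta(u,\alpha_3,\beta)-\boldsymbol\delta_-(K-u)\,\boldsymbol\eta(K,\alpha_3,\beta)$ for $u\in[0,K]$, and where the matrix $\boldsymbol I-\tilde{\boldsymbol P}$ is invertible and $$\begin{pmatrix}\tilde{\boldsymbol\chi}(0)\\ \tilde{\boldsymbol\chi}(K)\end{pmatrix}=\big(\boldsymbol I-\tilde{\boldsymbol P}\big)^{-1}\begin{pmatrix}\tilde{\boldsymbol b}^{\{0\}}\\ \tilde{\boldsymbol b}^{\{K\}}\end{pmatrix}.$$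
   Context: Model. $J$ is a continuous-time Markov chain on $\mathfrak D=\{1,\dots,d\}$ with generator $Q=(q_{ij})$, $q_i:=-q_{ii}=\sum_{j\ne i}q_{ij}$ (irreducibility not assumed). For each $i$, $Y_i$ is a compound Poisson process with arrival rate $\lambda_i\ge 0$ and non-negative jumps distributed as $B_i$, plus a strictly negative linear drift $r_i<0$. For $i\ne j$, $B_{ij}\ge0$ is a random variable. The free process $Y$ starts at $0$, evolves as $Y_i$ while $J$ is in state $i$, and jumps up by an independent copy of $B_{ij}$ when $J$ jumps from $i$ to $j\neq i$; all ingredients are independent. The workload $V$ with $V(0)=x\in[0,K]$ is the double reflection of $x+Y$ at $0$ and $K$ (a jump that would bring the workload above $K$ is truncated so that the workload becomes $K$). $I(t)$ is the total time in $[0,t]$ during which the workload is $0$ (idle time), and $L(t)$ is the cumulative amount of work lost in $[0,t]$ due to truncation at level $K$. $T_\beta$ is exponential with parameter $\beta$, independent of everything else. Subscript $i$ means $J(0)=i$; subscripts $x,i$ mean $V(0)=x$, $J(0)=i$. Stopping times: $\sigma(u)=\inf\{t\ge0:-Y(t)>u\}$, $\tau(u)=\inf\{t\ge0:Y(t)>u\}$, $u\ge0$. Matrices ($d\times d$): $\delta_{-,ij}(x)=\mathbb P_i(\sigma(x)\le\min\{\tau(K-x),T_\beta\},\,J(\sigma(x))=j)$; $\delta_{\star,ij}(x)=e^{-\alpha_1 x}\,\mathbb E_i\big(e^{-\alpha_1Y(T_\beta)}\mathbf 1_{\{T_\beta\le\min\{\sigma(x),\tau(K-x)\},\,J(T_\beta)=j\}}\big)$;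 $\eta_{ij}(u,\alpha,\beta)=\mathbb E_i\big(e^{-\alpha(Y(\tau(u))-u)}\mathbf 1_{\{\tau(u)\le T_\beta,\,J(\tau(u))=j\}}\big)$; $\tilde\eta_{ij}(u,\alpha,\beta)=\mathbb E_i\big(e^{-\alpha(Y(\tau(u))-u)}\mathbf 1_{\{\tau(u)\le\min\{\sigma(K-u),T_\beta\},\,J(\tau(u))=j\}}\big)$ for $u\in[0,K]$. Let $\tilde\omega_i=\beta+q_i+\lambda_i$. The $2d\times 2d$ matrix $\tilde{\boldsymbol P}$ consists of $d\times d$ blocks, $\tilde{\boldsymbol P}=\begin{pmatrix}\tilde{\boldsymbol P}^{\{0,0\}}&\tilde{\boldsymbol P}^{\{0,K\}}\\ \tilde{\boldsymbol P}^{\{K,0\}}&\tilde{\boldsymbol P}^{\{K,K\}}\end{pmatrix}$, where $$\tilde P^{\{0,0\}}_{i\ell}=\frac1{\tilde\omega_i+\alpha_2}\Big(\lambda_i\int_{[0,K]}\mathbb P(B_i\in dy)\,\delta_{-,i\ell}(y)+\sum_{k\ne i}q_{ik}\int_{[0,K]}\mathbb P(B_{ik}\in dy)\,\delta_{-,k\ell}(y)\Big),$$ $$\tilde P^{\{0,K\}}_{i\ell}=\frac1{\tilde\omega_i+\alpha_2}\Big(\lambda_i\Big[\int_{[0,K]}\mathbb P(B_i\in dy)\,\tilde\eta_{i\ell}(K-y,\alpha_3,\beta)+\mathbf 1_{\{i=\ell\}}\int_{(K,\infty)}\mathbb P(B_i\in dy)\,e^{-\alpha_3(y-K)}\Big]$$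 $$\qquad+\sum_{k\ne i}q_{ik}\Big[\int_{[0,K]}\mathbb P(B_{ik}\in dy)\,\tilde\eta_{k\ell}(K-y,\alpha_3,\beta)+\mathbf 1_{\{k=\ell\}}\int_{(K,\infty)}\mathbb P(B_{ik}\in dy)\,e^{-\alpha_3(y-K)}\Big]\Big),$$ $$\tilde b^{\{0\}}_{ij}=\frac1{\tilde\omega_i+\alpha_2}\Big(\beta\mathbf 1_{\{i=j\}}+\lambda_i\int_{[0,K]}\mathbb P(B_i\in dy)\,\delta_{\star,ij}(y)+\sum_{k\ne i}q_{ik}\int_{[0,K]}\mathbb P(B_{ik}\in dy)\,\delta_{\star,kj}(y)\Big),$$ and $\tilde{\boldsymbol P}^{\{K,0\}}=\boldsymbol\delta_-(K)$, $\tilde{\boldsymbol P}^{\{K,K\}}=\tilde{\boldsymbol\eta}(0,\alpha_3,\beta)$, $\tilde{\boldsymbol b}^{\{K\}}=\boldsymbol\delta_\star(K)$. *)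

theory Defs
  imports "HOL-Probability.Probability"
begin

definition generator :: "real^'d^'d \<Rightarrow> bool" where
  "generator Q \<longleftrightarrow>
     (\<forall>i j. i \<noteq> j \<longrightarrow> 0 \<le> Q $ i $ j) \<and> (\<forall>i. - (Q $ i $ i) = (\<Sum>j\<in>UNIV - {i}. Q $ i $ j))"

text \<open>Transition matrix of the embedded jump chain; an absorbing state is repeated for ever.\<close>

definition jump_matrix :: "real^'d^'d \<Rightarrow> real^'d^'d" where
  "jump_matrix Q = (\<chi> i j.
     if Q $ i $ i = 0 then of_bool (i = j)
     else if i = j then 0 else Q $ i $ j / - (Q $ i $ i))"

text \<open>The random ingredients, under a measure \<open>M\<close> for which the modulating chain starts in \<open>i0\<close>:
  jump chain \<open>Z\<close> and holding times \<open>S\<close> of a Markov chain with generator \<open>Q\<close>; for each state \<open>k\<close>,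
  interarrival times \<open>G k\<close> (rate \<open>lam k\<close>) and jump sizes \<open>b k\<close> (law \<open>B k\<close>) of a compound Poisson
  process; copies \<open>c i j n\<close> of the jump made at a transition \<open>i \<rightarrow> j\<close> (law \<open>C i j\<close>); an exponential
  time \<open>T\<close>. Holding and interarrival times live in \<^typ>\<open>ennreal\<close>, since those of rate \<open>0\<close> are
  infinite. Sample paths are regular for every outcome, not just almost surely, so that all
  path functionals below are measurable without completing \<open>M\<close>.\<close>

datatype 'd source = Chain | Gap 'd nat | Claim 'd nat | Transition_Jump 'd 'd nat | Clock

definition sources :: "'d source set" where
  "sources = - {Transition_Jump i i n | i n. True}"

locale modulated_input = prob_space M
  for M :: "'a measure" and Q :: "real^'d^'d"
    and lam :: "'d \<Rightarrow> real" and B :: "'d \<Rightarrow> real measure" and C :: "'d \<Rightarrow> 'd \<Rightarrow> real measure"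
    and beta :: real and i0 :: 'd
    and Z :: "nat \<Rightarrow> 'a \<Rightarrow> 'd" and S :: "nat \<Rightarrow> 'a \<Rightarrow> ennreal"
    and G :: "'d \<Rightarrow> nat \<Rightarrow> 'a \<Rightarrow> ennreal" and b :: "'d \<Rightarrow> nat \<Rightarrow> 'a \<Rightarrow> real"
    and c :: "'d \<Rightarrow> 'd \<Rightarrow> nat \<Rightarrow> 'a \<Rightarrow> real" and T :: "'a \<Rightarrow> real" +
  assumes Z_measurable: "\<And>n. Z n \<in> measurable M (count_space UNIV)"
    and S_measurable: "\<And>n. S n \<in> borel_measurable M"
    and chain_law: "\<And>n z t. (\<And>k. k \<le> n \<Longrightarrow> 0 \<le> t k) \<Longrightarrow>
      prob {\<omega> \<in> space M. \<forall>k\<le>n. Z k \<omega> = z k \<and> ennreal (t k) < S k \<omega>} =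
        of_bool (z 0 = i0) * (\<Prod>k<n. jump_matrix Q $ z k $ z (Suc k))
          * (\<Prod>k\<le>n. exp (Q $ z k $ z k * t k))"
    and chain_regular: "\<And>\<omega>. \<omega> \<in> space M \<Longrightarrow> (\<Sum>n. S n \<omega>) = \<infinity>"
    and G_measurable: "\<And>k n. G k n \<in> borel_measurable M"
    and G_law: "\<And>k n t. 0 \<le> t \<Longrightarrow>
      prob {\<omega> \<in> space M. ennreal t < G k n \<omega>} = exp (- lam k * t)"
    and G_regular: "\<And>k \<omega>. \<omega> \<in> space M \<Longrightarrow> (\<Sum>n. G k n \<omega>) = \<infinity>"
    and b_measurable: "\<And>k n. b k n \<in> borel_measurable M"
    and b_law: "\<And>k n. distr M borel (b k n) = B k"
    and b_nonneg: "\<And>k n \<omega>. \<omega> \<in> space M \<Longrightarrow> 0 \<le> b k n \<omega>"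
    and c_measurable: "\<And>i j n. i \<noteq> j \<Longrightarrow> c i j n \<in> borel_measurable M"
    and c_law: "\<And>i j n. i \<noteq> j \<Longrightarrow> distr M borel (c i j n) = C i j"
    and c_nonneg: "\<And>i j n \<omega>. i \<noteq> j \<Longrightarrow> \<omega> \<in> space M \<Longrightarrow> 0 \<le> c i j n \<omega>"
    and T_law: "distributed M lborel T (exponential_density beta)"
    and T_nonneg: "\<And>\<omega>. \<omega> \<in> space M \<Longrightarrow> 0 \<le> T \<omega>"
    and independent: "indep_sets (\<lambda>s. sets (case s of
          Chain \<Rightarrow> vimage_algebra (space M) (\<lambda>\<omega> n. (Z n \<omega>, S n \<omega>))
                     (PiM UNIV (\<lambda>n. count_space UNIV \<Otimes>\<^sub>M borel))
        | Gap k n \<Rightarrow> vimage_algebra (space M) (G k n) borel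
        | Claim k n \<Rightarrow> vimage_algebra (space M) (b k n) borel
        | Transition_Jump i j n \<Rightarrow> vimage_algebra (space M) (c i j n) borel
        | Clock \<Rightarrow> vimage_algebra (space M) T borel)) sources"

definition epoch :: "(nat \<Rightarrow> 'a \<Rightarrow> ennreal) \<Rightarrow> nat \<Rightarrow> 'a \<Rightarrow> ennreal" where
  "epoch S n \<omega> = (\<Sum>k<n. S k \<omega>)"

definition chain_process :: "(nat \<Rightarrow> 'a \<Rightarrow> 'd) \<Rightarrow> (nat \<Rightarrow> 'a \<Rightarrow> ennreal) \<Rightarrow> real \<Rightarrow> 'a \<Rightarrow> 'd" where
  "chain_process Z S t \<omega> = Z (card {n. epoch S (Suc n) \<omega> \<le> ennreal t}) \<omega>"

definition compound_poisson ::
  "real \<Rightarrow> (nat \<Rightarrow> 'a \<Rightarrow> ennreal) \<Rightarrow> (nat \<Rightarrow> 'a \<Rightarrow> real) \<Rightarrow> real \<Rightarrow> 'a \<Rightarrow> real" where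
  "compound_poisson r G b t \<omega> = r * t + (\<Sum>n | epoch G (Suc n) \<omega> \<le> ennreal t. b n \<omega>)"

text \<open>During its \<open>n\<close>-th sojourn, in state \<open>k = Z n \<omega>\<close>, the chain lets the increments of the
  \<open>k\<close>-th component process \<open>U k\<close> through.\<close>

definition modulated_process ::
  "(nat \<Rightarrow> 'a \<Rightarrow> 'd) \<Rightarrow> (nat \<Rightarrow> 'a \<Rightarrow> ennreal) \<Rightarrow> ('d \<Rightarrow> real \<Rightarrow> 'a \<Rightarrow> real)
    \<Rightarrow> ('d \<Rightarrow> 'd \<Rightarrow> nat \<Rightarrow> 'a \<Rightarrow> real) \<Rightarrow> real \<Rightarrow> 'a \<Rightarrow> real" where
  "modulated_process Z S U c t \<omega> =
     (\<Sum>n | epoch S n \<omega> \<le> ennreal t.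
        U (Z n \<omega>) (enn2real (min (ennreal t) (epoch S (Suc n) \<omega>))) \<omega>
        - U (Z n \<omega>) (enn2real (epoch S n \<omega>)) \<omega>)
     + (\<Sum>n | epoch S (Suc n) \<omega> \<le> ennreal t \<and> Z n \<omega> \<noteq> Z (Suc n) \<omega>.
          c (Z n \<omega>) (Z (Suc n) \<omega>) n \<omega>)"

text \<open>Two-sided Skorokhod problem on \<open>[0, K]\<close>: \<open>v\<close> is the reflection of the path \<open>y\<close>, the regulator
  \<open>l\<close> grows only while \<open>v = 0\<close>, and \<open>u\<close> only while \<open>v = K\<close>. When \<open>y\<close> can increase only by
  jumps, \<open>u\<close> adds up the truncated parts of those jumps. The regulators vanish before time \<open>0\<close>,
  so that their Stieltjes measures see a jump at time \<open>0\<close>.\<close>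

definition double_reflection ::
  "real \<Rightarrow> (real \<Rightarrow> real) \<Rightarrow> (real \<Rightarrow> real) \<Rightarrow> (real \<Rightarrow> real) \<Rightarrow> (real \<Rightarrow> real) \<Rightarrow> bool" where
  "double_reflection K y v l u \<longleftrightarrow>
     (\<forall>t\<ge>0. v t = y t + l t - u t \<and> 0 \<le> v t \<and> v t \<le> K) \<and>
     (\<forall>f\<in>{l, u}. mono f \<and> (\<forall>t. continuous (at_right t) f) \<and> (\<forall>t<0. f t = 0)) \<and>
     (AE t in interval_measure l. 0 \<le> t \<longrightarrow> v t = 0) \<and>
     (AE t in interval_measure u. 0 \<le> t \<longrightarrow> v t = K)"

definition idle_time :: "(real \<Rightarrow> real) \<Rightarrow> real \<Rightarrow> real" where
  "idle_time v t = measure lborel {s \<in> {0..t}. v s = 0}"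

text \<open>First passage times; the infimum of the empty set is \<open>\<infinity>\<close>.\<close>

definition passage_below :: "(real \<Rightarrow> 'a \<Rightarrow> real) \<Rightarrow> real \<Rightarrow> 'a \<Rightarrow> ennreal" where
  "passage_below Y u \<omega> = Inf (ennreal ` {t. 0 \<le> t \<and> - Y t \<omega> > u})"

definition passage_above :: "(real \<Rightarrow> 'a \<Rightarrow> real) \<Rightarrow> real \<Rightarrow> 'a \<Rightarrow> ennreal" where
  "passage_above Y u \<omega> = Inf (ennreal ` {t. 0 \<le> t \<and> Y t \<omega> > u})"

text \<open>From here on \<open>P i\<close> is the probability measure under which the chain starts in \<open>i\<close>. The
  dependence on the killing rate \<open>\<beta>\<close> is through the law of \<open>T\<close>.\<close>

definition delta_minus ::
  "('d \<Rightarrow> 'a measure) \<Rightarrow> (real \<Rightarrow> 'a \<Rightarrow> 'd) \<Rightarrow> (real \<Rightarrow> 'a \<Rightarrow> real) \<Rightarrow> ('a \<Rightarrow> real)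
    \<Rightarrow> real \<Rightarrow> real \<Rightarrow> real^'d^'d" where
  "delta_minus P J Y T K x = (\<chi> i j. measure (P i)
     {\<omega> \<in> space (P i).
        passage_below Y x \<omega> \<le> min (passage_above Y (K - x) \<omega>) (ennreal (T \<omega>)) \<and>
        J (enn2real (passage_below Y x \<omega>)) \<omega> = j})"

definition delta_star ::
  "('d \<Rightarrow> 'a measure) \<Rightarrow> (real \<Rightarrow> 'a \<Rightarrow> 'd) \<Rightarrow> (real \<Rightarrow> 'a \<Rightarrow> real) \<Rightarrow> ('a \<Rightarrow> real)
    \<Rightarrow> real \<Rightarrow> real \<Rightarrow> real \<Rightarrow> real^'d^'d" where
  "delta_star P J Y T K a1 x = (\<chi> i j. exp (- a1 * x) *
     (\<integral>\<omega>. exp (- a1 * Y (T \<omega>) \<omega>) *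
        of_bool (ennreal (T \<omega>) \<le> min (passage_below Y x \<omega>) (passage_above Y (K - x) \<omega>) \<and>
                 J (T \<omega>) \<omega> = j) \<partial>P i))"

definition eta ::
  "('d \<Rightarrow> 'a measure) \<Rightarrow> (real \<Rightarrow> 'a \<Rightarrow> 'd) \<Rightarrow> (real \<Rightarrow> 'a \<Rightarrow> real) \<Rightarrow> ('a \<Rightarrow> real)
    \<Rightarrow> real \<Rightarrow> real \<Rightarrow> real^'d^'d" where
  "eta P J Y T a u = (\<chi> i j.
     (\<integral>\<omega>. exp (- a * (Y (enn2real (passage_above Y u \<omega>)) \<omega> - u)) *
        of_bool (passage_above Y u \<omega> \<le> ennreal (T \<omega>) \<and>
                 J (enn2real (passage_above Y u \<omega>)) \<omega> = j) \<partial>P i))"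

definition eta_tilde ::
  "('d \<Rightarrow> 'a measure) \<Rightarrow> (real \<Rightarrow> 'a \<Rightarrow> 'd) \<Rightarrow> (real \<Rightarrow> 'a \<Rightarrow> real) \<Rightarrow> ('a \<Rightarrow> real)
    \<Rightarrow> real \<Rightarrow> real \<Rightarrow> real \<Rightarrow> real^'d^'d" where
  "eta_tilde P J Y T K a u = (\<chi> i j.
     (\<integral>\<omega>. exp (- a * (Y (enn2real (passage_above Y u \<omega>)) \<omega> - u)) *
        of_bool (passage_above Y u \<omega> \<le> min (passage_below Y (K - u) \<omega>) (ennreal (T \<omega>)) \<and>
                 J (enn2real (passage_above Y u \<omega>)) \<omega> = j) \<partial>P i))"

definition chi_tilde ::
  "('d \<Rightarrow> 'a measure) \<Rightarrow> (real \<Rightarrow> 'a \<Rightarrow> 'd) \<Rightarrow> ('a \<Rightarrow> real)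
    \<Rightarrow> (real \<Rightarrow> 'a \<Rightarrow> real \<Rightarrow> real) \<Rightarrow> (real \<Rightarrow> 'a \<Rightarrow> real \<Rightarrow> real)
    \<Rightarrow> real \<Rightarrow> real \<Rightarrow> real \<Rightarrow> real \<Rightarrow> real^'d^'d" where
  "chi_tilde P J T V L a1 a2 a3 x = (\<chi> i j.
     (\<integral>\<omega>. exp (- a1 * V x \<omega> (T \<omega>) - a2 * idle_time (V x \<omega>) (T \<omega>) - a3 * L x \<omega> (T \<omega>)) *
        of_bool (J (T \<omega>) \<omega> = j) \<partial>P i))"

text \<open>For each possible first jump out of the empty state \<open>i\<close>, the functional \<open>f\<close> is given the
  law of the jump size and the state of the chain after it.\<close>

definition first_jump ::
  "real^'d^'d \<Rightarrow> ('d \<Rightarrow> real) \<Rightarrow> ('d \<Rightarrow> real measure) \<Rightarrow> ('d \<Rightarrow> 'd \<Rightarrow> real measure)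
    \<Rightarrow> 'd \<Rightarrow> (real measure \<Rightarrow> 'd \<Rightarrow> real) \<Rightarrow> real" where
  "first_jump Q lam B C i f = lam i * f (B i) i + (\<Sum>k\<in>UNIV - {i}. Q $ i $ k * f (C i k) k)"

definition P_tilde ::
  "('d \<Rightarrow> 'a measure) \<Rightarrow> (real \<Rightarrow> 'a \<Rightarrow> 'd) \<Rightarrow> (real \<Rightarrow> 'a \<Rightarrow> real) \<Rightarrow> ('a \<Rightarrow> real)
    \<Rightarrow> real^'d^'d \<Rightarrow> ('d \<Rightarrow> real) \<Rightarrow> ('d \<Rightarrow> real measure) \<Rightarrow> ('d \<Rightarrow> 'd \<Rightarrow> real measure)
    \<Rightarrow> real \<Rightarrow> real \<Rightarrow> real \<Rightarrow> real \<Rightarrow> real^('d + 'd)^('d + 'd)" where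
  "P_tilde P J Y T Q lam B C beta K a2 a3 = (\<chi> row col.
     case row of
       Inl i \<Rightarrow> 1 / (beta - Q $ i $ i + lam i + a2) *
         (case col of
            Inl l \<Rightarrow> first_jump Q lam B C i (\<lambda>\<mu> k.
              LINT y:{0..K}|\<mu>. delta_minus P J Y T K y $ k $ l)
          | Inr l \<Rightarrow> first_jump Q lam B C i (\<lambda>\<mu> k.
              (LINT y:{0..K}|\<mu>. eta_tilde P J Y T K a3 (K - y) $ k $ l)
              + of_bool (k = l) * (LINT y:{K<..}|\<mu>. exp (- a3 * (y - K)))))
     | Inr i \<Rightarrow>
         (case col of
            Inl l \<Rightarrow> delta_minus P J Y T K K $ i $ l
          | Inr l \<Rightarrow> eta_tilde P J Y T K a3 0 $ i $ l))"

definition b_tilde ::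
  "('d \<Rightarrow> 'a measure) \<Rightarrow> (real \<Rightarrow> 'a \<Rightarrow> 'd) \<Rightarrow> (real \<Rightarrow> 'a \<Rightarrow> real) \<Rightarrow> ('a \<Rightarrow> real)
    \<Rightarrow> real^'d^'d \<Rightarrow> ('d \<Rightarrow> real) \<Rightarrow> ('d \<Rightarrow> real measure) \<Rightarrow> ('d \<Rightarrow> 'd \<Rightarrow> real measure)
    \<Rightarrow> real \<Rightarrow> real \<Rightarrow> real \<Rightarrow> real \<Rightarrow> real^'d^('d + 'd)" where
  "b_tilde P J Y T Q lam B C beta K a1 a2 = (\<chi> row j.
     case row of
       Inl i \<Rightarrow> 1 / (beta - Q $ i $ i + lam i + a2) *
         (beta * of_bool (i = j) + first_jump Q lam B C i (\<lambda>\<mu> k.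
            LINT y:{0..K}|\<mu>. delta_star P J Y T K a1 y $ k $ j))
     | Inr i \<Rightarrow> delta_star P J Y T K a1 K $ i $ j)"

definition stack :: "real^'d^'d \<Rightarrow> real^'d^'d \<Rightarrow> real^'d^('d + 'd)" where
  "stack A A' = (\<chi> row. case row of Inl i \<Rightarrow> A $ i | Inr i \<Rightarrow> A' $ i)"

end

theory Submission
  imports Defs
begin

section \<open>Renewal sequences restarted at a fixed time\<close>

text \<open>All assertions rest on renewal equations at the first event of the process, an event
  being a claim of the active component or a transition of the chain. Between events the free path
  is a line of negative slope \<open>r i\<close>, so everything up to the first event is explicit,
  and after it the process starts afresh from a new level and a new state. The strong Markov
  property at passage times is not invoked: the matrix identities hold because both sides solve the
  same equation, whose bounded solution is unique.

  Pathwise part. A \<open>world\<close> holds one outcome of all ingredients. By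
  \<open>free_shift\<close> and \<open>phase_shift\<close> the path after a time \<open>s\<close> is
  the path of the shifted world, which decomposes first passage times at the first event. The
  Skorokhod problem is solved explicitly between events and at a jump (\<open>v_before\<close>,
  \<open>at_jump\<close>). Hence each of the five integrands (of \<open>delta_minus\<close>,
  \<open>delta_star\<close>, \<open>eta_tilde\<close>, \<open>eta\<close> and
  \<open>chi_tilde\<close>) equals a recursion \<open>event_value\<close> along the events, each
  with its own data; \<open>event_value_unique\<close> reduces this to the one-step decomposition,
  since a regular world has finitely many events before its clock.

  Probabilistic part. Worlds have a product law (\<open>world_of_law\<close>). Memorylessness of the
  streams of claims (\<open>distr_restart\<close>), of the initial sojourn
  (\<open>nn_integral_hold\<close>) and of the clock yields \<open>nn_integral_first_event\<close>:
  with \<open>total_rate i\<close> the sum of killing, holding and claim rates, a first event at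
  time \<open>u\<close> carries the factor \<open>exp (- total_rate i * u)\<close> and is a claim,
  with intensity \<open>lam i\<close>, or a transition to \<open>k\<close>, with intensity
  \<open>Q $ i $ k\<close>; the world after it is fresh and independent of the jump. So the mean of
  each functional, as a function \<open>F\<close> of level and state, solves an integral equation
  (\<open>mean_eq\<close>). Cutting the time integral where the line reaches 0 gives it the form
  \<open>F = a + pass F\<close>, where \<open>pass\<close> collects the first events that keep the
  level in [0, K]. The term \<open>a\<close> accounts for the clock ringing (\<open>ring\<close>),
  for a jump above \<open>K\<close> (\<open>over\<close>), and for reaching 0, which stops
  \<open>delta_minus\<close>, restarts \<open>eta\<close> and the workload from level 0, and gives
  nothing for the other two. An overflowing workload restarts from \<open>K\<close> with a discount.

  Because the killing rate is positive, an event precedes the clock with probability at most some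
  constant below 1, so \<open>pass\<close> is a contraction (\<open>comparison\<close>,
  \<open>uniqueness\<close>). By linearity the workload transform is the combination of the three
  exit quantities with its own values at 0 and \<open>K\<close> as coefficients
  (\<open>decomposition\<close>); the formula for \<open>eta_tilde\<close> arises likewise
  (\<open>eta_decomposition\<close>).

  Boundary values. At \<open>K\<close> the decomposition is already a linear equation. At 0 the idle
  discount joins the exponential rate until the first jump, which leads into [0, K], where the
  decomposition applies, or is truncated at \<open>K\<close> (\<open>empty_state\<close>). The
  coefficient matrix is nonnegative with row sums below 1: in the rows of 0 because of the killing
  rate (\<open>empty_exit_sum\<close>), in those of \<open>K\<close> because the clock may ring
  while the line descends from \<open>K\<close> to 0 (\<open>exit_sum_top\<close>). Such a matrix
  subtracted from the identity is invertible (\<open>substochastic_invertible\<close>), and the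
  system can be solved.\<close>

definition arrival :: "(nat => ennreal) => nat => ennreal" where
  "arrival g n = (\<Sum>k<n. g k)"

text \<open>For a divergent sequence, the number of arrivals in [0, s], those at time 0 and at time
  \<open>s\<close> included.\<close>

definition renewals :: "(nat => ennreal) => real => nat" where
  "renewals g s = (LEAST n. ennreal s < arrival g (Suc n))"

text \<open>The waiting times seen from time \<open>s\<close>: the first is what remains of the
  interval in progress, which ends strictly after \<open>s\<close>; the later ones are
  untouched.\<close>

definition residual :: "(nat => ennreal) => real => nat => ennreal" where
  "residual g s n =
    (if n = 0 then arrival g (Suc (renewals g s)) - ennreal s else g (renewals g s + n))"

lemma sum_lessThan_add:
  fixes f :: "nat => real"
  shows "(\<Sum>n<N + M. f n) = (\<Sum>n<N. f n) + (\<Sum>m<M. f (N + m))"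
  by (induction M) (simp_all add: algebra_simps)

lemma epoch_eq_arrival: "epoch S n \<omega> = arrival (%k. S k \<omega>) n"
  by (simp add: epoch_def arrival_def)

lemma arrival_0 [simp]: "arrival g 0 = 0"
  by (simp add: arrival_def)

lemma arrival_Suc: "arrival g (Suc n) = arrival g n + g n"
  by (simp add: arrival_def)

lemma arrival_mono: "m \<le> n ==> arrival g m \<le> arrival g n"
  unfolding arrival_def by (rule sum_mono2) auto

locale renewal_sequence =
  fixes g :: "nat => ennreal"
  assumes divergent: "(\<Sum>n. g n) = \<infinity>"
begin

lemma exceeds: "\<exists>n. ennreal s < arrival g (Suc n)"
proof -
  have "(SUP n. arrival g n) = \<infinity>"
    using divergent by (simp add: suminf_eq_SUP arrival_def)
  then have "ennreal s < (SUP n. arrival g n)"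
    by (metis ennreal_less_top infinity_ennreal_def)
  then obtain n where n: "ennreal s < arrival g n"
    by (auto simp: less_SUP_iff)
  then have "ennreal s < arrival g (Suc n)"
    using arrival_mono[of n "Suc n" g] by (auto intro: less_le_trans)
  then show ?thesis ..
qed

lemma less_arrival_renewals: "ennreal s < arrival g (Suc (renewals g s))"
  unfolding renewals_def by (rule LeastI_ex[OF exceeds])

lemma arrival_le_iff: "arrival g (Suc n) \<le> ennreal s \<longleftrightarrow> n < renewals g s"
proof
  assume "arrival g (Suc n) \<le> ennreal s"
  then show "n < renewals g s"
    using less_arrival_renewals[of s] arrival_mono[of "Suc (renewals g s)" "Suc n" g]
    by (metis Suc_le_mono leD le_less_trans not_le_imp_less order_le_less_trans)
next
  assume "n < renewals g s"
  then show "arrival g (Suc n) \<le> ennreal s"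
    using not_less_Least[of n "%n. ennreal s < arrival g (Suc n)"] by (simp add: renewals_def)
qed

lemma arrival_le_iff': "arrival g n \<le> ennreal s \<longleftrightarrow> n \<le> renewals g s"
  by (cases n) (auto simp: arrival_le_iff)

lemma renewals_eqI:
  "arrival g n \<le> ennreal s ==> ennreal s < arrival g (Suc n) ==> renewals g s = n"
  by (metis arrival_le_iff arrival_le_iff' le_less_Suc_eq not_less less_Suc_eq_le)

lemma arrival_residual:
  assumes "0 \<le> s"
  shows "arrival (residual g s) (Suc n) = arrival g (renewals g s + Suc n) - ennreal s"
proof (induction n)
  case 0
  then show ?case by (simp add: arrival_Suc residual_def)
next
  case (Suc n)
  \<comment> \<open>Subtraction on \<open>ennreal\<close> is truncated, so moving it past the sum
    requires that this arrival is not earlier than \<open>s\<close>.\<close>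
  have "ennreal s \<le> arrival g (renewals g s + Suc n)"
    using less_arrival_renewals[of s] arrival_mono[of "Suc (renewals g s)" "renewals g s + Suc n" g]
    by (metis add_Suc_right le_add1 less_imp_le order_trans Suc_le_mono)
  then have "arrival g (renewals g s + Suc n) - ennreal s + g (renewals g s + Suc n) =
      arrival g (renewals g s + Suc n) + g (renewals g s + Suc n) - ennreal s"
    by (metis add.commute add_diff_eq_ennreal)
  then show ?case
    using Suc by (simp add: arrival_Suc[of _ "Suc n"] residual_def arrival_Suc[of g "renewals g s + Suc n", simplified])
qed

lemma arrival_residual_le_iff:
  assumes "0 \<le> s" "0 \<le> t"
  shows "arrival (residual g s) (Suc n) \<le> ennreal t \<longleftrightarrow>
    arrival g (Suc (renewals g s + n)) \<le> ennreal (s + t)"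
  using assms ennreal_minus_le_iff[of "arrival g (renewals g s + Suc n)" "ennreal s" "ennreal t"]
  by (simp add: arrival_residual)

text \<open>Divergence is a property of the tail: if the arrival that ends the current interval is
  finite, discarding it leaves a divergent tail, and if it is infinite the first residual time is
  already infinite.\<close>

lemma residual_divergent:
  assumes "0 \<le> s"
  shows "(\<Sum>n. residual g s n) = \<infinity>"
proof -
  let ?N = "Suc (renewals g s)"
  have split: "(\<Sum>n. g n) = (\<Sum>n. g (n + ?N)) + arrival g ?N"
    unfolding arrival_def by (rule suminf_offset) auto
  have tail: "(\<Sum>n. g (n + ?N)) \<le> (\<Sum>n. residual g s (n + 1))"
    by (rule suminf_le) (auto simp: residual_def add.commute)
  have residual: "(\<Sum>n. residual g s n) = (\<Sum>n. residual g s (n + 1)) + residual g s 0"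
    using suminf_offset[of "residual g s" 1] by simp
  show ?thesis
  proof (cases "arrival g ?N = \<infinity>")
    case True
    then have "residual g s 0 = \<infinity>" by (simp add: residual_def)
    with residual show ?thesis by simp
  next
    case False
    then have "(\<Sum>n. g (n + ?N)) = \<infinity>" using split divergent
      by (metis ennreal_add_eq_top infinity_ennreal_def)
    with tail have "(\<Sum>n. residual g s (n + 1)) = \<infinity>" by (simp add: top_unique)
    with residual show ?thesis by simp
  qed
qed

lemma residual_0_pos: "0 < residual g s 0"
  using less_arrival_renewals[of s] by (simp add: residual_def diff_gr0_ennreal)

lemma renewals_add:
  assumes "0 \<le> s" "0 \<le> t"
  shows "renewals g (s + t) = renewals g s + renewals (residual g s) t"
proof -
  interpret R: renewal_sequence "residual g s"
    by unfold_locales (rule residual_divergent[OF assms(1)])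
  have iff: "n < renewals (residual g s) t \<longleftrightarrow> renewals g s + n < renewals g (s + t)" for n
    using arrival_residual_le_iff[OF assms] R.arrival_le_iff arrival_le_iff by simp
  have "arrival g (renewals g s) \<le> ennreal s" by (simp add: arrival_le_iff')
  also have "\<dots> \<le> ennreal (s + t)" using assms by (simp add: ennreal_leI)
  finally have "renewals g s \<le> renewals g (s + t)" by (simp add: arrival_le_iff')
  \<comment> \<open>The two instances test the equivalence at the two candidate counts; each
    excludes one strict inequality.\<close>
  then show ?thesis
    using iff[of "renewals (residual g s) t"] iff[of "renewals g (s + t) - renewals g s"] by linarith
qed

lemma compound_eq: "{n. arrival g (Suc n) \<le> ennreal t} = {..<renewals g t}"
  by (auto simp: arrival_le_iff)

end

section \<open>Sample paths restarted at a fixed time\<close>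

text \<open>One outcome of all ingredients: the chain with its sojourn times, a stream of gaps and
  claim sizes for each state, for each transition number a table of jumps over all ordered pairs of
  states, and the killing clock. Keeping whole streams and tables makes the law of a world a product
  measure.\<close>

type_synonym 'd world = "(nat => 'd \<times> ennreal) \<times> ('d => nat => ennreal \<times> real)
  \<times> (nat => 'd \<times> 'd => real) \<times> real"

definition state :: "nat => 'd world => 'd" where "state n w = fst (fst w n)"
definition sojourn :: "nat => 'd world => ennreal" where "sojourn n w = snd (fst w n)"
definition gap :: "'d => nat => 'd world => ennreal" where "gap k n w = fst (fst (snd w) k n)"
definition claim :: "'d => nat => 'd world => real" where "claim k n w = snd (fst (snd w) k n)"
definition transit :: "'d => 'd => nat => 'd world => real" where
  "transit i j n w = fst (snd (snd w)) n (i, j)"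
definition clock :: "'d world => real" where "clock w = snd (snd (snd w))"

definition free :: "('d => real) => real => 'd world => real" where
  "free r = modulated_process state sojourn (%k. compound_poisson (r k) (gap k) (claim k)) transit"

definition phase :: "real => 'd world => 'd" where
  "phase = chain_process state sojourn"

text \<open>The marks travel with the gaps: the first residual interval keeps the mark of the
  interval in progress at \<open>s\<close>.\<close>

definition restart :: "real => (nat => ennreal \<times> 'b) => nat => ennreal \<times> 'b" where
  "restart s g = (%n. (residual (%n. fst (g n)) s n, snd (g (renewals (%n. fst (g n)) s + n))))"

text \<open>In \<open>modulated_process\<close> the component processes run in global time, also
  while the chain is elsewhere, so every stream is restarted at the same \<open>s\<close>. The swaps
  let \<open>restart\<close> act on the chain too, with the states as marks of the sojourn
  times.\<close>

definition shift :: "real => 'd world => 'd world" where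
  "shift s w =
    (%n. prod.swap (restart s (%n. prod.swap (fst w n)) n),
     %k. restart s (fst (snd w) k),
     %n. fst (snd (snd w)) (renewals (%n. sojourn n w) s + n),
     clock w - s)"

definition good :: "'d world => bool" where
  "good w \<longleftrightarrow> (\<Sum>n. sojourn n w) = \<infinity> \<and>
    (\<forall>k. (\<Sum>n. gap k n w) = \<infinity> \<and> (\<forall>n. 0 \<le> claim k n w)) \<and>
    (\<forall>i j n. 0 \<le> transit i j n w) \<and> 0 \<le> clock w"

lemma shift_simps:
  "state n (shift s w) = state (renewals (%n. sojourn n w) s + n) w"
  "sojourn n (shift s w) = residual (%n. sojourn n w) s n"
  "gap k n (shift s w) = residual (%n. gap k n w) s n"
  "claim k n (shift s w) = claim k (renewals (%n. gap k n w) s + n) w"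
  "transit i j n (shift s w) = transit i j (renewals (%n. sojourn n w) s + n) w"
  "clock (shift s w) = clock w - s"
  by (simp_all add: state_def sojourn_def gap_def claim_def transit_def clock_def shift_def restart_def)

lemma goodD:
  assumes "good w"
  shows "renewal_sequence (%n. sojourn n w)" "renewal_sequence (%n. gap k n w)"
    "0 \<le> claim k n w" "0 \<le> transit i j n w" "0 \<le> clock w"
  using assms by (auto simp: good_def renewal_sequence_def)

lemma good_shift:
  assumes "good w" "0 \<le> s" "s \<le> clock w"
  shows "good (shift s w)"
  using assms goodD[OF assms(1)]
  unfolding good_def shift_simps
  by (auto simp: renewal_sequence.residual_divergent)

definition level :: "real => 'd => 'd world => real => real" where
  "level \<rho> k w t = \<rho> * t + (\<Sum>n<renewals (%n. gap k n w) t. claim k n w)"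

lemma compound_poisson_eq_level:
  "good w ==> compound_poisson \<rho> (gap k) (claim k) t w = level \<rho> k w t"
  by (simp add: compound_poisson_def level_def epoch_eq_arrival renewal_sequence.compound_eq goodD)

lemma level_shift:
  assumes "good w" "0 \<le> s" "0 \<le> t"
  shows "level \<rho> k w (s + t) = level \<rho> k w s + level \<rho> k (shift s w) t"
proof -
  interpret renewal_sequence "%n. gap k n w" by (rule goodD[OF assms(1)])
  show ?thesis
    using renewals_add[OF assms(2,3)]
    by (simp add: level_def shift_simps algebra_simps sum_lessThan_add)
qed

text \<open>What the \<open>n\<close>-th sojourn, once completed, adds to the free process: the
  increment of the active component and the jump of the transition that ends it.\<close>

definition stage :: "('d => real) => 'd world => nat => real" where
  "stage r w n = level (r (state n w)) (state n w) w (enn2real (arrival (%n. sojourn n w) (Suc n)))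
      - level (r (state n w)) (state n w) w (enn2real (arrival (%n. sojourn n w) n))
      + (if state n w \<noteq> state (Suc n) w then transit (state n w) (state (Suc n) w) n w else 0)"

lemma free_eq:
  assumes "good w" "0 \<le> t"
  defines "M \<equiv> renewals (%n. sojourn n w) t"
  shows "free r t w = (\<Sum>n<M. stage r w n) + level (r (state M w)) (state M w) w t
    - level (r (state M w)) (state M w) w (enn2real (arrival (%n. sojourn n w) M))"
proof -
  interpret renewal_sequence "%n. sojourn n w" by (rule goodD[OF assms(1)])
  have 1: "{n. arrival (%n. sojourn n w) n \<le> ennreal t} = insert M {..<M}"
    by (auto simp: arrival_le_iff' M_def)
  have 2: "{n. arrival (%n. sojourn n w) (Suc n) \<le> ennreal t \<and> state n w \<noteq> state (Suc n) w}
      = {..<M} \<inter> {n. state n w \<noteq> state (Suc n) w}"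
    by (auto simp: arrival_le_iff M_def)
  have 3: "min (ennreal t) (arrival (%n. sojourn n w) (Suc n)) = arrival (%n. sojourn n w) (Suc n)"
    if "n < M" for n
    using that arrival_le_iff by (simp add: M_def min_def antisym)
  have 4: "min (ennreal t) (arrival (%n. sojourn n w) (Suc M)) = ennreal t"
    using less_arrival_renewals[of t] by (simp add: M_def min_absorb1 less_imp_le)
  show ?thesis
    unfolding free_def modulated_process_def compound_poisson_eq_level[OF assms(1)] epoch_eq_arrival 1 2
    using assms(2)
    by (simp add: 3 4 stage_def sum.distrib sum.If_cases)
qed

text \<open>Only the sojourn in progress at \<open>s\<close> is cut, and the increments of its
  component add up across the cut by \<open>level_shift\<close>. All later sojourns reappear in the
  shifted world with their number lowered by \<open>N\<close>.\<close>

lemma free_shift: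
  assumes w: "good w" and s: "0 \<le> s" "s \<le> clock w" and t: "0 \<le> t"
  shows "free r (s + t) w = free r s w + free r t (shift s w)"
proof -
  let ?S = "%n. sojourn n w"
  let ?S' = "%n. sojourn n (shift s w)"
  interpret renewal_sequence ?S by (rule goodD[OF w])
  interpret R: renewal_sequence ?S' by (rule goodD[OF good_shift[OF w s]])
  have S': "?S' = residual ?S s" by (auto simp: shift_simps)
  define N where "N = renewals ?S s"
  define M where "M = renewals ?S' t"
  have add: "renewals ?S (s + t) = N + M"
    unfolding N_def M_def S' by (rule renewals_add[OF s(1) t])
  \<comment> \<open>The ends of sojourns in both time scales. For \<open>m < M\<close> they are at
    most \<open>s + t\<close>, so \<open>enn2real\<close> is applied to finite values only.\<close>
  have arr: "level \<rho> k w (enn2real (arrival ?S (N + Suc m)))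
      = level \<rho> k w s + level \<rho> k (shift s w) (enn2real (arrival ?S' (Suc m)))"
    if "m < M" for m \<rho> k
  proof -
    have le: "arrival ?S (N + Suc m) \<le> ennreal (s + t)"
      using that add arrival_le_iff[of "N + m" "s + t"] by simp
    have ge: "ennreal s \<le> arrival ?S (N + Suc m)"
      using less_arrival_renewals[of s] arrival_mono[of "Suc N" "N + Suc m" ?S]
      by (auto simp: N_def intro: order_trans less_imp_le)
    obtain a where a: "arrival ?S (N + Suc m) = ennreal a" "0 \<le> a"
      using le by (metis ennreal_cases infinity_ennreal_def neq_top_trans ennreal_neq_top)
    have "arrival ?S' (Suc m) = ennreal (a - s)"
      using a s arrival_residual[OF s(1), of m] unfolding S' N_def[symmetric]
      by (simp add: ennreal_minus)
    moreover have "s \<le> a" using ge a s by (simp add: ennreal_le_iff)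
    ultimately show ?thesis
      using level_shift[OF w s(1), of "a - s" \<rho> k] a by simp
  qed
  have st: "state m (shift s w) = state (N + m) w" for m by (simp add: shift_simps N_def)
  have tr: "transit i j m (shift s w) = transit i j (N + m) w" for i j m by (simp add: shift_simps N_def)
  have lvl0: "level \<rho> k (shift s w) 0 = 0" for \<rho> k
    using level_shift[OF w s(1), of 0 \<rho> k] by simp
  have stage_later: "stage r w (N + Suc m) = stage r (shift s w) (Suc m)" if "Suc m < M" for m
    using arr[of m] arr[of "Suc m"] that by (simp add: stage_def st tr)
  have split: "(\<Sum>n<N + M. stage r w n) = (\<Sum>n<N. stage r w n) + (\<Sum>m<M. stage r w (N + m))"
    by (rule sum_lessThan_add)
  note eqs = free_eq[OF w s(1), of r, folded N_def]
    free_eq[OF good_shift[OF w s] t, of r, folded M_def]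
    free_eq[OF w, of "s + t" r, unfolded add]
  show ?thesis
  \<comment> \<open>If no transition falls in (s, s + t], the increment comes from one component.
    Otherwise stage \<open>N\<close> of the original world is stage 0 of the shifted one plus the
    part of that sojourn before \<open>s\<close>, and the other completed stages agree one by
    one.\<close>
  proof (cases M)
    case 0
    then show ?thesis
      using eqs s t st level_shift[OF w s(1) t] lvl0 by simp
  next
    case (Suc M')
    have "(\<Sum>m<M. stage r w (N + m)) = stage r w N + (\<Sum>m<M'. stage r w (N + Suc m))"
      unfolding Suc by (subst sum.lessThan_Suc_shift) simp
    moreover have "(\<Sum>m<M. stage r (shift s w) m)
        = stage r (shift s w) 0 + (\<Sum>m<M'. stage r (shift s w) (Suc m))"
      unfolding Suc by (subst sum.lessThan_Suc_shift) simp
    moreover have "(\<Sum>m<M'. stage r w (N + Suc m)) = (\<Sum>m<M'. stage r (shift s w) (Suc m))"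
      using stage_later Suc by (intro sum.cong) auto
    moreover have "stage r w N = stage r (shift s w) 0
        + level (r (state N w)) (state N w) w s
        - level (r (state N w)) (state N w) w (enn2real (arrival ?S N))"
      using arr[of 0] Suc by (simp add: stage_def st tr lvl0)
    ultimately show ?thesis
      using eqs s t st level_shift[OF w s(1) t] split arr[of M'] Suc by simp
  qed
qed

lemma phase_eq: "good w ==> phase t w = state (renewals (%n. sojourn n w) t) w"
  by (simp add: phase_def chain_process_def epoch_eq_arrival renewal_sequence.compound_eq goodD)

lemma phase_shift:
  assumes "good w" "0 \<le> s" "s \<le> clock w" "0 \<le> t"
  shows "phase (s + t) w = phase t (shift s w)"
  using assms good_shift[OF assms(1-3)]
  by (simp add: phase_eq renewal_sequence.renewals_add goodD shift_simps)

text \<open>Claims of inactive components leave the path unchanged, so only the stream of the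
  initial state competes with the first sojourn. The value may be 0 or infinite.\<close>

definition first_event :: "'d world => ennreal" where
  "first_event w = min (sojourn 0 w) (gap (state 0 w) 0 w)"

text \<open>Several claims and transitions may occur at the instant of the first event; their total
  size is its mark. Claims at time \<open>0\<close> do not count.\<close>

definition transition_jump :: "nat => 'd world => real" where
  "transition_jump n w =
    (if state n w \<noteq> state (Suc n) w then transit (state n w) (state (Suc n) w) n w else 0)"

definition first_mark :: "'d world => real" where
  "first_mark w =
    (\<Sum>n<renewals (%n. gap (state 0 w) n w) (enn2real (first_event w)). claim (state 0 w) n w)
    - (\<Sum>n<renewals (%n. gap (state 0 w) n w) 0. claim (state 0 w) n w)
    + (\<Sum>n<renewals (%n. sojourn n w) (enn2real (first_event w)). transition_jump n w)"

lemma first_event_shift_pos: "good w ==> 0 < first_event (shift s w)"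
  by (simp add: first_event_def shift_simps renewal_sequence.residual_0_pos goodD)

lemma renewals_before: "ennreal t < g 0 ==> renewals g t = 0"
  unfolding renewals_def by (rule Least_equality) (auto simp: arrival_def)

lemma renewals_first:
  assumes "g 0 = ennreal t" "0 < g 1"
  shows "renewals g t = 1"
  unfolding renewals_def
proof (rule Least_equality)
  show "ennreal t < arrival g (Suc 1)"
    using assms ennreal_add_left_cancel_less[of "ennreal t" 0 "g 1"] by (simp add: arrival_def)
  show "1 \<le> n" if "ennreal t < arrival g (Suc n)" for n
    using that assms(1) by (cases n) (simp_all add: arrival_def)
qed

lemma before_first_event:
  assumes "good w" "0 \<le> t" "ennreal t < first_event w"
  shows "free r t w = r (state 0 w) * t" "phase t w = state 0 w"
proof -
  have "0 < gap (state 0 w) 0 w"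
    using assms(3) by (auto simp: first_event_def intro: le_less_trans[of 0 "ennreal t"])
  then show "free r t w = r (state 0 w) * t" "phase t w = state 0 w"
    using assms by (simp_all add: free_eq phase_eq renewals_before first_event_def level_def goodD)
qed

lemma first_mark_nonneg:
  assumes w: "good w"
  shows "0 \<le> first_mark w"
proof -
  let ?g = "%n. gap (state 0 w) n w"
  \<comment> \<open>Monotonicity of the count, read off from \<open>renewals_add\<close> with first
    time 0.\<close>
  have "renewals ?g 0 \<le> renewals ?g (enn2real (first_event w))"
    using renewal_sequence.renewals_add[OF goodD(2)[OF w], of 0 "enn2real (first_event w)" "state 0 w"] by simp
  then have "(\<Sum>n<renewals ?g 0. claim (state 0 w) n w) \<le> (\<Sum>n<renewals ?g (enn2real (first_event w)). claim (state 0 w) n w)"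
    by (intro sum_mono2) (auto simp: goodD[OF w])
  moreover have "0 \<le> (\<Sum>n<renewals (%n. sojourn n w) (enn2real (first_event w)). transition_jump n w)"
    by (intro sum_nonneg) (auto simp: transition_jump_def goodD[OF w])
  ultimately show ?thesis by (simp add: first_mark_def)
qed

text \<open>No sojourn ends before \<open>e\<close>, so all transitions counted at \<open>e\<close>
  happen exactly then; the sojourns between them have length 0 and contribute only their
  jumps.\<close>

lemma at_first_event:
  assumes w: "good w" and e: "0 \<le> e" "first_event w = ennreal e"
  shows "free r e w = r (state 0 w) * e + first_mark w"
proof -
  let ?S = "%n. sojourn n w"
  let ?L = "%k t. level (r k) k w t"
  define M where "M = renewals ?S e"
  interpret renewal_sequence ?S by (rule goodD[OF w])
  have arr: "arrival ?S n = ennreal e" if "0 < n" "n \<le> M" for n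
  proof (rule antisym)
    show "arrival ?S n \<le> ennreal e" using that by (simp add: arrival_le_iff' M_def)
    have "ennreal e \<le> sojourn 0 w" using e by (auto simp: first_event_def min_def split: if_splits)
    also have "\<dots> = arrival ?S 1" by (simp add: arrival_def)
    also have "\<dots> \<le> arrival ?S n" using that by (intro arrival_mono) simp
    finally show "ennreal e \<le> arrival ?S n" .
  qed
  have "free r e w = ?L (state 0 w) e - ?L (state 0 w) 0 + (\<Sum>n<M. transition_jump n w)"
  proof (cases M)
    case 0
    then show ?thesis using free_eq[OF w e(1), of r] by (simp add: M_def)
  next
    case (Suc m)
    have "stage r w 0 = ?L (state 0 w) e - ?L (state 0 w) 0 + transition_jump 0 w"
      using arr[of 1] Suc e by (simp add: stage_def transition_jump_def)
    moreover have "stage r w (Suc n) = transition_jump (Suc n) w" if "n < m" for n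
      using arr[of "Suc n"] arr[of "Suc (Suc n)"] Suc that by (simp add: stage_def transition_jump_def)
    ultimately have "(\<Sum>n<M. stage r w n) = ?L (state 0 w) e - ?L (state 0 w) 0 + (\<Sum>n<M. transition_jump n w)"
      unfolding Suc sum.lessThan_Suc_shift by simp
    then show ?thesis using free_eq[OF w e(1), of r] arr[of M] Suc e by (simp add: M_def[symmetric])
  qed
  then show ?thesis
    using e by (simp add: first_mark_def level_def M_def)
qed

section \<open>First passage decomposed at the first event\<close>

definition first_time :: "(real => bool) => ennreal" where
  "first_time p = Inf (ennreal ` {t. 0 \<le> t \<and> p t})"

lemma passage_below_eq: "passage_below Y u \<omega> = first_time (%t. u < - Y t \<omega>)"
  by (simp add: passage_below_def first_time_def)

lemma passage_above_eq: "passage_above Y u \<omega> = first_time (%t. u < Y t \<omega>)"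
  by (simp add: passage_above_def first_time_def)

lemma first_time_ge:
  "(\<And>t. 0 \<le> t ==> ennreal t < e ==> \<not> p t) ==> e \<le> first_time p"
  unfolding first_time_def by (rule Inf_greatest) (auto simp: not_less[symmetric])

lemma first_time_eqI:
  assumes "0 \<le> s" "p s" "\<And>t. 0 \<le> t ==> t < s ==> \<not> p t"
  shows "first_time p = ennreal s"
proof (rule antisym)
  show "first_time p \<le> ennreal s" unfolding first_time_def using assms by (intro Inf_lower) auto
  show "ennreal s \<le> first_time p" using assms by (intro first_time_ge) (auto simp: ennreal_less_iff)
qed

lemma first_time_shift:
  assumes s: "0 \<le> s" and "\<And>t. 0 \<le> t ==> t < s ==> \<not> p t"
  shows "first_time p = ennreal s + first_time (%t. p (s + t))"
proof (rule antisym)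
  show "ennreal s + first_time (%t. p (s + t)) \<le> first_time p"
    unfolding first_time_def[of p]
  proof (rule Inf_greatest)
    fix z assume "z \<in> ennreal ` {t. 0 \<le> t \<and> p t}"
    then obtain t where t: "z = ennreal t" "0 \<le> t" "p t" by auto
    then have "s \<le> t" using assms(2)[of t] by (meson not_le)
    moreover have "first_time (%t. p (s + t)) \<le> ennreal (t - s)"
      unfolding first_time_def using t \<open>s \<le> t\<close> by (intro Inf_lower) auto
    ultimately have "ennreal s + first_time (%t. p (s + t)) \<le> ennreal s + ennreal (t - s)"
      by (intro add_left_mono)
    then show "ennreal s + first_time (%t. p (s + t)) \<le> z"
      using t s \<open>s \<le> t\<close> by (simp flip: ennreal_plus)
  qed
  have "first_time p - ennreal s \<le> first_time (%t. p (s + t))"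
    unfolding first_time_def[of "%t. p (s + t)"]
  proof (rule Inf_greatest)
    fix z assume "z \<in> ennreal ` {t. 0 \<le> t \<and> p (s + t)}"
    then obtain t where t: "z = ennreal t" "0 \<le> t" "p (s + t)" by auto
    then have "first_time p \<le> ennreal (s + t)"
      unfolding first_time_def using s by (intro Inf_lower[OF image_eqI[OF refl]]) simp
    then show "first_time p - ennreal s \<le> z"
      using t s by (simp add: ennreal_minus_le_iff add.commute)
  qed
  then show "first_time p \<le> ennreal s + first_time (%t. p (s + t))"
    by (simp add: ennreal_minus_le_iff add.commute)
qed

text \<open>Passage asks for a strict inequality, so a line satisfies it only just after its hitting
  time and the infimum is not attained; times slightly larger than \<open>s\<close> give the upper
  bound.\<close>

lemma first_time_after:
  assumes "0 \<le> s" "ennreal s < e" and "\<And>t. 0 \<le> t ==> ennreal t < e ==> p t \<longleftrightarrow> s < t"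
  shows "first_time p = ennreal s"
proof (rule antisym)
  show "ennreal s \<le> first_time p"
  proof (rule first_time_ge)
    fix t assume t: "0 \<le> t" "ennreal t < ennreal s"
    then show "\<not> p t"
      using assms(3)[OF t(1) less_trans[OF t(2) assms(2)]] by (simp add: ennreal_less_iff)
  qed
  show "first_time p \<le> ennreal s"
  proof (rule dense_ge)
    fix z assume "ennreal s < z"
    then have "ennreal s < min z e" using assms by simp
    then obtain c where c: "ennreal s < c" "c < min z e" using dense by blast
    then obtain t where t: "c = ennreal t" "0 \<le> t"
      by (metis ennreal_cases infinity_ennreal_def min_less_iff_conj not_less_iff_gr_or_eq top.not_eq_extremum)
    then have "first_time p \<le> ennreal t"
      unfolding first_time_def using assms c by (intro Inf_lower) (auto simp: ennreal_less_iff)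
    then show "first_time p \<le> z" using c t by auto
  qed
qed

lemma below_early:
  assumes "good w" "r (state 0 w) < 0" "0 \<le> x" "ennreal (x / - r (state 0 w)) < first_event w"
  shows "passage_below (free r) x w = ennreal (x / - r (state 0 w))"
  unfolding passage_below_eq
proof (rule first_time_after[OF _ assms(4)])
  show "0 \<le> x / - r (state 0 w)" using assms by (intro divide_nonneg_pos) auto
  show "x < - free r t w \<longleftrightarrow> x / - r (state 0 w) < t" if "0 \<le> t" "ennreal t < first_event w" for t
    using assms(1,2) that pos_divide_less_eq[of "- r (state 0 w)" x t]
    by (simp add: before_first_event mult.commute)
qed

lemma below_ge:
  assumes "good w" "r (state 0 w) < 0" "0 \<le> x" "first_event w \<le> ennreal (x / - r (state 0 w))"
  shows "first_event w \<le> passage_below (free r) x w"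
  unfolding passage_below_eq
proof (rule first_time_ge)
  fix t assume t: "0 \<le> t" "ennreal t < first_event w"
  then have "ennreal t < ennreal (x / - r (state 0 w))" using assms(4) by (rule_tac less_le_trans)
  then have "t < x / - r (state 0 w)" using t by (simp add: ennreal_less_iff)
  then show "\<not> x < - free r t w"
    using assms t pos_less_divide_eq[of "- r (state 0 w)" t x]
    by (simp add: before_first_event mult.commute)
qed

lemma below_pos: "good w ==> 0 < first_event w ==> r (state 0 w) < 0 ==> 0 < x ==> 0 < passage_below (free r) x w"
proof (cases "ennreal (x / - r (state 0 w)) < first_event w")
  case False
  assume *: "good w" "0 < first_event w" "r (state 0 w) < 0" "0 < x"
  with below_ge[of w r x] * False show ?thesis by (simp add: not_less) 
qed (simp add: below_early divide_pos_neg)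

text \<open>Drifts are negative, so the path can exceed a nonnegative level only by a jump.\<close>

lemma above_ge:
  assumes "good w" "r (state 0 w) < 0" "0 \<le> u"
  shows "first_event w \<le> passage_above (free r) u w"
  unfolding passage_above_eq
proof (rule first_time_ge)
  fix t assume t: "0 \<le> t" "ennreal t < first_event w"
  have "r (state 0 w) * t \<le> 0" using assms t by (simp add: mult_nonpos_nonneg)
  then show "\<not> u < free r t w"
    using assms t by (simp add: before_first_event)
qed

text \<open>The event comes no later than the clock, so the shifted world still has a nonnegative
  clock. The case \<open>e = 0\<close> is included; \<open>fresh_after\<close> excludes another
  event immediately afterwards.\<close>

locale world_step =
  fixes r :: "'d => real" and w :: "'d world" and e :: real
  assumes good: "good w" and drift: "\<And>i. r i < 0"
    and event: "first_event w = ennreal e" "0 \<le> e" "e \<le> clock w"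
begin

abbreviation "rate \<equiv> r (state 0 w)"
abbreviation "mark \<equiv> first_mark w"
abbreviation "after \<equiv> shift e w"

lemma good_after: "good after"
  by (rule good_shift[OF good event(2,3)])

lemma free_after: "0 \<le> t ==> free r (e + t) w = rate * e + mark + free r t after"
  using free_shift[OF good event(2,3)] at_first_event[OF good event(2,1)] by simp

lemma free_before: "0 \<le> t ==> t < e ==> free r t w = rate * t"
  using before_first_event(1)[OF good] event by (simp add: ennreal_less_iff)

lemma phase_before: "0 \<le> t ==> t < e ==> phase t w = state 0 w"
  using before_first_event(2)[OF good] event by (simp add: ennreal_less_iff)

lemma fresh_after: "0 < first_event after"
  by (rule first_event_shift_pos[OF good])

lemma free_0: "good v ==> 0 < first_event v ==> free r 0 v = 0"
  using before_first_event(1)[of v 0 r] by simp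

lemma phase_0: "good v ==> 0 < first_event v ==> phase 0 v = state 0 v"
  using before_first_event(2)[of v 0] by simp

lemma phase_after: "0 \<le> t ==> phase (e + t) w = phase t after"
  by (rule phase_shift[OF good event(2,3)])

lemma early_iff:
  assumes "0 \<le> x"
  shows "ennreal (x / - rate) < first_event w \<longleftrightarrow> x + rate * e < 0"
proof -
  have "0 < - rate" using drift by simp
  then have "x / - rate < e \<longleftrightarrow> x < e * - rate" and "0 \<le> x / - rate"
    using pos_divide_less_eq divide_nonneg_pos assms by blast+
  then show ?thesis
    unfolding event(1) by (simp add: ennreal_less_iff algebra_simps del: divide_minus_right) linarith
qed

lemma below_early':
  "0 \<le> x ==> x + rate * e < 0 ==> passage_below (free r) x w = ennreal (x / - rate)"
  using below_early[where r = r, OF good drift[of "state 0 w"], of x] early_iff[of x] by blast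

text \<open>A line that reaches the barrier exactly at \<open>e\<close> has not yet passed it,
  because passage is strict; hence the weak inequality. The passage is then searched for from the
  level after the jump.\<close>

lemma below_after:
  assumes "0 \<le> x + rate * e"
  shows "passage_below (free r) x w = ennreal e + passage_below (free r) (x + rate * e + mark) after"
proof -
  have "\<not> x < - free r t w" if "0 \<le> t" "t < e" for t
  proof -
    have "rate * e \<le> rate * t" using that drift[of "state 0 w"] by (simp add: mult_left_mono_neg)
    then show ?thesis using that assms by (simp add: free_before)
  qed
  then have "passage_below (free r) x w = ennreal e + first_time (%t. x < - free r (e + t) w)"
    unfolding passage_below_eq by (intro first_time_shift event)
  also have "first_time (%t. x < - free r (e + t) w) = passage_below (free r) (x + rate * e + mark) after"
    unfolding passage_below_eq first_time_def
    by (intro arg_cong[where f = Inf] image_cong) (auto simp: free_after)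
  finally show ?thesis .
qed

lemma not_above_before: "0 \<le> u ==> 0 \<le> t ==> t < e ==> \<not> u < free r t w"
  using drift[of "state 0 w"] mult_nonpos_nonneg[of rate t] by (simp add: free_before)

lemma above_hit: "0 \<le> u ==> u < rate * e + mark ==> passage_above (free r) u w = ennreal e"
  unfolding passage_above_eq
  using free_after[of 0] free_0[OF good_after fresh_after] event not_above_before by (intro first_time_eqI) auto

lemma above_after:
  assumes "0 \<le> u"
  shows "passage_above (free r) u w = ennreal e + passage_above (free r) (u - (rate * e + mark)) after"
proof -
  have "passage_above (free r) u w = ennreal e + first_time (%t. u < free r (e + t) w)"
    unfolding passage_above_eq using assms not_above_before by (intro first_time_shift event)
  also have "first_time (%t. u < free r (e + t) w) = passage_above (free r) (u - (rate * e + mark)) after"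
    unfolding passage_above_eq first_time_def
    by (intro arg_cong[where f = Inf] image_cong) (auto simp: free_after)
  finally show ?thesis .
qed

end

section \<open>Functionals computed event by event\<close>

text \<open>A functional evaluated along the events. \<open>A\<close> is its value if the clock
  rings before the next event, \<open>D\<close> the contribution collected at the event,
  \<open>W\<close> the weight of the continuation and \<open>X\<close> the level from which it
  continues. Their arguments are the state, the level, the elapsed time and, at an event, the mark;
  \<open>D\<close> also sees the world after the event. The counter bounds the number of events;
  exhausted, it yields 0, which makes the value increasing in \<open>n\<close>.\<close>

primrec event_value :: "('d => real => real => ennreal) => ('d => real => real => real => 'd world => ennreal)
    => ('d => real => real => real => ennreal) => ('d => real => real => real => real)
    => nat => real => 'd world => ennreal" where
  "event_value A D W X 0 x w = 0"
| "event_value A D W X (Suc n) x w =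
    (if ennreal (clock w) < first_event w then A (state 0 w) x (clock w)
     else D (state 0 w) x (enn2real (first_event w)) (first_mark w) (shift (enn2real (first_event w)) w)
       + W (state 0 w) x (enn2real (first_event w)) (first_mark w) *
         event_value A D W X n (X (state 0 w) x (enn2real (first_event w)) (first_mark w))
           (shift (enn2real (first_event w)) w))"

text \<open>All arrivals up to the clock are counted, also those of inactive components, which makes
  the count additive under \<open>shift\<close>. It is the termination measure of the recursion
  along the events.\<close>

definition event_count :: "('d::finite) world => nat" where
  "event_count w = renewals (%n. sojourn n w) (clock w) + (\<Sum>k\<in>UNIV. renewals (%n. gap k n w) (clock w))"

lemma event_count_after:
  fixes w :: "('d::finite) world"
  assumes "world_step r w e"
  shows "event_count (shift e w) < event_count w"
proof -
  interpret world_step r w e by fact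
  have S: "renewals (%n. sojourn n w) (clock w)
      = renewals (%n. sojourn n w) e + renewals (%n. sojourn n after) (clock after)"
    using renewal_sequence.renewals_add[OF goodD(1)[OF good], of e "clock w - e"] event
    by (simp add: shift_simps)
  have G: "renewals (%n. gap k n w) (clock w)
      = renewals (%n. gap k n w) e + renewals (%n. gap k n after) (clock after)" for k
    using renewal_sequence.renewals_add[OF goodD(2)[OF good], of e "clock w - e" k] event
    by (simp add: shift_simps)
  have "0 < renewals (%n. sojourn n w) e + (\<Sum>k\<in>UNIV. renewals (%n. gap k n w) e)"
  proof (cases "sojourn 0 w = ennreal e")
    case True
    then show ?thesis
      using renewal_sequence.arrival_le_iff[OF goodD(1)[OF good], of 0 e] by (simp add: arrival_def)
  next
    case False
    then have "gap (state 0 w) 0 w = ennreal e"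
      using event by (auto simp: first_event_def min_def split: if_splits)
    then have "0 < renewals (%n. gap (state 0 w) n w) e"
      using renewal_sequence.arrival_le_iff[OF goodD(2)[OF good], of "state 0 w" 0 e] by (simp add: arrival_def)
    moreover have "renewals (%n. gap (state 0 w) n w) e \<le> (\<Sum>k\<in>UNIV. renewals (%n. gap k n w) e)"
      by (rule member_le_sum) auto
    ultimately show ?thesis by linarith
  qed
  then show ?thesis
    unfolding event_count_def S G by (simp add: sum.distrib)
qed

text \<open>\<open>Rel x w y\<close> reads: \<open>y\<close> is a value of the functional from level
  \<open>x\<close> in the world \<open>w\<close>. A relation serves here because the workload
  functional depends on a reflected path that is not given as a function of the world. The induction
  works since each event lowers \<open>event_count\<close>; where the weight is 0, nothing has to be
  known about the continuation.\<close>

lemma event_value_unique: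
  fixes Rel :: "real => ('d::finite) world => ennreal => bool"
  assumes drift: "\<And>i. r i < 0"
    and good: "\<And>x w y. Rel x w y ==> good w"
    and early: "\<And>x w y. Rel x w y ==> ennreal (clock w) < first_event w ==>
      y = A (state 0 w) x (clock w)"
    and late: "\<And>x w y e. Rel x w y ==> world_step r w e ==>
      \<exists>y'. y = D (state 0 w) x e (first_mark w) (shift e w) + W (state 0 w) x e (first_mark w) * y' \<and>
        (W (state 0 w) x e (first_mark w) \<noteq> 0 \<longrightarrow> Rel (X (state 0 w) x e (first_mark w)) (shift e w) y')"
  shows "Rel x w y ==> event_count w < n ==> y = event_value A D W X n x w"
proof (induction n arbitrary: x w y)
  case (Suc n)
  show ?case
  proof (cases "ennreal (clock w) < first_event w")
    case True
    then show ?thesis using early[OF Suc.prems(1)] by simp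
  next
    case False
    let ?e = "enn2real (first_event w)"
    have fin: "first_event w \<noteq> \<infinity>"
      using False by (auto simp: not_less top_unique)
    then have "first_event w = ennreal ?e" by (simp add: less_top)
    moreover have "?e \<le> clock w"
      using False goodD(5)[OF good[OF Suc.prems(1)]] by (simp add: enn2real_leI not_less)
    ultimately interpret world_step r w ?e
      using good[OF Suc.prems(1)] drift by unfold_locales auto
    obtain y' where y': "y = D (state 0 w) x ?e (first_mark w) (shift ?e w) + W (state 0 w) x ?e (first_mark w) * y'"
        "W (state 0 w) x ?e (first_mark w) \<noteq> 0 ==> Rel (X (state 0 w) x ?e (first_mark w)) (shift ?e w) y'"
      using late[OF Suc.prems(1) world_step_axioms] by auto
    have "event_count (shift ?e w) < n"
      using event_count_after[OF world_step_axioms] Suc.prems(2) by simp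
    then have "W (state 0 w) x ?e (first_mark w) * y' = W (state 0 w) x ?e (first_mark w) *
        event_value A D W X n (X (state 0 w) x ?e (first_mark w)) (shift ?e w)"
      using Suc.IH y'(2) by (cases "W (state 0 w) x ?e (first_mark w) = 0") auto
    then show ?thesis using False y'(1) by simp
  qed
qed simp

context world_step begin

lemma clock_eq: "ennreal (clock w) = ennreal e + ennreal (clock after)"
  using event by (simp add: shift_simps flip: ennreal_plus)

lemma add_le_clock: "ennreal e + a \<le> ennreal (clock w) \<longleftrightarrow> a \<le> ennreal (clock after)"
  unfolding clock_eq by (simp add: ennreal_add_left_cancel_le)

lemma clock_le_add: "ennreal (clock w) \<le> ennreal e + a \<longleftrightarrow> ennreal (clock after) \<le> a"
  unfolding clock_eq by (simp add: ennreal_add_left_cancel_le)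

lemma phase_add: "a \<noteq> \<infinity> ==> phase (enn2real (ennreal e + a)) w = phase (enn2real a) after"
  using event by (simp add: enn2real_plus less_top phase_after)

lemma free_add:
  "a \<noteq> \<infinity> ==> free r (enn2real (ennreal e + a)) w = rate * e + mark + free r (enn2real a) after"
  using event by (simp add: enn2real_plus less_top free_after)

lemma mark_nonneg: "0 \<le> mark"
  by (rule first_mark_nonneg[OF good])

lemma phase_e: "phase e w = state 0 after"
  using phase_after[of 0] phase_0[OF good_after fresh_after] by simp

lemma free_e: "free r e w = rate * e + mark"
  using free_after[of 0] free_0[OF good_after fresh_after] by simp

lemma level_le: "x + rate * e \<le> x"
  using mult_nonpos_nonneg[of rate e] drift[of "state 0 w"] event by simp

end

definition minus_value :: "('d => real) => real => 'd => real => 'd world => real" where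
  "minus_value r K l x w = of_bool
    (passage_below (free r) x w \<le> min (passage_above (free r) (K - x) w) (ennreal (clock w)) \<and>
     phase (enn2real (passage_below (free r) x w)) w = l)"

definition star_value :: "('d => real) => real => real => 'd => real => 'd world => real" where
  "star_value r K a j x w = exp (- a * (x + free r (clock w) w)) * of_bool
    (ennreal (clock w) \<le> min (passage_below (free r) x w) (passage_above (free r) (K - x) w) \<and>
     phase (clock w) w = j)"

text \<open>Parametrised by the starting level \<open>x\<close>, so that the distance to the upper
  barrier is \<open>K - x\<close>: this is the integrand of \<open>eta_tilde\<close> at
  \<open>K - x\<close>. The same holds for \<open>eta_value\<close> and \<open>eta\<close>.\<close>

definition tilde_value :: "('d => real) => real => real => 'd => real => 'd world => real" where
  "tilde_value r K a l x w =
    exp (- a * (free r (enn2real (passage_above (free r) (K - x) w)) w - (K - x))) * of_bool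
    (passage_above (free r) (K - x) w \<le> min (passage_below (free r) x w) (ennreal (clock w)) \<and>
     phase (enn2real (passage_above (free r) (K - x) w)) w = l)"

definition eta_value :: "('d => real) => real => real => 'd => real => 'd world => real" where
  "eta_value r K a l x w =
    exp (- a * (free r (enn2real (passage_above (free r) (K - x) w)) w - (K - x))) * of_bool
    (passage_above (free r) (K - x) w \<le> ennreal (clock w) \<and>
     phase (enn2real (passage_above (free r) (K - x) w)) w = l)"

definition move :: "('d => real) => 'd => real => real => real => real" where
  "move r i x u m = x + r i * u + m"

definition inside :: "('d => real) => real => 'd => real => real => real => ennreal" where
  "inside r K i x u m = of_bool (0 \<le> x + r i * u \<and> x + r i * u + m \<le> K)"

definition inside_top :: "('d => real) => real => 'd => real => real => real => ennreal" where
  "inside_top r K i x u m = of_bool (x + r i * u + m \<le> K)"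

definition minus_early :: "('d => real) => 'd => 'd => real => real => ennreal" where
  "minus_early r l i x u = of_bool (x + r i * u \<le> 0 \<and> i = l)"

definition minus_late :: "('d => real) => 'd => 'd => real => real => real => 'd world => ennreal" where
  "minus_late r l i x u m w' = of_bool (x + r i * u < 0 \<and> i = l)"

definition star_early :: "('d => real) => real => 'd => 'd => real => real => ennreal" where
  "star_early r a j i x u = ennreal (exp (- a * (x + r i * u))) * of_bool (0 \<le> x + r i * u \<and> i = j)"

text \<open>The clock may ring at the very moment of a jump above \<open>K\<close>; the term below keeps the
  decomposition exact on that null event.\<close>

definition star_late :: "('d => real) => real => real => 'd => 'd => real => real => real => 'd world => ennreal" where
  "star_late r K a j i x u m w' = ennreal (exp (- a * (x + r i * u + m))) *
    of_bool (0 \<le> x + r i * u \<and> K < x + r i * u + m \<and> clock w' = 0 \<and> state 0 w' = j)"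

definition tilde_late :: "('d => real) => real => real => 'd => 'd => real => real => real => 'd world => ennreal" where
  "tilde_late r K a l i x u m w' = ennreal (exp (- a * (x + r i * u + m - K))) *
    of_bool (0 \<le> x + r i * u \<and> K < x + r i * u + m \<and> state 0 w' = l)"

definition eta_late :: "('d => real) => real => real => 'd => 'd => real => real => real => 'd world => ennreal" where
  "eta_late r K a l i x u m w' = ennreal (exp (- a * (x + r i * u + m - K))) *
    of_bool (K < x + r i * u + m \<and> state 0 w' = l)"

lemma ennreal_of_bool: "ennreal (of_bool p) = of_bool p"
  by simp

lemma drift_iff:
  assumes "(\<rho>::real) < 0"
  shows "x / - \<rho> \<le> t \<longleftrightarrow> x + \<rho> * t \<le> 0" "t \<le> x / - \<rho> \<longleftrightarrow> 0 \<le> x + \<rho> * t"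
  using pos_divide_le_eq[of "- \<rho>" x t] pos_le_divide_eq[of "- \<rho>" t x] assms
  by (auto simp: algebra_simps)

context
  fixes r :: "('d::finite) => real" and K :: real
  assumes r: "\<And>i. r i < 0"
begin

lemma quotient_nonneg: "0 \<le> x ==> 0 \<le> x / - r i"
  using r[of i] by (intro divide_nonneg_pos) auto

text \<open>Three cases at the first event: the line has passed below 0 earlier, which decides the
  value; the jump exceeds \<open>K\<close>, and the value is 0; or the path stays in [0, K], and
  both passage times are \<open>e\<close> plus those of the shifted world. If the clock rings first,
  only the position of the line at that time matters. The other functionals follow the same
  pattern.\<close>

lemma minus_event_value:
  assumes "good w" "0 \<le> x" "x \<le> K" "event_count w < n"
  shows "ennreal (minus_value r K l x w) = event_value (minus_early r l) (minus_late r l) (inside r K) (move r) n x w"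
proof (rule event_value_unique[where r = r and Rel = "%x w y. good w \<and> 0 \<le> x \<and> x \<le> K \<and> y = ennreal (minus_value r K l x w)", OF r])
  fix x w y
  assume *: "good w \<and> 0 \<le> x \<and> x \<le> K \<and> y = ennreal (minus_value r K l x w)"
  show "good w" using * by simp
  {
    assume early: "ennreal (clock w) < first_event w"
    let ?i = "state 0 w"
    have above: "first_event w \<le> passage_above (free r) (K - x) w"
      using * r by (intro above_ge) auto
    show "y = minus_early r l ?i x (clock w)"
    proof (cases "ennreal (x / - r ?i) < first_event w")
      case True
      have b: "passage_below (free r) x w = ennreal (x / - r ?i)"
        using * r True by (intro below_early) auto
      have ph: "phase (x / - r ?i) w = ?i"
        using * True quotient_nonneg[of x ?i] by (intro before_first_event) auto
      have "ennreal (x / - r ?i) \<le> passage_above (free r) (K - x) w"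
        using above True by (meson less_imp_le order_trans)
      moreover have "ennreal (x / - r ?i) \<le> ennreal (clock w) \<longleftrightarrow> x + r ?i * clock w \<le> 0"
        using * goodD(5)[of w] drift_iff(1)[OF r] by (simp add: ennreal_le_iff)
      ultimately show ?thesis
        using * quotient_nonneg[of x ?i] ph unfolding minus_value_def b minus_early_def
        by (auto simp del: divide_minus_right)
    next
      case False
      then have "first_event w \<le> passage_below (free r) x w"
        using * r by (intro below_ge) auto
      then have "\<not> passage_below (free r) x w \<le> ennreal (clock w)" using early by auto
      moreover have "\<not> x + r ?i * clock w \<le> 0"
      proof
        assume "x + r ?i * clock w \<le> 0"
        then have "x / - r ?i \<le> clock w" using drift_iff(1)[OF r] by blast
        then show False using False early ennreal_leI by (meson le_less_trans)
      qed
      ultimately show ?thesis using * by (simp add: minus_value_def minus_early_def)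
    qed
  }
  {
    fix e assume "world_step r w e"
    then interpret world_step r w e .
    show "\<exists>y'. y = minus_late r l (state 0 w) x e (first_mark w) (shift e w) + inside r K (state 0 w) x e (first_mark w) * y' \<and>
        (inside r K (state 0 w) x e (first_mark w) \<noteq> 0 \<longrightarrow> good (shift e w) \<and> 0 \<le> move r (state 0 w) x e (first_mark w) \<and>
          move r (state 0 w) x e (first_mark w) \<le> K \<and> y' = ennreal (minus_value r K l (move r (state 0 w) x e (first_mark w)) (shift e w)))"
    proof (cases "x + rate * e < 0")
      case True
      have q: "0 \<le> x / - rate" using * by (intro quotient_nonneg) auto
      have lt: "ennreal (x / - rate) < ennreal e" using early_iff[of x] True * event by simp
      then have "ennreal (x / - rate) \<le> passage_above (free r) (K - x) w"
        using above_ge[OF good drift, of "K - x"] * event by (auto intro: order_trans less_imp_le)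
      moreover have "ennreal (x / - rate) \<le> ennreal (clock w)"
        using lt event by (meson ennreal_leI less_imp_le order_trans)
      moreover have "phase (x / - rate) w = state 0 w"
        using q lt by (intro phase_before) (auto simp: ennreal_less_iff)
      ultimately have "minus_value r K l x w = of_bool (state 0 w = l)"
        using below_early'[OF _ True] * q by (simp add: minus_value_def del: divide_minus_right)
      then show ?thesis using True * by (simp add: minus_late_def inside_def)
    next
      case False
      have below: "passage_below (free r) x w = ennreal e + passage_below (free r) (x + rate * e + mark) after"
        using False by (intro below_after) auto
      show ?thesis
      proof (cases "x + rate * e + mark \<le> K")
        case True
        have above: "passage_above (free r) (K - x) w
            = ennreal e + passage_above (free r) (K - (x + rate * e + mark)) after"
          using above_after[of "K - x"] * by (simp add: algebra_simps)
        have "minus_value r K l x w = minus_value r K l (x + rate * e + mark) after"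
        \<comment> \<open>\<open>enn2real\<close> sends infinity to 0, so the case of no passage is
          kept apart; both indicators vanish in it.\<close>
        proof (cases "passage_below (free r) (x + rate * e + mark) after = \<infinity>")
          case fin: False
          show ?thesis
            unfolding minus_value_def below above min.bounded_iff add_le_clock phase_add[OF fin]
            using fin by (auto simp: ennreal_add_left_cancel_le)
        next
          case True
          then show ?thesis
            unfolding minus_value_def below by (simp add: top_unique)
        qed
        then show ?thesis
          using True False * good_after mark_nonneg by (simp add: minus_late_def inside_def move_def)
      next
        case out: False
        have "passage_above (free r) (K - x) w = ennreal e"
          using * out by (intro above_hit) auto
        \<comment> \<open>A tie of the two passage times would count as a passage below; it is
          excluded because the path is above \<open>K\<close>, hence positive, and needs positive
          time to come down.\<close>
        moreover have "0 < passage_below (free r) (x + rate * e + mark) after"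
          using out False * drift good_after fresh_after by (intro below_pos) auto
        ultimately have "minus_value r K l x w = 0"
          unfolding minus_value_def below using ennreal_add_left_cancel_le[of "ennreal e" _ 0]
          by (auto simp: not_le[symmetric])
        then show ?thesis using out False * by (simp add: minus_late_def inside_def)
      qed
    qed
  }
qed (use assms in auto)

lemma star_event_value:
  assumes "good w" "0 \<le> x" "x \<le> K" "event_count w < n"
  shows "ennreal (star_value r K a j x w) = event_value (star_early r a j) (star_late r K a j) (inside r K) (move r) n x w"
proof (rule event_value_unique[where r = r and Rel = "%x w y. good w \<and> 0 \<le> x \<and> x \<le> K \<and> y = ennreal (star_value r K a j x w)", OF r])
  fix x w y
  assume *: "good w \<and> 0 \<le> x \<and> x \<le> K \<and> y = ennreal (star_value r K a j x w)"
  show "good w" using * by simp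
  {
    assume early: "ennreal (clock w) < first_event w"
    let ?i = "state 0 w"
    have T: "0 \<le> clock w" using * by (simp add: goodD)
    have "first_event w \<le> passage_above (free r) (K - x) w"
      using * r by (intro above_ge) auto
    then have above: "ennreal (clock w) \<le> passage_above (free r) (K - x) w" using early by auto
    have vals: "free r (clock w) w = r ?i * clock w" "phase (clock w) w = ?i"
      using * T early by (auto simp: before_first_event)
    have "ennreal (clock w) \<le> passage_below (free r) x w \<longleftrightarrow> 0 \<le> x + r ?i * clock w"
    proof (cases "ennreal (x / - r ?i) < first_event w")
      case True
      have b: "passage_below (free r) x w = ennreal (x / - r ?i)"
        using * r True by (intro below_early) auto
      show ?thesis unfolding b
        using * quotient_nonneg[of x ?i] drift_iff(2)[OF r, of "clock w" x ?i] by (simp only: ennreal_le_iff)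
    next
      case False
      then have "first_event w \<le> passage_below (free r) x w"
        using * r by (intro below_ge) auto
      moreover have "clock w \<le> x / - r ?i"
        using False early quotient_nonneg[of x ?i] * by (metis ennreal_le_iff le_less_trans less_imp_le not_le)
      ultimately show ?thesis using early drift_iff(2)[OF r, of "clock w" x ?i] by auto
    qed
    then show "y = star_early r a j ?i x (clock w)"
      using * above by (auto simp: star_value_def star_early_def vals)
  }
  {
    fix e assume "world_step r w e"
    then interpret world_step r w e .
    show "\<exists>y'. y = star_late r K a j (state 0 w) x e (first_mark w) (shift e w) + inside r K (state 0 w) x e (first_mark w) * y' \<and>
        (inside r K (state 0 w) x e (first_mark w) \<noteq> 0 \<longrightarrow> good (shift e w) \<and> 0 \<le> move r (state 0 w) x e (first_mark w) \<and>
          move r (state 0 w) x e (first_mark w) \<le> K \<and> y' = ennreal (star_value r K a j (move r (state 0 w) x e (first_mark w)) (shift e w)))"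
    proof (cases "x + rate * e < 0")
      case True
      have "ennreal (x / - rate) < ennreal e" using early_iff[of x] True * event by simp
      then have "ennreal (x / - rate) < ennreal (clock w)"
        using event by (meson ennreal_leI less_le_trans)
      then have "star_value r K a j x w = 0"
        using below_early'[OF _ True] * by (simp add: star_value_def not_le[symmetric] del: divide_minus_right)
      then show ?thesis using True * by (simp add: star_late_def inside_def)
    next
      case False
      have below: "passage_below (free r) x w = ennreal e + passage_below (free r) (x + rate * e + mark) after"
        using False by (intro below_after) auto
      have T: "clock w = e + clock after" "0 \<le> clock after" using event by (simp_all add: shift_simps)
      have end_vals: "free r (clock w) w = rate * e + mark + free r (clock after) after"
          "phase (clock w) w = phase (clock after) after"
        unfolding T(1) using T(2) by (simp_all add: free_after phase_after)
      show ?thesis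
      proof (cases "x + rate * e + mark \<le> K")
        case True
        have above: "passage_above (free r) (K - x) w
            = ennreal e + passage_above (free r) (K - (x + rate * e + mark)) after"
          using above_after[of "K - x"] * by (simp add: algebra_simps)
        have "star_value r K a j x w = star_value r K a j (x + rate * e + mark) after"
          unfolding star_value_def below above min.bounded_iff clock_le_add end_vals
          by (simp add: add.assoc)
        then show ?thesis
          using True False * good_after mark_nonneg by (simp add: star_late_def inside_def move_def)
      next
        case out: False
        have above: "passage_above (free r) (K - x) w = ennreal e + 0"
          using * out above_hit[of "K - x"] by simp
        have "star_value r K a j x w = exp (- a * (x + rate * e + mark)) * of_bool (clock after = 0 \<and> state 0 after = j)"
          unfolding star_value_def below above min.bounded_iff clock_le_add end_vals
          using T(2) free_0[OF good_after fresh_after] phase_0[OF good_after fresh_after] by (auto simp: ennreal_eq_0_iff add.assoc)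
        then show ?thesis using out False * by (simp add: star_late_def inside_def ennreal_mult)
      qed
    qed
  }
qed (use assms in auto)

lemma tilde_event_value:
  assumes "good w" "0 \<le> x" "x \<le> K" "event_count w < n"
  shows "ennreal (tilde_value r K a l x w) = event_value (%_ _ _. 0) (tilde_late r K a l) (inside r K) (move r) n x w"
proof (rule event_value_unique[where r = r and Rel = "%x w y. good w \<and> 0 \<le> x \<and> x \<le> K \<and> y = ennreal (tilde_value r K a l x w)", OF r])
  fix x w y
  assume *: "good w \<and> 0 \<le> x \<and> x \<le> K \<and> y = ennreal (tilde_value r K a l x w)"
  show "good w" using * by simp
  {
    assume early: "ennreal (clock w) < first_event w"
    have "first_event w \<le> passage_above (free r) (K - x) w"
      using * r by (intro above_ge) auto
    then have "\<not> passage_above (free r) (K - x) w \<le> ennreal (clock w)" using early by auto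
    then show "y = 0" using * by (simp add: tilde_value_def)
  }
  {
    fix e assume "world_step r w e"
    then interpret world_step r w e .
    show "\<exists>y'. y = tilde_late r K a l (state 0 w) x e (first_mark w) (shift e w) + inside r K (state 0 w) x e (first_mark w) * y' \<and>
        (inside r K (state 0 w) x e (first_mark w) \<noteq> 0 \<longrightarrow> good (shift e w) \<and> 0 \<le> move r (state 0 w) x e (first_mark w) \<and>
          move r (state 0 w) x e (first_mark w) \<le> K \<and> y' = ennreal (tilde_value r K a l (move r (state 0 w) x e (first_mark w)) (shift e w)))"
    proof (cases "x + rate * e < 0")
      case True
      have "ennreal (x / - rate) < ennreal e" using early_iff[of x] True * event by simp
      then have "ennreal (x / - rate) < passage_above (free r) (K - x) w"
        using above_ge[OF good drift, of "K - x"] * event by (auto intro: less_le_trans)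
      then have "tilde_value r K a l x w = 0"
        using below_early'[OF _ True] * by (simp add: tilde_value_def not_le[symmetric] del: divide_minus_right)
      then show ?thesis using True * by (simp add: tilde_late_def inside_def)
    next
      case False
      have below: "passage_below (free r) x w = ennreal e + passage_below (free r) (x + rate * e + mark) after"
        using False by (intro below_after) auto
      show ?thesis
      proof (cases "x + rate * e + mark \<le> K")
        case True
        let ?a = "passage_above (free r) (K - (x + rate * e + mark)) after"
        have above: "passage_above (free r) (K - x) w = ennreal e + ?a"
          using above_after[of "K - x"] * by (simp add: algebra_simps)
        have "tilde_value r K a l x w = tilde_value r K a l (x + rate * e + mark) after"
        proof (cases "?a = \<infinity>")
          case False
          then show ?thesis
            unfolding tilde_value_def below above min.bounded_iff add_le_clock phase_add[OF False] free_add[OF False]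
            by (auto simp: ennreal_add_left_cancel_le algebra_simps)
        qed (simp add: tilde_value_def above top_unique)
        then show ?thesis
          using True False * good_after mark_nonneg by (simp add: tilde_late_def inside_def move_def)
      next
        case out: False
        have "passage_above (free r) (K - x) w = ennreal e"
          using * out by (intro above_hit) auto
        then have "tilde_value r K a l x w = exp (- a * (x + rate * e + mark - K)) * of_bool (state 0 after = l)"
          using event by (simp add: tilde_value_def below free_e phase_e algebra_simps)
        then show ?thesis using out False * by (simp add: tilde_late_def inside_def ennreal_mult)
      qed
    qed
  }
qed (use assms in auto)

text \<open>Without a lower barrier the level may become negative along the recursion; only
  \<open>x <= K\<close> is handed on from event to event.\<close>

lemma eta_event_value:
  assumes "good w" "x \<le> K" "event_count w < n"
  shows "ennreal (eta_value r K a l x w) = event_value (%_ _ _. 0) (eta_late r K a l) (inside_top r K) (move r) n x w"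
proof (rule event_value_unique[where r = r and Rel = "%x w y. good w \<and> x \<le> K \<and> y = ennreal (eta_value r K a l x w)", OF r])
  fix x w y
  assume *: "good w \<and> x \<le> K \<and> y = ennreal (eta_value r K a l x w)"
  show "good w" using * by simp
  {
    assume early: "ennreal (clock w) < first_event w"
    have "first_event w \<le> passage_above (free r) (K - x) w"
      using * r by (intro above_ge) auto
    then have "\<not> passage_above (free r) (K - x) w \<le> ennreal (clock w)" using early by auto
    then show "y = 0" using * by (simp add: eta_value_def)
  }
  {
    fix e assume "world_step r w e"
    then interpret world_step r w e .
    show "\<exists>y'. y = eta_late r K a l (state 0 w) x e (first_mark w) (shift e w) + inside_top r K (state 0 w) x e (first_mark w) * y' \<and>
        (inside_top r K (state 0 w) x e (first_mark w) \<noteq> 0 \<longrightarrow> good (shift e w) \<and>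
          move r (state 0 w) x e (first_mark w) \<le> K \<and> y' = ennreal (eta_value r K a l (move r (state 0 w) x e (first_mark w)) (shift e w)))"
    proof (cases "x + rate * e + mark \<le> K")
      case True
      let ?a = "passage_above (free r) (K - (x + rate * e + mark)) after"
      have above: "passage_above (free r) (K - x) w = ennreal e + ?a"
        using above_after[of "K - x"] * by (simp add: algebra_simps)
      have "eta_value r K a l x w = eta_value r K a l (x + rate * e + mark) after"
      proof (cases "?a = \<infinity>")
        case False
        then show ?thesis
          unfolding eta_value_def above add_le_clock phase_add[OF False] free_add[OF False]
          by (auto simp: algebra_simps)
      qed (simp add: eta_value_def above top_unique)
      then show ?thesis
        using True * good_after by (simp add: eta_late_def inside_top_def move_def)
    next
      case out: False
      have "passage_above (free r) (K - x) w = ennreal e"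
        using * out by (intro above_hit) auto
      then have "eta_value r K a l x w = exp (- a * (x + rate * e + mark - K)) * of_bool (state 0 after = l)"
        using event by (simp add: eta_value_def free_e phase_e algebra_simps)
      then show ?thesis using out * by (simp add: eta_late_def inside_top_def ennreal_mult)
    qed
  }
qed (use assms in auto)

end

section \<open>Two-sided reflection between events\<close>

text \<open>The support condition on the Stieltjes measure of \<open>f\<close>, expressed without
  the measure for an \<open>f\<close> that starts from 0: \<open>f\<close> is constant while
  \<open>v\<close> avoids \<open>c\<close>, and it has no jump from the left at a time where
  \<open>v\<close> differs from \<open>c\<close>. In this form the condition survives a shift of the
  time origin.\<close>

definition grows_at :: "(real => real) => (real => real) => real => bool" where
  "grows_at f v c \<longleftrightarrow> f 0 = 0 \<and> mono_on {0..} f \<and>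
    (\<forall>s t. 0 \<le> s \<longrightarrow> s < t \<longrightarrow> (\<forall>q\<in>{s<..t}. v q \<noteq> c) \<longrightarrow> f t = f s) \<and>
    (\<forall>t \<epsilon>. 0 < t \<longrightarrow> v t \<noteq> c \<longrightarrow> 0 < \<epsilon> \<longrightarrow> (\<exists>q. 0 \<le> q \<and> q < t \<and> f t < f q + \<epsilon>))"

definition reflected :: "real => (real => real) => (real => real) => (real => real) => (real => real) => bool" where
  "reflected K y v l u \<longleftrightarrow> (\<forall>t\<ge>0. v t = y t + l t - u t \<and> 0 \<le> v t \<and> v t \<le> K) \<and>
    grows_at l v 0 \<and> grows_at u v K"

lemma reflected_cong:
  assumes "\<And>t. 0 \<le> t ==> y t = y' t"
  shows "reflected K y v l u \<longleftrightarrow> reflected K y' v l u"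
  unfolding reflected_def using assms by auto

text \<open>The mass of a point is the jump of \<open>f\<close> there, by continuity from above
  along half-open intervals shrinking to \<open>t\<close>. A null point therefore has values of
  \<open>f\<close> close to \<open>f t\<close> at earlier times, which can be chosen after
  \<open>a\<close>.\<close>

lemma emeasure_interval_measure_singleton:
  assumes f: "mono f" "\<And>t. continuous (at_right t) f" and null: "emeasure (interval_measure f) {t} = 0" and \<epsilon>: "0 < \<epsilon>" and "a < t"
  shows "\<exists>q. a \<le> q \<and> q < t \<and> f t < f q + \<epsilon>"
proof (rule ccontr)
  assume "\<not> (\<exists>q. a \<le> q \<and> q < t \<and> f t < f q + \<epsilon>)"
  then have jump: "f q + \<epsilon> \<le> f t" if "a \<le> q" "q < t" for q using that by force
  define I where "I n = {t - (t - a) / Suc n <.. t}" for n :: nat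
  have I: "emeasure (interval_measure f) (I n) = f t - f (t - (t - a) / Suc n)" for n
    unfolding I_def using \<open>a < t\<close> f by (intro emeasure_interval_measure_Ioc) (auto dest: monoD)
  have Inter: "(\<Inter>n. I n) = {t}"
  proof (safe)
    fix q assume q: "q \<in> (\<Inter>n. I n)"
    show "q = t"
    proof (rule ccontr)
      assume "q \<noteq> t"
      moreover have "q \<le> t" using q by (auto simp: I_def)
      ultimately have "0 < (t - q) / (t - a)" using \<open>a < t\<close> by simp
      then obtain n where n: "inverse (real (Suc n)) < (t - q) / (t - a)"
        using reals_Archimedean by blast
      have "(t - a) / Suc n < t - q"
        using n \<open>a < t\<close> by (simp add: field_simps)
      moreover have "t - (t - a) / Suc n < q" using q by (auto simp: I_def)
      ultimately show False by simp
    qed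
  qed (use \<open>a < t\<close> in \<open>auto simp: I_def\<close>)
  have "decseq I"
    unfolding decseq_def
  proof (intro allI impI)
    fix m n :: nat assume "m \<le> n"
    then have "(t - a) / Suc n \<le> (t - a) / Suc m" using \<open>a < t\<close> by (intro divide_left_mono) auto
    then show "I n \<subseteq> I m" by (auto simp: I_def)
  qed
  have "(INF n. emeasure (interval_measure f) (I n)) = emeasure (interval_measure f) (\<Inter>n. I n)"
  proof (rule INF_emeasure_decseq)
    show "range I \<subseteq> sets (interval_measure f)" by (auto simp: I_def)
  qed (fact, simp add: I)
  then have "(INF n. emeasure (interval_measure f) (I n)) = 0" using null by (simp add: Inter)
  moreover have "ennreal \<epsilon> \<le> (INF n. emeasure (interval_measure f) (I n))"
  proof (rule INF_greatest)
    fix n :: nat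
    have "(t - a) / Suc n \<le> (t - a) / 1" using \<open>a < t\<close> by (intro divide_left_mono) auto
    then have "a \<le> t - (t - a) / Suc n" by simp
    moreover have "t - (t - a) / Suc n < t" using \<open>a < t\<close> by simp
    ultimately show "ennreal \<epsilon> \<le> emeasure (interval_measure f) (I n)"
      unfolding I using jump[of "t - (t - a) / Suc n"] by (intro ennreal_leI) linarith
  qed
  ultimately show False using \<epsilon> by simp
qed

text \<open>Borel sets of nonnegative times on which \<open>v\<close> differs from \<open>c\<close>
  are null; this is applied to intervals \<open>{s<..t}\<close> and to single points. At time 0 the
  jump is measured from time \<open>-1\<close>, where \<open>f\<close> vanishes, so a nonzero
  initial value forces \<open>v 0 = c\<close>.\<close>

lemma
  assumes f: "mono f" "\<And>t. continuous (at_right t) f" "\<And>t. t < 0 ==> f t = 0"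
    and ae: "AE t in interval_measure f. 0 \<le> t \<longrightarrow> v t = c"
  shows grows_at_interval_measure: "grows_at (%t. f t - f 0) v c"
    and no_initial_growth: "v 0 \<noteq> c ==> f 0 = 0"
proof -
  have null: "emeasure (interval_measure f) A = 0"
    if "A \<in> sets borel" "\<And>t. t \<in> A ==> 0 \<le> t \<and> v t \<noteq> c" for A
  proof -
    have "AE t in interval_measure f. t \<notin> A"
      using ae by eventually_elim (use that(2) in blast)
    then show ?thesis using that(1) by (simp add: AE_iff_null_sets null_setsD1)
  qed
  have jump: "\<exists>q. a \<le> q \<and> q < t \<and> f t < f q + \<epsilon>" if "a < t" "0 \<le> t" "v t \<noteq> c" "0 < \<epsilon>" for a t \<epsilon>
    using that by (intro emeasure_interval_measure_singleton f null) auto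
  show "f 0 = 0" if "v 0 \<noteq> c"
  proof (rule ccontr)
    assume "f 0 \<noteq> 0"
    moreover have "0 \<le> f 0" using monoD[OF f(1), of "-1" 0] f(3)[of "-1"] by simp
    ultimately show False using jump[of "-1" 0 "f 0"] that f(3) by force
  qed
  show "grows_at (%t. f t - f 0) v c"
    unfolding grows_at_def
  proof (intro conjI allI impI)
    show "mono_on {0..} (%t. f t - f 0)" using f(1) by (simp add: mono_on_def mono_def)
    fix s t :: real assume st: "0 \<le> s" "s < t" "\<forall>q\<in>{s<..t}. v q \<noteq> c"
    then have "emeasure (interval_measure f) {s<..t} = 0" by (intro null) auto
    then have "f t - f s \<le> 0"
      using st f by (simp add: emeasure_interval_measure_Ioc monoD)
    then show "f t - f 0 = f s - f 0" using st f(1) by (simp add: antisym monoD)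
  next
    fix t \<epsilon> :: real assume "0 < t" "v t \<noteq> c" "0 < \<epsilon>"
    then obtain q where "0 \<le> q" "q < t" "f t < f q + \<epsilon>" using jump[of 0 t \<epsilon>] by auto
    then show "\<exists>q\<ge>0. q < t \<and> f t - f 0 < f q - f 0 + \<epsilon>" by (intro exI[of _ q]) simp
  qed simp
qed

text \<open>A one-dimensional complementarity problem: the amount \<open>u\<close> removed from
  \<open>b\<close> is determined by being nonzero only when the cap \<open>K\<close> is
  reached.\<close>

lemma clipped:
  fixes a b u K :: real
  assumes "a = b - u" "0 \<le> u" "a \<le> K" "a \<noteq> K ==> u = 0"
  shows "a = min K b \<and> u = max 0 (b - K)"
proof (cases "a = K")
  case True
  then have "K \<le> b" "u = b - K" using assms(1,2) by linarith+
  then show ?thesis using True by (simp add: min_absorb1 max_absorb2)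
next
  case False
  then have "u = 0" "b = a" using assms by auto
  then show ?thesis using assms(3) by (simp add: min_absorb2 max_absorb1)
qed

text \<open>The initial level is nonnegative, so it can only be truncated at \<open>K\<close>.
  Subtracting the truncated amount leaves a reflection problem whose regulators start from
  0.\<close>

lemma double_reflection_initial:
  assumes R: "double_reflection K y v l u" and y0: "0 \<le> y 0" and K: "0 < K"
  shows "reflected K (%t. v 0 + (y t - y 0)) v l (%t. u t - u 0)"
    and "v 0 = min K (y 0)" and "u 0 = max 0 (y 0 - K)"
proof -
  have l: "mono l" "\<And>t. continuous (at_right t) l" "\<And>t. t < 0 ==> l t = 0"
    and u: "mono u" "\<And>t. continuous (at_right t) u" "\<And>t. t < 0 ==> u t = 0"
    and ae: "AE t in interval_measure l. 0 \<le> t \<longrightarrow> v t = 0" "AE t in interval_measure u. 0 \<le> t \<longrightarrow> v t = K"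
    and v: "\<And>t. 0 \<le> t ==> v t = y t + l t - u t \<and> 0 \<le> v t \<and> v t \<le> K"
    using R by (auto simp: double_reflection_def)
  have l0: "0 \<le> l 0" using monoD[OF l(1), of "-1" 0] l(3)[of "-1"] by simp
  have u0: "0 \<le> u 0" using monoD[OF u(1), of "-1" 0] u(3)[of "-1"] by simp
  have "v 0 \<noteq> 0 ==> l 0 = 0" by (rule no_initial_growth[OF l ae(1)])
  moreover have vK: "v 0 \<noteq> K ==> u 0 = 0" by (rule no_initial_growth[OF u ae(2)])
  \<comment> \<open>If \<open>l 0\<close> were positive, then \<open>v 0 = 0\<close>, hence
    \<open>u 0 = 0\<close> because \<open>0 < K\<close>, contradicting
    \<open>v 0 = y 0 + l 0 - u 0\<close> with \<open>0 <= y 0\<close>.\<close>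
  ultimately have l_0: "l 0 = 0" using v[of 0] l0 u0 y0 K by fastforce
  show v0: "v 0 = min K (y 0)" and "u 0 = max 0 (y 0 - K)"
    using clipped[of "v 0" "y 0" "u 0" K] v[of 0] l_0 u0 vK by auto
  have "v t = v 0 + (y t - y 0) + l t - (u t - u 0) \<and> 0 \<le> v t \<and> v t \<le> K" if "0 \<le> t" for t
    using v[OF that] v[of 0] l_0 by auto
  then show "reflected K (%t. v 0 + (y t - y 0)) v l (%t. u t - u 0)"
    unfolding reflected_def
    using grows_at_interval_measure[OF l ae(1), unfolded l_0 diff_zero] grows_at_interval_measure[OF u ae(2)] by blast
qed

lemma grows_atD:
  assumes "grows_at f v c"
  shows "f 0 = 0" "\<And>s t. 0 \<le> s ==> s \<le> t ==> f s \<le> f t"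
    "\<And>s t. 0 \<le> s ==> s \<le> t ==> (\<And>q. s < q ==> q \<le> t ==> v q \<noteq> c) ==> f t = f s"
    "\<And>t \<epsilon>. 0 < t ==> v t \<noteq> c ==> 0 < \<epsilon> ==> \<exists>q. 0 \<le> q \<and> q < t \<and> f t < f q + \<epsilon>"
  using assms unfolding grows_at_def
  by (simp, force simp: mono_on_def, metis greaterThanAtMost_iff order_le_less, simp)

lemma grows_at_shift:
  assumes f: "grows_at f v c" and e: "0 \<le> e"
  shows "grows_at (%t. f (e + t) - f e) (%t. v (e + t)) c"
  unfolding grows_at_def
proof (intro conjI allI impI)
  note D = grows_atD[OF f]
  show "mono_on {0..} (%t. f (e + t) - f e)" using D(2) e by (auto simp: mono_on_def)
  {
    fix s t :: real assume st: "0 \<le> s" "s < t" "\<forall>q\<in>{s<..t}. v (e + q) \<noteq> c"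
    have "v q \<noteq> c" if "e + s < q" "q \<le> e + t" for q using st(3)[rule_format, of "q - e"] that by auto
    then have "f (e + t) = f (e + s)" using st e by (intro D(3)) auto
    then show "f (e + t) - f e = f (e + s) - f e" by simp
  }
  fix t \<epsilon> :: real assume t: "0 < t" "v (e + t) \<noteq> c" "0 < \<epsilon>"
  then obtain q where q: "0 \<le> q" "q < e + t" "f (e + t) < f q + \<epsilon>"
    using D(4)[of "e + t" \<epsilon>] e by auto
  \<comment> \<open>If the time \<open>q\<close> found for the unshifted path lies before
    \<open>e\<close>, monotonicity allows moving it up to \<open>e\<close>.\<close>
  show "\<exists>q\<ge>0. q < t \<and> f (e + t) - f e < f (e + q) - f e + \<epsilon>"
    using q t D(2)[of q e] by (intro exI[of _ "max 0 (q - e)"]) (auto simp: max_def)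
qed simp

section \<open>Explicit reflection of a decreasing line up to its first jump\<close>

locale reflected_start =
  fixes K x \<rho> :: real and y v l u :: "real => real" and e :: ennreal
  assumes refl: "reflected K y v l u" and K: "0 < K" and x: "0 \<le> x" "x \<le> K" and \<rho>: "\<rho> < 0"
    and start: "\<And>t. 0 \<le> t ==> ennreal t < e ==> y t = x + \<rho> * t" and e: "0 < e"
begin

lemma v: "0 \<le> t ==> v t = y t + l t - u t" "0 \<le> t ==> 0 \<le> v t" "0 \<le> t ==> v t \<le> K"
  using refl unfolding reflected_def by blast+

lemma grows: "grows_at l v 0" "grows_at u v K"
  using refl by (simp_all add: reflected_def)

lemmas lu0 = grows_atD(1)[OF grows(1)] grows_atD(1)[OF grows(2)]
lemmas mono = grows_atD(2)[OF grows(1)] grows_atD(2)[OF grows(2)]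
lemmas l_constant = grows_atD(3)[OF grows(1)]
lemmas u_constant = grows_atD(3)[OF grows(2)]
lemmas l_left = grows_atD(4)[OF grows(1)]

abbreviation "w t \<equiv> max (x + \<rho> * t) 0"

lemma w_diff: "s \<le> t ==> \<rho> * t - \<rho> * s \<le> w t - w s"
  using mult_left_mono_neg[of s t \<rho>] less_imp_le[OF \<rho>] by (auto simp: max_def)

text \<open>Let \<open>s\<close> be the supremum of the times up to \<open>t\<close> with
  \<open>v <= w\<close>. After it \<open>v > w >= 0\<close>, so the lower regulator rests and
  \<open>v\<close> falls at least as fast as \<open>w\<close>; thus \<open>v\<close> cannot have got
  above \<open>w\<close>.\<close>

lemma upper:
  assumes t: "0 \<le> t" "ennreal t < e"
  shows "v t \<le> w t"
proof (rule ccontr)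
  assume gt: "\<not> v t \<le> w t"
  have early: "ennreal q < e" if "q \<le> t" for q using that t by (meson ennreal_leI le_less_trans)
  define A where "A = {q. 0 \<le> q \<and> q \<le> t \<and> v q \<le> w q}"
  have "0 \<in> A" using t v(1)[of 0] start[of 0] e lu0 x by (simp add: A_def)
  have bdd: "bdd_above A" by (auto simp: A_def bdd_above_def)
  define s where "s = Sup A"
  have s0: "0 \<le> s" using \<open>0 \<in> A\<close> bdd by (simp add: s_def cSup_upper)
  have st: "s \<le> t" unfolding s_def using \<open>0 \<in> A\<close> by (intro cSup_least) (auto simp: A_def)
  have big: "w q < v q" if "s < q" "q \<le> t" for q
  proof (rule ccontr)
    assume "\<not> w q < v q"
    then have "q \<in> A" unfolding A_def mem_Collect_eq not_less using that s0 by (intro conjI) auto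
    then show False using cSup_upper[OF _ bdd] that by (fastforce simp: s_def)
  qed
  have step: "v t' \<le> v q + \<rho> * t' - \<rho> * q + (l t' - l q)" if "0 \<le> q" "q \<le> t'" "t' \<le> t" for q t'
    using that v(1)[of t'] v(1)[of q] start[of t'] start[of q] early[of t'] early[of q] mono(2)[of q t']
    by auto
  show False
  proof (cases "v s \<le> w s")
    case True
    have "l t = l s" using s0 st big by (intro l_constant) (auto dest: big)
    then show False using step[of s t] s0 st True w_diff[OF st] gt by auto
  next
    \<comment> \<open>The supremum is not attained. As \<open>v s\<close> is positive,
      \<open>l\<close> has no jump at \<open>s\<close> and grows by less than
      \<open>v s - w s\<close> from some \<open>q < s\<close> on; a point \<open>q'\<close> of
      \<open>A\<close> between \<open>q\<close> and \<open>s\<close> then gives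
      \<open>v s < v s\<close>.\<close>
    case False
    then have "s \<notin> A" by (simp add: A_def)
    then have "s \<noteq> 0" using \<open>0 \<in> A\<close> by auto
    then obtain q where q: "0 \<le> q" "q < s" "l s < l q + (v s - w s)"
      using False s0 l_left[of s "v s - w s"] by (auto simp: max_def split: if_splits)
    obtain q' where q': "q' \<in> A" "q < q'"
      using q(2) less_cSupD[of A q] \<open>0 \<in> A\<close> by (auto simp: s_def)
    have "q' \<le> s" using q'(1) bdd by (simp add: s_def cSup_upper)
    then show False
      using step[of q' s] q' q mono(1)[of q q'] w_diff[of q' s] st by (auto simp: A_def)
  qed
qed

text \<open>Even from \<open>x = K\<close> the line is below \<open>K\<close> at every positive
  time, so the upper regulator cannot act before \<open>e\<close>.\<close>

lemma u_before: "0 \<le> t ==> ennreal t < e ==> u t = 0"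
proof -
  assume t: "0 \<le> t" "ennreal t < e"
  have "v q \<noteq> K" if "0 < q" "q \<le> t" for q
  proof -
    have "v q \<le> w q" using that t by (intro upper) (auto intro: le_less_trans ennreal_leI)
    moreover have "w q < K" using K x that \<rho> by (auto simp: max_def mult_neg_pos add_strict_increasing2 intro: add_le_less_mono[of x K _ 0, simplified])
    ultimately show ?thesis by linarith
  qed
  then show ?thesis using u_constant[of 0 t] t lu0 by simp
qed

lemma v_before: "0 \<le> t ==> ennreal t < e ==> v t = w t"
  and l_before: "0 \<le> t ==> ennreal t < e ==> l t = max 0 (- (x + \<rho> * t))"
  using upper[of t] u_before[of t] start[of t] v[of t] mono(1)[of 0 t] lu0 by (auto simp: max_def)

lemma u_before_jump:
  assumes "e = ennreal s" "v s \<noteq> K"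
  shows "u s = 0"
proof -
  have s: "0 < s" using assms e by simp
  have "v q \<noteq> K" if "0 < q" "q \<le> s" for q
  proof (cases "q = s")
    case False
    then have "v q = w q" using that assms by (intro v_before) (auto simp: ennreal_less_iff)
    moreover have "w q < K" using K x that \<rho> by (auto simp: max_def mult_neg_pos intro: add_le_less_mono[of x K _ 0, simplified])
    ultimately show ?thesis by linarith
  qed (use assms in simp)
  then show ?thesis using u_constant[of 0 s] s lu0 by simp
qed

text \<open>The lower regulator does not jump at \<open>s\<close>: this is its support condition if
  \<open>v s\<close> differs from 0, and if \<open>v s = 0\<close> the upper regulator rests, so the
  nonnegative terms \<open>w s\<close>, \<open>m\<close> and the increment of \<open>l\<close> add
  up to 0. What remains is the complementarity problem at the cap.\<close>

lemma at_jump: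
  assumes s: "e = ennreal s" "0 \<le> s" and jump: "y s = x + \<rho> * s + m" "0 \<le> m"
  shows "v s = min K (w s + m)" "u s = max 0 (w s + m - K)"
proof -
  have "0 < s" using s e by simp
  let ?l = "max 0 (- (x + \<rho> * s))"
  have near: "l q = max 0 (- (x + \<rho> * q))" if "0 \<le> q" "q < s" for q
    using that s by (intro l_before) (auto simp: ennreal_less_iff)
  have "?l \<le> l s"
  proof (rule tendsto_le[OF trivial_limit_at_left_real])
    show "((%q. max 0 (- (x + \<rho> * q))) \<longlongrightarrow> ?l) (at_left s)" by (intro tendsto_intros)
    show "\<forall>\<^sub>F q in at_left s. max 0 (- (x + \<rho> * q)) \<le> l s"
      unfolding eventually_at_left[OF \<open>0 < s\<close>]
      using near mono(1) \<open>0 < s\<close> by (intro exI[of _ 0]) (metis less_imp_le)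
  qed (rule tendsto_const)
  moreover have "l s \<le> ?l" if pos: "v s \<noteq> 0"
  proof (rule field_le_epsilon)
    fix \<epsilon> :: real assume "0 < \<epsilon>"
    then obtain q where q: "0 \<le> q" "q < s" "l s < l q + \<epsilon>" using l_left[OF \<open>0 < s\<close> pos] by blast
    then show "l s \<le> ?l + \<epsilon>"
      using near[of q] mult_left_mono_neg[of q s \<rho>] less_imp_le[OF \<rho>] by (auto simp: max_def split: if_splits)
  qed
  moreover have "0 \<le> u s" using mono(2)[of 0 s] s lu0 by simp
  moreover have "w s = x + \<rho> * s + ?l" by (simp add: max_def)
  ultimately have eq: "v s = w s + m + (l s - ?l) - u s" and l: "?l \<le> l s" "v s \<noteq> 0 ==> l s = ?l"
      and u: "0 \<le> u s"
    using v(1)[of s] s jump by auto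
  have "l s = ?l"
  proof (cases "v s = 0")
    case True
    then have "u s = 0" using u_before_jump[OF s(1)] K by simp
    moreover have "0 \<le> w s" by simp
    ultimately show ?thesis using True eq l(1) jump(2) by linarith
  qed (rule l(2))
  then show "v s = min K (w s + m)" "u s = max 0 (w s + m - K)"
    using clipped[OF _ u v(3)[OF s(2)] u_before_jump[OF s(1)], of "w s + m"] eq by simp_all
qed

end

text \<open>\<open>x / - r i\<close> is the time at which the line reaches 0, so the factor of
  \<open>a2\<close> is the idle time accumulated by \<open>t\<close>. In \<open>chi_weight\<close>
  it is joined by the work lost at the jump.\<close>

definition chi_early :: "('d => real) => real => real => 'd => 'd => real => real => ennreal" where
  "chi_early r a1 a2 j i x t =
    ennreal (exp (- a1 * max (x + r i * t) 0 - a2 * max 0 (t - x / - r i))) * of_bool (i = j)"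

definition chi_weight :: "('d => real) => real => real => real => 'd => real => real => real => ennreal" where
  "chi_weight r K a2 a3 i x u m =
    ennreal (exp (- a2 * max 0 (u - x / - r i) - a3 * max 0 (max (x + r i * u) 0 + m - K)))"

definition chi_move :: "('d => real) => real => 'd => real => real => real => real" where
  "chi_move r K i x u m = min K (max (x + r i * u) 0 + m)"

text \<open>An event at time 0 is excluded by \<open>fresh\<close>, so the reflected path starts
  along a line. A world after an event is always of this kind.\<close>

locale world_reflection =
  fixes r :: "('d::finite) => real" and w :: "'d world" and K x :: real and v l u :: "real => real"
  assumes good: "good w" and drift: "\<And>i. r i < 0" and K: "0 < K" and x: "0 \<le> x" "x \<le> K"
    and refl: "reflected K (%t. x + free r t w) v l u" and fresh: "0 < first_event w"
begin

sublocale R: reflected_start K x "r (state 0 w)" "%t. x + free r t w" v l u "first_event w"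
  using good drift K x refl
  using fresh by unfold_locales (auto simp: before_first_event)

abbreviation "zeros \<equiv> {s \<in> {0..clock w}. v s = 0}"

lemma zero_iff:
  assumes "0 \<le> t" "ennreal t < first_event w"
  shows "v t = 0 \<longleftrightarrow> x / - r (state 0 w) \<le> t"
  unfolding R.v_before[OF assms] drift_iff(1)[OF drift] by (auto simp: max_def)

lemma clock_nonneg: "0 \<le> clock w" and hit_nonneg: "0 \<le> x / - r (state 0 w)"
  using goodD(5)[OF good] quotient_nonneg[of r x] drift x by auto

lemma zeros_early:
  assumes "ennreal (clock w) < first_event w"
  shows "zeros = {x / - r (state 0 w)..clock w}"
proof -
  have "ennreal s < first_event w" if "s \<le> clock w" for s
    using that assms by (meson ennreal_leI le_less_trans)
  then show ?thesis using zero_iff hit_nonneg by (auto simp del: divide_minus_right)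
qed

end

locale world_reflection_step = world_reflection r w K x v l u + world_step r w e
  for r :: "('d::finite) => real" and w :: "'d world" and K x :: real and v l u :: "real => real" and e :: real
begin

lemma after_values:
  "v e = chi_move r K (state 0 w) x e (first_mark w)"
  "u e = max 0 (max (x + r (state 0 w) * e) 0 + first_mark w - K)"
  unfolding chi_move_def using R.at_jump[OF event(1,2), of "first_mark w"] mark_nonneg by (auto simp: free_e)

lemma reflection_after:
  "world_reflection r after K (v e) (%t. v (e + t)) (%t. l (e + t) - l e) (%t. u (e + t) - u e)"
proof unfold_locales
  show "0 \<le> v e" "v e \<le> K" using R.v[of e] event by auto
  show "reflected K (%t. v e + free r t after) (%t. v (e + t)) (%t. l (e + t) - l e) (%t. u (e + t) - u e)"
    unfolding reflected_def
  proof (intro conjI allI impI)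
    fix t :: real assume "0 \<le> t"
    then show "v (e + t) = v e + free r t after + (l (e + t) - l e) - (u (e + t) - u e)"
        "0 \<le> v (e + t)" "v (e + t) \<le> K"
      using R.v[of "e + t"] R.v(1)[of e] event free_after[of t] free_e by auto
  qed (use grows_at_shift[OF R.grows(1) event(2)] grows_at_shift[OF R.grows(2) event(2)] in auto)
qed (fact good_after drift K fresh_after)+

text \<open>The minimum makes the first interval empty if the line does not reach 0 before
  \<open>e\<close>. The second set is the translate of the idle set of the world after the
  event.\<close>

lemma zeros_split:
  "zeros = {min e (x / - rate)..<e} \<union> {s. s - e \<in> {s \<in> {0..clock after}. v (e + s) = 0}}" (is "_ = ?A \<union> ?B")
proof -
  have "s \<in> zeros \<longleftrightarrow> s \<in> ?A" if "s < e" for s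
    using that zero_iff[of s] event hit_nonneg
    by (auto simp: ennreal_less_iff min_le_iff_disj simp del: divide_minus_right)
  moreover have "s \<in> zeros \<longleftrightarrow> s \<in> ?B" if "e \<le> s" for s
    using that event by (auto simp: shift_simps)
  moreover have "s \<notin> ?B" if "s < e" for s using that by auto
  moreover have "s \<notin> ?A" if "e \<le> s" for s using that by auto
  ultimately show ?thesis by (intro set_eqI) (metis (no_types, lifting) Un_iff not_le)
qed

end

lemma translate_measure:
  assumes "B \<in> sets borel"
  shows "{s. s - e \<in> B} \<in> sets borel" "measure lborel {s. s - (e::real) \<in> B} = measure lborel B"
    "emeasure lborel {s. s - e \<in> B} = emeasure lborel B"
proof -
  have *: "(%s. s - e) -` B \<inter> space lborel = {s. s - e \<in> B}" by auto
  have m: "(%s. s - e) \<in> measurable lborel borel" by simp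
  show "{s. s - e \<in> B} \<in> sets borel" using measurable_sets[OF m assms] unfolding * by simp
  have translate_fun: "(%s. s - e) = (+) (- e)" by auto
  have "distr lborel borel (%s. s - e) = lborel"
    using lborel_distr_plus[of "- e"] unfolding translate_fun by simp
  then show "measure lborel {s. s - (e::real) \<in> B} = measure lborel B"
    "emeasure lborel {s. s - e \<in> B} = emeasure lborel B"
    using measure_distr[OF m assms] emeasure_distr[OF m assms] unfolding * by simp_all
qed

lemma world_step_cases:
  assumes "good w" "\<And>i. r i < (0::real)"
  obtains "ennreal (clock w) < first_event w" | e where "world_step r w e"
proof (cases "ennreal (clock w) < first_event w")
  case False
  let ?e = "enn2real (first_event w)"
  have fin: "first_event w \<noteq> \<infinity>" using False by (auto simp: not_less top_unique)
  then have "first_event w = ennreal ?e" by (simp add: less_top)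
  moreover have "?e \<le> clock w"
    using False goodD(5)[OF assms(1)] by (simp add: enn2real_leI not_less)
  ultimately have "world_step r w ?e" using assms by unfold_locales auto
  then show ?thesis using that by blast
qed

text \<open>Additivity of the idle time requires Borel idle sets. By induction over the events such
  a set is an interval joined to a translate of the idle set after the event.\<close>

lemma zeros_borel:
  fixes w :: "('d::finite) world"
  assumes "world_reflection r w K x v l u"
  shows "{s \<in> {0..clock w}. v s = 0} \<in> sets borel"
  using assms
proof (induction "event_count w" arbitrary: w x v l u rule: less_induct)
  case less
  interpret world_reflection r w K x v l u by fact
  show ?case
  proof (rule world_step_cases[of w r, OF good drift])
    assume "ennreal (clock w) < first_event w"
    then show ?thesis by (subst zeros_early) simp_all
  next
    fix e assume step: "world_step r w e"
    then interpret world_step r w e .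
    interpret world_reflection_step r w K x v l u e ..
    show ?thesis
      unfolding zeros_split
      by (intro sets.Un translate_measure(1) less.hyps[OF event_count_after[OF step] reflection_after]) simp
  qed
qed

text \<open>Idle time and lost work are additive over the first event, so their discounts multiply
  out into \<open>chi_weight\<close>, while the final level and state are those of the reflected
  path after the event.\<close>

lemma chi_event_value:
  assumes "world_reflection r w K x v l u" "event_count w < n"
  shows "ennreal (exp (- a1 * v (clock w) - a2 * idle_time v (clock w) - a3 * u (clock w)) * of_bool (phase (clock w) w = j))
    = event_value (chi_early r a1 a2 j) (%_ _ _ _ _. 0) (chi_weight r K a2 a3) (chi_move r K) n x w"
proof -
  define val where "val w v u =
    ennreal (exp (- a1 * v (clock w) - a2 * idle_time v (clock w) - a3 * u (clock w)) * of_bool (phase (clock w) w = j))"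
    for w :: "'a world" and v u
  have drift: "\<And>i. r i < 0" using assms(1) by (simp add: world_reflection_def)
  show ?thesis
    unfolding val_def[symmetric]
  proof (rule event_value_unique[where r = r and Rel = "%x w y. \<exists>v l u. world_reflection r w K x v l u \<and> y = val w v u", OF drift])
    fix x w y
    assume "\<exists>v l u. world_reflection r w K x v l u \<and> y = val w v u"
    then obtain v l u where "world_reflection r w K x v l u" and y: "y = val w v u" by blast
    then interpret world_reflection r w K x v l u by simp
    show "good w" by (rule good)
    {
      assume early: "ennreal (clock w) < first_event w"
      show "y = chi_early r a1 a2 j (state 0 w) x (clock w)"
        unfolding y val_def idle_time_def zeros_early[OF early] chi_early_def
        using R.v_before[OF clock_nonneg early] R.u_before[OF clock_nonneg early]
          before_first_event(2)[OF good clock_nonneg early]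
        by (auto simp: max_def of_bool_def simp del: divide_minus_right)
    }
    fix e assume "world_step r w e"
    then interpret world_step r w e .
    interpret world_reflection_step r w K x v l u e ..
    define B where "B = {s \<in> {0..clock after}. v (e + s) = 0}"
    have B: "B \<in> sets borel" unfolding B_def by (rule zeros_borel[OF reflection_after])
    have T: "clock w = e + clock after" "0 \<le> clock after" using event by (simp_all add: shift_simps)
    have "emeasure lborel B \<le> emeasure lborel {0..clock after}" by (rule emeasure_mono) (auto simp: B_def)
    also have "\<dots> < \<infinity>" by (simp add: emeasure_lborel_Icc_eq)
    finally have fin: "emeasure lborel B \<noteq> \<infinity>" by simp
    have "idle_time v (clock w) = measure lborel ({min e (x / - rate)..<e} \<union> {s. s - e \<in> B})"
      using arg_cong[OF zeros_split, of "measure lborel"] by (simp add: idle_time_def B_def del: divide_minus_right)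
    also have "\<dots> = measure lborel {min e (x / - rate)..<e} + measure lborel {s. s - e \<in> B}"
    proof (rule measure_Union)
      show "emeasure lborel {min e (x / - rate)..<e} \<noteq> \<infinity>"
        by (simp add: emeasure_lborel_Ico[OF min.cobounded1])
      show "emeasure lborel {s. s - e \<in> B} \<noteq> \<infinity>" using fin translate_measure(3)[OF B] by simp
      show "{s. s - e \<in> B} \<in> sets lborel" using translate_measure(1)[OF B] by simp
    qed (auto simp: B_def)
    also have "measure lborel {min e (x / - rate)..<e} = max 0 (e - x / - rate)"
      by (simp add: measure_def emeasure_lborel_Ico[OF min.cobounded1] del: divide_minus_right)
    also have "measure lborel {s. s - e \<in> B} = idle_time (%t. v (e + t)) (clock after)"
      unfolding translate_measure(2)[OF B] by (simp add: idle_time_def B_def)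
    finally have idle: "idle_time v (clock w) = max 0 (e - x / - rate) + idle_time (%t. v (e + t)) (clock after)" .
    have ph: "phase (clock w) w = phase (clock after) after" unfolding T(1) by (rule phase_after[OF T(2)])
    have "y = chi_weight r K a2 a3 (state 0 w) x e mark * val after (%t. v (e + t)) (%t. u (e + t) - u e)"
      unfolding y val_def chi_weight_def ph idle after_values(2)[symmetric]
      by (simp add: T(1) algebra_simps exp_add[symmetric] flip: ennreal_mult)
    then show "\<exists>y'. y = 0 + chi_weight r K a2 a3 (state 0 w) x e mark * y' \<and>
        (chi_weight r K a2 a3 (state 0 w) x e mark \<noteq> 0 \<longrightarrow>
          (\<exists>v l u. world_reflection r after K (chi_move r K (state 0 w) x e mark) v l u \<and> y' = val after v u))"
      using reflection_after unfolding after_values(1) by auto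
  qed (use assms in auto)
qed

text \<open>If the world has an event at time \<open>0\<close>, the reflected path starts with a jump, which is
  the first step of the event-by-event computation.\<close>

lemma chi_event_value_double_reflection:
  fixes w :: "('d::finite) world"
  assumes w: "good w" and r: "\<And>i. r i < 0" and K: "0 < K" and x: "0 \<le> x" "x \<le> K"
    and R: "double_reflection K (%t. x + free r t w) v l u" and n: "event_count w < n"
  shows "ennreal (exp (- a1 * v (clock w) - a2 * idle_time v (clock w) - a3 * u (clock w)) * of_bool (phase (clock w) w = j))
    = event_value (chi_early r a1 a2 j) (%_ _ _ _ _. 0) (chi_weight r K a2 a3) (chi_move r K) n x w"
proof (cases "0 < first_event w")
  case True
  then have y0: "x + free r 0 w = x" using before_first_event(1)[OF w, of 0 r] by simp
  note init = double_reflection_initial[OF R _ K, unfolded y0, OF x(1)]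
  have "v 0 = x" "u 0 = 0" using init(2,3) x by auto
  with init(1) have "reflected K (%t. x + free r t w) v l u" by simp
  then have "world_reflection r w K x v l u" using w r K x True by unfold_locales auto
  then show ?thesis using n by (rule chi_event_value)
next
  case False
  then interpret world_step r w 0
    using w r goodD(5)[OF w] by unfold_locales auto
  have y: "x + free r t w = x + first_mark w + free r t after" if "0 \<le> t" for t
    using free_after[OF that] by simp
  have y0: "x + free r 0 w = x + first_mark w" using free_e by simp
  have m: "0 \<le> first_mark w" by (rule mark_nonneg)
  note init = double_reflection_initial[OF R _ K, unfolded y0]
  have "0 \<le> x + first_mark w" using x m by simp
  note init = init[OF this]
  have mv: "chi_move r K (state 0 w) x 0 mark = v 0" using init(2) x by (simp add: chi_move_def)
  \<comment> \<open>No time has passed, so the weight is only the discount for the work lost by the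
    jump at time 0.\<close>
  have wt: "chi_weight r K a2 a3 (state 0 w) x 0 mark = ennreal (exp (- a3 * u 0))"
  proof -
    have "x / r (state 0 w) \<le> 0" using x drift by (intro divide_nonneg_neg) auto
    then show ?thesis using init(3) x by (simp add: chi_weight_def max_def)
  qed
  have "reflected K (%t. v 0 + free r t after) v l (%t. u t - u 0)"
  proof (rule iffD1[OF reflected_cong init(1)])
    fix t :: real assume "0 \<le> t"
    from free_after[OF this] show "v 0 + (x + free r t w - (x + first_mark w)) = v 0 + free r t after"
      by simp
  qed
  moreover have "0 \<le> v 0" "v 0 \<le> K" using init(2) x m K by auto
  ultimately have "world_reflection r after K (v 0) v l (%t. u t - u 0)"
    by (intro world_reflection.intro good_after drift K fresh_after)
  from chi_event_value[OF this]
  have after: "ennreal (exp (- a1 * v (clock after) - a2 * idle_time v (clock after) - a3 * (u (clock after) - u 0)) * of_bool (phase (clock after) after = j))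
    = event_value (chi_early r a1 a2 j) (%_ _ _ _ _. 0) (chi_weight r K a2 a3) (chi_move r K) k (v 0) after"
    if "event_count after < k" for k using that .
  obtain k where k: "n = Suc k" "event_count after < k"
    using n event_count_after[OF world_step_axioms] by (cases n) auto
  have T: "clock after = clock w" "phase (clock w) w = phase (clock w) after"
    using phase_after[of "clock w"] event by (simp_all add: shift_simps)
  have "event_value (chi_early r a1 a2 j) (%_ _ _ _ _. 0) (chi_weight r K a2 a3) (chi_move r K) n x w
    = chi_weight r K a2 a3 (state 0 w) x 0 mark * event_value (chi_early r a1 a2 j) (%_ _ _ _ _. 0) (chi_weight r K a2 a3) (chi_move r K) k (v 0) after"
    using event k(1) mv by simp
  also have "\<dots> = ennreal (exp (- a3 * u 0) * (exp (- a1 * v (clock after) - a2 * idle_time v (clock after) - a3 * (u (clock after) - u 0)) * of_bool (phase (clock after) after = j)))"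
    unfolding after[OF k(2), symmetric] wt by (rule ennreal_mult'[symmetric]) simp
  also have "exp (- a3 * u 0) * (exp (- a1 * v (clock after) - a2 * idle_time v (clock after) - a3 * (u (clock after) - u 0)) * of_bool (phase (clock after) after = j))
    = exp (- a1 * v (clock w) - a2 * idle_time v (clock w) - a3 * u (clock w)) * of_bool (phase (clock w) w = j)"
    unfolding T mult.assoc[symmetric] exp_add[symmetric] by (simp add: algebra_simps)
  finally show ?thesis ..
qed

section \<open>Exponential waiting times and their renewal sequences\<close>

text \<open>Rate 0 means that the event never occurs: the law is then the point mass at
  infinity.\<close>

definition waiting :: "real => ennreal measure" where
  "waiting lam = (if lam = 0 then return borel \<infinity>
     else distr (density lborel (exponential_density lam)) borel ennreal)"

lemma sets_waiting [simp, measurable_cong]: "sets (waiting lam) = sets borel"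
  by (simp add: waiting_def)

lemma space_waiting [simp]: "space (waiting lam) = UNIV"
  by (simp add: waiting_def)

lemma prob_space_waiting: "0 \<le> lam ==> prob_space (waiting lam)"
  unfolding waiting_def
  using prob_space_exponential_density[of lam]
  by (auto intro!: prob_space_return prob_space.prob_space_distr)

lemma nn_integral_waiting:
  assumes [measurable]: "f \<in> borel_measurable borel" and lam: "0 \<le> lam"
  shows "(\<integral>\<^sup>+x. f x \<partial>waiting lam) =
    (\<integral>\<^sup>+u. ennreal (lam * exp (- lam * u)) * indicator {0<..} u * f (ennreal u) \<partial>lborel)
    + (if lam = 0 then f \<infinity> else 0)"
proof (cases "lam = 0")
  case False
  have "(\<integral>\<^sup>+x. f x \<partial>waiting lam) = (\<integral>\<^sup>+u. ennreal (exponential_density lam u) * f (ennreal u) \<partial>lborel)"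
    using False by (simp add: waiting_def nn_integral_distr nn_integral_density)
  also have "\<dots> = (\<integral>\<^sup>+u. ennreal (lam * exp (- lam * u)) * indicator {0<..} u * f (ennreal u) \<partial>lborel)"
    using AE_lborel_singleton[of 0]
    by (intro nn_integral_cong_AE, eventually_elim)
      (auto simp: exponential_density_def indicator_def mult.commute)
  finally show ?thesis using False by simp
qed (simp add: waiting_def nn_integral_return)

lemma nn_integral_waiting_finite:
  assumes [measurable]: "f \<in> borel_measurable borel" and lam: "0 \<le> lam"
  shows "(\<integral>\<^sup>+x. indicator {..<\<infinity>} x * f x \<partial>waiting lam) =
    (\<integral>\<^sup>+u. ennreal (lam * exp (- lam * u)) * indicator {0<..} u * f (ennreal u) \<partial>lborel)"
  by (subst nn_integral_waiting) (use lam in auto)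

text \<open>Translation by \<open>s\<close> in the exponential density; at rate 0 the identity rests
  on infinity minus \<open>s\<close> being infinity.\<close>

lemma waiting_memoryless:
  assumes f [measurable]: "f \<in> borel_measurable borel" and lam: "0 \<le> lam" and s: "0 \<le> s"
  shows "(\<integral>\<^sup>+x. indicator {ennreal s<..} x * f (x - ennreal s) \<partial>waiting lam)
    = ennreal (exp (- lam * s)) * (\<integral>\<^sup>+x. f x \<partial>waiting lam)"
proof -
  let ?h = "%u. ennreal (lam * exp (- lam * u)) * indicator {0<..} u * (indicator {ennreal s<..} (ennreal u) * f (ennreal u - ennreal s))"
  have "(\<integral>\<^sup>+u. ?h u \<partial>lborel) = (\<integral>\<^sup>+u. ?h (s + u) \<partial>lborel)"
    using nn_integral_real_affine[of ?h 1 s] by simp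
  also have "\<dots> = (\<integral>\<^sup>+u. ennreal (exp (- lam * s)) * (ennreal (lam * exp (- lam * u)) * indicator {0<..} u * f (ennreal u)) \<partial>lborel)"
  proof (rule nn_integral_cong)
    fix u :: real
    have "lam * exp (- lam * (s + u)) = exp (- lam * s) * (lam * exp (- lam * u))"
      by (simp add: algebra_simps flip: exp_add)
    then show "?h (s + u) = ennreal (exp (- lam * s)) * (ennreal (lam * exp (- lam * u)) * indicator {0<..} u * f (ennreal u))"
      using s lam by (auto simp: indicator_def ennreal_minus ennreal_less_iff ennreal_mult mult_ac)
  qed
  also have "\<dots> = ennreal (exp (- lam * s)) * (\<integral>\<^sup>+u. ennreal (lam * exp (- lam * u)) * indicator {0<..} u * f (ennreal u) \<partial>lborel)"
    by (rule nn_integral_cmult) measurable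
  finally show ?thesis
    using lam by (simp add: nn_integral_waiting distrib_left)
qed

lemma emeasure_waiting_greaterThan:
  assumes "0 \<le> lam" "0 \<le> s"
  shows "emeasure (waiting lam) {ennreal s<..} = ennreal (exp (- lam * s))"
  using waiting_memoryless[of "%_. 1" lam s] assms prob_space.emeasure_space_1[OF prob_space_waiting[OF assms(1)]]
  by simp

text \<open>Half-lines \<open>{a<..}\<close> and the whole space form an intersection-stable
  generator, so the tails at finite points determine a law on \<open>ennreal\<close>, any mass at
  infinity included.\<close>

lemma waiting_unique:
  assumes "prob_space M" "sets M = sets borel" "0 \<le> lam"
    and tail: "\<And>s. 0 \<le> s ==> emeasure M {ennreal s<..} = ennreal (exp (- lam * s))"
  shows "M = waiting lam"
proof (rule measure_eqI_generator_eq[where E = "insert UNIV (range greaterThan)" and A = "%_. UNIV"])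
  show "Int_stable (insert UNIV (range (greaterThan :: ennreal => _)))"
  proof (intro Int_stableI)
    have "{x<..} \<inter> {y<..} = {max x y<..}" for x y :: ennreal by auto
    then show "X \<inter> Y \<in> insert UNIV (range greaterThan)"
      if "X \<in> insert UNIV (range greaterThan)" "Y \<in> insert UNIV (range greaterThan)" for X Y :: "ennreal set"
      using that by auto
  qed
  have sp: "space M = UNIV" using sets_eq_imp_space_eq[OF assms(2)] by simp
  fix X :: "ennreal set" assume "X \<in> insert UNIV (range greaterThan)"
  then consider "X = UNIV" | a where "X = {a<..}" by auto
  then show "emeasure M X = emeasure (waiting lam) X"
  proof cases
    case 1
    then show ?thesis
      using prob_space.emeasure_space_1[OF assms(1)] prob_space.emeasure_space_1[OF prob_space_waiting[OF assms(3)]] sp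
      by simp
  next
    case (2 a)
    have [simp]: "{\<top>::ennreal<..} = {}" by auto
    show ?thesis
      using 2 tail emeasure_waiting_greaterThan[OF assms(3)] by (cases a) (auto simp: greaterThan_def[symmetric])
  qed
next
  have "sets (borel :: ennreal measure) = sigma_sets UNIV (range greaterThan)"
    by (subst borel_Ioi) simp
  also have "\<dots> = sigma_sets UNIV (insert UNIV (range greaterThan))"
    by (intro sigma_sets_eqI) (auto intro: sigma_sets_top)
  finally show "sets M = sigma_sets UNIV (insert UNIV (range greaterThan))"
      "sets (waiting lam) = sigma_sets UNIV (insert UNIV (range (greaterThan :: ennreal => _)))"
    using assms(2) by simp_all
  show "emeasure M UNIV \<noteq> \<infinity>"
    using finite_measure.emeasure_finite[OF prob_space.finite_measure[OF assms(1)], of UNIV] by simp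
qed auto

section \<open>Restarting an independent sequence of exponential gaps with marks\<close>

abbreviation "gaps g \<equiv> (%n. fst (g n))"

lemma measurable_PiM_UNIV:
  assumes "\<And>n. (%p. F p n) \<in> measurable D (N n)"
  shows "F \<in> measurable D (PiM UNIV N)"
  using assms by (intro measurable_PiM_single') (auto simp: measurable_def)

lemma measurable_renewals [measurable]:
  "(%(s, g). renewals (gaps g) s) \<in> measurable (borel \<Otimes>\<^sub>M PiM UNIV (%_. borel \<Otimes>\<^sub>M N)) (count_space UNIV)"
  unfolding renewals_def arrival_def by measurable

lemma measurable_restart [measurable]:
  "(%(s, g). restart s g) \<in> measurable (borel \<Otimes>\<^sub>M PiM UNIV (%_. borel \<Otimes>\<^sub>M N)) (PiM UNIV (%_. borel \<Otimes>\<^sub>M N))"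
proof -
  let ?D = "borel \<Otimes>\<^sub>M PiM UNIV (%_::nat. borel \<Otimes>\<^sub>M N) :: (real \<times> (nat => ennreal \<times> _)) measure"
  \<comment> \<open>The index depends on the sequence itself, so measurability is checked for each
    of its countably many values.\<close>
  have pick [measurable]: "(%p. snd p (renewals (gaps (snd p)) (fst p) + n)) \<in> measurable ?D (borel \<Otimes>\<^sub>M N)" for n
  proof (rule measurable_compose_countable[where f = "%m p. snd p (m + n)" and g = "%p. renewals (gaps (snd p)) (fst p)"])
    show "(%p. renewals (gaps (snd p)) (fst p)) \<in> measurable ?D (count_space UNIV)"
      using measurable_renewals[of N] by (simp add: case_prod_beta')
  qed measurable
  have arr [measurable]: "(%p. arrival (gaps (snd p)) (Suc (renewals (gaps (snd p)) (fst p)))) \<in> borel_measurable ?D"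
  proof (rule measurable_compose_countable[where f = "%m p. arrival (gaps (snd p)) (Suc m)" and g = "%p. renewals (gaps (snd p)) (fst p)"])
    show "(%p. renewals (gaps (snd p)) (fst p)) \<in> measurable ?D (count_space UNIV)"
      using measurable_renewals[of N] by (simp add: case_prod_beta')
    show "(%p. arrival (gaps (snd p)) (Suc m)) \<in> borel_measurable ?D" for m
      unfolding arrival_def by measurable
  qed
  have "(%p. restart (fst p) (snd p)) \<in> measurable ?D (PiM UNIV (%_. borel \<Otimes>\<^sub>M N))"
    unfolding restart_def residual_def
  proof (rule measurable_PiM_UNIV)
    show "(%p. (if n = 0 then arrival (gaps (snd p)) (Suc (renewals (gaps (snd p)) (fst p))) - ennreal (fst p)
        else fst (snd p (renewals (gaps (snd p)) (fst p) + n)),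
        snd (snd p (renewals (gaps (snd p)) (fst p) + n)))) \<in> measurable ?D (borel \<Otimes>\<^sub>M N)" for n :: nat
      by (cases "n = 0") (simp_all, measurable)
  qed
  then show ?thesis by (simp add: case_prod_beta')
qed

lemma arrival_case_nat: "arrival (gaps (case_nat x g)) (Suc n) = fst x + arrival (gaps g) n"
  unfolding arrival_def by (subst sum.lessThan_Suc_shift) simp

lemma restart_early:
  assumes "ennreal s < fst x"
  shows "restart s (case_nat x g) = case_nat (fst x - ennreal s, snd x) g"
proof -
  have "renewals (gaps (case_nat x g)) s = 0" using assms by (intro renewals_before) simp
  then show ?thesis
    by (auto simp: restart_def residual_def arrival_case_nat fun_eq_iff split: nat.split)
qed

text \<open>The first interval is over by time \<open>s\<close>, so only the remaining sequence
  matters, viewed from \<open>s - \<gamma>\<close>. This is the recursive step of the renewal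
  argument.\<close>

lemma restart_late:
  assumes reg: "renewal_sequence (gaps (case_nat x g))" and x: "fst x = ennreal \<gamma>" "0 \<le> \<gamma>" "\<gamma> \<le> s"
  shows "restart s (case_nat x g) = restart (s - \<gamma>) g"
proof -
  interpret renewal_sequence "gaps (case_nat x g)" by fact
  have iff: "ennreal s < arrival (gaps (case_nat x g)) (Suc n) \<longleftrightarrow> ennreal (s - \<gamma>) < arrival (gaps g) n" for n
  proof -
    have "ennreal s = ennreal \<gamma> + ennreal (s - \<gamma>)" using x by (simp flip: ennreal_plus)
    then show ?thesis
      unfolding arrival_case_nat x(1) by (simp add: ennreal_add_left_cancel_less)
  qed
  have ren: "renewals (gaps (case_nat x g)) s = Suc (renewals (gaps g) (s - \<gamma>))"
    unfolding renewals_def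
  proof (subst Least_Suc)
    show "ennreal s < arrival (gaps (case_nat x g)) (Suc (renewals (gaps (case_nat x g)) s))"
      by (rule less_arrival_renewals)
    show "\<not> ennreal s < arrival (gaps (case_nat x g)) (Suc 0)" unfolding iff by simp
  qed (simp add: iff)
  have "ennreal \<gamma> + a - ennreal s = a - ennreal (s - \<gamma>)" for a
  proof -
    have "ennreal s = ennreal \<gamma> + ennreal (s - \<gamma>)" using x by (simp flip: ennreal_plus)
    then show ?thesis using x
      by (cases a) (auto simp: ennreal_minus algebra_simps simp flip: ennreal_plus)
  qed
  then have *: "arrival (gaps (case_nat x g)) (Suc (Suc n)) - ennreal s
      = arrival (gaps g) (Suc n) - ennreal (s - \<gamma>)" for n
    unfolding arrival_case_nat x(1) .
  show ?thesis
    unfolding restart_def ren residual_def * by (rule ext) simp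
qed

lemma one_minus_exp_integral:
  assumes "0 \<le> (lam::real)" "0 \<le> s"
  shows "(\<integral>\<^sup>+u. ennreal (lam * exp (- lam * u)) * indicator {0<..} u * indicator {..s} u \<partial>lborel) = ennreal (1 - exp (- lam * s))"
proof -
  have "(\<integral>\<^sup>+u. ennreal (lam * exp (- lam * u)) * indicator {0<..} u * indicator {..s} u \<partial>lborel)
      = (\<integral>\<^sup>+u. ennreal (lam * exp (- lam * u)) * indicator {0..s} u \<partial>lborel)"
    using AE_lborel_singleton[of 0] by (intro nn_integral_cong_AE, eventually_elim) (auto simp: indicator_def)
  also have "\<dots> = ennreal (- exp (- lam * s) - - exp (- lam * 0))"
    using assms by (intro nn_integral_FTC_Icc) (auto intro!: derivative_eq_intros)
  finally show ?thesis by simp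
qed

locale renewal_law =
  fixes lam :: real and B :: "real measure"
  assumes lam: "0 \<le> lam" and prob_B: "prob_space B" and sets_B [measurable_cong]: "sets B = sets borel"
    and regular: "AE g in PiM UNIV (%_::nat. waiting lam \<Otimes>\<^sub>M B). renewal_sequence (gaps g)"
begin

sublocale W: prob_space "waiting lam" by (rule prob_space_waiting[OF lam])
sublocale B: prob_space B by (rule prob_B)
sublocale WB: pair_prob_space "waiting lam" B ..
sublocale SL: prob_space "PiM UNIV (%_::nat. waiting lam \<Otimes>\<^sub>M B)"
  by (intro prob_space_PiM prob_space_pair W.prob_space_axioms B.prob_space_axioms)
sublocale S: sequence_space "waiting lam \<Otimes>\<^sub>M B" ..

abbreviation "SL \<equiv> PiM UNIV (%_::nat. waiting lam \<Otimes>\<^sub>M B)"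
abbreviation "SB \<equiv> PiM UNIV (%_::nat. borel \<Otimes>\<^sub>M borel :: (ennreal \<times> real) measure)"

lemma sets_SL [measurable_cong]: "sets SL = sets SB"
  by (intro sets_PiM_cong sets_pair_measure_cong) (auto simp: sets_B)

lemma restart_SL [measurable]: "restart s \<in> measurable SL SL"
proof -
  have "(%g. case (s, g) of (s, g) => restart s g) \<in> measurable SB SB" by measurable
  then show ?thesis by (simp add: measurable_cong_sets[OF sets_SL sets_SL])
qed

lemma nn_integral_SL:
  assumes [measurable]: "f \<in> borel_measurable SL"
  shows "(\<integral>\<^sup>+g. f g \<partial>SL) = (\<integral>\<^sup>+x. \<integral>\<^sup>+m. \<integral>\<^sup>+g. f (case_nat (x, m) g) \<partial>SL \<partial>B \<partial>waiting lam)"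
proof -
  have "(\<integral>\<^sup>+g. f g \<partial>SL) = (\<integral>\<^sup>+g. f g \<partial>distr ((waiting lam \<Otimes>\<^sub>M B) \<Otimes>\<^sub>M SL) SL (%(x, g). case_nat x g))"
    by (simp add: S.PiM_iter)
  also have "\<dots> = (\<integral>\<^sup>+p. f (case_nat (fst p) (snd p)) \<partial>((waiting lam \<Otimes>\<^sub>M B) \<Otimes>\<^sub>M SL))"
    by (subst nn_integral_distr) (auto simp: case_prod_beta')
  also have "\<dots> = (\<integral>\<^sup>+x. \<integral>\<^sup>+g. f (case_nat x g) \<partial>SL \<partial>(waiting lam \<Otimes>\<^sub>M B))"
    by (subst SL.nn_integral_fst[symmetric]) auto
  also have "\<dots> = (\<integral>\<^sup>+x. \<integral>\<^sup>+m. \<integral>\<^sup>+g. f (case_nat (x, m) g) \<partial>SL \<partial>B \<partial>waiting lam)"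
    by (subst B.nn_integral_fst[symmetric]) auto
  finally show ?thesis .
qed

lemma AE_SL_step: "AE x in waiting lam. AE m in B. AE g in SL. renewal_sequence (gaps (case_nat (x, m) g))"
proof -
  interpret P: pair_prob_space "waiting lam \<Otimes>\<^sub>M B" SL ..
  have [measurable]: "Measurable.pred SL (%g. renewal_sequence (gaps g))"
    unfolding renewal_sequence_def by measurable
  have "AE g in distr ((waiting lam \<Otimes>\<^sub>M B) \<Otimes>\<^sub>M SL) SL (%(x, g). case_nat x g). renewal_sequence (gaps g)"
    using regular by (subst S.PiM_iter)
  then have "AE p in (waiting lam \<Otimes>\<^sub>M B) \<Otimes>\<^sub>M SL. renewal_sequence (gaps (case_nat (fst p) (snd p)))"
    by (subst (asm) AE_distr_iff) (auto simp: case_prod_beta')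
  from P.AE_pair[OF this] have "AE x in waiting lam \<Otimes>\<^sub>M B. AE g in SL. renewal_sequence (gaps (case_nat x g))"
    by (simp only: fst_conv snd_conv)
  then show ?thesis by (rule WB.AE_pair)
qed

text \<open>Conditioning on the first gap: with probability \<open>exp (- lam * s)\<close> it
  exceeds \<open>s\<close>, and by memorylessness the restarted sequence has the original law;
  otherwise it equals some \<open>u <= s\<close>, and the remaining sequence is restarted at
  \<open>s - u\<close>.\<close>

lemma nn_integral_restart_split:
  assumes [measurable]: "f \<in> borel_measurable SL" and s: "0 \<le> s"
  shows "(\<integral>\<^sup>+g. f (restart s g) \<partial>SL) = ennreal (exp (- lam * s)) * (\<integral>\<^sup>+g. f g \<partial>SL)
    + (\<integral>\<^sup>+u. ennreal (lam * exp (- lam * u)) * indicator {0<..} u * (indicator {..s} u * (\<integral>\<^sup>+g. f (restart (s - u) g) \<partial>SL)) \<partial>lborel)"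
proof -
  have [measurable]: "(%u. \<integral>\<^sup>+g. f (restart (s - u) g) \<partial>SL) \<in> borel_measurable borel"
  proof -
    have "(%(u, g). restart (s - u) g) \<in> measurable (borel \<Otimes>\<^sub>M SB) SB"
      using measurable_compose[OF _ measurable_restart[of "borel :: real measure"], of "%(u, g). (s - u, g)" "borel \<Otimes>\<^sub>M SB"]
      by (simp add: case_prod_beta')
    then have [measurable]: "(%(u, g). restart (s - u) g) \<in> measurable (borel \<Otimes>\<^sub>M SL) SL"
      by (simp add: measurable_cong_sets[OF sets_pair_measure_cong[OF refl sets_SL] sets_SL])
    show ?thesis by measurable
  qed
  let ?g = "%x. \<integral>\<^sup>+m. \<integral>\<^sup>+g. f (case_nat (x, m) g) \<partial>SL \<partial>B"
  let ?F = "%u. \<integral>\<^sup>+g. f (restart (s - u) g) \<partial>SL"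
  have "(\<integral>\<^sup>+g. f (restart s g) \<partial>SL) = (\<integral>\<^sup>+x. \<integral>\<^sup>+m. \<integral>\<^sup>+g. f (restart s (case_nat (x, m) g)) \<partial>SL \<partial>B \<partial>waiting lam)"
    by (rule nn_integral_SL) measurable
  also have "\<dots> = (\<integral>\<^sup>+x. indicator {ennreal s<..} x * ?g (x - ennreal s) + indicator {..ennreal s} x * ?F (enn2real x) \<partial>waiting lam)"
    using AE_SL_step
  proof (intro nn_integral_cong_AE, eventually_elim)
    fix x assume ae: "AE m in B. AE g in SL. renewal_sequence (gaps (case_nat (x, m) g))"
    show "(\<integral>\<^sup>+m. \<integral>\<^sup>+g. f (restart s (case_nat (x, m) g)) \<partial>SL \<partial>B)
      = indicator {ennreal s<..} x * ?g (x - ennreal s) + indicator {..ennreal s} x * ?F (enn2real x)"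
    proof (cases "ennreal s < x")
      case True
      then show ?thesis by (simp add: restart_early)
    next
      case False
      then have "x \<noteq> \<infinity>" by (auto simp: not_less top_unique)
      then obtain \<gamma> where x: "x = ennreal \<gamma>" "0 \<le> \<gamma>" by (cases x) auto
      then have "\<gamma> \<le> s" using False s by (simp add: not_less)
      have "(\<integral>\<^sup>+m. \<integral>\<^sup>+g. f (restart s (case_nat (x, m) g)) \<partial>SL \<partial>B) = (\<integral>\<^sup>+m. ?F \<gamma> \<partial>B)"
        using ae
      proof (intro nn_integral_cong_AE, eventually_elim)
        fix m assume "AE g in SL. renewal_sequence (gaps (case_nat (x, m) g))"
        then show "(\<integral>\<^sup>+g. f (restart s (case_nat (x, m) g)) \<partial>SL) = ?F \<gamma>"
        proof (intro nn_integral_cong_AE, eventually_elim)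
          fix g assume "renewal_sequence (gaps (case_nat (x, m) g))"
          then have "restart s (case_nat (x, m) g) = restart (s - \<gamma>) g"
            using x \<open>\<gamma> \<le> s\<close> by (intro restart_late) auto
          then show "f (restart s (case_nat (x, m) g)) = f (restart (s - \<gamma>) g)" by simp
        qed
      qed
      then show ?thesis using False x by (simp add: B.emeasure_space_1)
    qed
  qed
  also have "\<dots> = (\<integral>\<^sup>+x. indicator {ennreal s<..} x * ?g (x - ennreal s) \<partial>waiting lam)
      + (\<integral>\<^sup>+x. indicator {..ennreal s} x * ?F (enn2real x) \<partial>waiting lam)"
    by (rule nn_integral_add) measurable
  also have "(\<integral>\<^sup>+x. indicator {ennreal s<..} x * ?g (x - ennreal s) \<partial>waiting lam)
      = ennreal (exp (- lam * s)) * (\<integral>\<^sup>+g. f g \<partial>SL)"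
    by (subst waiting_memoryless) (use lam s in \<open>auto simp: nn_integral_SL\<close>)
  also have "(\<integral>\<^sup>+x. indicator {..ennreal s} x * ?F (enn2real x) \<partial>waiting lam)
      = (\<integral>\<^sup>+u. ennreal (lam * exp (- lam * u)) * indicator {0<..} u * (indicator {..s} u * ?F u) \<partial>lborel)"
    by (subst nn_integral_waiting)
      (use lam s in \<open>auto intro!: nn_integral_cong simp: indicator_def top_unique\<close>)
  finally show ?thesis .
qed

text \<open>Both the law of the restarted sequence and the original law solve the renewal equation
  above, which is a contraction on bounded functions of \<open>s \<le> U\<close>.\<close>

lemma distr_restart:
  assumes "0 \<le> U"
  shows "distr SL SL (restart U) = SL"
proof (rule measure_eqI)
  fix A assume "A \<in> sets (distr SL SL (restart U))"
  then have A [measurable]: "A \<in> sets SL" by simp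
  define F where "F s = (\<integral>\<^sup>+g. indicator A (restart s g) \<partial>SL)" for s
  define c where "c = (\<integral>\<^sup>+g. indicator A g \<partial>SL)"
  \<comment> \<open>The probability that a gap is at most \<open>U\<close>; it bounds the mass of
    every kernel \<open>?k s\<close> with \<open>s <= U\<close> and is less than 1.\<close>
  define q where "q = 1 - exp (- lam * U)"
  let ?k = "%s u. ennreal (lam * exp (- lam * u)) * indicator {0<..} u * indicator {..s} u :: ennreal"
  have q: "0 \<le> q" "q < 1" using lam assms by (auto simp: q_def)
  have "(\<integral>\<^sup>+g. indicator A (f g) \<partial>SL) \<le> (\<integral>\<^sup>+g. 1 \<partial>SL)" for f
    by (rule nn_integral_mono) (simp add: indicator_def)
  then have "(\<integral>\<^sup>+g. indicator A (f g) \<partial>SL) \<le> 1" for f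
    by (simp add: SL.emeasure_space_1)
  from this[of "restart _"] this[of id] have le1: "F s \<le> 1" "c \<le> 1" for s
    unfolding F_def c_def id_apply .
  have F: "F s = ennreal (exp (- lam * s)) * c + (\<integral>\<^sup>+u. ?k s u * F (s - u) \<partial>lborel)" if "0 \<le> s" for s
    unfolding F_def c_def
    by (subst nn_integral_restart_split) (use that in \<open>simp_all add: mult_ac\<close>)
  have k: "(\<integral>\<^sup>+u. ?k s u \<partial>lborel) = ennreal (1 - exp (- lam * s))" if "0 \<le> s" for s
    by (rule one_minus_exp_integral[OF lam that])
  have c: "c = ennreal (exp (- lam * s)) * c + (\<integral>\<^sup>+u. ?k s u * c \<partial>lborel)" if "0 \<le> s" for s
  proof -
    have "ennreal (exp (- lam * s)) + ennreal (1 - exp (- lam * s)) = 1"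
      using that lam by (simp flip: ennreal_plus)
    moreover have "(\<integral>\<^sup>+u. ?k s u * c \<partial>lborel) = (\<integral>\<^sup>+u. ?k s u \<partial>lborel) * c"
      by (rule nn_integral_multc) measurable
    ultimately show ?thesis unfolding k[OF that] by (simp add: distrib_right[symmetric])
  qed
  \<comment> \<open>An error of at most \<open>q ^ n\<close> in the integrand becomes at most
    \<open>q ^ Suc n\<close> after one application of the equation. The bound is stated additively
    because differences are truncated in \<open>ennreal\<close>.\<close>
  have contract: "f \<le> g + ennreal (q ^ Suc n)"
    if s: "0 \<le> s" "s \<le> U" and f: "f = ennreal (exp (- lam * s)) * c + (\<integral>\<^sup>+u. ?k s u * f' u \<partial>lborel)"
      and g: "g = ennreal (exp (- lam * s)) * c + (\<integral>\<^sup>+u. ?k s u * g' u \<partial>lborel)"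
      and le: "\<And>u. 0 < u ==> u \<le> s ==> f' u \<le> g' u + ennreal (q ^ n)"
      and [measurable]: "g' \<in> borel_measurable borel"
    for s f g f' g' n
  proof -
    have "(\<integral>\<^sup>+u. ?k s u * f' u \<partial>lborel) \<le> (\<integral>\<^sup>+u. ?k s u * g' u + ?k s u * ennreal (q ^ n) \<partial>lborel)"
      using le by (intro nn_integral_mono) (auto simp: indicator_def distrib_left[symmetric] intro!: mult_left_mono)
    also have "\<dots> = (\<integral>\<^sup>+u. ?k s u * g' u \<partial>lborel) + ennreal (1 - exp (- lam * s)) * ennreal (q ^ n)"
      using nn_integral_multc[of "?k s" lborel "ennreal (q ^ n)"] by (subst nn_integral_add) (simp_all only: k[OF s(1)], measurable)
    also have "ennreal (1 - exp (- lam * s)) * ennreal (q ^ n) \<le> ennreal (q ^ Suc n)"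
      using s lam q by (auto simp: q_def ennreal_mult'[symmetric] intro!: ennreal_leI mult_right_mono mult_left_mono)
    finally show ?thesis unfolding f g by (simp add: add.assoc add_left_mono)
  qed
  have [measurable]: "(%u. F (s - u)) \<in> borel_measurable borel" for s
  proof -
    have "(%(u, g). restart (s - u) g) \<in> measurable (borel \<Otimes>\<^sub>M SB) SB"
      using measurable_compose[OF _ measurable_restart[of "borel :: real measure"], of "%(u, g). (s - u, g)" "borel \<Otimes>\<^sub>M SB"]
      by (simp add: case_prod_beta')
    then have [measurable]: "(%(u, g). restart (s - u) g) \<in> measurable (borel \<Otimes>\<^sub>M SL) SL"
      by (simp add: measurable_cong_sets[OF sets_pair_measure_cong[OF refl sets_SL] sets_SL])
    show ?thesis unfolding F_def by measurable
  qed
  \<comment> \<open>The induction starts from the trivial bound 1, since \<open>F s\<close> and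
    \<open>c\<close> are integrals of an indicator over a probability measure.\<close>
  have "F s \<le> c + ennreal (q ^ n) \<and> c \<le> F s + ennreal (q ^ n)" if "0 \<le> s" "s \<le> U" for s n
    using that
  proof (induction n arbitrary: s)
    case 0
    then show ?case using le1 by (auto intro: add_increasing)
  next
    case (Suc n)
    show ?case
      using Suc.IH Suc.prems F[of s] c[of s] by (intro conjI contract[of s]) auto
  qed
  then have le: "F U \<le> c + ennreal (q ^ n)" "c \<le> F U + ennreal (q ^ n)" for n using assms by auto
  have lim: "(%n. a + ennreal (q ^ n)) \<longlonglongrightarrow> a + ennreal 0" for a
    using q by (intro tendsto_add tendsto_const tendsto_ennrealI LIMSEQ_power_zero) auto
  have "F U \<le> c + ennreal 0" "c \<le> F U + ennreal 0"
    by (rule LIMSEQ_le_const[OF lim], use le in blast)+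
  then have "F U = c" by simp
  have "emeasure (distr SL SL (restart U)) A = (\<integral>\<^sup>+g. indicator A g \<partial>distr SL SL (restart U))"
    using A by (intro nn_integral_indicator[symmetric]) simp
  also have "\<dots> = F U" unfolding F_def by (rule nn_integral_distr) measurable
  also have "\<dots> = emeasure SL A" unfolding \<open>F U = c\<close> c_def by (rule nn_integral_indicator[OF A])
  finally show "emeasure (distr SL SL (restart U)) A = emeasure SL A" .
qed simp

lemma nn_integral_restart:
  assumes [measurable]: "f \<in> borel_measurable SL" and "0 \<le> s"
  shows "(\<integral>\<^sup>+g. f (restart s g) \<partial>SL) = (\<integral>\<^sup>+g. f g \<partial>SL)"
  using nn_integral_distr[of "restart s" SL SL f] assms by (simp add: distr_restart)

lemma nn_integral_restart_early:
  assumes [measurable]: "f \<in> borel_measurable SL" and s: "0 \<le> s"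
  shows "(\<integral>\<^sup>+g. indicator {ennreal s<..} (fst (g 0)) * f (restart s g) \<partial>SL) = ennreal (exp (- lam * s)) * (\<integral>\<^sup>+g. f g \<partial>SL)"
proof -
  let ?g = "%x. \<integral>\<^sup>+m. \<integral>\<^sup>+g. f (case_nat (x, m) g) \<partial>SL \<partial>B"
  have "(\<integral>\<^sup>+g. indicator {ennreal s<..} (fst (g 0)) * f (restart s g) \<partial>SL)
      = (\<integral>\<^sup>+x. \<integral>\<^sup>+m. \<integral>\<^sup>+g. indicator {ennreal s<..} x * f (restart s (case_nat (x, m) g)) \<partial>SL \<partial>B \<partial>waiting lam)"
    by (subst nn_integral_SL) simp_all
  also have "\<dots> = (\<integral>\<^sup>+x. indicator {ennreal s<..} x * ?g (x - ennreal s) \<partial>waiting lam)"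
    by (intro nn_integral_cong) (auto simp: restart_early split: split_indicator)
  also have "\<dots> = ennreal (exp (- lam * s)) * (\<integral>\<^sup>+g. f g \<partial>SL)"
    by (subst waiting_memoryless) (use lam s in \<open>auto simp: nn_integral_SL\<close>)
  finally show ?thesis .
qed

end

section \<open>The law of the modulating chain\<close>

abbreviation "chain_space \<equiv> PiM UNIV (%_::nat. count_space UNIV \<Otimes>\<^sub>M (borel :: ennreal measure))"

text \<open>A negative time stands for no condition on that sojourn. It has to be treated apart:
  \<open>ennreal\<close> maps negative numbers to 0, and the condition would become positivity of
  the sojourn.\<close>

definition cylinder :: "nat => (nat => 'd) => (nat => real) => (nat => 'd \<times> ennreal) set" where
  "cylinder n z t = {\<xi>. \<forall>k\<le>n. fst (\<xi> k) = z k \<and> (t k < 0 \<or> ennreal (t k) < snd (\<xi> k))}"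

lemma space_chain_space [simp]: "space (chain_space :: (nat => 'd \<times> ennreal) measure) = UNIV"
  by (simp add: space_PiM space_pair_measure)

lemma cylinder_sets [measurable, simp]: "cylinder n z t \<in> sets (chain_space :: (nat => 'd::finite \<times> ennreal) measure)"
proof -
  have "{\<xi> \<in> space chain_space. \<forall>k\<in>{..n}. fst (\<xi> k) = z k \<and> (t k < 0 \<or> ennreal (t k) < snd (\<xi> k))} \<in> sets chain_space"
    by measurable
  then show ?thesis by (simp add: cylinder_def Ball_def)
qed

lemma all_le_Suc: "(\<forall>k\<le>Suc n. P k) \<longleftrightarrow> P 0 \<and> (\<forall>k\<le>n. P (Suc k))"
  by (metis Suc_le_mono le0 not0_implies_Suc)

lemma cylinder_Int:
  assumes "n \<le> m"
  shows "cylinder n z t \<inter> cylinder m z' t' =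
    (if \<forall>k\<le>n. z k = z' k then cylinder m z' (%k. if k \<le> n then max (t k) (t' k) else t' k) else {})"
proof -
  define ok where "ok a s \<longleftrightarrow> a < 0 \<or> ennreal a < s" for a s
  have max: "ok (max a b) s \<longleftrightarrow> ok a s \<and> ok b s" for a b s
    using ennreal_leI[of a b] ennreal_leI[of b a]
    by (cases "a \<le> b") (auto simp: ok_def max_def intro: le_less_trans)
  have cyl: "cylinder n z t = {\<xi>. \<forall>k\<le>n. fst (\<xi> k) = z k \<and> ok (t k) (snd (\<xi> k))}" for n z t
    by (simp add: cylinder_def ok_def)
  show ?thesis
  proof (cases "\<forall>k\<le>n. z k = z' k")
    case True
    then show ?thesis unfolding cyl using assms by (auto simp: max)
  next
    case False
    then obtain k where "k \<le> n" "z k \<noteq> z' k" by blast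
    then have "cylinder n z t \<inter> cylinder m z' t' = {}" unfolding cyl using assms by force
    then show ?thesis unfolding if_not_P[OF False] .
  qed
qed

text \<open>Each coordinate event is a finite union of cylinders over all prefixes of states. Only
  cylinders with at least two coordinates are taken, so that the first transition is always
  specified.\<close>

lemma sigma_sets_cylinder:
  "sets (chain_space :: (nat => 'd::finite \<times> ennreal) measure) =
    sigma_sets UNIV (insert {} (range (%(n, z, t). cylinder (Suc n) z t)))" (is "_ = sigma_sets UNIV ?E")
proof (rule antisym)
  show "sigma_sets UNIV ?E \<subseteq> sets (chain_space :: (nat => 'd \<times> ennreal) measure)"
  proof -
    have "?E \<subseteq> sets (chain_space :: (nat => 'd \<times> ennreal) measure)" by auto
    from sets.sigma_sets_subset[OF this] show ?thesis by simp
  qed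
  define N :: "(nat => 'd \<times> ennreal) measure" where "N = sigma UNIV ?E"
  have sN: "space N = UNIV" "sets N = sigma_sets UNIV ?E" by (auto simp: N_def)
  have cyl: "cylinder (Suc n) z t \<in> sets N" for n z t
    unfolding sN by (intro sigma_sets.Basic) auto
  have fin: "finite (PiE {..n::nat} (%_. UNIV :: 'd set))" for n by (intro finite_PiE) auto
  have restr: "\<exists>z\<in>PiE {..n} (%_. UNIV). \<forall>k\<le>n. fst (\<xi> k) = z k" for \<xi> :: "nat => 'd \<times> ennreal" and n
    by (intro bexI[of _ "restrict (%k. fst (\<xi> k)) {..n}"]) auto
  have 1: "(%\<xi>. fst (\<xi> n)) \<in> measurable N (count_space UNIV)" for n
  proof (rule measurableI)
    fix A :: "'d set"
    have "(%\<xi>. fst (\<xi> n)) -` A \<inter> space N = (\<Union>z\<in>{z \<in> PiE {..Suc n} (%_. UNIV). z n \<in> A}. cylinder (Suc n) z (%_. - 1))"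
    proof (intro set_eqI iffI)
      fix \<xi> :: "nat => 'd \<times> ennreal" assume "\<xi> \<in> (%\<xi>. fst (\<xi> n)) -` A \<inter> space N"
      moreover obtain z where "z \<in> PiE {..Suc n} (%_. UNIV)" "\<forall>k\<le>Suc n. fst (\<xi> k) = z k"
        using restr[where n = "Suc n" and \<xi> = \<xi>] by blast
      ultimately show "\<xi> \<in> (\<Union>z\<in>{z \<in> PiE {..Suc n} (%_. UNIV). z n \<in> A}. cylinder (Suc n) z (%_. - 1))"
        by (intro UN_I[of z]) (simp_all add: cylinder_def)
    next
      fix \<xi> :: "nat => 'd \<times> ennreal"
      assume "\<xi> \<in> (\<Union>z\<in>{z \<in> PiE {..Suc n} (%_. UNIV). z n \<in> A}. cylinder (Suc n) z (%_. - 1))"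
      then obtain z where "z n \<in> A" "\<xi> \<in> cylinder (Suc n) z (%_. - 1)" by blast
      then show "\<xi> \<in> (%\<xi>. fst (\<xi> n)) -` A \<inter> space N" by (simp add: cylinder_def sN)
    qed
    also have "\<dots> \<in> sets N" using fin[of "Suc n"] cyl by (intro sets.finite_UN) auto
    finally show "(%\<xi>. fst (\<xi> n)) -` A \<inter> space N \<in> sets N" .
  qed auto
  have 2: "(%\<xi>. snd (\<xi> n)) \<in> borel_measurable N" for n
  proof (rule borel_measurableI_greater)
    fix a :: ennreal
    show "{\<xi> \<in> space N. a < snd (\<xi> n)} \<in> sets N"
    proof (cases a)
      case (real s)
      have "{\<xi> \<in> space N. a < snd (\<xi> n)} = (\<Union>z\<in>PiE {..Suc n} (%_. UNIV). cylinder (Suc n) z (%k. if k = n then s else - 1))"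
      proof (intro set_eqI iffI)
        fix \<xi> :: "nat => 'd \<times> ennreal" assume "\<xi> \<in> {\<xi> \<in> space N. a < snd (\<xi> n)}"
        moreover obtain z where "z \<in> PiE {..Suc n} (%_. UNIV)" "\<forall>k\<le>Suc n. fst (\<xi> k) = z k"
          using restr[where n = "Suc n" and \<xi> = \<xi>] by blast
        ultimately show "\<xi> \<in> (\<Union>z\<in>PiE {..Suc n} (%_. UNIV). cylinder (Suc n) z (%k. if k = n then s else - 1))"
          using real by (intro UN_I[of z]) (simp_all add: cylinder_def)
      next
        fix \<xi> :: "nat => 'd \<times> ennreal"
        assume "\<xi> \<in> (\<Union>z\<in>PiE {..Suc n} (%_. UNIV). cylinder (Suc n) z (%k. if k = n then s else - 1))"
        then obtain z where "\<xi> \<in> cylinder (Suc n) z (%k. if k = n then s else - 1)" by blast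
        then have "s < 0 \<or> ennreal s < snd (\<xi> n)"
          unfolding cylinder_def mem_Collect_eq by (drule_tac spec[of _ n]) simp
        then show "\<xi> \<in> {\<xi> \<in> space N. a < snd (\<xi> n)}" using real by (simp add: sN)
      qed
      also have "\<dots> \<in> sets N" using fin[of "Suc n"] cyl by (intro sets.finite_UN) auto
      finally show ?thesis .
    qed simp
  qed
  have "sets (chain_space :: (nat => 'd \<times> ennreal) measure) \<subseteq> sets N"
  proof (rule sets_PiM_in_sets)
    show "space N = (\<Pi>\<^sub>E i\<in>UNIV. space (count_space UNIV \<Otimes>\<^sub>M borel))" by (simp add: sN space_pair_measure)
    fix n :: nat and A :: "('d \<times> ennreal) set" assume A: "A \<in> sets (count_space UNIV \<Otimes>\<^sub>M borel)"
    have "(%\<xi>. (fst (\<xi> n), snd (\<xi> n))) \<in> measurable N (count_space UNIV \<Otimes>\<^sub>M borel)"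
      using 1 2 by (rule measurable_Pair)
    from measurable_sets[OF this A] show "{\<xi> \<in> space N. \<xi> n \<in> A} \<in> sets N"
      by (simp add: vimage_def Int_def conj_commute)
  qed
  then show "sets (chain_space :: (nat => 'd \<times> ennreal) measure) \<subseteq> sigma_sets UNIV ?E" by (simp add: sN)
qed

lemma chain_measure_eqI:
  fixes M M' :: "(nat => 'd::finite \<times> ennreal) measure"
  assumes sets: "sets M = sets chain_space" "sets M' = sets chain_space" and fin: "finite_measure M"
    and eq: "\<And>n z t. emeasure M (cylinder (Suc n) z t) = emeasure M' (cylinder (Suc n) z t)"
  shows "M = M'"
proof -
  \<comment> \<open>A countable cover of the space by generators: the pair of the first two states,
    decoded from \<open>n\<close>, with no condition on the sojourns.\<close>
  define A :: "nat => (nat => 'd \<times> ennreal) set" where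
    "A n = (let p = from_nat n in cylinder (Suc 0) (%k. if k = 0 then fst p else snd p) (%_. - 1))" for n
  show ?thesis
  proof (rule measure_eqI_generator_eq[where E = "insert {} (range (%(n, z, t). cylinder (Suc n) z t))" and \<Omega> = UNIV and A = A])
    show "Int_stable (insert {} (range (%(n, z, t). cylinder (Suc n) z t :: (nat => 'd \<times> ennreal) set)))"
    proof (rule Int_stableI)
      fix X Y :: "(nat => 'd \<times> ennreal) set"
      assume XY: "X \<in> insert {} (range (%(n, z, t). cylinder (Suc n) z t))"
        "Y \<in> insert {} (range (%(n, z, t). cylinder (Suc n) z t))"
      have step: "cylinder (Suc n) z t \<inter> cylinder (Suc m) z' t' \<in> insert {} (range (%(n, z, t). cylinder (Suc n) z t))"
        if "n \<le> m" for n m and z z' :: "nat => 'd" and t t'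
      proof (cases "\<forall>k\<le>Suc n. z k = z' k")
        case True
        then show ?thesis
          using cylinder_Int[of "Suc n" "Suc m" z t z' t'] that
          by (intro insertI2 image_eqI[of _ _ "(m, z', %k. if k \<le> Suc n then max (t k) (t' k) else t' k)"]) simp_all
      next
        case False
        then show ?thesis
          unfolding cylinder_Int[OF Suc_le_mono[THEN iffD2, OF that]] by (simp only: if_not_P) simp
      qed
      then show "X \<inter> Y \<in> insert {} (range (%(n, z, t). cylinder (Suc n) z t))"
      proof (cases "X = {} \<or> Y = {}")
        case False
        then have "X \<in> range (%(n, z, t). cylinder (Suc n) z t)" "Y \<in> range (%(n, z, t). cylinder (Suc n) z t)"
          using XY by simp_all
        then obtain p p' where p: "X = (%(n, z, t). cylinder (Suc n) z t) p" "Y = (%(n, z, t). cylinder (Suc n) z t) p'"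
          by blast
        obtain n z t m z' t' where "p = (n, z, t)" "p' = (m, z', t')" by (cases p, cases p')
        with p have X: "X = cylinder (Suc n) z t" and Y: "Y = cylinder (Suc m) z' t'" by simp_all
        show ?thesis
          using step[of n m z t z' t'] step[of m n z' t' z t] unfolding X Y
          by (cases "n \<le> m") (simp_all only: Int_commute not_le nat_le_linear less_imp_le)
      qed auto
    qed
    show "sets M = sigma_sets UNIV (insert {} (range (%(n, z, t). cylinder (Suc n) z t)))"
      "sets M' = sigma_sets UNIV (insert {} (range (%(n, z, t). cylinder (Suc n) z t)))"
      using sets sigma_sets_cylinder by auto
    show "range A \<subseteq> insert {} (range (%(n, z, t). cylinder (Suc n) z t))"
      by (auto simp: A_def Let_def image_iff split_paired_Ex)
    have "\<xi> \<in> A (to_nat (fst (\<xi> 0), fst (\<xi> 1)))" for \<xi> :: "nat => 'd \<times> ennreal"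
      by (auto simp: A_def cylinder_def le_Suc_eq)
    then show "(\<Union>n. A n) = UNIV" by blast
    show "emeasure M (A n) \<noteq> \<infinity>" for n
      using finite_measure.emeasure_finite[OF fin] by simp
  qed (use eq in auto)
qed

section \<open>Consequences of the cylinder probabilities of the chain\<close>

locale chain_law =
  fixes Q :: "real^'d^'d::finite" and N :: "'d => (nat => 'd \<times> ennreal) measure"
  assumes gen: "generator Q" and prob_N: "\<And>i. prob_space (N i)"
    and sets_N [measurable_cong, simp]: "\<And>i. sets (N i) = sets chain_space"
    and law: "\<And>i n z t. (\<And>k. k \<le> n ==> 0 \<le> t k) ==> measure (N i) (cylinder n z t) =
      of_bool (z 0 = i) * (\<Prod>k<n. jump_matrix Q $ z k $ z (Suc k)) * (\<Prod>k\<le>n. exp (Q $ z k $ z k * t k))"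
begin

sublocale N: prob_space "N i" for i by (rule prob_N)

lemma space_N [simp]: "space (N i) = UNIV"
  using sets_eq_imp_space_eq[OF sets_N[of i]] by simp

lemma Q_nonneg: "i \<noteq> j ==> 0 \<le> Q $ i $ j"
  using gen by (simp add: generator_def)

lemma Q_diag: "- (Q $ i $ i) = (\<Sum>j\<in>UNIV - {i}. Q $ i $ j)"
  using gen by (simp add: generator_def)

lemma Q_diag_nonpos: "Q $ i $ i \<le> 0"
proof -
  have "0 \<le> (\<Sum>j\<in>UNIV - {i}. Q $ i $ j)" using Q_nonneg by (intro sum_nonneg) auto
  then show ?thesis using Q_diag[of i] by linarith
qed

lemma jump_matrix_nonneg: "0 \<le> jump_matrix Q $ i $ j"
  using Q_nonneg[of i j] Q_diag_nonpos[of i] by (auto simp: jump_matrix_def intro: divide_nonneg_nonpos)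

text \<open>Recovers the off-diagonal rates. For an absorbing state they all vanish, being
  nonnegative with sum 0.\<close>

lemma jump_matrix_rate: "jump_matrix Q $ i $ k * - (Q $ i $ i) = (if k = i then 0 else Q $ i $ k)"
proof (cases "Q $ i $ i = 0")
  case True
  then have "(\<Sum>j\<in>UNIV - {i}. Q $ i $ j) = 0" using Q_diag[of i] by simp
  then have "\<forall>j\<in>UNIV - {i}. Q $ i $ j = 0"
    using Q_nonneg by (subst (asm) sum_nonneg_eq_0_iff) auto
  then have "Q $ i $ k = 0" if "k \<noteq> i" using that by simp
  then show ?thesis using True by (auto simp: jump_matrix_def)
qed (auto simp: jump_matrix_def)

lemma sum_jump_matrix: "(\<Sum>j\<in>UNIV. jump_matrix Q $ i $ j) = 1"
proof (cases "Q $ i $ i = 0")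
  case True
  then show ?thesis by (simp add: jump_matrix_def of_bool_def)
next
  case False
  have "(\<Sum>j\<in>UNIV. jump_matrix Q $ i $ j) = (\<Sum>j\<in>UNIV - {i}. Q $ i $ j / - (Q $ i $ i))"
    using False by (subst sum.remove[of _ i]) (auto simp: jump_matrix_def intro!: sum.cong)
  also have "\<dots> = 1"
    using False Q_diag[of i] by (simp add: sum_divide_distrib[symmetric] sum_negf)
  finally show ?thesis .
qed

abbreviation "staying n z \<equiv> cylinder n z (%_. 0)"

text \<open>The rows of the jump matrix sum to 1, so demanding one more positive sojourn, in
  whatever state, costs no probability. This is the induction step of
  \<open>AE_positive\<close>.\<close>

lemma staying_extend:
  "measure (N i) (\<Union>j. staying (Suc n) (z(Suc n := j))) = measure (N i) (staying n z)"
proof -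
  have "measure (N i) (\<Union>j\<in>UNIV. staying (Suc n) (z(Suc n := j))) = (\<Sum>j\<in>UNIV. measure (N i) (staying (Suc n) (z(Suc n := j))))"
  proof (rule N.finite_measure_finite_Union)
    have "staying (Suc n) (z(Suc n := j)) \<subseteq> {\<xi>. fst (\<xi> (Suc n)) = j}" for j by (auto simp: cylinder_def)
    then show "disjoint_family_on (%j. staying (Suc n) (z(Suc n := j))) UNIV"
      unfolding disjoint_family_on_def by blast
  qed auto
  also have "\<dots> = (\<Sum>j\<in>UNIV. of_bool (z 0 = i) * (\<Prod>k<n. jump_matrix Q $ z k $ z (Suc k)) * jump_matrix Q $ z n $ j)"
    by (simp add: law)
  also have "\<dots> = measure (N i) (staying n z)"
    by (simp add: law sum_distrib_left[symmetric] sum_jump_matrix)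
  finally show ?thesis .
qed

lemma AE_positive: "AE \<xi> in N i. \<forall>n. 0 < snd (\<xi> n)"
proof -
  have "AE \<xi> in N i. \<forall>k\<le>n. 0 < snd (\<xi> k)" for n
  proof (induction n)
    case 0
    have "measure (N i) (staying 0 (%_. i)) = 1" by (simp add: law)
    then have "AE \<xi> in N i. \<xi> \<in> staying 0 (%_. i)"
      by (subst N.prob_eq_1[symmetric]) auto
    then show ?case by eventually_elim (simp add: cylinder_def)
  next
    case (Suc n)
    have "AE \<xi> in N i. \<xi> \<in> staying n z \<longrightarrow> 0 < snd (\<xi> (Suc n))" for z
    proof -
      let ?U = "\<Union>j. staying (Suc n) (z(Suc n := j))"
      have sub: "?U \<subseteq> staying n z" by (auto simp: cylinder_def)
      have "measure (N i) (staying n z - ?U) = 0"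
        using staying_extend[of i n z] by (subst N.finite_measure_Diff) (use sub in auto)
      then have "AE \<xi> in N i. \<xi> \<notin> staying n z - ?U"
        by (subst N.prob_eq_0[symmetric]) auto
      then show ?thesis
      proof eventually_elim
        case (elim \<xi>)
        show ?case
        proof
          assume "\<xi> \<in> staying n z"
          then obtain j where "\<xi> \<in> staying (Suc n) (z(Suc n := j))" using elim by blast
          then show "0 < snd (\<xi> (Suc n))"
            unfolding cylinder_def mem_Collect_eq by (drule_tac spec[of _ "Suc n"]) simp
        qed
      qed
    qed
    then have "AE \<xi> in N i. \<forall>z\<in>PiE {..n} (%_. UNIV). \<xi> \<in> staying n z \<longrightarrow> 0 < snd (\<xi> (Suc n))"
      by (intro AE_finite_allI finite_PiE) auto
    with Suc show ?case
    proof eventually_elim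
      case (elim \<xi>)
      \<comment> \<open>The path lies in the cylinder of its own first states;
        \<open>restrict\<close> puts these into the finite set over which the null sets were
        united.\<close>
      have "\<xi> \<in> staying n (restrict (%k. fst (\<xi> k)) {..n})"
        using elim(1) by (auto simp: cylinder_def)
      then have "0 < snd (\<xi> (Suc n))"
        using bspec[OF elim(2), of "restrict (%k. fst (\<xi> k)) {..n}"] by simp
      then show ?case using elim(1) by (auto simp: le_Suc_eq)
    qed
  qed
  then have "AE \<xi> in N i. \<forall>n. \<forall>k\<le>n. 0 < snd (\<xi> k)" by (simp add: AE_all_countable)
  then show ?thesis by eventually_elim auto
qed

definition weight :: "'d => nat => (nat => 'd) => (nat => real) => real" where
  "weight i n z t = of_bool (z 0 = i) * (\<Prod>k<n. jump_matrix Q $ z k $ z (Suc k)) * (\<Prod>k\<le>n. exp (Q $ z k $ z k * max 0 (t k)))"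

lemma weight_nonneg: "0 \<le> weight i n z t"
  by (simp add: weight_def prod_nonneg jump_matrix_nonneg)

lemma weight_Suc: "weight i (Suc n) z t = of_bool (z 0 = i) * exp (Q $ i $ i * max 0 (t 0)) * jump_matrix Q $ i $ z 1
    * weight (z 1) n (%k. z (Suc k)) (%k. t (Suc k))"
  unfolding weight_def prod.lessThan_Suc_shift prod.atMost_Suc_shift by (auto simp: mult_ac)

text \<open>Extends \<open>law\<close> to negative times: sojourns are almost surely positive, so an
  absent condition amounts to the condition at time 0.\<close>

lemma emeasure_cylinder: "emeasure (N i) (cylinder n z t) = ennreal (weight i n z t)"
proof -
  have "emeasure (N i) (cylinder n z t) = emeasure (N i) (cylinder n z (%k. max 0 (t k)))"
    using AE_positive[of i]
  proof (intro emeasure_eq_AE, eventually_elim)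
    fix \<xi> :: "nat => 'd \<times> ennreal" assume "\<forall>n. 0 < snd (\<xi> n)"
    then have "t k < 0 \<or> ennreal (t k) < snd (\<xi> k) \<longleftrightarrow> ennreal (max 0 (t k)) < snd (\<xi> k)" for k
      by (auto simp: max_def)
    then show "\<xi> \<in> cylinder n z t \<longleftrightarrow> \<xi> \<in> cylinder n z (%k. max 0 (t k))"
      by (simp add: cylinder_def)
  qed auto
  then show ?thesis by (simp add: N.emeasure_eq_measure law weight_def)
qed

lemma AE_start: "AE \<xi> in N i. fst (\<xi> 0) = i"
proof -
  have "measure (N i) (staying 0 (%_. i)) = 1" by (simp add: law)
  then have "AE \<xi> in N i. \<xi> \<in> staying 0 (%_. i)"
    by (subst N.prob_eq_1[symmetric]) auto
  then show ?thesis by eventually_elim (simp add: cylinder_def)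
qed

definition hold :: "real => (nat => 'd \<times> ennreal) => nat => 'd \<times> ennreal" where
  "hold s \<xi> = case_nat (fst (\<xi> 0), snd (\<xi> 0) - ennreal s) (%n. \<xi> (Suc n))"

lemma measurable_hold [measurable]:
  "(%(s, \<xi>). hold s \<xi>) \<in> measurable (borel \<Otimes>\<^sub>M chain_space) chain_space"
proof -
  have "(%p. hold (fst p) (snd p)) \<in> measurable (borel \<Otimes>\<^sub>M chain_space) chain_space"
  proof (rule measurable_PiM_UNIV)
    show "(%p. hold (fst p) (snd p) n) \<in> measurable (borel \<Otimes>\<^sub>M chain_space) (count_space UNIV \<Otimes>\<^sub>M borel)" for n
      by (cases n) (simp_all add: hold_def)
  qed
  then show ?thesis by (simp add: case_prod_beta')
qed

text \<open>Memorylessness of the initial sojourn. Both sides come from finite measures, compared on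
  cylinders: exceeding \<open>s\<close> and then a further \<open>max 0 (t 0)\<close> multiplies the
  weight by \<open>exp (Q $ i $ i * s)\<close>.\<close>

lemma nn_integral_hold:
  assumes f [measurable]: "f \<in> borel_measurable chain_space" and s: "0 \<le> s"
  shows "(\<integral>\<^sup>+\<xi>. indicator {ennreal s<..} (snd (\<xi> 0)) * f (hold s \<xi>) \<partial>N i)
    = ennreal (exp (Q $ i $ i * s)) * (\<integral>\<^sup>+\<xi>. f \<xi> \<partial>N i)"
proof -
  have h: "hold s \<in> measurable chain_space chain_space"
    using measurable_compose[OF measurable_Pair1' measurable_hold, of s] by simp
  then have [measurable]: "hold s \<in> measurable (N i) chain_space" "hold s \<in> measurable (density (N i) g) chain_space" for g
    by (simp_all add: measurable_cong_sets[OF sets_N refl])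
  let ?M = "distr (density (N i) (%\<xi>. indicator {ennreal s<..} (snd (\<xi> 0)))) chain_space (hold s)"
  have "scale_measure (ennreal (exp (Q $ i $ i * s))) (N i) = ?M"
  proof (rule chain_measure_eqI)
    show "finite_measure (scale_measure (ennreal (exp (Q $ i $ i * s))) (N i))"
      using N.emeasure_space_1[of i] by (intro finite_measureI) (simp add: space_scale_measure)
    fix n z t
    have "{\<xi>. ennreal s < snd (\<xi> 0)} \<inter> hold s -` cylinder (Suc n) z t = cylinder (Suc n) z (t(0 := s + max 0 (t 0)))"
    proof -
      have *: "ennreal s < a \<and> (b < 0 \<or> ennreal b < a - ennreal s) \<longleftrightarrow> ennreal (s + max 0 b) < a" for a b
        using s by (cases a) (auto simp: ennreal_minus ennreal_less_iff max_def simp del: ennreal_plus)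
      have "ennreal s < snd (\<xi> 0) \<and> (\<forall>k\<le>Suc n. fst (hold s \<xi> k) = z k \<and> (t k < 0 \<or> ennreal (t k) < snd (hold s \<xi> k)))
          \<longleftrightarrow> fst (\<xi> 0) = z 0 \<and> ennreal (s + max 0 (t 0)) < snd (\<xi> 0) \<and>
            (\<forall>k\<le>n. fst (\<xi> (Suc k)) = z (Suc k) \<and> (t (Suc k) < 0 \<or> ennreal (t (Suc k)) < snd (\<xi> (Suc k))))" for \<xi> :: "nat => 'd \<times> ennreal"
        unfolding all_le_Suc using * by (auto simp: hold_def)
      moreover have "s + max 0 (t 0) \<ge> 0" using s by simp
      ultimately show ?thesis
        unfolding cylinder_def by (auto simp: all_le_Suc)
    qed
    then have mem: "ennreal s < snd (\<xi> 0) \<and> \<xi> \<in> hold s -` cylinder (Suc n) z t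
        \<longleftrightarrow> \<xi> \<in> cylinder (Suc n) z (t(0 := s + max 0 (t 0)))" for \<xi> by blast
    have pre: "hold s -` cylinder (Suc n) z t \<in> sets (N i)"
      using measurable_sets[OF h cylinder_sets[of "Suc n" z t]] by simp
    have "emeasure ?M (cylinder (Suc n) z t)
        = emeasure (density (N i) (%\<xi>. indicator {ennreal s<..} (snd (\<xi> 0)))) (hold s -` cylinder (Suc n) z t)"
      by (subst emeasure_distr) simp_all
    also have "\<dots> = (\<integral>\<^sup>+\<xi>. indicator {ennreal s<..} (snd (\<xi> 0)) * indicator (hold s -` cylinder (Suc n) z t) \<xi> \<partial>N i)"
      using pre by (intro emeasure_density) simp_all
    also have "\<dots> = (\<integral>\<^sup>+\<xi>. indicator (cylinder (Suc n) z (t(0 := s + max 0 (t 0)))) \<xi> \<partial>N i)"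
      using mem by (intro nn_integral_cong) (auto split: split_indicator)
    also have "\<dots> = emeasure (N i) (cylinder (Suc n) z (t(0 := s + max 0 (t 0))))"
      by (rule nn_integral_indicator) simp
    also have "\<dots> = ennreal (exp (Q $ i $ i * s)) * emeasure (N i) (cylinder (Suc n) z t)"
      unfolding emeasure_cylinder weight_Suc using s
      by (simp add: ennreal_mult'[symmetric] distrib_left exp_add mult_ac)
    finally show "emeasure (scale_measure (ennreal (exp (Q $ i $ i * s))) (N i)) (cylinder (Suc n) z t) = emeasure ?M (cylinder (Suc n) z t)"
      by simp
  qed auto
  from arg_cong[OF this, of "%M. nn_integral M f"] show ?thesis
    by (simp add: nn_integral_scale_measure nn_integral_distr nn_integral_density)
qed

text \<open>On the event that the second state is \<open>k\<close>, the chain from \<open>i\<close>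
  is an exponential sojourn followed by an independent chain from \<open>k\<close>, weighted by the
  jump probability. Jump probability times holding rate is \<open>Q $ i $ k\<close>, so nothing is
  left for an absorbing state.\<close>

lemma nn_integral_first_transition:
  assumes f [measurable]: "case_prod f \<in> borel_measurable (borel \<Otimes>\<^sub>M chain_space)"
  shows "(\<integral>\<^sup>+\<xi>. indicator {..<\<infinity>} (snd (\<xi> 0)) * f (enn2real (snd (\<xi> 0))) (%n. \<xi> (Suc n)) \<partial>N i)
    = (\<Sum>k\<in>UNIV - {i}. \<integral>\<^sup>+u. ennreal (Q $ i $ k * exp (Q $ i $ i * u)) * indicator {0<..} u * (\<integral>\<^sup>+\<xi>. f u \<xi> \<partial>N k) \<partial>lborel)"
proof -
  let ?q = "- (Q $ i $ i)"
  have q: "0 \<le> ?q" using Q_diag_nonpos[of i] by simp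
  interpret W: prob_space "waiting ?q" by (rule prob_space_waiting[OF q])
  let ?join = "%(s, \<xi>). case_nat (i, s) \<xi> :: nat => 'd \<times> ennreal"
  have join [measurable]: "?join \<in> measurable (waiting ?q \<Otimes>\<^sub>M N k) chain_space" for k
  proof (rule measurable_PiM_UNIV)
    show "(%p. ?join p n) \<in> measurable (waiting ?q \<Otimes>\<^sub>M N k) (count_space UNIV \<Otimes>\<^sub>M borel)" for n
      by (cases n) (simp_all add: case_prod_beta')
  qed
  have [measurable]: "(%\<xi>. indicator {k} (fst (\<xi> 1)) :: ennreal) \<in> borel_measurable chain_space" for k :: 'd
    by measurable
  \<comment> \<open>Compared on cylinders, which always specify the second state;
    \<open>weight_Suc\<close> then splits off the first sojourn and the first transition.\<close>
  have disintegrate: "density (N i) (%\<xi>. indicator {k} (fst (\<xi> 1)))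
      = scale_measure (ennreal (jump_matrix Q $ i $ k)) (distr (waiting ?q \<Otimes>\<^sub>M N k) chain_space ?join)" for k
  proof (rule chain_measure_eqI)
    interpret P: pair_prob_space "waiting ?q" "N k" ..
    show "finite_measure (density (N i) (%\<xi>. indicator {k} (fst (\<xi> 1))))"
    proof (rule finite_measureI)
      have "UNIV \<in> sets (chain_space :: (nat => 'd \<times> ennreal) measure)"
        using sets.top[of "chain_space :: (nat => 'd \<times> ennreal) measure"] by simp
      then have "emeasure (density (N i) (%\<xi>. indicator {k} (fst (\<xi> 1)))) UNIV
          = (\<integral>\<^sup>+\<xi>. indicator {k} (fst (\<xi> 1)) * indicator UNIV \<xi> \<partial>N i)"
        by (intro emeasure_density) simp_all
      also have "\<dots> \<le> (\<integral>\<^sup>+\<xi>. 1 \<partial>N i)" by (rule nn_integral_mono) (simp add: indicator_def)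
      also have "\<dots> = 1" using N.emeasure_space_1[of i] by simp
      finally show "emeasure (density (N i) (%\<xi>. indicator {k} (fst (\<xi> 1)))) (space (density (N i) (%\<xi>. indicator {k} (fst (\<xi> 1))))) \<noteq> \<infinity>"
        by (auto simp: top_unique)
    qed
    fix n z t
    have fst_cylinder: "fst (\<xi> 1) = z 1" if "\<xi> \<in> cylinder (Suc n) z t" for \<xi> :: "nat => 'd \<times> ennreal" and n z t
      using that by (simp add: cylinder_def)
    have "emeasure (density (N i) (%\<xi>. indicator {k} (fst (\<xi> 1)))) (cylinder (Suc n) z t)
        = (\<integral>\<^sup>+\<xi>. of_bool (z 1 = k) * indicator (cylinder (Suc n) z t) \<xi> \<partial>N i)"
    proof -
      have "emeasure (density (N i) (%\<xi>. indicator {k} (fst (\<xi> 1)))) (cylinder (Suc n) z t)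
          = (\<integral>\<^sup>+\<xi>. indicator {k} (fst (\<xi> 1)) * indicator (cylinder (Suc n) z t) \<xi> \<partial>N i)"
        by (rule emeasure_density) simp_all
      also have "\<dots> = (\<integral>\<^sup>+\<xi>. of_bool (z 1 = k) * indicator (cylinder (Suc n) z t) \<xi> \<partial>N i)"
        using fst_cylinder[of _ n z t] by (intro nn_integral_cong) (simp split: split_indicator)
      finally show ?thesis .
    qed
    also have "\<dots> = of_bool (z 1 = k) * ennreal (weight i (Suc n) z t)"
      by (simp add: nn_integral_cmult_indicator emeasure_cylinder)
    also have "\<dots> = ennreal (jump_matrix Q $ i $ k) *
        (of_bool (z 0 = i) * ennreal (exp (- ?q * max 0 (t 0))) * ennreal (weight k n (%k. z (Suc k)) (%k. t (Suc k))))"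
      unfolding weight_Suc
      by (cases "z 1 = k"; cases "z 0 = i")
        (simp_all add: ennreal_mult'[symmetric] ennreal_mult''[symmetric] jump_matrix_nonneg weight_nonneg mult_ac, simp_all add: weight_def)
    also have "of_bool (z 0 = i) * ennreal (exp (- ?q * max 0 (t 0))) * ennreal (weight k n (%k. z (Suc k)) (%k. t (Suc k)))
        = emeasure (distr (waiting ?q \<Otimes>\<^sub>M N k) chain_space ?join) (cylinder (Suc n) z t)"
    proof -
      let ?R = "{s. z 0 = i \<and> (t 0 < 0 \<or> ennreal (t 0) < s)}"
      have "?join -` cylinder (Suc n) z t \<inter> space (waiting ?q \<Otimes>\<^sub>M N k)
          = ?R \<times> cylinder n (%k. z (Suc k)) (%k. t (Suc k))"
        unfolding cylinder_def all_le_Suc by (auto simp: space_pair_measure)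
      then have "emeasure (distr (waiting ?q \<Otimes>\<^sub>M N k) chain_space ?join) (cylinder (Suc n) z t)
          = emeasure (waiting ?q) ?R * emeasure (N k) (cylinder n (%k. z (Suc k)) (%k. t (Suc k)))"
        by (subst emeasure_distr) (simp_all add: N.emeasure_pair_measure_Times)
      moreover have "emeasure (waiting ?q) ?R = of_bool (z 0 = i) * ennreal (exp (- ?q * max 0 (t 0)))"
      proof (cases "t 0 < 0")
        case True
        then show ?thesis using W.emeasure_space_1 by (simp add: max_def)
      next
        case False
        then have "?R = (if z 0 = i then {ennreal (t 0)<..} else {})" by auto
        then show ?thesis using False emeasure_waiting_greaterThan[OF q, of "t 0"] by (simp add: max_def)
      qed
      ultimately show ?thesis by (simp add: emeasure_cylinder)
    qed
    finally show "emeasure (density (N i) (%\<xi>. indicator {k} (fst (\<xi> 1)))) (cylinder (Suc n) z t)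
        = emeasure (scale_measure (ennreal (jump_matrix Q $ i $ k)) (distr (waiting ?q \<Otimes>\<^sub>M N k) chain_space ?join)) (cylinder (Suc n) z t)"
      by simp
  qed auto
  define g where "g \<xi> = indicator {..<\<infinity>} (snd (\<xi> 0)) * f (enn2real (snd (\<xi> 0))) (%n. \<xi> (Suc n))" for \<xi>
  have g [measurable]: "g \<in> borel_measurable chain_space"
  proof -
    have "(%\<xi> n. \<xi> (Suc n)) \<in> measurable chain_space (chain_space :: (nat => 'd \<times> ennreal) measure)"
      by (rule measurable_PiM_UNIV) measurable
    moreover have "(%\<xi>. enn2real (snd (\<xi> 0))) \<in> borel_measurable (chain_space :: (nat => 'd \<times> ennreal) measure)"
      by measurable
    ultimately have "(%\<xi>. (enn2real (snd (\<xi> 0)), %n. \<xi> (Suc n))) \<in> measurable chain_space (borel \<Otimes>\<^sub>M (chain_space :: (nat => 'd \<times> ennreal) measure))"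
      by (intro measurable_Pair)
    from measurable_compose[OF this f]
    have "(%\<xi>. case_prod f (enn2real (snd (\<xi> 0)), %n. \<xi> (Suc n))) \<in> borel_measurable chain_space" .
    then have [measurable]: "(%\<xi>. f (enn2real (snd (\<xi> 0))) (%n. \<xi> (Suc n))) \<in> borel_measurable chain_space"
      by simp
    show ?thesis unfolding g_def by measurable
  qed
  have part: "(\<integral>\<^sup>+\<xi>. indicator {k} (fst (\<xi> 1)) * g \<xi> \<partial>N i) = (if k = i then 0 else
      \<integral>\<^sup>+u. ennreal (Q $ i $ k * exp (Q $ i $ i * u)) * indicator {0<..} u * (\<integral>\<^sup>+\<xi>. f u \<xi> \<partial>N k) \<partial>lborel)" for k
  proof -
    have [measurable]: "(%u. \<integral>\<^sup>+\<xi>. f u \<xi> \<partial>N k) \<in> borel_measurable borel"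
      using N.borel_measurable_nn_integral[of f borel k] f
      by (simp add: measurable_cong_sets[OF sets_pair_measure_cong[OF refl sets_N] refl])
    have "(\<integral>\<^sup>+\<xi>. indicator {k} (fst (\<xi> 1)) * g \<xi> \<partial>N i) = nn_integral (density (N i) (%\<xi>. indicator {k} (fst (\<xi> 1)))) g"
      by (rule nn_integral_density[symmetric]) (simp_all add: g)
    also have "\<dots> = ennreal (jump_matrix Q $ i $ k) * (\<integral>\<^sup>+p. g (?join p) \<partial>(waiting ?q \<Otimes>\<^sub>M N k))"
      unfolding disintegrate by (simp add: nn_integral_scale_measure nn_integral_distr g)
    also have "(\<integral>\<^sup>+p. g (?join p) \<partial>(waiting ?q \<Otimes>\<^sub>M N k)) = (\<integral>\<^sup>+s. \<integral>\<^sup>+\<xi>. g (?join (s, \<xi>)) \<partial>N k \<partial>waiting ?q)"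
      by (rule N.nn_integral_fst[symmetric]) (rule measurable_compose[OF join g])
    also have "\<dots> = (\<integral>\<^sup>+s. indicator {..<\<infinity>} s * (\<integral>\<^sup>+\<xi>. f (enn2real s) \<xi> \<partial>N k) \<partial>waiting ?q)"
      by (intro nn_integral_cong) (auto simp: g_def split: split_indicator)
    also have "\<dots> = (\<integral>\<^sup>+u. ennreal (?q * exp (- ?q * u)) * indicator {0<..} u * (\<integral>\<^sup>+\<xi>. f u \<xi> \<partial>N k) \<partial>lborel)"
      by (subst nn_integral_waiting_finite) (use q in \<open>auto intro!: nn_integral_cong split: split_indicator\<close>)
    also have "ennreal (jump_matrix Q $ i $ k) * \<dots> = (\<integral>\<^sup>+u. ennreal (jump_matrix Q $ i $ k * ?q * exp (- ?q * u)) * indicator {0<..} u * (\<integral>\<^sup>+\<xi>. f u \<xi> \<partial>N k) \<partial>lborel)"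
      by (subst nn_integral_cmult[symmetric], measurable, intro nn_integral_cong)
        (simp only: mult.assoc ennreal_mult'[OF jump_matrix_nonneg])
    finally show ?thesis unfolding jump_matrix_rate by simp
  qed
  have "(\<integral>\<^sup>+\<xi>. g \<xi> \<partial>N i) = (\<integral>\<^sup>+\<xi>. (\<Sum>k\<in>UNIV. indicator {k} (fst (\<xi> 1)) * g \<xi>) \<partial>N i)"
    by (intro nn_integral_cong) (simp add: sum_distrib_right[symmetric] indicator_def of_bool_def)
  also have "\<dots> = (\<Sum>k\<in>UNIV. \<integral>\<^sup>+\<xi>. indicator {k} (fst (\<xi> 1)) * g \<xi> \<partial>N i)"
    by (rule nn_integral_sum) (simp add: g)
  also have "\<dots> = (\<Sum>k\<in>UNIV - {i}. \<integral>\<^sup>+u. ennreal (Q $ i $ k * exp (Q $ i $ i * u)) * indicator {0<..} u * (\<integral>\<^sup>+\<xi>. f u \<xi> \<partial>N k) \<partial>lborel)"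
    unfolding part by (simp add: sum.remove[of UNIV i])
  finally show ?thesis unfolding g_def .
qed

end

section \<open>The first event equation\<close>

text \<open>Replacing one coordinate of a product by an independent copy does not change the
  integral: the old coordinate is overwritten and integrates out.\<close>

lemma nn_integral_PiM_resample:
  fixes M :: "'i::finite => 'b measure"
  assumes prob: "\<And>i. prob_space (M i)" and f [measurable]: "f \<in> borel_measurable (PiM UNIV M)"
  shows "(\<integral>\<^sup>+g. f g \<partial>PiM UNIV M) = (\<integral>\<^sup>+y. \<integral>\<^sup>+g. f (g(i := y)) \<partial>PiM UNIV M \<partial>M i)"
proof -
  interpret product_prob_space M by (intro product_prob_spaceI prob)
  interpret R: prob_space "PiM (UNIV - {i}) M" by (intro prob_space_PiM prob)
  have ins: "insert i (UNIV - {i}) = UNIV" by auto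
  have one: "(\<integral>\<^sup>+g. h g \<partial>PiM UNIV M) = (\<integral>\<^sup>+y. \<integral>\<^sup>+g. h (g(i := y)) \<partial>PiM (UNIV - {i}) M \<partial>M i)"
    if "h \<in> borel_measurable (PiM UNIV M)" for h
    using product_nn_integral_insert_rev[of "UNIV - {i}" i h] that unfolding ins by simp
  have "(\<integral>\<^sup>+g. f (g(i := y)) \<partial>PiM UNIV M) = (\<integral>\<^sup>+g. f (g(i := y)) \<partial>PiM (UNIV - {i}) M)"
    if y: "y \<in> space (M i)" for y
  proof -
    have m: "(%g. g(i := y)) \<in> measurable (PiM UNIV M) (PiM UNIV M)"
    proof (rule measurable_PiM_UNIV)
      show "(%g. (g(i := y)) n) \<in> measurable (PiM UNIV M) (M n)" for n
        using y by (cases "n = i") simp_all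
    qed
    have "(\<integral>\<^sup>+g. f (g(i := y)) \<partial>PiM UNIV M)
        = (\<integral>\<^sup>+y'. \<integral>\<^sup>+g. f ((g(i := y'))(i := y)) \<partial>PiM (UNIV - {i}) M \<partial>M i)"
      by (rule one) (rule measurable_compose[OF m f])
    also have "\<dots> = (\<integral>\<^sup>+g. f (g(i := y)) \<partial>PiM (UNIV - {i}) M)"
      using prob_space.emeasure_space_1[OF prob] by simp
    finally show ?thesis .
  qed
  then show ?thesis unfolding one[OF f] by (intro nn_integral_cong) simp
qed

section \<open>The product law of a world and its memorylessness\<close>

abbreviation "mark_space \<equiv> PiM UNIV (%_::nat. borel \<Otimes>\<^sub>M borel :: (ennreal \<times> real) measure)"
abbreviation "component_space \<equiv> PiM UNIV (%_. mark_space)"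
abbreviation "transit_space \<equiv> PiM UNIV (%_::nat. PiM UNIV (%_. borel :: real measure))"
abbreviation "rest_space \<equiv> component_space \<Otimes>\<^sub>M (transit_space \<Otimes>\<^sub>M (borel :: real measure))"
abbreviation "world_space \<equiv> chain_space \<Otimes>\<^sub>M rest_space"

definition killing :: "real => real measure" where
  "killing beta = density lborel (exponential_density beta)"

lemma sets_killing [simp, measurable_cong]: "sets (killing beta) = sets borel"
  by (simp add: killing_def)

lemma nn_integral_killing:
  assumes [measurable]: "f \<in> borel_measurable borel"
  shows "(\<integral>\<^sup>+t. f t \<partial>killing beta) = (\<integral>\<^sup>+t. ennreal (beta * exp (- beta * t)) * indicator {0<..} t * f t \<partial>lborel)"
proof -
  have "(\<integral>\<^sup>+t. f t \<partial>killing beta) = (\<integral>\<^sup>+t. ennreal (exponential_density beta t) * f t \<partial>lborel)"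
    by (simp add: killing_def nn_integral_density)
  also have "\<dots> = (\<integral>\<^sup>+t. ennreal (beta * exp (- beta * t)) * indicator {0<..} t * f t \<partial>lborel)"
    using AE_lborel_singleton[of 0]
    by (intro nn_integral_cong_AE, eventually_elim)
      (auto simp: exponential_density_def indicator_def mult.commute)
  finally show ?thesis .
qed

lemma killing_memoryless:
  assumes [measurable]: "f \<in> borel_measurable borel" and "0 < beta" "0 \<le> s"
  shows "(\<integral>\<^sup>+t. indicator {s..} t * f (t - s) \<partial>killing beta) = ennreal (exp (- beta * s)) * (\<integral>\<^sup>+t. f t \<partial>killing beta)"
proof -
  let ?h = "%t. ennreal (beta * exp (- beta * t)) * indicator {0<..} t * (indicator {s..} t * f (t - s))"
  have "(\<integral>\<^sup>+t. ?h t \<partial>lborel) = (\<integral>\<^sup>+t. ?h (s + t) \<partial>lborel)"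
    using nn_integral_real_affine[of ?h 1 s] by simp
  also have "\<dots> = (\<integral>\<^sup>+t. ennreal (exp (- beta * s)) * (ennreal (beta * exp (- beta * t)) * indicator {0<..} t * f t) \<partial>lborel)"
    using AE_lborel_singleton[of 0]
  proof (intro nn_integral_cong_AE, eventually_elim)
    fix t :: real assume "t \<noteq> 0"
    have "beta * exp (- beta * (s + t)) = exp (- beta * s) * (beta * exp (- beta * t))"
      by (simp add: algebra_simps flip: exp_add)
    then have "ennreal (beta * exp (- beta * (s + t))) = ennreal (exp (- beta * s)) * ennreal (beta * exp (- beta * t))"
      by (simp only: ennreal_mult'[OF exp_ge_zero])
    then show "?h (s + t) = ennreal (exp (- beta * s)) * (ennreal (beta * exp (- beta * t)) * indicator {0<..} t * f t)"
      using assms \<open>t \<noteq> 0\<close> by (auto simp: indicator_def mult.assoc)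
  qed
  also have "\<dots> = ennreal (exp (- beta * s)) * (\<integral>\<^sup>+t. ennreal (beta * exp (- beta * t)) * indicator {0<..} t * f t \<partial>lborel)"
    by (rule nn_integral_cmult) measurable
  finally show ?thesis by (simp add: nn_integral_killing)
qed

lemma measurable_restart_all [measurable]:
  "(%(u, g). %k. restart u (g k)) \<in> measurable (borel \<Otimes>\<^sub>M component_space) (component_space :: ('d => _) measure)"
proof -
  have "(%p. %k. restart (fst p) (snd p k)) \<in> measurable (borel \<Otimes>\<^sub>M component_space) (component_space :: ('d => _) measure)"
  proof (rule measurable_PiM_UNIV)
    fix k :: 'd
    have "(%p. (fst p, snd p k)) \<in> measurable (borel \<Otimes>\<^sub>M component_space) (borel \<Otimes>\<^sub>M mark_space)"
      by measurable
    from measurable_compose[OF this measurable_restart[of "borel :: real measure"]]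
    show "(%p. restart (fst p) (snd p k)) \<in> measurable (borel \<Otimes>\<^sub>M component_space) mark_space" by simp
  qed
  then show ?thesis by (simp add: case_prod_beta')
qed

lemma measurable_restart_all_fixed:
  "(%g k. restart u (g k)) \<in> measurable component_space (component_space :: ('d => _) measure)"
proof -
  have "(%g. (u, g)) \<in> measurable component_space (borel \<Otimes>\<^sub>M (component_space :: ('d => _) measure))"
    by measurable
  from measurable_compose[OF this measurable_restart_all] show ?thesis by simp
qed

lemma measurable_coordinate:
  "(%g. g i n) \<in> measurable (PiM UNIV (%_. PiM UNIV (%_. N))) N"
  by (rule measurable_compose[where f = "%g. g i" and g = "%x. x n" and N = "PiM UNIV (%_. N)"]) simp_all

lemma measurable_update [measurable]:
  "(%(y, g). g(i := y)) \<in> measurable (mark_space \<Otimes>\<^sub>M component_space) (component_space :: ('d => _) measure)"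
proof -
  have "(%p. (snd p)(i := fst p)) \<in> measurable (mark_space \<Otimes>\<^sub>M component_space) (component_space :: ('d => _) measure)"
  proof (rule measurable_PiM_UNIV)
    show "(%p. ((snd p)(i := fst p)) k) \<in> measurable (mark_space \<Otimes>\<^sub>M component_space) mark_space" for k
      by (cases "k = i") simp_all
  qed
  then show ?thesis by (simp add: case_prod_beta')
qed

lemma measurable_fun_upd_same: "(%g. g(i := y)) \<in> measurable component_space (component_space :: ('d => _) measure)"
proof (rule measurable_PiM_UNIV)
  show "(%g. (g(i := y)) k) \<in> measurable component_space mark_space" for k
    by (cases "k = i") (simp_all add: space_PiM space_pair_measure)
qed

locale world_law = chain_law Q N for Q :: "real^'d^'d::finite" and N +
  fixes lam :: "'d => real" and B :: "'d => real measure" and C :: "'d => 'd => real measure" and beta :: real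
  assumes renewal: "\<And>k. renewal_law (lam k) (B k)"
    and regular_chain: "\<And>i. AE \<xi> in N i. renewal_sequence (%n. snd (\<xi> n))"
    and prob_C: "\<And>i j. i \<noteq> j ==> prob_space (C i j)" and sets_C: "\<And>i j. i \<noteq> j ==> sets (C i j) = sets borel"
    and beta: "0 < beta"
begin

sublocale renewal: renewal_law "lam k" "B k" for k by (rule renewal)

definition "claims = PiM UNIV (%k. PiM UNIV (%_::nat. waiting (lam k) \<Otimes>\<^sub>M B k))"
text \<open>A table over all ordered pairs of states; the point mass at 0 on the diagonal makes it a
  full product.\<close>

definition "jump_vector = PiM UNIV (%(i, j). if i = j then return borel 0 else C i j)"
definition "transits = PiM UNIV (%_::nat. jump_vector)"
definition "rest = claims \<Otimes>\<^sub>M (transits \<Otimes>\<^sub>M killing beta)"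
definition "world i = N i \<Otimes>\<^sub>M rest"

lemma jump_law: "prob_space (case p of (i, j) => if i = j then return borel 0 else C i j)"
    "sets (case p of (i, j) => if i = j then return borel 0 else C i j) = sets borel"
  by (cases p; simp add: prob_C sets_C prob_space_return)+

lemma sets_claims [simp, measurable_cong]: "sets claims = sets component_space"
  unfolding claims_def by (rule sets_PiM_cong[OF refl]) (rule renewal.sets_SL)

lemma sets_jump_vector [simp, measurable_cong]: "sets jump_vector = sets (PiM UNIV (%_. borel))"
  unfolding jump_vector_def by (rule sets_PiM_cong[OF refl]) (rule jump_law)

lemma sets_transits [simp, measurable_cong]: "sets transits = sets transit_space"
  unfolding transits_def by (intro sets_PiM_cong refl) simp

lemma sets_rest [simp, measurable_cong]: "sets rest = sets rest_space"
  unfolding rest_def by (intro sets_pair_measure_cong) auto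

lemma sets_world [simp, measurable_cong]: "sets (world i) = sets world_space"
  unfolding world_def by (intro sets_pair_measure_cong) auto

sublocale claims: prob_space claims
  unfolding claims_def by (rule prob_space_PiM) (rule renewal.SL.prob_space_axioms)

sublocale jump_vector: prob_space jump_vector
  unfolding jump_vector_def by (rule prob_space_PiM) (rule jump_law)

sublocale transits: prob_space transits
  unfolding transits_def by (intro prob_space_PiM jump_vector.prob_space_axioms)

sublocale killing: prob_space "killing beta"
  unfolding killing_def by (rule prob_space_exponential_density[OF beta])

sublocale rest: prob_space rest
  unfolding rest_def by (intro prob_space_pair claims.prob_space_axioms transits.prob_space_axioms killing.prob_space_axioms)

sublocale world: prob_space "world i" for i
  unfolding world_def by (intro prob_space_pair N.prob_space_axioms rest.prob_space_axioms)

lemma component_sets_cong: "measurable mark_space M = measurable (PiM UNIV (%_::nat. waiting (lam k) \<Otimes>\<^sub>M B k)) M"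
  using renewal.sets_SL[of k] by (intro measurable_cong_sets) auto

lemma restart_components:
  assumes f [measurable]: "f \<in> borel_measurable component_space" and u: "0 \<le> u"
  shows "(\<integral>\<^sup>+g. f (%k. restart u (g k)) \<partial>claims) = (\<integral>\<^sup>+g. f g \<partial>claims)"
proof -
  let ?SL = "%k. PiM UNIV (%_::nat. waiting (lam k) \<Otimes>\<^sub>M B k)"
  have "distr (PiM UNIV ?SL) (PiM UNIV ?SL) (compose UNIV (restart u)) = PiM UNIV (%k. distr (?SL k) (?SL k) (restart u))"
    by (intro distr_PiM_finite_prob_space' renewal.SL.prob_space_axioms renewal.restart_SL) simp_all
  then have d: "distr claims claims (compose UNIV (restart u)) = claims"
    unfolding claims_def by (simp only: renewal.distr_restart[OF u])
  have eq: "compose UNIV (restart u) = (%g k. restart u (g k))" by (auto simp: compose_def fun_eq_iff)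
  have m: "compose UNIV (restart u) \<in> measurable claims claims" unfolding eq
    using measurable_restart_all_fixed[of u]
    unfolding measurable_cong_sets[OF sets_claims sets_claims] .
  have "(\<integral>\<^sup>+g. f g \<partial>claims) = (\<integral>\<^sup>+g. f (compose UNIV (restart u) g) \<partial>claims)"
    by (subst d[symmetric], rule nn_integral_distr[OF m]) simp
  then show ?thesis unfolding eq by (rule sym)
qed

lemma resample_component:
  assumes f: "f \<in> borel_measurable component_space"
  shows "(\<integral>\<^sup>+g. f g \<partial>claims)
    = (\<integral>\<^sup>+y. \<integral>\<^sup>+g. f (g(i := y)) \<partial>claims \<partial>PiM UNIV (%_::nat. waiting (lam i) \<Otimes>\<^sub>M B i))"
proof -
  have "f \<in> borel_measurable claims" using f by (simp add: measurable_cong_sets[OF sets_claims refl])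
  then show ?thesis
    unfolding claims_def by (intro nn_integral_PiM_resample) (rule renewal.SL.prob_space_axioms)
qed

lemma restart_update: "(%k. restart u ((g(i := y)) k)) = (%k. restart u (g k))(i := restart u y)"
  by auto

text \<open>Resampling stream \<open>i\<close> separates it from the others: these keep their law
  when restarted at \<open>u\<close>, and for stream \<open>i\<close> a first gap beyond
  \<open>u\<close> is the memoryless case.\<close>

lemma components_before_claim:
  assumes f [measurable]: "f \<in> borel_measurable component_space" and u: "0 \<le> u"
  shows "(\<integral>\<^sup>+g. indicator {ennreal u<..} (fst (g i 0)) * f (%k. restart u (g k)) \<partial>claims)
    = ennreal (exp (- lam i * u)) * (\<integral>\<^sup>+g. f g \<partial>claims)"
proof -
  let ?SL = "PiM UNIV (%_::nat. waiting (lam i) \<Otimes>\<^sub>M B i)"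
  define h where "h y = (\<integral>\<^sup>+g. f (g(i := y)) \<partial>claims)" for y
  have [measurable]: "(%(y, g). f (g(i := y))) \<in> borel_measurable (mark_space \<Otimes>\<^sub>M component_space)"
    using measurable_compose[OF measurable_update f] by (simp add: case_prod_beta')
  have upd: "(%g. f (g(i := y))) \<in> borel_measurable component_space" for y
    using measurable_compose[OF measurable_fun_upd_same f, of i y] .
  have h [measurable]: "h \<in> borel_measurable ?SL"
    unfolding component_sets_cong[symmetric] h_def by measurable
  have all [measurable]: "(%g k. restart u (g k)) \<in> measurable component_space component_space"
    by (rule measurable_restart_all_fixed)
  have [measurable]: "(%g. f (%k. restart u (g k))) \<in> borel_measurable component_space"
    by (rule measurable_compose[OF all f])
  have [measurable]: "(%g. g i 0) \<in> measurable component_space (borel \<Otimes>\<^sub>M borel)"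
    by (rule measurable_coordinate)
  have "(\<integral>\<^sup>+g. indicator {ennreal u<..} (fst (g i 0)) * f (%k. restart u (g k)) \<partial>claims)
      = (\<integral>\<^sup>+y. \<integral>\<^sup>+g. indicator {ennreal u<..} (fst ((g(i := y)) i 0)) * f (%k. restart u ((g(i := y)) k)) \<partial>claims \<partial>?SL)"
    by (rule resample_component) measurable
  also have "\<dots> = (\<integral>\<^sup>+y. indicator {ennreal u<..} (fst (y 0)) * h (restart u y) \<partial>?SL)"
  proof (rule nn_integral_cong)
    fix y
    show "(\<integral>\<^sup>+g. indicator {ennreal u<..} (fst ((g(i := y)) i 0)) * f (%k. restart u ((g(i := y)) k)) \<partial>claims)
        = indicator {ennreal u<..} (fst (y 0)) * h (restart u y)"
      unfolding restart_update h_def using restart_components[OF upd u, of "restart u y"]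
      by (simp split: split_indicator)
  qed
  also have "\<dots> = ennreal (exp (- lam i * u)) * (\<integral>\<^sup>+y. h y \<partial>?SL)"
    by (rule renewal.nn_integral_restart_early[OF h u])
  also have "(\<integral>\<^sup>+y. h y \<partial>?SL) = (\<integral>\<^sup>+g. f g \<partial>claims)"
    unfolding h_def by (rule resample_component[symmetric]) measurable
  finally show ?thesis .
qed

text \<open>The restart takes place at the random time of the first claim of stream
  \<open>i\<close>. The other streams are independent of that time, so their invariance under a
  restart at a fixed time applies; stream \<open>i\<close> itself leaves its tail.\<close>

lemma components_first_claim:
  assumes f [measurable]: "f \<in> borel_measurable (borel \<Otimes>\<^sub>M (borel \<Otimes>\<^sub>M component_space))"
  shows "(\<integral>\<^sup>+g. indicator {..<\<infinity>} (fst (g i 0)) * f (enn2real (fst (g i 0)), snd (g i 0), %k. restart (enn2real (fst (g i 0))) (g k)) \<partial>claims)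
    = (\<integral>\<^sup>+u. ennreal (lam i * exp (- lam i * u)) * indicator {0<..} u * (\<integral>\<^sup>+m. \<integral>\<^sup>+g. f (u, m, g) \<partial>claims \<partial>B i) \<partial>lborel)"
proof -
  let ?SL = "PiM UNIV (%_::nat. waiting (lam i) \<Otimes>\<^sub>M B i)"
  define h where "h p = (\<integral>\<^sup>+g. f (fst p, fst (snd p), g(i := snd (snd p))) \<partial>claims)" for p
  have sec: "(%g. f (u, m, g(i := y))) \<in> borel_measurable component_space" for u m y
    using measurable_fun_upd_same[of i y] by measurable
  have h [measurable]: "h \<in> borel_measurable (borel \<Otimes>\<^sub>M (borel \<Otimes>\<^sub>M mark_space))"
    unfolding h_def by measurable
  have hSL: "(%y. h (u, m, y)) \<in> borel_measurable ?SL" for u m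
    unfolding component_sets_cong[symmetric] by measurable
  have [measurable]: "(%(u, g). restart u g) \<in> measurable (borel \<Otimes>\<^sub>M mark_space) mark_space" by (rule measurable_restart)
  have coord [measurable]: "(%g. g i 0) \<in> measurable component_space (borel \<Otimes>\<^sub>M borel)"
    by (rule measurable_coordinate)
  have "(%g. (enn2real (fst (g i 0)), g)) \<in> measurable component_space (borel \<Otimes>\<^sub>M component_space)"
    by (intro measurable_Pair) measurable
  from measurable_compose[OF this measurable_restart_all]
  have [measurable]: "(%g. %k. restart (enn2real (fst (g i 0))) (g k)) \<in> measurable component_space component_space" by simp
  have "(\<integral>\<^sup>+g. indicator {..<\<infinity>} (fst (g i 0)) * f (enn2real (fst (g i 0)), snd (g i 0), %k. restart (enn2real (fst (g i 0))) (g k)) \<partial>claims)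
      = (\<integral>\<^sup>+y. \<integral>\<^sup>+g. indicator {..<\<infinity>} (fst ((g(i := y)) i 0)) *
          f (enn2real (fst ((g(i := y)) i 0)), snd ((g(i := y)) i 0), %k. restart (enn2real (fst ((g(i := y)) i 0))) ((g(i := y)) k)) \<partial>claims \<partial>?SL)"
    by (rule resample_component) measurable
  also have "\<dots> = (\<integral>\<^sup>+y. indicator {..<\<infinity>} (fst (y 0)) * h (enn2real (fst (y 0)), snd (y 0), restart (enn2real (fst (y 0))) y) \<partial>?SL)"
  proof (rule nn_integral_cong)
    fix y :: "nat => ennreal \<times> real"
    show "(\<integral>\<^sup>+g. indicator {..<\<infinity>} (fst ((g(i := y)) i 0)) *
          f (enn2real (fst ((g(i := y)) i 0)), snd ((g(i := y)) i 0), %k. restart (enn2real (fst ((g(i := y)) i 0))) ((g(i := y)) k)) \<partial>claims)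
        = indicator {..<\<infinity>} (fst (y 0)) * h (enn2real (fst (y 0)), snd (y 0), restart (enn2real (fst (y 0))) y)"
      unfolding restart_update h_def using restart_components[OF sec, of "enn2real (fst (y 0))"]
      by (simp split: split_indicator)
  qed
  also have "\<dots> = (\<integral>\<^sup>+x. \<integral>\<^sup>+m. \<integral>\<^sup>+y. indicator {..<\<infinity>} x * h (enn2real x, m, restart (enn2real x) (case_nat (x, m) y)) \<partial>?SL \<partial>B i \<partial>waiting (lam i))"
  proof (subst renewal.nn_integral_SL)
    show "(%y. indicator {..<\<infinity>} (fst (y 0)) * h (enn2real (fst (y 0)), snd (y 0), restart (enn2real (fst (y 0))) y)) \<in> borel_measurable ?SL"
      unfolding component_sets_cong[symmetric] by measurable
  qed simp
  also have "\<dots> = (\<integral>\<^sup>+x. indicator {..<\<infinity>} x * (\<integral>\<^sup>+m. \<integral>\<^sup>+y. h (enn2real x, m, y) \<partial>?SL \<partial>B i) \<partial>waiting (lam i))"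
    using renewal.AE_SL_step[of i]
  proof (intro nn_integral_cong_AE, eventually_elim)
    fix x assume ae: "AE m in B i. AE g in ?SL. renewal_sequence (gaps (case_nat (x, m) g))"
    show "(\<integral>\<^sup>+m. \<integral>\<^sup>+y. indicator {..<\<infinity>} x * h (enn2real x, m, restart (enn2real x) (case_nat (x, m) y)) \<partial>?SL \<partial>B i)
        = indicator {..<\<infinity>} x * (\<integral>\<^sup>+m. \<integral>\<^sup>+y. h (enn2real x, m, y) \<partial>?SL \<partial>B i)"
    proof (cases x)
      case (real \<gamma>)
      have "(\<integral>\<^sup>+m. \<integral>\<^sup>+y. h (\<gamma>, m, restart \<gamma> (case_nat (x, m) y)) \<partial>?SL \<partial>B i) = (\<integral>\<^sup>+m. \<integral>\<^sup>+y. h (\<gamma>, m, y) \<partial>?SL \<partial>B i)"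
        using ae
      proof (intro nn_integral_cong_AE, eventually_elim)
        fix m assume "AE g in ?SL. renewal_sequence (gaps (case_nat (x, m) g))"
        \<comment> \<open>At its own first arrival the stream is its tail restarted at 0, which
          discards possible gaps of length 0 and does not change the law.\<close>
        then have "(\<integral>\<^sup>+y. h (\<gamma>, m, restart \<gamma> (case_nat (x, m) y)) \<partial>?SL) = (\<integral>\<^sup>+y. h (\<gamma>, m, restart 0 y) \<partial>?SL)"
        proof (intro nn_integral_cong_AE, eventually_elim)
          fix g assume "renewal_sequence (gaps (case_nat (x, m) g))"
          then show "h (\<gamma>, m, restart \<gamma> (case_nat (x, m) g)) = h (\<gamma>, m, restart 0 g)"
            using restart_late[of "(x, m)" g \<gamma> \<gamma>] real by simp
        qed
        also have "\<dots> = (\<integral>\<^sup>+y. h (\<gamma>, m, y) \<partial>?SL)"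
          by (rule renewal.nn_integral_restart[OF hSL]) simp
        finally show "(\<integral>\<^sup>+y. h (\<gamma>, m, restart \<gamma> (case_nat (x, m) y)) \<partial>?SL) = (\<integral>\<^sup>+y. h (\<gamma>, m, y) \<partial>?SL)" .
      qed
      then show ?thesis using real by simp
    qed simp
  qed
  also have "\<dots> = (\<integral>\<^sup>+x. indicator {..<\<infinity>} x * (\<integral>\<^sup>+m. \<integral>\<^sup>+g. f (enn2real x, m, g) \<partial>claims \<partial>B i) \<partial>waiting (lam i))"
  proof -
    have "(\<integral>\<^sup>+y. h (u, m, y) \<partial>?SL) = (\<integral>\<^sup>+g. f (u, m, g) \<partial>claims)" for u m
      unfolding h_def using resample_component[of "%g. f (u, m, g)" i] by simp
    then show ?thesis by simp
  qed
  also have "\<dots> = (\<integral>\<^sup>+u. ennreal (lam i * exp (- lam i * u)) * indicator {0<..} u * (\<integral>\<^sup>+m. \<integral>\<^sup>+g. f (u, m, g) \<partial>claims \<partial>B i) \<partial>lborel)"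
    by (subst nn_integral_waiting_finite) (use renewal.lam in \<open>auto intro!: nn_integral_cong split: split_indicator\<close>)
  finally show ?thesis .
qed

text \<open>A transition from \<open>i\<close> to \<open>k\<close> consumes one table and reads its
  entry \<open>(i, k)\<close>; the remaining tables are independent of it and have the original
  law.\<close>

lemma transits_head:
  assumes f [measurable]: "f \<in> borel_measurable (borel \<Otimes>\<^sub>M transit_space)" and "i \<noteq> k"
  shows "(\<integral>\<^sup>+c. f (c 0 (i, k), %n. c (Suc n)) \<partial>transits) = (\<integral>\<^sup>+m. \<integral>\<^sup>+c. f (m, c) \<partial>transits \<partial>C i k)"
proof -
  interpret S: sequence_space jump_vector ..
  interpret V: product_prob_space "%(i, j). if i = j then return borel 0 else C i j" UNIV
    by (rule product_prob_spaceI) (rule jump_law)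
  have tail [measurable]: "(%c n. c (Suc n)) \<in> measurable transit_space (transit_space :: (nat => 'd \<times> 'd => real) measure)"
    by (rule measurable_PiM_UNIV) measurable
  have join: "case_prod case_nat \<in> measurable (jump_vector \<Otimes>\<^sub>M transits) transits"
    unfolding transits_def by measurable
  have it: "distr (jump_vector \<Otimes>\<^sub>M transits) transits (case_prod case_nat) = transits"
    using S.PiM_iter unfolding transits_def by simp
  have "(%c. c 0 (i, k)) \<in> borel_measurable (transit_space :: (nat => 'd \<times> 'd => real) measure)"
    by (rule measurable_coordinate)
  from measurable_compose[OF measurable_Pair[OF this tail] f]
  have m: "(%c. f (c 0 (i, k), %n. c (Suc n))) \<in> borel_measurable transits"
    unfolding measurable_cong_sets[OF sets_transits refl] .
  have "(\<integral>\<^sup>+c. f (c 0 (i, k), %n. c (Suc n)) \<partial>transits)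
      = (\<integral>\<^sup>+p. f (fst p (i, k), snd p) \<partial>(jump_vector \<Otimes>\<^sub>M transits))"
  proof -
    have "(\<integral>\<^sup>+c. f (c 0 (i, k), %n. c (Suc n)) \<partial>transits)
        = (\<integral>\<^sup>+c. f (c 0 (i, k), %n. c (Suc n)) \<partial>distr (jump_vector \<Otimes>\<^sub>M transits) transits (case_prod case_nat))"
      unfolding it by (rule refl)
    also have "\<dots> = (\<integral>\<^sup>+p. f (case_prod case_nat p 0 (i, k), %n. case_prod case_nat p (Suc n)) \<partial>(jump_vector \<Otimes>\<^sub>M transits))"
      by (rule nn_integral_distr[OF join]) (unfold measurable_distr_eq1, rule m)
    also have "\<dots> = (\<integral>\<^sup>+p. f (fst p (i, k), snd p) \<partial>(jump_vector \<Otimes>\<^sub>M transits))"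
      by (rule nn_integral_cong) (simp add: case_prod_beta')
    finally show ?thesis .
  qed
  also have "\<dots> = (\<integral>\<^sup>+v. \<integral>\<^sup>+c. f (v (i, k), c) \<partial>transits \<partial>jump_vector)"
  proof -
    have "(%p. fst p (i, k)) \<in> borel_measurable (PiM UNIV (%_. borel) \<Otimes>\<^sub>M (transit_space :: (nat => 'd \<times> 'd => real) measure))"
      by (rule measurable_compose[OF measurable_fst measurable_component_singleton]) simp
    from measurable_compose[OF measurable_Pair[OF this measurable_snd] f]
    have "(%p. f (fst p (i, k), snd p)) \<in> borel_measurable (jump_vector \<Otimes>\<^sub>M transits)"
      unfolding measurable_cong_sets[OF sets_pair_measure_cong[OF sets_jump_vector sets_transits] refl] .
    from transits.nn_integral_fst[OF this] show ?thesis by simp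
  qed
  also have "\<dots> = (\<integral>\<^sup>+m. \<integral>\<^sup>+c. f (m, c) \<partial>transits \<partial>distr jump_vector (C i k) (%v. v (i, k)))"
  proof (rule nn_integral_distr[symmetric])
    have "(%v. v (i, k)) \<in> borel_measurable (PiM UNIV (%_::'d \<times> 'd. borel :: real measure))" by simp
    then show "(%v. v (i, k)) \<in> measurable jump_vector (C i k)"
      unfolding measurable_cong_sets[OF sets_jump_vector sets_C[OF \<open>i \<noteq> k\<close>]] .
    have "f \<in> borel_measurable (borel \<Otimes>\<^sub>M transits)"
      unfolding measurable_cong_sets[OF sets_pair_measure_cong[OF refl sets_transits] refl] by (rule f)
    from transits.borel_measurable_nn_integral_fst[OF this]
    show "(%m. \<integral>\<^sup>+c. f (m, c) \<partial>transits) \<in> borel_measurable (distr jump_vector (C i k) (%v. v (i, k)))"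
      unfolding measurable_distr_eq1 measurable_cong_sets[OF sets_C[OF \<open>i \<noteq> k\<close>] refl] .
  qed
  also have "distr jump_vector (C i k) (%v. v (i, k)) = C i k"
    using V.PiM_component[of "(i, k)"] \<open>i \<noteq> k\<close> unfolding jump_vector_def by simp
  finally show ?thesis .
qed

end

section \<open>Measurability of the path functionals of a world\<close>

lemma measurable_state [measurable]: "state n \<in> measurable world_space (count_space UNIV)"
  unfolding state_def
  by (rule measurable_compose[OF _ measurable_fst], rule measurable_compose[OF measurable_fst measurable_component_singleton]) simp

lemma measurable_sojourn [measurable]: "sojourn n \<in> borel_measurable world_space"
  unfolding sojourn_def
  by (rule measurable_compose[OF _ measurable_snd], rule measurable_compose[OF measurable_fst measurable_component_singleton]) simp

lemma measurable_claim_pair: "(%w. fst (snd w) k n) \<in> measurable world_space (borel \<Otimes>\<^sub>M borel)"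
  by (rule measurable_compose[OF measurable_compose[OF measurable_snd measurable_fst] measurable_coordinate])

lemma measurable_gap [measurable]: "gap k n \<in> borel_measurable world_space"
  unfolding gap_def by (rule measurable_compose[OF measurable_claim_pair measurable_fst])

lemma measurable_claim [measurable]: "claim k n \<in> borel_measurable world_space"
  unfolding claim_def by (rule measurable_compose[OF measurable_claim_pair measurable_snd])

lemma measurable_transit [measurable]: "transit i j n \<in> borel_measurable world_space"
  unfolding transit_def
  by (rule measurable_compose[OF measurable_compose[OF measurable_compose[OF measurable_snd measurable_snd] measurable_fst] measurable_coordinate])

lemma measurable_clock [measurable]: "clock \<in> borel_measurable world_space"
  unfolding clock_def
  by (rule measurable_compose[OF measurable_compose[OF measurable_snd measurable_snd] measurable_snd])

lemma measurable_at_state: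
  fixes f :: "'d::finite => 'd world => 'b"
  assumes "\<And>k. f k \<in> measurable world_space N"
  shows "(%w. f (state n w) w) \<in> measurable world_space N"
  by (rule measurable_compose_countable[OF assms measurable_state])

lemma measurable_first_event [measurable]: "first_event \<in> borel_measurable (world_space :: ('d::finite world) measure)"
proof -
  have [measurable]: "(%w. gap (state 0 w) 0 w) \<in> borel_measurable (world_space :: 'd world measure)"
    by (rule measurable_at_state) measurable
  show ?thesis unfolding first_event_def by measurable
qed

lemma measurable_swap_chain: "(%\<xi> n. prod.swap (\<xi> n)) \<in> measurable (PiM UNIV (%_. A \<Otimes>\<^sub>M D)) (PiM UNIV (%_. D \<Otimes>\<^sub>M A))"
proof (rule measurable_PiM_UNIV)
  show "(%\<xi>. prod.swap (\<xi> n)) \<in> measurable (PiM UNIV (%_. A \<Otimes>\<^sub>M D)) (D \<Otimes>\<^sub>M A)" for n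
    by (rule measurable_compose[where f = "%\<xi>. \<xi> n" and g = prod.swap and N = "A \<Otimes>\<^sub>M D"])
      (simp_all add: prod.swap_def[abs_def])
qed

lemma measurable_renewals_sojourn:
  assumes e: "e \<in> borel_measurable (world_space :: ('d::finite world) measure)"
  shows "(%w. renewals (%n. sojourn n w) (e w)) \<in> measurable (world_space :: ('d world) measure) (count_space UNIV)"
proof -
  have "(%w. %n. prod.swap (fst w n)) \<in> measurable (world_space :: 'd world measure) (PiM UNIV (%_::nat. borel \<Otimes>\<^sub>M count_space UNIV))"
    by (rule measurable_compose[OF measurable_fst measurable_swap_chain])
  from measurable_compose[OF measurable_Pair[OF e this] measurable_renewals]
  show ?thesis by (simp add: sojourn_def)
qed

lemma measurable_renewals_gap:
  assumes e: "e \<in> borel_measurable (world_space :: ('d::finite world) measure)"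
  shows "(%w. renewals (%n. gap k n w) (e w)) \<in> measurable (world_space :: ('d world) measure) (count_space UNIV)"
proof -
  have "(%w. fst (snd w) k) \<in> measurable (world_space :: 'd world measure) mark_space"
    by (rule measurable_compose[OF measurable_compose[OF measurable_snd measurable_fst] measurable_component_singleton]) simp
  from measurable_compose[OF measurable_Pair[OF e this] measurable_renewals]
  show ?thesis by (simp add: gap_def)
qed

lemma measurable_transition_jump: "transition_jump n \<in> borel_measurable (world_space :: ('d::finite world) measure)"
proof -
  have [measurable]: "(%w. transit (state n w) (state (Suc n) w) n w) \<in> borel_measurable (world_space :: 'd world measure)"
    by (rule measurable_at_state[where f = "%k w. transit k (state (Suc n) w) n w"], rule measurable_at_state) measurable
  show ?thesis unfolding transition_jump_def by measurable
qed

lemma measurable_first_mark [measurable]: "first_mark \<in> borel_measurable (world_space :: ('d::finite world) measure)"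
proof -
  let ?W = "world_space :: 'd world measure"
  have e: "(%w. enn2real (first_event w)) \<in> borel_measurable ?W" by measurable
  have claims: "(%w. \<Sum>n<renewals (%n. gap k n w) (u w). claim k n w) \<in> borel_measurable ?W"
    if "u \<in> borel_measurable ?W" for k u
    by (rule measurable_compose_countable[OF _ measurable_renewals_gap[OF that], where f = "%m w. \<Sum>n<m. claim k n w"]) measurable
  have jumps: "(%w. \<Sum>n<renewals (%n. sojourn n w) (enn2real (first_event w)). transition_jump n w) \<in> borel_measurable ?W"
    by (rule measurable_compose_countable[OF _ measurable_renewals_sojourn[OF e], where f = "%m w. \<Sum>n<m. transition_jump n w"])
      (intro borel_measurable_sum measurable_transition_jump)
  have "(%w. \<Sum>n<renewals (%n. gap (state 0 w) n w) (enn2real (first_event w)). claim (state 0 w) n w) \<in> borel_measurable ?W"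
    "(%w. \<Sum>n<renewals (%n. gap (state 0 w) n w) 0. claim (state 0 w) n w) \<in> borel_measurable ?W"
    by (rule measurable_at_state[where f = "%k w. \<Sum>n<renewals (%n. gap k n w) (_ w). claim k n w"], rule claims[OF e])
      (rule measurable_at_state[where f = "%k w. \<Sum>n<renewals (%n. gap k n w) 0. claim k n w"], rule claims[of "%_. 0"], simp)
  then show ?thesis
    unfolding first_mark_def[abs_def] by (intro borel_measurable_add borel_measurable_diff jumps)
qed

lemma measurable_shift [measurable]:
  "(%(u, w). shift u w) \<in> measurable (borel \<Otimes>\<^sub>M world_space) (world_space :: ('d::finite world) measure)"
proof -
  let ?D = "borel \<Otimes>\<^sub>M (world_space :: 'd world measure)"
  have u: "fst \<in> measurable ?D borel" and w: "snd \<in> measurable ?D world_space" by measurable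
  have chain: "(%p. fst (snd p)) \<in> measurable ?D chain_space"
    and comp: "(%p. fst (snd (snd p))) \<in> measurable ?D component_space"
    and tr: "(%p. fst (snd (snd (snd p)))) \<in> measurable ?D transit_space"
    by measurable
  have sw: "(%p n. prod.swap (fst (snd p) n)) \<in> measurable ?D (PiM UNIV (%_::nat. borel \<Otimes>\<^sub>M count_space UNIV))"
    by (rule measurable_compose[OF chain measurable_swap_chain])
  have r1: "(%p. restart (fst p) (%n. prod.swap (fst (snd p) n))) \<in> measurable ?D (PiM UNIV (%_::nat. borel \<Otimes>\<^sub>M count_space UNIV))"
    using measurable_compose[OF measurable_Pair[OF u sw] measurable_restart] by simp
  have c1: "(%p n. prod.swap (restart (fst p) (%n. prod.swap (fst (snd p) n)) n)) \<in> measurable ?D chain_space"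
    by (rule measurable_compose[OF r1 measurable_swap_chain])
  have c2: "(%p k. restart (fst p) (fst (snd (snd p)) k)) \<in> measurable ?D component_space"
    using measurable_compose[OF measurable_Pair[OF u comp] measurable_restart_all] by simp
  have ren: "(%p. renewals (%n. sojourn n (snd p)) (fst p)) \<in> measurable ?D (count_space UNIV)"
    using measurable_compose[OF measurable_Pair[OF u sw] measurable_renewals] by (simp add: sojourn_def)
  have c3: "(%p n. fst (snd (snd (snd p))) (renewals (%n. sojourn n (snd p)) (fst p) + n)) \<in> measurable ?D transit_space"
  proof (rule measurable_PiM_UNIV)
    fix n
    show "(%p. fst (snd (snd (snd p))) (renewals (%n. sojourn n (snd p)) (fst p) + n)) \<in> measurable ?D (PiM UNIV (%_. borel))"
      by (rule measurable_compose_countable[OF _ ren, where f = "%m p. fst (snd (snd (snd p))) (m + n)"],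
        rule measurable_compose[OF tr measurable_component_singleton]) simp
  qed
  have c4: "(%p. clock (snd p) - fst p) \<in> borel_measurable ?D" by measurable
  have "(%p. shift (fst p) (snd p)) \<in> measurable ?D world_space"
    unfolding shift_def by (intro measurable_Pair c1 c2 c3 c4)
  then show ?thesis by (simp add: case_prod_beta')
qed

section \<open>The law of a world at its first event\<close>

context world_law
begin

lemma nn_integral_rest:
  assumes F: "F \<in> borel_measurable rest_space"
  shows "(\<integral>\<^sup>+v. F v \<partial>rest) = (\<integral>\<^sup>+g. \<integral>\<^sup>+c. \<integral>\<^sup>+t. F (g, c, t) \<partial>killing beta \<partial>transits \<partial>claims)"
proof -
  interpret TK: prob_space "transits \<Otimes>\<^sub>M killing beta"
    by (intro prob_space_pair transits.prob_space_axioms killing.prob_space_axioms)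
  have F': "F \<in> borel_measurable (claims \<Otimes>\<^sub>M (transits \<Otimes>\<^sub>M killing beta))"
    using F unfolding measurable_cong_sets[OF sets_rest[unfolded rest_def] refl] .
  have "(%q. F (g, q)) \<in> borel_measurable (transits \<Otimes>\<^sub>M killing beta)" if "g \<in> space claims" for g
    by (rule measurable_compose[OF measurable_Pair1'[OF that] F'])
  then show ?thesis
    unfolding rest_def
    by (subst TK.nn_integral_fst[OF F', symmetric]) (intro nn_integral_cong killing.nn_integral_fst[symmetric])
qed

lemma nn_integral_world:
  assumes F: "F \<in> borel_measurable world_space"
  shows "(\<integral>\<^sup>+w. F w \<partial>world i) = (\<integral>\<^sup>+\<xi>. \<integral>\<^sup>+v. F (\<xi>, v) \<partial>rest \<partial>N i)"
proof -
  have F': "F \<in> borel_measurable (N i \<Otimes>\<^sub>M rest)"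
    using F unfolding measurable_cong_sets[OF sets_world[unfolded world_def] refl] .
  show ?thesis unfolding world_def by (rule rest.nn_integral_fst[OF F', symmetric])
qed

lemma borel_claims: "f \<in> borel_measurable component_space ==> f \<in> borel_measurable claims"
  unfolding measurable_cong_sets[OF sets_claims refl] .

lemma measurable_inner:
  assumes H: "H \<in> borel_measurable (D \<Otimes>\<^sub>M rest_space)"
  shows "(%(p, c). \<integral>\<^sup>+t. H (fst p, snd p, c, t) \<partial>killing beta) \<in> borel_measurable ((D \<Otimes>\<^sub>M component_space) \<Otimes>\<^sub>M transit_space)"
    "(%p. \<integral>\<^sup>+c. \<integral>\<^sup>+t. H (fst p, snd p, c, t) \<partial>killing beta \<partial>transits) \<in> borel_measurable (D \<Otimes>\<^sub>M component_space)"
proof -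
  have "(%q. H (fst (fst (fst q)), snd (fst (fst q)), snd (fst q), snd q)) \<in> borel_measurable (((D \<Otimes>\<^sub>M component_space) \<Otimes>\<^sub>M transit_space) \<Otimes>\<^sub>M killing beta)"
    by (rule measurable_compose[OF _ H]) measurable
  from killing.borel_measurable_nn_integral_fst[OF this]
  show 1: "(%(p, c). \<integral>\<^sup>+t. H (fst p, snd p, c, t) \<partial>killing beta) \<in> borel_measurable ((D \<Otimes>\<^sub>M component_space) \<Otimes>\<^sub>M transit_space)"
    by (simp add: case_prod_beta')
  then have "(%(p, c). \<integral>\<^sup>+t. H (fst p, snd p, c, t) \<partial>killing beta) \<in> borel_measurable ((D \<Otimes>\<^sub>M component_space) \<Otimes>\<^sub>M transits)"
    unfolding measurable_cong_sets[OF sets_pair_measure_cong[OF refl sets_transits] refl] .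
  from transits.borel_measurable_nn_integral_fst[OF this]
  show "(%p. \<integral>\<^sup>+c. \<integral>\<^sup>+t. H (fst p, snd p, c, t) \<partial>killing beta \<partial>transits) \<in> borel_measurable (D \<Otimes>\<^sub>M component_space)"
    by simp
qed

lemma rest_transition_measurable:
  fixes i k :: 'd and H :: "real \<times> ('d => nat => ennreal \<times> real) \<times> (nat => 'd \<times> 'd => real) \<times> real => ennreal"
  assumes H: "H \<in> borel_measurable (borel \<Otimes>\<^sub>M rest_space)"
  shows "(%v. indicator {ennreal u<..} (fst (fst v i 0)) * (indicator {u..} (snd (snd v)) *
      H (fst (snd v) 0 (i, k), (%k. restart u (fst v k)), (%n. fst (snd v) (Suc n)), snd (snd v) - u))) \<in> borel_measurable rest_space"
proof -
  have tail: "(%c n. c (Suc n)) \<in> measurable transit_space (transit_space :: (nat => 'd \<times> 'd => real) measure)"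
    by (rule measurable_PiM_UNIV) simp
    have [measurable]: "(%v. fst (snd v) 0 (i, k)) \<in> borel_measurable (rest_space :: (('d => nat => ennreal \<times> real) \<times> (nat => 'd \<times> 'd => real) \<times> real) measure)"
      by (rule measurable_compose[OF measurable_compose[OF measurable_snd measurable_fst] measurable_coordinate])
    have [measurable]: "(%v. %k. restart u (fst v k)) \<in> measurable (rest_space :: (('d => nat => ennreal \<times> real) \<times> (nat => 'd \<times> 'd => real) \<times> real) measure) (component_space :: ('d => _) measure)"
      by (rule measurable_compose[OF measurable_fst measurable_restart_all_fixed])
    have [measurable]: "(%v n. fst (snd v) (Suc n)) \<in> measurable (rest_space :: (('d => nat => ennreal \<times> real) \<times> (nat => 'd \<times> 'd => real) \<times> real) measure) (transit_space :: (nat => 'd \<times> 'd => real) measure)"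
    proof -
      have "(%v. fst (snd v)) \<in> measurable (rest_space :: (('d => nat => ennreal \<times> real) \<times> (nat => 'd \<times> 'd => real) \<times> real) measure) (transit_space :: (nat => 'd \<times> 'd => real) measure)" by measurable
      from measurable_compose[OF this tail] show ?thesis .
    qed
    have [measurable]: "(%v. H (fst (snd v) 0 (i, k), (%k. restart u (fst v k)), (%n. fst (snd v) (Suc n)), snd (snd v) - u)) \<in> borel_measurable (rest_space :: (('d => nat => ennreal \<times> real) \<times> (nat => 'd \<times> 'd => real) \<times> real) measure)"
      by (rule measurable_compose[OF _ H]) measurable
    have [measurable]: "(%v. fst v i 0) \<in> measurable (rest_space :: (('d => nat => ennreal \<times> real) \<times> (nat => 'd \<times> 'd => real) \<times> real) measure) (borel \<Otimes>\<^sub>M borel)"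
      by (rule measurable_compose[OF measurable_fst measurable_coordinate])
    show ?thesis by measurable
qed

text \<open>The chain moves from \<open>i\<close> to \<open>k\<close> at time \<open>u\<close>. That
  neither a claim of stream \<open>i\<close> nor the clock comes before \<open>u\<close> has
  probability \<open>exp (- (lam i + beta) * u)\<close>; given this, what is left of the ingredients
  is again distributed as \<open>rest\<close>, independently of the jump.\<close>

lemma rest_transition:
  assumes H: "H \<in> borel_measurable (borel \<Otimes>\<^sub>M rest_space)" and "i \<noteq> k" and u: "0 \<le> u"
  shows "(\<integral>\<^sup>+v. indicator {ennreal u<..} (fst (fst v i 0)) * (indicator {u..} (snd (snd v)) *
      H (fst (snd v) 0 (i, k), (%k. restart u (fst v k)), (%n. fst (snd v) (Suc n)), snd (snd v) - u)) \<partial>rest)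
    = ennreal (exp (- (lam i + beta) * u)) * (\<integral>\<^sup>+m. \<integral>\<^sup>+v. H (m, v) \<partial>rest \<partial>C i k)"
proof -
  interpret C: prob_space "C i k" by (rule prob_C[OF \<open>i \<noteq> k\<close>])
  interpret P: pair_prob_space claims "C i k" ..
  define \<Psi> where "\<Psi> p = (\<integral>\<^sup>+c. \<integral>\<^sup>+t. H (fst p, snd p, c, t) \<partial>killing beta \<partial>transits)" for p
  have \<Psi>: "\<Psi> \<in> borel_measurable (borel \<Otimes>\<^sub>M component_space)"
    unfolding \<Psi>_def by (rule measurable_inner(2)[OF H])
  have \<Psi>': "(%(g, m). \<Psi> (m, g)) \<in> borel_measurable (claims \<Otimes>\<^sub>M C i k)"
    unfolding measurable_cong_sets[OF sets_pair_measure_cong[OF sets_claims sets_C[OF \<open>i \<noteq> k\<close>]] refl]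
    using measurable_compose[OF measurable_pair_swap' \<Psi>] by (simp add: case_prod_beta')
  define \<Phi> where "\<Phi> g = (\<integral>\<^sup>+m. \<Psi> (m, g) \<partial>C i k)" for g
  have \<Phi>: "\<Phi> \<in> borel_measurable component_space"
    using C.borel_measurable_nn_integral_fst[OF \<Psi>'] unfolding \<Phi>_def measurable_cong_sets[OF sets_claims refl] by simp
  have Ht: "(%t. H (m, g, c, t)) \<in> borel_measurable borel" for m g c
    by (rule measurable_compose[OF _ H]) (simp add: space_PiM space_pair_measure)
  have tail: "(%c n. c (Suc n)) \<in> measurable transit_space (transit_space :: (nat => 'd \<times> 'd => real) measure)"
    by (rule measurable_PiM_UNIV) simp
  note meas = rest_transition_measurable[OF H, of u i k]
  have "(\<integral>\<^sup>+v. indicator {ennreal u<..} (fst (fst v i 0)) * (indicator {u..} (snd (snd v)) *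
      H (fst (snd v) 0 (i, k), (%k. restart u (fst v k)), (%n. fst (snd v) (Suc n)), snd (snd v) - u)) \<partial>rest)
    = (\<integral>\<^sup>+g. indicator {ennreal u<..} (fst (g i 0)) * (ennreal (exp (- beta * u)) * \<Phi> (%k. restart u (g k))) \<partial>claims)"
    unfolding nn_integral_rest[OF meas]
  proof (rule nn_integral_cong)
    fix g :: "'d => nat => ennreal \<times> real"
    let ?g = "%k. restart u (g k)"
    have inner: "(\<integral>\<^sup>+t. indicator {ennreal u<..} (fst (g i 0)) * (indicator {u..} t * H (c 0 (i, k), ?g, %n. c (Suc n), t - u)) \<partial>killing beta)
      = indicator {ennreal u<..} (fst (g i 0)) * ennreal (exp (- beta * u)) * (\<integral>\<^sup>+t. H (c 0 (i, k), ?g, %n. c (Suc n), t) \<partial>killing beta)" for c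
      using killing_memoryless[OF Ht beta u] by (simp split: split_indicator)
    have F: "(%(m, c). \<integral>\<^sup>+t. H (m, ?g, c, t) \<partial>killing beta) \<in> borel_measurable (borel \<Otimes>\<^sub>M transit_space)"
      using measurable_compose[OF _ measurable_inner(1)[OF H], of "%(m, c). ((m, ?g), c)" "borel \<Otimes>\<^sub>M transit_space"]
      by (simp add: case_prod_beta' space_PiM space_pair_measure)
    have Fc: "(%c. \<integral>\<^sup>+t. H (c 0 (i, k), ?g, %n. c (Suc n), t) \<partial>killing beta) \<in> borel_measurable transits"
      unfolding measurable_cong_sets[OF sets_transits refl]
      using measurable_compose[OF measurable_Pair[OF measurable_coordinate tail] F, of 0 "(i, k)"] by simp
    show "(\<integral>\<^sup>+c. \<integral>\<^sup>+t. indicator {ennreal u<..} (fst (fst (g, c, t) i 0)) * (indicator {u..} (snd (snd (g, c, t))) *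
        H (fst (snd (g, c, t)) 0 (i, k), (%k. restart u (fst (g, c, t) k)), (%n. fst (snd (g, c, t)) (Suc n)), snd (snd (g, c, t)) - u)) \<partial>killing beta \<partial>transits)
      = indicator {ennreal u<..} (fst (g i 0)) * (ennreal (exp (- beta * u)) * \<Phi> ?g)"
      unfolding fst_conv snd_conv inner nn_integral_cmult[OF Fc]
      using transits_head[OF F \<open>i \<noteq> k\<close>] by (simp add: \<Phi>_def \<Psi>_def mult.assoc)
  qed
  also have "\<dots> = (\<integral>\<^sup>+g. ennreal (exp (- beta * u)) * (indicator {ennreal u<..} (fst (g i 0)) * \<Phi> (%k. restart u (g k))) \<partial>claims)"
    by (simp add: mult_ac)
  also have "\<dots> = ennreal (exp (- beta * u)) * (\<integral>\<^sup>+g. indicator {ennreal u<..} (fst (g i 0)) * \<Phi> (%k. restart u (g k)) \<partial>claims)"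
  proof (rule nn_integral_cmult, rule borel_claims)
    have "(%g. indicator {ennreal u<..} (fst (g i 0)) :: ennreal) \<in> borel_measurable component_space"
      by (rule measurable_compose[where f = "%g. g i 0" and g = "%p. indicator {ennreal u<..} (fst p)", OF measurable_coordinate]) measurable
    then show "(%g. indicator {ennreal u<..} (fst (g i 0)) * \<Phi> (%k. restart u (g k))) \<in> borel_measurable component_space"
      by (rule borel_measurable_times_ennreal) (rule measurable_compose[OF measurable_restart_all_fixed \<Phi>])
  qed
  also have "\<dots> = ennreal (exp (- beta * u)) * (ennreal (exp (- lam i * u)) * (\<integral>\<^sup>+g. \<Phi> g \<partial>claims))"
    unfolding components_before_claim[OF \<Phi> u] ..
  also have "(\<integral>\<^sup>+g. \<Phi> g \<partial>claims) = (\<integral>\<^sup>+m. \<integral>\<^sup>+g. \<Psi> (m, g) \<partial>claims \<partial>C i k)"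
    unfolding \<Phi>_def using P.Fubini'[OF \<Psi>'] by simp
  also have "\<dots> = (\<integral>\<^sup>+m. \<integral>\<^sup>+v. H (m, v) \<partial>rest \<partial>C i k)"
  proof (rule nn_integral_cong)
    fix m
    have "(%v. H (m, v)) \<in> borel_measurable rest_space"
      by (rule measurable_compose[OF _ H]) simp
    from nn_integral_rest[OF this] show "(\<integral>\<^sup>+g. \<Psi> (m, g) \<partial>claims) = (\<integral>\<^sup>+v. H (m, v) \<partial>rest)"
      by (simp add: \<Psi>_def)
  qed
  also have "ennreal (exp (- beta * u)) * (ennreal (exp (- lam i * u)) * a) = ennreal (exp (- (lam i + beta) * u)) * a" for a
  proof -
    have "exp (- (lam i + beta) * u) = exp (- beta * u) * exp (- lam i * u)"
      by (subst exp_add[symmetric]) (simp add: algebra_simps)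
    then show ?thesis by (simp only: ennreal_mult'[OF exp_ge_zero] mult.assoc)
  qed
  finally show ?thesis .
qed

end

context world_law
begin

lemma rest_claim_measurable:
  fixes i :: 'd and H :: "(real \<times> real) \<times> ('d => nat => ennreal \<times> real) \<times> (nat => 'd \<times> 'd => real) \<times> real => ennreal"
  assumes H: "H \<in> borel_measurable ((borel \<Otimes>\<^sub>M borel) \<Otimes>\<^sub>M rest_space)"
  shows "(%v. indicator {..<s} (fst (fst v i 0)) * (indicator {enn2real (fst (fst v i 0))..} (snd (snd v)) *
      H ((enn2real (fst (fst v i 0)), snd (fst v i 0)), (%k. restart (enn2real (fst (fst v i 0))) (fst v k)), fst (snd v), snd (snd v) - enn2real (fst (fst v i 0))))) \<in> borel_measurable rest_space"
proof -
  have coord: "(%v. fst v i 0) \<in> measurable (rest_space :: (('d => nat => ennreal \<times> real) \<times> (nat => 'd \<times> 'd => real) \<times> real) measure) (borel \<Otimes>\<^sub>M borel)"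
    by (rule measurable_compose[OF measurable_fst measurable_coordinate])
    note coord [measurable]
    have "(%v. (enn2real (fst (fst v i 0)), fst v)) \<in> measurable (rest_space :: (('d => nat => ennreal \<times> real) \<times> (nat => 'd \<times> 'd => real) \<times> real) measure) (borel \<Otimes>\<^sub>M component_space)" by measurable
    from measurable_compose[OF this measurable_restart_all]
    have [measurable]: "(%v k. restart (enn2real (fst (fst v i 0))) (fst v k)) \<in> measurable (rest_space :: (('d => nat => ennreal \<times> real) \<times> (nat => 'd \<times> 'd => real) \<times> real) measure) component_space" by simp
    have [measurable]: "(%v. H ((enn2real (fst (fst v i 0)), snd (fst v i 0)), (%k. restart (enn2real (fst (fst v i 0))) (fst v k)), fst (snd v), snd (snd v) - enn2real (fst (fst v i 0)))) \<in> borel_measurable (rest_space :: (('d => nat => ennreal \<times> real) \<times> (nat => 'd \<times> 'd => real) \<times> real) measure)"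
      by (rule measurable_compose[OF _ H]) measurable
    have "(%v :: ('d => nat => ennreal \<times> real) \<times> (nat => 'd \<times> 'd => real) \<times> real. indicator {enn2real (fst (fst v i 0))..} (snd (snd v)) :: ennreal) = (%v. if enn2real (fst (fst v i 0)) \<le> snd (snd v) then 1 else 0)"
      by (auto simp: indicator_def)
    then have [measurable]: "(%v. indicator {enn2real (fst (fst v i 0))..} (snd (snd v)) :: ennreal) \<in> borel_measurable (rest_space :: (('d => nat => ennreal \<times> real) \<times> (nat => 'd \<times> 'd => real) \<times> real) measure)"
      by simp
    show ?thesis by measurable
qed

text \<open>Here \<open>s\<close> plays the role of the end of the first sojourn. A first claim of
  stream \<open>i\<close> before \<open>s\<close> and before the clock has exponential density in
  time, a size with law \<open>B i\<close>, and what is left is again distributed as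
  \<open>rest\<close>.\<close>

lemma rest_claim:
  assumes H: "H \<in> borel_measurable ((borel \<Otimes>\<^sub>M borel) \<Otimes>\<^sub>M rest_space)"
  shows "(\<integral>\<^sup>+v. indicator {..<s} (fst (fst v i 0)) * (indicator {enn2real (fst (fst v i 0))..} (snd (snd v)) *
      H ((enn2real (fst (fst v i 0)), snd (fst v i 0)), (%k. restart (enn2real (fst (fst v i 0))) (fst v k)), fst (snd v), snd (snd v) - enn2real (fst (fst v i 0)))) \<partial>rest)
    = (\<integral>\<^sup>+u. ennreal (lam i * exp (- lam i * u)) * indicator {0<..} u * (indicator {..<s} (ennreal u) * (ennreal (exp (- beta * u)) *
        (\<integral>\<^sup>+m. \<integral>\<^sup>+v. H ((u, m), v) \<partial>rest \<partial>B i))) \<partial>lborel)"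
proof -
  define \<Psi> where "\<Psi> p = (\<integral>\<^sup>+c. \<integral>\<^sup>+t. H (fst p, snd p, c, t) \<partial>killing beta \<partial>transits)" for p
  have \<Psi>: "\<Psi> \<in> borel_measurable ((borel \<Otimes>\<^sub>M borel) \<Otimes>\<^sub>M component_space)"
    unfolding \<Psi>_def by (rule measurable_inner(2)[OF H])
  define f where "f q = indicator {..<s} (ennreal (fst q)) * (ennreal (exp (- beta * fst q)) * \<Psi> ((fst q, fst (snd q)), snd (snd q)))" for q
  have f: "f \<in> borel_measurable (borel \<Otimes>\<^sub>M (borel \<Otimes>\<^sub>M component_space))"
  proof -
    have [measurable]: "(%q. \<Psi> ((fst q, fst (snd q)), snd (snd q))) \<in> borel_measurable (borel \<Otimes>\<^sub>M (borel \<Otimes>\<^sub>M component_space))"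
      by (rule measurable_compose[OF _ \<Psi>]) measurable
    show ?thesis unfolding f_def by measurable
  qed
  have Ht: "(%t. H (p, g, c, t)) \<in> borel_measurable borel" for p g c
    by (rule measurable_compose[OF _ H]) (simp add: space_PiM space_pair_measure)
  note meas = rest_claim_measurable[OF H, of s i]
  have "(\<integral>\<^sup>+v. indicator {..<s} (fst (fst v i 0)) * (indicator {enn2real (fst (fst v i 0))..} (snd (snd v)) *
      H ((enn2real (fst (fst v i 0)), snd (fst v i 0)), (%k. restart (enn2real (fst (fst v i 0))) (fst v k)), fst (snd v), snd (snd v) - enn2real (fst (fst v i 0)))) \<partial>rest)
    = (\<integral>\<^sup>+g. indicator {..<\<infinity>} (fst (g i 0)) * f (enn2real (fst (g i 0)), snd (g i 0), %k. restart (enn2real (fst (g i 0))) (g k)) \<partial>claims)"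
    unfolding nn_integral_rest[OF meas]
  proof (rule nn_integral_cong)
    fix g :: "'d => nat => ennreal \<times> real"
    let ?u = "enn2real (fst (g i 0))"
    let ?g = "%k. restart ?u (g k)"
    let ?p = "(?u, snd (g i 0))"
    have inner: "(\<integral>\<^sup>+t. indicator {..<s} (fst (g i 0)) * (indicator {?u..} t * H (?p, ?g, c, t - ?u)) \<partial>killing beta)
      = indicator {..<s} (fst (g i 0)) * ennreal (exp (- beta * ?u)) * (\<integral>\<^sup>+t. H (?p, ?g, c, t) \<partial>killing beta)" for c
      using killing_memoryless[OF Ht beta, of ?u ?p ?g c] by (simp split: split_indicator)
    have F: "(%c. \<integral>\<^sup>+t. H (?p, ?g, c, t) \<partial>killing beta) \<in> borel_measurable transits"
      unfolding measurable_cong_sets[OF sets_transits refl]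
      using measurable_compose[OF _ measurable_inner(1)[OF H], of "%c. ((?p, ?g), c)" transit_space]
      by (simp add: space_PiM space_pair_measure)
    \<comment> \<open>The bound \<open>s\<close> is tested on the real value of the gap; finiteness
      is recorded separately because \<open>enn2real\<close> sends an infinite gap to 0.\<close>
    have "indicator {..<s} (fst (g i 0)) = (indicator {..<\<infinity>} (fst (g i 0)) * indicator {..<s} (ennreal ?u) :: ennreal)"
      by (cases "fst (g i 0)") (auto simp: indicator_def)
    then show "(\<integral>\<^sup>+c. \<integral>\<^sup>+t. indicator {..<s} (fst (fst (g, c, t) i 0)) * (indicator {enn2real (fst (fst (g, c, t) i 0))..} (snd (snd (g, c, t))) *
        H ((enn2real (fst (fst (g, c, t) i 0)), snd (fst (g, c, t) i 0)), (%k. restart (enn2real (fst (fst (g, c, t) i 0))) (fst (g, c, t) k)), fst (snd (g, c, t)), snd (snd (g, c, t)) - enn2real (fst (fst (g, c, t) i 0)))) \<partial>killing beta \<partial>transits)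
      = indicator {..<\<infinity>} (fst (g i 0)) * f (?u, snd (g i 0), ?g)"
      unfolding fst_conv snd_conv inner nn_integral_cmult[OF F] by (simp add: f_def \<Psi>_def mult_ac)
  qed
  also have "\<dots> = (\<integral>\<^sup>+u. ennreal (lam i * exp (- lam i * u)) * indicator {0<..} u * (\<integral>\<^sup>+m. \<integral>\<^sup>+g. f (u, m, g) \<partial>claims \<partial>B i) \<partial>lborel)"
    by (rule components_first_claim[OF f])
  also have "\<dots> = (\<integral>\<^sup>+u. ennreal (lam i * exp (- lam i * u)) * indicator {0<..} u * (indicator {..<s} (ennreal u) * (ennreal (exp (- beta * u)) *
        (\<integral>\<^sup>+m. \<integral>\<^sup>+v. H ((u, m), v) \<partial>rest \<partial>B i))) \<partial>lborel)"
  proof (rule nn_integral_cong)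
    fix u :: real
    have 1: "(\<integral>\<^sup>+g. \<Psi> ((u, m), g) \<partial>claims) = (\<integral>\<^sup>+v. H ((u, m), v) \<partial>rest)" for m
    proof -
      have "(%v. H ((u, m), v)) \<in> borel_measurable rest_space" by (rule measurable_compose[OF _ H]) simp
      from nn_integral_rest[OF this] show ?thesis by (simp add: \<Psi>_def)
    qed
    have 2: "(%g. \<Psi> ((u, m), g)) \<in> borel_measurable claims" for m
      by (rule borel_claims) (rule measurable_compose[OF _ \<Psi>], simp)
    have 3: "(%m. \<integral>\<^sup>+v. H ((u, m), v) \<partial>rest) \<in> borel_measurable (B i)"
    proof -
      have "(%q. H ((u, fst q), snd q)) \<in> borel_measurable (borel \<Otimes>\<^sub>M rest_space)"
        by (rule measurable_compose[OF _ H]) measurable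
      then have "(%q. H ((u, fst q), snd q)) \<in> borel_measurable (B i \<Otimes>\<^sub>M rest)"
        unfolding measurable_cong_sets[OF sets_pair_measure_cong[OF renewal.sets_B sets_rest] refl] .
      from rest.borel_measurable_nn_integral_fst[OF this] show ?thesis by simp
    qed
    show "ennreal (lam i * exp (- lam i * u)) * indicator {0<..} u * (\<integral>\<^sup>+m. \<integral>\<^sup>+g. f (u, m, g) \<partial>claims \<partial>B i)
      = ennreal (lam i * exp (- lam i * u)) * indicator {0<..} u * (indicator {..<s} (ennreal u) * (ennreal (exp (- beta * u)) *
        (\<integral>\<^sup>+m. \<integral>\<^sup>+v. H ((u, m), v) \<partial>rest \<partial>B i)))"
    proof -
      define c where "c = indicator {..<s} (ennreal u) * ennreal (exp (- beta * u))"
      have "(\<integral>\<^sup>+m. \<integral>\<^sup>+g. f (u, m, g) \<partial>claims \<partial>B i) = (\<integral>\<^sup>+m. \<integral>\<^sup>+g. c * \<Psi> ((u, m), g) \<partial>claims \<partial>B i)"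
        by (simp add: f_def c_def mult.assoc)
      also have "\<dots> = (\<integral>\<^sup>+m. c * (\<integral>\<^sup>+v. H ((u, m), v) \<partial>rest) \<partial>B i)"
        unfolding nn_integral_cmult[OF 2] 1 ..
      also have "\<dots> = c * (\<integral>\<^sup>+m. \<integral>\<^sup>+v. H ((u, m), v) \<partial>rest \<partial>B i)"
        by (rule nn_integral_cmult[OF 3])
      finally show ?thesis by (simp add: c_def mult.assoc)
    qed
  qed
  finally show ?thesis .
qed

text \<open>The first claim time has a density apart from a possible atom at infinity, so it avoids
  any given finite time. Ties with the end of the sojourn are thereby negligible.\<close>

lemma AE_rest_no_atom:
  assumes a: "0 \<le> a"
  shows "AE v in rest. fst (fst v i 0) \<noteq> ennreal a"
proof -
  have "(%v. fst v i 0) \<in> measurable (rest_space :: (('d => nat => ennreal \<times> real) \<times> (nat => 'd \<times> 'd => real) \<times> real) measure) (borel \<Otimes>\<^sub>M borel)"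
    by (rule measurable_compose[OF measurable_fst measurable_coordinate])
  then have [measurable]: "(%v. fst v i 0) \<in> measurable rest (borel \<Otimes>\<^sub>M borel)"
    unfolding measurable_cong_sets[OF sets_rest refl] .
  define H :: "(real \<times> real) \<times> ('d => nat => ennreal \<times> real) \<times> (nat => 'd \<times> 'd => real) \<times> real => ennreal"
    where "H q = 1" for q
  let ?A = "{v \<in> space rest. fst (fst v i 0) = ennreal a}"
  have sets: "?A \<in> sets rest" by measurable
  have eq: "(\<integral>\<^sup>+g. indicator {..<\<infinity>} (fst (g i 0)) * indicator {a} (enn2real (fst (g i 0))) \<partial>claims)
      = (\<integral>\<^sup>+u. ennreal (lam i * exp (- lam i * u)) * indicator {0<..} u * (\<integral>\<^sup>+m. \<integral>\<^sup>+g. indicator {a} u \<partial>claims \<partial>B i) \<partial>lborel)"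
    using components_first_claim[of "%q. indicator {a} (fst q)" i] by simp
  have "AE u in lborel. ennreal (lam i * exp (- lam i * u)) * indicator {0<..} u * (\<integral>\<^sup>+m. \<integral>\<^sup>+g. indicator {a} u \<partial>claims \<partial>B i) = 0"
    using AE_lborel_singleton[of a] by eventually_elim simp
  then have "(\<integral>\<^sup>+u. ennreal (lam i * exp (- lam i * u)) * indicator {0<..} u * (\<integral>\<^sup>+m. \<integral>\<^sup>+g. indicator {a} u \<partial>claims \<partial>B i) \<partial>lborel) = (\<integral>\<^sup>+u. 0 \<partial>(lborel :: real measure))"
    by (rule nn_integral_cong_AE)
  with eq have zero: "(\<integral>\<^sup>+g. indicator {..<\<infinity>} (fst (g i 0)) * indicator {a} (enn2real (fst (g i 0))) \<partial>claims) = 0"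
    by simp
  have [measurable]: "(%g. g i 0) \<in> measurable component_space (borel \<Otimes>\<^sub>M borel)" by (rule measurable_coordinate)
  have m: "(%v. indicator {ennreal a} (fst (fst v i 0)) :: ennreal) \<in> borel_measurable rest_space"
    by (rule measurable_compose[OF measurable_compose[OF measurable_fst measurable_coordinate]]) measurable
  have "emeasure rest ?A = (\<integral>\<^sup>+v. indicator {ennreal a} (fst (fst v i 0)) \<partial>rest)"
    by (subst nn_integral_indicator[OF sets, symmetric]) (auto intro!: nn_integral_cong split: split_indicator)
  also have "\<dots> = (\<integral>\<^sup>+g. indicator {ennreal a} (fst (g i 0)) \<partial>claims)"
    unfolding nn_integral_rest[OF m] by (simp add: transits.emeasure_space_1 killing.emeasure_space_1)
  also have "\<dots> \<le> (\<integral>\<^sup>+g. indicator {..<\<infinity>} (fst (g i 0)) * indicator {a} (enn2real (fst (g i 0))) \<partial>claims)"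
    using a by (intro nn_integral_mono) (auto split: split_indicator)
  finally have "emeasure rest ?A = 0" using zero by simp
  then show ?thesis using sets by (subst AE_iff_null) (auto simp: null_setsI)
qed

text \<open>Applied to the second gap, this excludes two claims of a stream at the time of the first
  one, so that the mark of a first claim is a single claim size.\<close>

lemma AE_rest_gap: "AE v in rest. fst (fst v i n) \<noteq> 0"
proof -
  interpret TK: prob_space "transits \<Otimes>\<^sub>M killing beta"
    by (intro prob_space_pair transits.prob_space_axioms killing.prob_space_axioms)
  interpret P: pair_prob_space claims "transits \<Otimes>\<^sub>M killing beta" ..
  have WB: "pair_sigma_finite (waiting (lam i)) (B i)"
    by (intro pair_sigma_finite.intro prob_space_imp_sigma_finite prob_space_waiting renewal.lam renewal.prob_B)
  have "emeasure (waiting (lam i)) {ennreal 0<..} = 1"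
    using emeasure_waiting_greaterThan[OF renewal.lam, of 0] by simp
  then have "measure (waiting (lam i)) {0<..} = 1" by (simp add: measure_def)
  then have "AE x in waiting (lam i). x \<in> {0<..}"
    by (rule prob_space.AE_prob_1[OF prob_space_waiting[OF renewal.lam]])
  then have "AE p in waiting (lam i) \<Otimes>\<^sub>M B i. fst p \<noteq> 0"
  proof (intro pair_sigma_finite.AE_pair_measure[OF WB])
    have "fst \<in> measurable (waiting (lam i) \<Otimes>\<^sub>M B i) (borel :: ennreal measure)" by measurable
    from measurable_sets[OF this, of "- {0}"]
    show "{p \<in> space (waiting (lam i) \<Otimes>\<^sub>M B i). fst p \<noteq> 0} \<in> sets (waiting (lam i) \<Otimes>\<^sub>M B i)"
      by (simp add: vimage_def Int_def conj_commute)
  qed (simp add: zero_less_iff_neq_zero)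
  then have "AE y in PiM UNIV (%_::nat. waiting (lam i) \<Otimes>\<^sub>M B i). fst (y n) \<noteq> 0"
    by (intro AE_PiM_component[where P = "%p. fst p \<noteq> 0"] prob_space_pair prob_space_waiting renewal.lam renewal.prob_B) auto
  then have "AE g in claims. fst (g i n) \<noteq> 0"
    unfolding claims_def by (intro AE_PiM_component[where P = "%y. fst (y n) \<noteq> 0"] renewal.SL.prob_space_axioms) auto
  then have ae: "AE g in claims. AE q in transits \<Otimes>\<^sub>M killing beta. fst (fst (g, q) i n) \<noteq> 0"
    by eventually_elim simp
  have m: "(%v. fst (fst v i n)) \<in> borel_measurable (claims \<Otimes>\<^sub>M (transits \<Otimes>\<^sub>M killing beta))"
    by (rule measurable_compose[OF measurable_fst borel_claims]) (rule measurable_compose[OF measurable_coordinate measurable_fst])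
  have "{v \<in> space (claims \<Otimes>\<^sub>M (transits \<Otimes>\<^sub>M killing beta)). fst (fst v i n) \<noteq> 0} \<in> sets (claims \<Otimes>\<^sub>M (transits \<Otimes>\<^sub>M killing beta))"
    using measurable_sets[OF m, of "- {0}"] by (simp add: vimage_def Int_def conj_commute)
  from P.AE_pair_measure[OF this ae] show ?thesis unfolding rest_def .
qed

text \<open>\<open>nn_integral_first_transition\<close> applied to the indicator of
  \<open>i\<close>: its sum runs over the states other than \<open>i\<close>, from which the chain
  almost surely does not start in \<open>i\<close>.\<close>

lemma AE_no_self_jump: "AE \<xi> in N i. snd (\<xi> 0) \<noteq> \<infinity> \<longrightarrow> fst (\<xi> 1) \<noteq> i"
proof -
  let ?f = "%(u::real) (\<xi> :: nat => 'd \<times> ennreal). indicator {i} (fst (\<xi> 0)) :: ennreal"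
  have "(\<integral>\<^sup>+\<xi>. indicator {..<\<infinity>} (snd (\<xi> 0)) * indicator {i} (fst (\<xi> (Suc 0))) \<partial>N i)
      = (\<Sum>k\<in>UNIV - {i}. \<integral>\<^sup>+u. ennreal (Q $ i $ k * exp (Q $ i $ i * u)) * indicator {0<..} u * (\<integral>\<^sup>+\<xi>. ?f u \<xi> \<partial>N k) \<partial>lborel)"
    by (rule nn_integral_first_transition[of ?f i]) simp
  also have "\<dots> = 0"
  proof (rule sum.neutral, intro ballI)
    fix k assume "k \<in> UNIV - {i}"
    then have "k \<noteq> i" by simp
    have "AE \<xi> in N k. indicator {i} (fst (\<xi> 0)) = (0 :: ennreal)"
      using AE_start[of k] by eventually_elim (use \<open>k \<noteq> i\<close> in simp)
    then have "(\<integral>\<^sup>+\<xi>. ?f u \<xi> \<partial>N k) = (\<integral>\<^sup>+\<xi>. 0 \<partial>N k)" for u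
      by (rule nn_integral_cong_AE)
    then show "(\<integral>\<^sup>+u. ennreal (Q $ i $ k * exp (Q $ i $ i * u)) * indicator {0<..} u * (\<integral>\<^sup>+\<xi>. ?f u \<xi> \<partial>N k) \<partial>lborel) = 0"
      by simp
  qed
  finally have "AE \<xi> in N i. indicator {..<\<infinity>} (snd (\<xi> 0)) * indicator {i} (fst (\<xi> (Suc 0))) = (0 :: ennreal)"
    by (subst (asm) nn_integral_0_iff_AE) simp_all
  then show ?thesis by eventually_elim (auto simp: indicator_def less_top split: if_splits)
qed

lemma measurable_mark_integral:
  assumes H: "H \<in> borel_measurable ((borel \<Otimes>\<^sub>M borel) \<Otimes>\<^sub>M world_space)"
    and D: "prob_space D" "sets D = sets borel"
  shows "(%(u, \<xi>). \<integral>\<^sup>+m. \<integral>\<^sup>+v. H ((u, m), \<xi>, v) \<partial>rest \<partial>D) \<in> borel_measurable (borel \<Otimes>\<^sub>M chain_space)"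
proof -
  interpret D: prob_space D by (rule D)
  have "(%q. H ((fst (fst (fst q)), snd (fst q)), snd (fst (fst q)), snd q)) \<in> borel_measurable (((borel \<Otimes>\<^sub>M chain_space) \<Otimes>\<^sub>M D) \<Otimes>\<^sub>M rest)"
    unfolding measurable_cong_sets[OF sets_pair_measure_cong[OF sets_pair_measure_cong[OF refl D(2)] sets_rest] refl]
    by (rule measurable_compose[OF _ H]) measurable
  from D.borel_measurable_nn_integral_fst[OF rest.borel_measurable_nn_integral_fst[OF this]]
  show ?thesis by (simp add: case_prod_beta')
qed

lemma swap_mark:
  assumes H: "H \<in> borel_measurable ((borel \<Otimes>\<^sub>M borel) \<Otimes>\<^sub>M world_space)"
    and D: "prob_space D" "sets D = sets borel"
  shows "(\<integral>\<^sup>+\<xi>. \<integral>\<^sup>+m. \<integral>\<^sup>+v. H ((u, m), \<xi>, v) \<partial>rest \<partial>D \<partial>N k) = (\<integral>\<^sup>+m. \<integral>\<^sup>+w. H ((u, m), w) \<partial>world k \<partial>D)"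
proof -
  interpret D: prob_space D by (rule D)
  interpret P: pair_sigma_finite D "N k" ..
  have "(%q. H ((u, fst (fst q)), snd (fst q), snd q)) \<in> borel_measurable ((D \<Otimes>\<^sub>M N k) \<Otimes>\<^sub>M rest)"
    unfolding measurable_cong_sets[OF sets_pair_measure_cong[OF sets_pair_measure_cong[OF D(2) sets_N] sets_rest] refl]
    by (rule measurable_compose[OF _ H]) measurable
  from rest.borel_measurable_nn_integral_fst[OF this]
  have "(%(m, \<xi>). \<integral>\<^sup>+v. H ((u, m), \<xi>, v) \<partial>rest) \<in> borel_measurable (D \<Otimes>\<^sub>M N k)"
    by (simp add: case_prod_beta')
  from P.Fubini'[OF this]
  have "(\<integral>\<^sup>+\<xi>. \<integral>\<^sup>+m. \<integral>\<^sup>+v. H ((u, m), \<xi>, v) \<partial>rest \<partial>D \<partial>N k) = (\<integral>\<^sup>+m. \<integral>\<^sup>+\<xi>. \<integral>\<^sup>+v. H ((u, m), \<xi>, v) \<partial>rest \<partial>N k \<partial>D)"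
    by simp
  also have "\<dots> = (\<integral>\<^sup>+m. \<integral>\<^sup>+w. H ((u, m), w) \<partial>world k \<partial>D)"
  proof (rule nn_integral_cong)
    fix m
    have "(%w. H ((u, m), w)) \<in> borel_measurable world_space" by (rule measurable_compose[OF _ H]) simp
    from nn_integral_world[OF this, of k]
    show "(\<integral>\<^sup>+\<xi>. \<integral>\<^sup>+v. H ((u, m), \<xi>, v) \<partial>rest \<partial>N k) = (\<integral>\<^sup>+w. H ((u, m), w) \<partial>world k)" by simp
  qed
  finally show ?thesis .
qed

text \<open>Positivity of the second sojourn ensures that exactly one transition is counted at
  \<open>u\<close>.\<close>

lemma shift_at_transition:
  assumes "snd (\<xi> 0) = ennreal u" "0 \<le> u" "0 < snd (\<xi> 1)"
  shows "shift u (\<xi>, g, c, t) = (%n. \<xi> (Suc n), %k. restart u (g k), %n. c (Suc n), t - u)"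
proof -
  have ren: "renewals (%n. snd (\<xi> n)) u = Suc 0" using renewals_first[of "%n. snd (\<xi> n)" u] assms by simp
  have "residual (%n. snd (\<xi> n)) u n = snd (\<xi> (Suc n))" for n
    using assms by (simp add: residual_def ren arrival_def)
  then show ?thesis
    by (simp add: shift_def restart_def sojourn_def clock_def ren prod.swap_def)
qed

lemma shift_before_transition:
  assumes "ennreal u < snd (\<xi> 0)"
  shows "shift u (\<xi>, g, c, t) = (hold u \<xi>, %k. restart u (g k), c, t - u)"
proof -
  have ren: "renewals (%n. snd (\<xi> n)) u = 0" using assms by (intro renewals_before) simp
  have "prod.swap (restart u (%n. prod.swap (\<xi> n)) n) = hold u \<xi> n" for n
    by (cases n) (simp_all add: restart_def residual_def ren arrival_def hold_def prod.swap_def)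
  then show ?thesis
    by (simp add: shift_def sojourn_def clock_def ren)
qed

text \<open>Competing exponential clocks. The common exponent says that claims, transitions and the
  killing clock have all waited until \<open>u\<close>; then a claim occurs with intensity
  \<open>lam i\<close> and leaves a world from \<open>i\<close>, or a transition to \<open>k\<close>
  with intensity \<open>Q $ i $ k\<close> and leaves a world from \<open>k\<close>. The new world is
  independent of time and jump size, and therefore appears as an inner integral.\<close>

lemma nn_integral_first_event:
  assumes H: "H \<in> borel_measurable ((borel \<Otimes>\<^sub>M borel) \<Otimes>\<^sub>M world_space)"
  shows "(\<integral>\<^sup>+w. indicator {..ennreal (clock w)} (first_event w) *
      H ((enn2real (first_event w), first_mark w), shift (enn2real (first_event w)) w) \<partial>world i)
    = (\<integral>\<^sup>+u. ennreal (lam i * exp (- (beta - Q $ i $ i + lam i) * u)) * indicator {0<..} u * (\<integral>\<^sup>+m. \<integral>\<^sup>+w. H ((u, m), w) \<partial>world i \<partial>B i) \<partial>lborel)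
    + (\<Sum>k\<in>UNIV - {i}. \<integral>\<^sup>+u. ennreal (Q $ i $ k * exp (- (beta - Q $ i $ i + lam i) * u)) * indicator {0<..} u * (\<integral>\<^sup>+m. \<integral>\<^sup>+w. H ((u, m), w) \<partial>world k \<partial>C i k) \<partial>lborel)"
proof -
  define I where "I w = indicator {..ennreal (clock w)} (first_event w) *
      H ((enn2real (first_event w), first_mark w), shift (enn2real (first_event w)) w)" for w
  have I: "I \<in> borel_measurable world_space"
  proof -
    have "(%w. (enn2real (first_event w), w)) \<in> measurable world_space (borel \<Otimes>\<^sub>M (world_space :: 'd world measure))"
      by measurable
    from measurable_compose[OF this measurable_shift]
    have [measurable]: "(%w. shift (enn2real (first_event w)) w) \<in> measurable world_space (world_space :: 'd world measure)" by simp
    have [measurable]: "(%w. H ((enn2real (first_event w), first_mark w), shift (enn2real (first_event w)) w)) \<in> borel_measurable (world_space :: 'd world measure)"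
      by (rule measurable_compose[OF _ H]) measurable
    have "(%w :: 'd world. indicator {..ennreal (clock w)} (first_event w) :: ennreal) = (%w. if first_event w \<le> ennreal (clock w) then 1 else 0)"
      by (auto simp: indicator_def)
    moreover have "(%w :: 'd world. if first_event w \<le> ennreal (clock w) then 1 else 0 :: ennreal) \<in> borel_measurable world_space"
      by measurable
    ultimately have [measurable]: "(%w :: 'd world. indicator {..ennreal (clock w)} (first_event w) :: ennreal) \<in> borel_measurable world_space"
      by (simp only:)
    show ?thesis unfolding I_def by measurable
  qed
  define T where "T k u \<xi> = (\<integral>\<^sup>+m. \<integral>\<^sup>+v. H ((u, m), \<xi>, v) \<partial>rest \<partial>C i k)" for k u and \<xi> :: "nat => 'd \<times> ennreal"
  define R where "R u \<xi> = (\<integral>\<^sup>+m. \<integral>\<^sup>+v. H ((u, m), \<xi>, v) \<partial>rest \<partial>B i)" for u and \<xi> :: "nat => 'd \<times> ennreal"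
  have T: "case_prod (T k) \<in> borel_measurable (borel \<Otimes>\<^sub>M chain_space)" if "k \<noteq> i" for k
    unfolding T_def using measurable_mark_integral[OF H prob_C sets_C, of i k] that by simp
  have R: "case_prod R \<in> borel_measurable (borel \<Otimes>\<^sub>M chain_space)"
    unfolding R_def by (rule measurable_mark_integral[OF H renewal.prob_B renewal.sets_B])
  define f where "f u \<xi> = (\<Sum>k\<in>UNIV - {i}. indicator {k} (fst (\<xi> 0)) * (ennreal (exp (- (lam i + beta) * u)) * T k u \<xi>))"
    for u and \<xi> :: "nat => 'd \<times> ennreal"
  have f: "case_prod f \<in> borel_measurable (borel \<Otimes>\<^sub>M chain_space)"
  proof -
    have [measurable]: "(%p. T k (fst p) (snd p)) \<in> borel_measurable (borel \<Otimes>\<^sub>M chain_space)" if "k \<noteq> i" for k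
      using T[OF that] by (simp add: case_prod_beta')
    have "(%p. f (fst p) (snd p)) \<in> borel_measurable (borel \<Otimes>\<^sub>M chain_space)"
      unfolding f_def by (intro borel_measurable_sum) measurable
    then show ?thesis by (simp add: case_prod_beta')
  qed
  \<comment> \<open>Given the chain, \<open>A\<close> is the contribution of a transition coming
    first, and the integral of \<open>b\<close> over \<open>u\<close> that of a claim coming first,
    at time \<open>u\<close>.\<close>
  define A where "A \<xi> = indicator {..<\<infinity>} (snd (\<xi> 0)) * f (enn2real (snd (\<xi> 0))) (%n. \<xi> (Suc n))" for \<xi> :: "nat => 'd \<times> ennreal"
  define b where "b u \<xi> = ennreal (lam i * exp (- lam i * u)) * indicator {0<..} u * (indicator {ennreal u<..} (snd (\<xi> 0)) * (ennreal (exp (- beta * u)) * R u (hold u \<xi>)))"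
    for u and \<xi> :: "nat => 'd \<times> ennreal"
  have Rhold: "(%p. R (fst p) (hold (fst p) (snd p))) \<in> borel_measurable (borel \<Otimes>\<^sub>M chain_space)"
    using measurable_compose[OF measurable_Pair[OF measurable_fst measurable_hold] R] by (simp add: case_prod_beta')
  have b: "case_prod b \<in> borel_measurable (borel \<Otimes>\<^sub>M chain_space)"
  proof -
    note Rhold [measurable]
    have "(%p. indicator {ennreal (fst p)<..} (snd (snd p 0)) :: ennreal) = (%p. if ennreal (fst p) < snd (snd p (0::nat) :: 'd \<times> ennreal) then 1 else 0)"
      by (auto simp: indicator_def)
    then have [measurable]: "(%p. indicator {ennreal (fst p)<..} (snd (snd p 0)) :: ennreal) \<in> borel_measurable (borel \<Otimes>\<^sub>M (chain_space :: (nat => 'd \<times> ennreal) measure))"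
      by simp
    have "(%p. b (fst p) (snd p)) \<in> borel_measurable (borel \<Otimes>\<^sub>M chain_space)"
      unfolding b_def by measurable
    then show ?thesis by (simp add: case_prod_beta')
  qed
  have inner: "(\<integral>\<^sup>+v. I (\<xi>, v) \<partial>rest) = A \<xi> + (\<integral>\<^sup>+u. b u \<xi> \<partial>lborel)"
    if start: "fst (\<xi> 0) = i" and pos: "\<forall>n. 0 < snd (\<xi> n)" and reg: "renewal_sequence (%n. snd (\<xi> n))"
      and change: "snd (\<xi> 0) \<noteq> \<infinity> \<longrightarrow> fst (\<xi> 1) \<noteq> i" for \<xi>
  proof -
    let ?u = "enn2real (snd (\<xi> 0))" and ?k = "fst (\<xi> 1)"
    let ?\<gamma> = "%v :: ('d => nat => ennreal \<times> real) \<times> (nat => 'd \<times> 'd => real) \<times> real. fst (fst v i 0)"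
    define IA where "IA v = indicator {..<\<infinity>} (snd (\<xi> 0)) * (indicator {ennreal ?u<..} (?\<gamma> v) * (indicator {?u..} (snd (snd v)) *
      H ((?u, fst (snd v) 0 (i, ?k)), (%n. \<xi> (Suc n)), (%k. restart ?u (fst v k)), (%n. fst (snd v) (Suc n)), snd (snd v) - ?u)))"
      for v :: "('d => nat => ennreal \<times> real) \<times> (nat => 'd \<times> 'd => real) \<times> real"
    define IB where "IB v = indicator {..<snd (\<xi> 0)} (?\<gamma> v) * (indicator {enn2real (?\<gamma> v)..} (snd (snd v)) *
      H ((enn2real (?\<gamma> v), snd (fst v i 0)), hold (enn2real (?\<gamma> v)) \<xi>, (%k. restart (enn2real (?\<gamma> v)) (fst v k)), fst (snd v), snd (snd v) - enn2real (?\<gamma> v)))"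
      for v :: "('d => nat => ennreal \<times> real) \<times> (nat => 'd \<times> 'd => real) \<times> real"
    have HA: "(%q. H ((?u, fst q), (%n. \<xi> (Suc n)), snd q)) \<in> borel_measurable (borel \<Otimes>\<^sub>M rest_space)"
      by (rule measurable_compose[OF _ H]) (simp add: space_PiM space_pair_measure)
    have HB: "(%q. H (fst q, hold (fst (fst q)) \<xi>, snd q)) \<in> borel_measurable ((borel \<Otimes>\<^sub>M borel) \<Otimes>\<^sub>M rest_space)"
    proof (rule measurable_compose[OF _ H])
      have "(%q :: (real \<times> real) \<times> ('d => nat => ennreal \<times> real) \<times> (nat => 'd \<times> 'd => real) \<times> real. (fst (fst q), \<xi>)) \<in> measurable ((borel \<Otimes>\<^sub>M borel) \<Otimes>\<^sub>M rest_space) (borel \<Otimes>\<^sub>M chain_space)"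
        by (intro measurable_Pair measurable_const measurable_compose[OF measurable_fst measurable_fst]) simp
      from measurable_compose[OF this measurable_hold]
      show "(%q. (fst q, hold (fst (fst q)) \<xi>, snd q)) \<in> measurable ((borel \<Otimes>\<^sub>M borel) \<Otimes>\<^sub>M rest_space) ((borel \<Otimes>\<^sub>M borel) \<Otimes>\<^sub>M world_space)"
        by (intro measurable_Pair measurable_fst measurable_snd) simp
    qed
    have AE: "AE v in rest. I (\<xi>, v) = IA v + IB v"
    proof -
      have "AE v in rest. ?\<gamma> v \<noteq> ennreal 0" "AE v in rest. ?\<gamma> v \<noteq> ennreal ?u"
        by (rule AE_rest_no_atom, simp)+
      moreover have "AE v in rest. fst (fst v i 1) \<noteq> 0" by (rule AE_rest_gap)
      ultimately show ?thesis
      proof eventually_elim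
        case (elim v)
        obtain g c t where v: "v = (g, c, t)" by (cases v) auto
        let ?w = "(\<xi>, g, c, t) :: 'd world"
        have st: "state 0 ?w = i" "sojourn 0 ?w = snd (\<xi> 0)" "gap i 0 ?w = fst (g i 0)" "claim i 0 ?w = snd (g i 0)"
          "state (Suc 0) ?w = ?k" "transit i ?k 0 ?w = c 0 (i, ?k)" "clock ?w = t"
          using start by (simp_all add: state_def sojourn_def gap_def claim_def transit_def clock_def)
        have \<gamma>: "?\<gamma> v = fst (g i 0)" by (simp add: v)
        \<comment> \<open>The clock coordinate of an arbitrary world may be negative; the
          equivalence survives because \<open>a\<close> is positive.\<close>
        have t_iff: "ennreal a \<le> ennreal t \<longleftrightarrow> a \<le> t" if "0 < a" for a
          using that by (cases "0 \<le> t") (auto simp: ennreal_neg ennreal_le_iff)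
        \<comment> \<open>A tie at a finite time is excluded by \<open>AE_rest_no_atom\<close>; if
          both times are infinite there is no event and all terms vanish.\<close>
        consider "snd (\<xi> 0) = \<infinity>" "fst (g i 0) = \<infinity>" | "snd (\<xi> 0) < fst (g i 0)" | "fst (g i 0) < snd (\<xi> 0)"
        proof (cases "snd (\<xi> 0) = fst (g i 0)")
          case True
          then have "snd (\<xi> 0) = \<infinity>" using elim(2) \<gamma> by (metis ennreal_enn2real infinity_ennreal_def less_top)
          with True that(1) show ?thesis by simp
        qed (use that neq_iff in blast)
        then show ?case
        proof cases
          case 1
          then show ?thesis
            unfolding v I_def IA_def IB_def by (simp add: first_event_def st top_unique)
        next
          case 2
          then have fin: "snd (\<xi> 0) \<noteq> \<infinity>" by auto
          then have u: "snd (\<xi> 0) = ennreal ?u" by (simp add: less_top)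
          have "0 < ?u" using pos u by (metis enn2real_nonneg ennreal_0 less_irrefl order_le_less)
          have "first_event ?w = snd (\<xi> 0)" using 2 by (simp add: first_event_def st min_absorb1 less_imp_le)
          then have fe: "first_event ?w = ennreal ?u" using u by (rule trans)
          have fm: "first_mark ?w = c 0 (i, ?k)"
          proof -
            have "renewals (%n. sojourn n ?w) ?u = 1"
              using renewals_first[of "%n. sojourn n ?w" ?u] u pos by (simp add: sojourn_def)
            moreover have "renewals (%n. gap i n ?w) ?u = 0" "renewals (%n. gap i n ?w) 0 = 0"
              using 2 u elim(1) \<gamma> by (auto intro!: renewals_before simp: gap_def zero_less_iff_neq_zero)
            moreover have "transition_jump 0 ?w = c 0 (i, ?k)"
              using change fin start by (simp add: transition_jump_def state_def transit_def)
            ultimately show ?thesis by (simp add: first_mark_def fe st(1))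
          qed
          have sh: "shift ?u ?w = (%n. \<xi> (Suc n), %k. restart ?u (g k), %n. c (Suc n), t - ?u)"
            using pos using u by (intro shift_at_transition) simp_all
          have eI: "I ?w = indicator {..ennreal t} (ennreal ?u) * H ((?u, c 0 (i, ?k)), shift ?u ?w)"
            unfolding I_def fe fm st(7) by simp
          have "indicator {..ennreal t} (ennreal ?u) = (indicator {?u..} t :: ennreal)"
            using t_iff[OF \<open>0 < ?u\<close>] by (simp add: indicator_def)
          moreover have "IB v = 0" using 2 by (simp add: IB_def v)
          moreover have "indicator {ennreal ?u<..} (fst (g i 0)) = (1 :: ennreal)" using 2 u by simp
          moreover have "indicator {..<\<infinity>} (snd (\<xi> 0)) = (1 :: ennreal)" using fin by (simp add: less_top)
          ultimately show ?thesis
            unfolding v eI sh IA_def fst_conv snd_conv by simp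
        next
          case 3
          then have "fst (g i 0) \<noteq> \<infinity>" by auto
          then have u: "fst (g i 0) = ennreal (enn2real (fst (g i 0)))" by (simp add: less_top)
          let ?a = "enn2real (fst (g i 0))"
          have "0 < ?a" using elim(1) \<gamma> u by (metis enn2real_nonneg order_le_less)
          have "first_event ?w = fst (g i 0)" using 3 by (simp add: first_event_def st min_absorb2 less_imp_le)
          then have fe: "first_event ?w = ennreal ?a" using u by (rule trans)
          have fm: "first_mark ?w = snd (g i 0)" 
          proof -
            have "renewals (%n. sojourn n ?w) ?a = 0"
              using 3 u by (intro renewals_before) (simp add: sojourn_def)
            moreover have "renewals (%n. gap i n ?w) ?a = 1"
              using renewals_first[of "%n. gap i n ?w" ?a] u elim(3) by (simp add: gap_def v zero_less_iff_neq_zero)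
            moreover have "renewals (%n. gap i n ?w) 0 = 0"
              using elim(1) \<gamma> by (intro renewals_before) (simp add: gap_def zero_less_iff_neq_zero)
            ultimately show ?thesis by (simp add: first_mark_def fe st(1,4))
          qed
          have sh: "shift ?a ?w = (hold ?a \<xi>, %k. restart ?a (g k), c, t - ?a)"
            using 3 u by (intro shift_before_transition) simp
          have eI: "I ?w = indicator {..ennreal t} (ennreal ?a) * H ((?a, snd (g i 0)), shift ?a ?w)"
            unfolding I_def fe fm st(7) by simp
          have "indicator {..ennreal t} (ennreal ?a) = (indicator {?a..} t :: ennreal)"
            using t_iff[OF \<open>0 < ?a\<close>] by (simp add: indicator_def)
          moreover have "IA v = 0"
            using 3 by (cases "snd (\<xi> 0)") (auto simp: IA_def v indicator_def)
          moreover have "indicator {..<snd (\<xi> 0)} (fst (g i 0)) = (1 :: ennreal)" using 3 by simp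
          ultimately show ?thesis
            unfolding v eI sh IB_def fst_conv snd_conv by simp
        qed
      qed
    qed
    have IA_int: "(\<integral>\<^sup>+v. IA v \<partial>rest) = A \<xi>" and IA_meas: "IA \<in> borel_measurable rest_space"
    proof -
      define J where "J v = indicator {ennreal ?u<..} (?\<gamma> v) * (indicator {?u..} (snd (snd v)) *
        H ((?u, fst (snd v) 0 (i, ?k)), (%n. \<xi> (Suc n)), (%k. restart ?u (fst v k)), (%n. fst (snd v) (Suc n)), snd (snd v) - ?u))"
        for v :: "('d => nat => ennreal \<times> real) \<times> (nat => 'd \<times> 'd => real) \<times> real"
      have J: "J \<in> borel_measurable rest_space"
        using rest_transition_measurable[OF HA, of ?u i ?k] unfolding J_def fst_conv snd_conv .
      have IA: "IA v = indicator {..<\<infinity>} (snd (\<xi> 0)) * J v" for v by (simp add: IA_def J_def)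
      show "IA \<in> borel_measurable rest_space"
        unfolding IA[abs_def] by (intro borel_measurable_times_ennreal J) simp
      have J': "J \<in> borel_measurable rest" using J unfolding measurable_cong_sets[OF sets_rest refl] .
      show "(\<integral>\<^sup>+v. IA v \<partial>rest) = A \<xi>"
      proof (cases "snd (\<xi> 0) = \<infinity>")
        case True
        then show ?thesis by (simp add: IA_def A_def)
      next
        case False
        then have k: "i \<noteq> ?k" using change by auto
        have "f ?u (%n. \<xi> (Suc n)) = ennreal (exp (- (lam i + beta) * ?u)) * T ?k ?u (%n. \<xi> (Suc n))"
          unfolding f_def using k by (subst sum.remove[of _ ?k]) (auto intro!: sum.neutral)
        moreover have "(\<integral>\<^sup>+v. J v \<partial>rest) = ennreal (exp (- (lam i + beta) * ?u)) * T ?k ?u (%n. \<xi> (Suc n))"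
          using rest_transition[OF HA k enn2real_nonneg] unfolding fst_conv snd_conv T_def J_def .
        ultimately show ?thesis
          using False unfolding IA nn_integral_cmult[OF J'] A_def by simp
      qed
    qed
    have IB_int: "(\<integral>\<^sup>+v. IB v \<partial>rest) = (\<integral>\<^sup>+u. b u \<xi> \<partial>lborel)"
    proof -
      have ind: "indicator {ennreal u<..} (snd (\<xi> 0)) = (indicator {..<snd (\<xi> 0)} (ennreal u) :: ennreal)" for u
        by (simp add: indicator_def)
      show ?thesis
        unfolding IB_def b_def R_def ind using rest_claim[OF HB, of "snd (\<xi> 0)" i] unfolding fst_conv snd_conv .
    qed
    have IB_meas: "IB \<in> borel_measurable rest_space"
      using rest_claim_measurable[OF HB, of "snd (\<xi> 0)" i] unfolding IB_def fst_conv snd_conv .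
    have "(\<integral>\<^sup>+v. I (\<xi>, v) \<partial>rest) = (\<integral>\<^sup>+v. IA v + IB v \<partial>rest)"
      using AE by (rule nn_integral_cong_AE)
    also have "\<dots> = (\<integral>\<^sup>+v. IA v \<partial>rest) + (\<integral>\<^sup>+v. IB v \<partial>rest)"
      using IA_meas IB_meas unfolding measurable_cong_sets[OF sets_rest[symmetric] refl] by (rule nn_integral_add)
    finally show ?thesis unfolding IA_int IB_int .
  qed
  have "(\<integral>\<^sup>+w. I w \<partial>world i) = (\<integral>\<^sup>+\<xi>. A \<xi> + (\<integral>\<^sup>+u. b u \<xi> \<partial>lborel) \<partial>N i)"
    unfolding nn_integral_world[OF I]
    using AE_start[of i] AE_positive[of i] regular_chain[of i] AE_no_self_jump[of i]
    by (intro nn_integral_cong_AE, eventually_elim) (rule inner)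
  also have "\<dots> = (\<integral>\<^sup>+\<xi>. A \<xi> \<partial>N i) + (\<integral>\<^sup>+\<xi>. \<integral>\<^sup>+u. b u \<xi> \<partial>lborel \<partial>N i)"
  proof (rule nn_integral_add)
    have tail: "(%\<xi> n. \<xi> (Suc n)) \<in> measurable chain_space (chain_space :: (nat => 'd \<times> ennreal) measure)"
      by (rule measurable_PiM_UNIV) measurable
    have "(%\<xi>. enn2real (snd (\<xi> 0))) \<in> borel_measurable (chain_space :: (nat => 'd \<times> ennreal) measure)"
      by measurable
    from measurable_compose[OF measurable_Pair[OF this tail] f]
    have [measurable]: "(%\<xi>. f (enn2real (snd (\<xi> 0))) (%n. \<xi> (Suc n))) \<in> borel_measurable chain_space" by simp
    have "A \<in> borel_measurable chain_space" unfolding A_def by measurable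
    then show "A \<in> borel_measurable (N i)" unfolding measurable_cong_sets[OF sets_N refl] .
    have "(%(\<xi>, u). b u \<xi>) \<in> borel_measurable (chain_space \<Otimes>\<^sub>M lborel)"
      using measurable_compose[OF measurable_pair_swap' b] by (simp add: case_prod_beta')
    from lborel.borel_measurable_nn_integral_fst[OF this]
    show "(%\<xi>. \<integral>\<^sup>+u. b u \<xi> \<partial>lborel) \<in> borel_measurable (N i)"
      unfolding measurable_cong_sets[OF sets_N refl] by simp
  qed
  also have "(\<integral>\<^sup>+\<xi>. A \<xi> \<partial>N i) = (\<Sum>k\<in>UNIV - {i}. \<integral>\<^sup>+u. ennreal (Q $ i $ k * exp (Q $ i $ i * u)) * indicator {0<..} u * (\<integral>\<^sup>+\<xi>. f u \<xi> \<partial>N k) \<partial>lborel)"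
    unfolding A_def by (rule nn_integral_first_transition[OF f])
  also have "\<dots> = (\<Sum>k\<in>UNIV - {i}. \<integral>\<^sup>+u. ennreal (Q $ i $ k * exp (- (beta - Q $ i $ i + lam i) * u)) * indicator {0<..} u * (\<integral>\<^sup>+m. \<integral>\<^sup>+w. H ((u, m), w) \<partial>world k \<partial>C i k) \<partial>lborel)"
  proof (intro sum.cong refl nn_integral_cong)
    fix k and u :: real assume "k \<in> UNIV - {i}"
    then have k: "k \<noteq> i" by simp
    have "(\<integral>\<^sup>+\<xi>. f u \<xi> \<partial>N k) = (\<integral>\<^sup>+\<xi>. ennreal (exp (- (lam i + beta) * u)) * T k u \<xi> \<partial>N k)"
      using AE_start[of k]
    proof (intro nn_integral_cong_AE, eventually_elim)
      fix \<xi> :: "nat => 'd \<times> ennreal" assume "fst (\<xi> 0) = k"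
      then show "f u \<xi> = ennreal (exp (- (lam i + beta) * u)) * T k u \<xi>"
        unfolding f_def using k by (subst sum.remove[of _ k]) (auto intro!: sum.neutral)
    qed
    also have "\<dots> = ennreal (exp (- (lam i + beta) * u)) * (\<integral>\<^sup>+\<xi>. T k u \<xi> \<partial>N k)"
    proof (rule nn_integral_cmult)
      show "T k u \<in> borel_measurable (N k)"
        unfolding measurable_cong_sets[OF sets_N refl] using measurable_compose[OF measurable_Pair1' T[OF k], of u] by simp
    qed
    also have "(\<integral>\<^sup>+\<xi>. T k u \<xi> \<partial>N k) = (\<integral>\<^sup>+m. \<integral>\<^sup>+w. H ((u, m), w) \<partial>world k \<partial>C i k)"
      unfolding T_def using k by (intro swap_mark[OF H] prob_C sets_C) auto
    also have "ennreal (Q $ i $ k * exp (Q $ i $ i * u)) * indicator {0<..} u * (ennreal (exp (- (lam i + beta) * u)) * a)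
        = ennreal (Q $ i $ k * exp (- (beta - Q $ i $ i + lam i) * u)) * indicator {0<..} u * a" for a
    proof -
      have "exp (- (beta - Q $ i $ i + lam i) * u) = exp (Q $ i $ i * u) * exp (- (lam i + beta) * u)"
        by (subst exp_add[symmetric]) (simp add: algebra_simps)
      then show ?thesis
        by (simp only: ennreal_mult'[OF Q_nonneg[OF k[symmetric]]] ennreal_mult'[OF exp_ge_zero]) (simp only: mult_ac)
    qed
    finally show "ennreal (Q $ i $ k * exp (Q $ i $ i * u)) * indicator {0<..} u * (\<integral>\<^sup>+\<xi>. f u \<xi> \<partial>N k)
        = ennreal (Q $ i $ k * exp (- (beta - Q $ i $ i + lam i) * u)) * indicator {0<..} u * (\<integral>\<^sup>+m. \<integral>\<^sup>+w. H ((u, m), w) \<partial>world k \<partial>C i k)" .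
  qed
  also have "(\<integral>\<^sup>+\<xi>. \<integral>\<^sup>+u. b u \<xi> \<partial>lborel \<partial>N i) = (\<integral>\<^sup>+u. \<integral>\<^sup>+\<xi>. b u \<xi> \<partial>N i \<partial>lborel)"
  proof -
    interpret P: pair_sigma_finite lborel "N i" ..
    have "case_prod b \<in> borel_measurable (lborel \<Otimes>\<^sub>M N i)"
      unfolding measurable_cong_sets[OF sets_pair_measure_cong[OF sets_lborel sets_N] refl] by (rule b)
    from P.Fubini'[OF this] show ?thesis .
  qed
  also have "\<dots> = (\<integral>\<^sup>+u. ennreal (lam i * exp (- (beta - Q $ i $ i + lam i) * u)) * indicator {0<..} u * (\<integral>\<^sup>+m. \<integral>\<^sup>+w. H ((u, m), w) \<partial>world i \<partial>B i) \<partial>lborel)"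
  proof (rule nn_integral_cong)
    fix u :: real
    show "(\<integral>\<^sup>+\<xi>. b u \<xi> \<partial>N i) = ennreal (lam i * exp (- (beta - Q $ i $ i + lam i) * u)) * indicator {0<..} u * (\<integral>\<^sup>+m. \<integral>\<^sup>+w. H ((u, m), w) \<partial>world i \<partial>B i)"
    proof (cases "0 < u")
      case True
      have Ru: "R u \<in> borel_measurable chain_space"
        using measurable_compose[OF measurable_Pair1' R, of u] by simp
      have Rh: "(%\<xi>. R u (hold u \<xi>)) \<in> borel_measurable chain_space"
        using measurable_compose[OF measurable_Pair1' Rhold, of u] by simp
      have Rm: "(%\<xi>. indicator {ennreal u<..} (snd (\<xi> 0)) * R u (hold u \<xi>)) \<in> borel_measurable (N i)"
        unfolding measurable_cong_sets[OF sets_N refl] by (intro borel_measurable_times_ennreal Rh) measurable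
      let ?c = "ennreal (lam i * exp (- lam i * u)) * ennreal (exp (- beta * u))"
      have "(\<integral>\<^sup>+\<xi>. b u \<xi> \<partial>N i) = (\<integral>\<^sup>+\<xi>. ?c * (indicator {ennreal u<..} (snd (\<xi> 0)) * R u (hold u \<xi>)) \<partial>N i)"
        using True by (simp add: b_def mult_ac)
      also have "\<dots> = ?c * (ennreal (exp (Q $ i $ i * u)) * (\<integral>\<^sup>+\<xi>. R u \<xi> \<partial>N i))"
        unfolding nn_integral_cmult[OF Rm] using True by (subst nn_integral_hold[OF Ru]) simp_all
      also have "(\<integral>\<^sup>+\<xi>. R u \<xi> \<partial>N i) = (\<integral>\<^sup>+m. \<integral>\<^sup>+w. H ((u, m), w) \<partial>world i \<partial>B i)"
        unfolding R_def by (intro swap_mark[OF H] renewal.prob_B renewal.sets_B)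
      also have "?c * (ennreal (exp (Q $ i $ i * u)) * a) = ennreal (lam i * exp (- (beta - Q $ i $ i + lam i) * u)) * a" for a
      proof -
        have "exp (- (beta - Q $ i $ i + lam i) * u) = exp (- lam i * u) * (exp (- beta * u) * exp (Q $ i $ i * u))"
          by (subst exp_add[symmetric])+ (simp add: algebra_simps)
        then show ?thesis by (simp only: ennreal_mult'[OF renewal.lam] ennreal_mult'[OF exp_ge_zero] mult.assoc)
      qed
      finally show ?thesis using True by simp
    qed (simp add: b_def)
  qed
  finally show ?thesis unfolding I_def by (simp add: add.commute)
qed

end

section \<open>Means of functionals computed event by event\<close>

lemma event_value_mono: "event_value A D W X n x w \<le> event_value A D W X (Suc n) x w"
proof (induction n arbitrary: x w)
  case (Suc n)
  show ?case
    unfolding event_value.simps(2)[of A D W X "Suc n" x w] event_value.simps(2)[of A D W X n x w]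
    by (cases "ennreal (clock w) < first_event w")
      (simp_all only: if_True if_False order_refl, intro add_left_mono mult_left_mono Suc zero_le)
qed simp

lemma incseq_event_value: "incseq (%n. event_value A D W X n x w)"
  by (rule incseq_SucI) (rule event_value_mono)

lemma SUP_const_add_ennreal: "(SUP n. c + f n) = c + (SUP n. f n :: ennreal)"
  using ennreal_SUP_add_left[of UNIV f c] by (simp add: add.commute)

text \<open>Removes the counter. As the supremum of an increasing sequence it stays measurable and
  satisfies the one-step equation in every world.\<close>

definition event_limit where
  "event_limit A D W X x w = (SUP n. event_value A D W X n x w)"

lemma event_limit_rec:
  "event_limit A D W X x w =
    (if ennreal (clock w) < first_event w then A (state 0 w) x (clock w)
     else D (state 0 w) x (enn2real (first_event w)) (first_mark w) (shift (enn2real (first_event w)) w)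
       + W (state 0 w) x (enn2real (first_event w)) (first_mark w) *
         event_limit A D W X (X (state 0 w) x (enn2real (first_event w)) (first_mark w))
           (shift (enn2real (first_event w)) w))"
proof -
  have "event_limit A D W X x w = (SUP n. event_value A D W X (Suc n) x w)"
    unfolding event_limit_def
  proof (rule antisym)
    show "(SUP n. event_value A D W X n x w) \<le> (SUP n. event_value A D W X (Suc n) x w)"
      by (rule SUP_mono') (rule event_value_mono)
    show "(SUP n. event_value A D W X (Suc n) x w) \<le> (SUP n. event_value A D W X n x w)"
      by (rule SUP_least) (rule SUP_upper[OF UNIV_I])
  qed
  then show ?thesis
    by (cases "ennreal (clock w) < first_event w")
      (simp_all add: event_limit_def SUP_const_add_ennreal SUP_mult_left_ennreal)
qed

lemma event_limit_eqI:
  assumes "\<And>n. N < n ==> y = event_value A D W X n x w"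
  shows "event_limit A D W X x w = y"
  unfolding event_limit_def
proof (rule antisym)
  show "(SUP n. event_value A D W X n x w) \<le> y"
  proof (rule SUP_least)
    fix n
    have "event_value A D W X n x w \<le> event_value A D W X (Suc (max n N)) x w"
      by (rule incseqD[OF incseq_event_value]) simp
    also have "\<dots> = y" by (rule sym[OF assms]) simp
    finally show "event_value A D W X n x w \<le> y" .
  qed
  show "y \<le> (SUP n. event_value A D W X n x w)"
    using assms[of "Suc N"] by (auto intro: SUP_upper2[of "Suc N"])
qed

context world_law
begin

definition total_rate :: "'d => real" where
  "total_rate i = beta - Q $ i $ i + lam i"

definition jump_integral :: "'d => (real => 'd => ennreal) => ennreal" where
  "jump_integral i h = ennreal (lam i) * (\<integral>\<^sup>+m. h m i \<partial>B i)
    + (\<Sum>k\<in>UNIV - {i}. ennreal (Q $ i $ k) * (\<integral>\<^sup>+m. h m k \<partial>C i k))"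

lemma AE_state: "AE w in world i. state 0 w = i"
proof -
  interpret P: pair_prob_space "N i" rest ..
  have "AE p in N i \<Otimes>\<^sub>M rest. fst (fst p 0) = i"
  proof (rule P.AE_pair_measure)
    have "{p \<in> space (N i \<Otimes>\<^sub>M rest). state 0 p = i} \<in> sets (N i \<Otimes>\<^sub>M rest)"
      using measurable_sets[OF measurable_state[of 0], of "{i}"] sets_world[of i] sets_eq_imp_space_eq[OF sets_world[of i]]
      unfolding world_def by (simp add: vimage_def Int_def conj_commute)
    then show "{p \<in> space (N i \<Otimes>\<^sub>M rest). fst (fst p 0) = i} \<in> sets (N i \<Otimes>\<^sub>M rest)" by (simp add: state_def)
    show "AE \<xi> in N i. AE v in rest. fst (fst (\<xi>, v) 0) = i"
      using AE_start[of i] by eventually_elim simp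
  qed
  then show ?thesis unfolding world_def state_def .
qed

text \<open>The clock has density \<open>beta * exp (- beta * u)\<close>; given its value
  \<open>u\<close>, the first claim and the first sojourn exceed it independently, with
  probabilities \<open>exp (- lam i * u)\<close> and \<open>exp (Q $ i $ i * u)\<close>.\<close>

lemma nn_integral_no_event:
  assumes f: "f \<in> borel_measurable borel"
  shows "(\<integral>\<^sup>+w. indicator {ennreal (clock w)<..} (first_event w) * f (clock w) \<partial>world i)
    = (\<integral>\<^sup>+u. ennreal (exp (- total_rate i * u)) * indicator {0<..} u * (ennreal beta * f u) \<partial>lborel)"
proof -
  define I where "I w = indicator {ennreal (clock w)<..} (first_event w) * f (clock w)" for w :: "'d world"
  have I: "I \<in> borel_measurable world_space"
  proof -
    have "(%w :: 'd world. indicator {ennreal (clock w)<..} (first_event w) :: ennreal) = (%w. if ennreal (clock w) < first_event w then 1 else 0)"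
      by (auto simp: indicator_def)
    then have [measurable]: "(%w :: 'd world. indicator {ennreal (clock w)<..} (first_event w) :: ennreal) \<in> borel_measurable world_space"
      by simp
    have [measurable]: "(%w :: 'd world. f (clock w)) \<in> borel_measurable world_space"
      by (rule measurable_compose[OF measurable_clock f])
    show ?thesis unfolding I_def by measurable
  qed
  let ?before = "%t s. indicator {ennreal t<..} s :: ennreal"
  have before: "(%p. ?before (fst p) (snd p)) \<in> borel_measurable (borel \<Otimes>\<^sub>M borel)"
  proof -
    have "(%p. ?before (fst p) (snd p)) = (%p. if ennreal (fst p) < snd p then 1 else 0)"
      by (auto simp: indicator_def)
    then show ?thesis by simp
  qed
  have gm: "(%g. fst (g i 0)) \<in> borel_measurable claims" for i
    by (rule borel_claims) (rule measurable_compose[OF measurable_coordinate measurable_fst])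
  interpret PC: pair_sigma_finite claims "killing beta" ..
  interpret PN: pair_sigma_finite "N i" "killing beta" ..
  have inner: "(\<integral>\<^sup>+v. I (\<xi>, v) \<partial>rest) = (\<integral>\<^sup>+t. ?before t (snd (\<xi> 0)) * (ennreal (exp (- lam i * t)) * indicator {0<..} t * f t) \<partial>killing beta)"
    if start: "fst (\<xi> 0) = i" for \<xi>
  proof -
    have Iv: "(%v. I (\<xi>, v)) \<in> borel_measurable rest_space"
      by (rule measurable_compose[OF _ I]) (simp add: space_PiM space_pair_measure)
    have "(\<integral>\<^sup>+v. I (\<xi>, v) \<partial>rest) = (\<integral>\<^sup>+g. \<integral>\<^sup>+c. \<integral>\<^sup>+t. I (\<xi>, g, c, t) \<partial>killing beta \<partial>transits \<partial>claims)"
      by (rule nn_integral_rest[OF Iv])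
    also have "\<dots> = (\<integral>\<^sup>+g. \<integral>\<^sup>+t. ?before t (snd (\<xi> 0)) * (?before t (fst (g i 0)) * f t) \<partial>killing beta \<partial>claims)"
    proof (rule nn_integral_cong)
      fix g :: "'d => nat => ennreal \<times> real"
      have "I (\<xi>, g, c, t) = ?before t (snd (\<xi> 0)) * (?before t (fst (g i 0)) * f t)" for c t
        using start by (auto simp: I_def first_event_def state_def sojourn_def gap_def clock_def indicator_def)
      then show "(\<integral>\<^sup>+c. \<integral>\<^sup>+t. I (\<xi>, g, c, t) \<partial>killing beta \<partial>transits) = (\<integral>\<^sup>+t. ?before t (snd (\<xi> 0)) * (?before t (fst (g i 0)) * f t) \<partial>killing beta)"
        by (simp add: transits.emeasure_space_1)
    qed
    also have "\<dots> = (\<integral>\<^sup>+t. \<integral>\<^sup>+g. ?before t (snd (\<xi> 0)) * (?before t (fst (g i 0)) * f t) \<partial>claims \<partial>killing beta)"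
    proof (rule PC.Fubini'[symmetric])
      have 1: "(%p. ?before (snd p) (fst (fst p i 0))) \<in> borel_measurable (claims \<Otimes>\<^sub>M killing beta)"
        using measurable_compose[OF measurable_Pair[OF measurable_snd measurable_compose[OF measurable_fst gm]] before] by simp
      have 2: "(%p. ?before (snd p) (snd (\<xi> 0))) \<in> borel_measurable (claims \<Otimes>\<^sub>M killing beta)"
      proof -
        have "(%p. (snd p, snd (\<xi> 0))) \<in> measurable (claims \<Otimes>\<^sub>M killing beta) (borel \<Otimes>\<^sub>M borel)"
          by (intro measurable_Pair measurable_const) simp_all
        from measurable_compose[OF this before] show ?thesis by simp
      qed
      have 3: "(%p. f (snd p)) \<in> borel_measurable (claims \<Otimes>\<^sub>M killing beta)"
        by (rule measurable_compose[OF measurable_snd]) (unfold measurable_cong_sets[OF sets_killing refl], rule f)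
      show "(%(g, t). ?before t (snd (\<xi> 0)) * (?before t (fst (g i 0)) * f t)) \<in> borel_measurable (claims \<Otimes>\<^sub>M killing beta)"
        unfolding case_prod_beta' by (intro borel_measurable_times_ennreal 1 2 3)
    qed
    also have "\<dots> = (\<integral>\<^sup>+t. ?before t (snd (\<xi> 0)) * (ennreal (exp (- lam i * t)) * indicator {0<..} t * f t) \<partial>killing beta)"
    proof (rule nn_integral_cong_AE)
      have "AE t in killing beta. 0 < t"
        unfolding killing_def using AE_lborel_singleton[of 0]
        by (subst AE_density) (auto simp: exponential_density_def elim!: eventually_mono)
      then show "AE t in killing beta. (\<integral>\<^sup>+g. ?before t (snd (\<xi> 0)) * (?before t (fst (g i 0)) * f t) \<partial>claims)
          = ?before t (snd (\<xi> 0)) * (ennreal (exp (- lam i * t)) * indicator {0<..} t * f t)"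
      proof eventually_elim
        fix t :: real assume t: "0 < t"
        have m: "(%g. ?before t (fst (g i 0))) \<in> borel_measurable claims"
        proof -
          have "(%s. ?before t s) \<in> borel_measurable borel" by measurable
          from measurable_compose[OF gm this] show ?thesis .
        qed
        have "(\<integral>\<^sup>+g. ?before t (fst (g i 0)) \<partial>claims) = ennreal (exp (- lam i * t))"
          using components_before_claim[of "%_. 1" t i] t by (simp add: claims.emeasure_space_1)
        then show "(\<integral>\<^sup>+g. ?before t (snd (\<xi> 0)) * (?before t (fst (g i 0)) * f t) \<partial>claims)
          = ?before t (snd (\<xi> 0)) * (ennreal (exp (- lam i * t)) * indicator {0<..} t * f t)"
          using t by (simp add: nn_integral_cmult nn_integral_multc m split: split_indicator)
      qed
    qed
    finally show ?thesis .
  qed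
  have ef: "(%t. ennreal (exp (- lam i * t)) * indicator {0<..} t * f t) \<in> borel_measurable borel"
    using f by measurable
  have "(\<integral>\<^sup>+w. I w \<partial>world i) = (\<integral>\<^sup>+\<xi>. \<integral>\<^sup>+t. ?before t (snd (\<xi> 0)) * (ennreal (exp (- lam i * t)) * indicator {0<..} t * f t) \<partial>killing beta \<partial>N i)"
    unfolding nn_integral_world[OF I] using AE_start[of i]
    by (intro nn_integral_cong_AE, eventually_elim) (rule inner)
  also have "\<dots> = (\<integral>\<^sup>+t. \<integral>\<^sup>+\<xi>. ?before t (snd (\<xi> 0)) * (ennreal (exp (- lam i * t)) * indicator {0<..} t * f t) \<partial>N i \<partial>killing beta)"
  proof (rule PN.Fubini'[symmetric])
    have 1: "(%p. ?before (snd p) (snd (fst p 0))) \<in> borel_measurable (N i \<Otimes>\<^sub>M killing beta)"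
    proof -
      have "(%\<xi>. snd (\<xi> 0)) \<in> borel_measurable (N i)" unfolding measurable_cong_sets[OF sets_N refl] by measurable
      from measurable_compose[OF measurable_Pair[OF measurable_snd measurable_compose[OF measurable_fst this]] before]
      show ?thesis by simp
    qed
    have 2: "(%p. ennreal (exp (- lam i * snd p)) * indicator {0<..} (snd p) * f (snd p)) \<in> borel_measurable (N i \<Otimes>\<^sub>M killing beta)"
      by (rule measurable_compose[OF measurable_snd]) (unfold measurable_cong_sets[OF sets_killing refl], rule ef)
    show "(%(\<xi>, t). ?before t (snd (\<xi> 0)) * (ennreal (exp (- lam i * t)) * indicator {0<..} t * f t)) \<in> borel_measurable (N i \<Otimes>\<^sub>M killing beta)"
      unfolding case_prod_beta' by (intro borel_measurable_times_ennreal[OF 1 2])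
  qed
  also have "\<dots> = (\<integral>\<^sup>+t. ennreal (exp (Q $ i $ i * t)) * (ennreal (exp (- lam i * t)) * indicator {0<..} t * f t) \<partial>killing beta)"
  proof (rule nn_integral_cong)
    fix t :: real
    have m: "(%\<xi>. ?before t (snd (\<xi> 0))) \<in> borel_measurable (N i)"
      unfolding measurable_cong_sets[OF sets_N refl] by measurable
    show "(\<integral>\<^sup>+\<xi>. ?before t (snd (\<xi> 0)) * (ennreal (exp (- lam i * t)) * indicator {0<..} t * f t) \<partial>N i)
      = ennreal (exp (Q $ i $ i * t)) * (ennreal (exp (- lam i * t)) * indicator {0<..} t * f t)"
    proof (cases "0 < t")
      case True
      have "(\<integral>\<^sup>+\<xi>. ?before t (snd (\<xi> 0)) \<partial>N i) = ennreal (exp (Q $ i $ i * t))"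
        using nn_integral_hold[of "%_. 1" t i] True N.emeasure_space_1[of i] by simp
      then show ?thesis by (subst nn_integral_multc[OF m]) simp
    qed simp
  qed
  also have "\<dots> = (\<integral>\<^sup>+t. ennreal (beta * exp (- beta * t)) * indicator {0<..} t * (ennreal (exp (Q $ i $ i * t)) * (ennreal (exp (- lam i * t)) * indicator {0<..} t * f t)) \<partial>lborel)"
    by (rule nn_integral_killing, rule borel_measurable_times_ennreal[OF _ ef]) measurable
  also have "\<dots> = (\<integral>\<^sup>+u. ennreal (exp (- total_rate i * u)) * indicator {0<..} u * (ennreal beta * f u) \<partial>lborel)"
  proof (rule nn_integral_cong)
    fix u :: real
    have "exp (- total_rate i * u) = exp (- beta * u) * (exp (Q $ i $ i * u) * exp (- lam i * u))"
      unfolding total_rate_def by (subst exp_add[symmetric])+ (simp add: algebra_simps)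
    moreover have "ennreal (beta * exp (- beta * u)) = ennreal beta * ennreal (exp (- beta * u))"
      using beta by (intro ennreal_mult') simp
    ultimately show "ennreal (beta * exp (- beta * u)) * indicator {0<..} u * (ennreal (exp (Q $ i $ i * u)) * (ennreal (exp (- lam i * u)) * indicator {0<..} u * f u))
      = ennreal (exp (- total_rate i * u)) * indicator {0<..} u * (ennreal beta * f u)"
      by (simp only: ennreal_mult'[OF exp_ge_zero]) (simp add: mult_ac split: split_indicator)
  qed
  finally show ?thesis unfolding I_def .
qed

end

locale event_functional = world_law Q N lam B C beta
  for Q :: "real^'d^'d::finite" and N lam B C beta +
  fixes A :: "'d => real => real => ennreal" and D :: "'d => real => real => real => 'd world => ennreal"
    and W :: "'d => real => real => real => ennreal" and X :: "'d => real => real => real => real"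
  assumes A_meas: "\<And>i. (%p. A i (fst p) (snd p)) \<in> borel_measurable (borel \<Otimes>\<^sub>M borel)"
    and D_meas: "\<And>i. (%p. D i (fst (fst p)) (fst (snd (fst p))) (snd (snd (fst p))) (snd p)) \<in> borel_measurable ((borel \<Otimes>\<^sub>M (borel \<Otimes>\<^sub>M borel)) \<Otimes>\<^sub>M world_space)"
    and W_meas: "\<And>i. (%p. W i (fst p) (fst (snd p)) (snd (snd p))) \<in> borel_measurable (borel \<Otimes>\<^sub>M (borel \<Otimes>\<^sub>M borel))"
    and X_meas: "\<And>i. (%p. X i (fst p) (fst (snd p)) (snd (snd p))) \<in> borel_measurable (borel \<Otimes>\<^sub>M (borel \<Otimes>\<^sub>M borel))"
begin

lemma event_value_measurable:
  "(%p. event_value A D W X n (fst p) (snd p)) \<in> borel_measurable (borel \<Otimes>\<^sub>M world_space)"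
proof (induction n)
  case (Suc n)
  let ?D = "borel \<Otimes>\<^sub>M (world_space :: 'd world measure)"
  let ?u = "%p :: real \<times> 'd world. enn2real (first_event (snd p))"
  let ?m = "%p :: real \<times> 'd world. first_mark (snd p)"
  let ?s = "%p :: real \<times> 'd world. shift (?u p) (snd p)"
  have u: "?u \<in> borel_measurable ?D" and m: "?m \<in> borel_measurable ?D" and x: "fst \<in> borel_measurable ?D" by measurable
  have s: "?s \<in> measurable ?D world_space"
    using measurable_compose[OF measurable_Pair[OF u measurable_snd] measurable_shift] by simp
  have st: "(%p. state 0 (snd p)) \<in> measurable ?D (count_space UNIV)" by measurable
  note xum = measurable_Pair[OF x measurable_Pair[OF u m]]
  have 1: "(%p. A (state 0 (snd p)) (fst p) (clock (snd p))) \<in> borel_measurable ?D"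
    by (rule measurable_compose_countable[OF _ st, where f = "%i p. A i (fst p) (clock (snd p))"])
      (use measurable_compose[OF measurable_Pair[OF x measurable_compose[OF measurable_snd measurable_clock]] A_meas] in simp)
  have 2: "(%p. D (state 0 (snd p)) (fst p) (?u p) (?m p) (?s p)) \<in> borel_measurable ?D"
    by (rule measurable_compose_countable[OF _ st, where f = "%i p. D i (fst p) (?u p) (?m p) (?s p)"])
      (use measurable_compose[OF measurable_Pair[OF xum s] D_meas] in simp)
  have 3: "(%p. W (state 0 (snd p)) (fst p) (?u p) (?m p)) \<in> borel_measurable ?D"
    by (rule measurable_compose_countable[OF _ st, where f = "%i p. W i (fst p) (?u p) (?m p)"])
      (use measurable_compose[OF xum W_meas] in simp)
  have 4: "(%p. X (state 0 (snd p)) (fst p) (?u p) (?m p)) \<in> borel_measurable ?D"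
    by (rule measurable_compose_countable[OF _ st, where f = "%i p. X i (fst p) (?u p) (?m p)"])
      (use measurable_compose[OF xum X_meas] in simp)
  have 5: "(%p. event_value A D W X n (X (state 0 (snd p)) (fst p) (?u p) (?m p)) (?s p)) \<in> borel_measurable ?D"
    using measurable_compose[OF measurable_Pair[OF 4 s] Suc] by simp
  have 6: "Measurable.pred ?D (%p. ennreal (clock (snd p)) < first_event (snd p))"
    by measurable
  show ?case
    unfolding event_value.simps
    by (intro measurable_If 1 borel_measurable_add borel_measurable_times_ennreal 2 3 5) (use 6 in simp)
qed simp

definition mean :: "real => 'd => ennreal" where
  "mean x i = (\<integral>\<^sup>+w. event_limit A D W X x w \<partial>world i)"

lemma event_limit_measurable:
  "(%p. event_limit A D W X (fst p) (snd p)) \<in> borel_measurable (borel \<Otimes>\<^sub>M world_space)"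
  unfolding event_limit_def by (rule borel_measurable_SUP) (auto intro: event_value_measurable)

lemma mean_measurable: "(%x. mean x i) \<in> borel_measurable borel"
proof -
  have "(%p. event_limit A D W X (fst p) (snd p)) \<in> borel_measurable (borel \<Otimes>\<^sub>M world i)"
    unfolding measurable_cong_sets[OF sets_pair_measure_cong[OF refl sets_world] refl] by (rule event_limit_measurable)
  from world.borel_measurable_nn_integral_fst[OF this] show ?thesis by (simp add: mean_def)
qed

text \<open>Integrates \<open>event_limit_rec\<close>: the clock ringing first gives the term with
  \<open>A\<close> (\<open>nn_integral_no_event\<close>), and an event coming first gives the jump
  integral, in which the continuation is again a mean because the world after the event is fresh
  (\<open>nn_integral_first_event\<close>).\<close>

lemma mean_eq:
  "mean x i = (\<integral>\<^sup>+u. ennreal (exp (- total_rate i * u)) * indicator {0<..} u *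
    (ennreal beta * A i x u + jump_integral i (%m k. (\<integral>\<^sup>+w. D i x u m w \<partial>world k) + W i x u m * mean (X i x u m) k)) \<partial>lborel)"
proof -
  define H where "H p = D i x (fst (fst p)) (snd (fst p)) (snd p) + W i x (fst (fst p)) (snd (fst p)) *
      event_limit A D W X (X i x (fst (fst p)) (snd (fst p))) (snd p)" for p
  have xp: "(%p. (x, fst p)) \<in> measurable ((borel \<Otimes>\<^sub>M borel) \<Otimes>\<^sub>M (world_space :: 'd world measure)) (borel \<Otimes>\<^sub>M (borel \<Otimes>\<^sub>M borel))"
    by (intro measurable_Pair measurable_const measurable_fst) simp
  have D1: "(%p. D i x (fst (fst p)) (snd (fst p)) (snd p)) \<in> borel_measurable ((borel \<Otimes>\<^sub>M borel) \<Otimes>\<^sub>M world_space)"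
    using measurable_compose[OF measurable_Pair[OF xp measurable_snd] D_meas] by simp
  have W1: "(%p. W i x (fst (fst p)) (snd (fst p))) \<in> borel_measurable ((borel \<Otimes>\<^sub>M borel) \<Otimes>\<^sub>M (world_space :: 'd world measure))"
    using measurable_compose[OF xp W_meas] by simp
  have X1: "(%p. X i x (fst (fst p)) (snd (fst p))) \<in> borel_measurable ((borel \<Otimes>\<^sub>M borel) \<Otimes>\<^sub>M (world_space :: 'd world measure))"
    using measurable_compose[OF xp X_meas] by simp
  have H: "H \<in> borel_measurable ((borel \<Otimes>\<^sub>M borel) \<Otimes>\<^sub>M world_space)"
    unfolding H_def
    using measurable_compose[OF measurable_Pair[OF X1 measurable_snd] event_limit_measurable]
    by (intro borel_measurable_add borel_measurable_times_ennreal D1 W1) simp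
  define h where "h u m k = (\<integral>\<^sup>+w. D i x u m w \<partial>world k) + W i x u m * mean (X i x u m) k" for u m k
  have hH: "(\<integral>\<^sup>+w. H ((u, m), w) \<partial>world k) = h u m k" for u m k
  proof -
    have d: "(%w. D i x u m w) \<in> borel_measurable (world k)"
      unfolding measurable_cong_sets[OF sets_world refl] using measurable_compose[OF measurable_Pair1' D1, of "(u, m)"]
      by (simp add: space_pair_measure)
    have e: "(%w. event_limit A D W X y w) \<in> borel_measurable (world k)" for y
      unfolding measurable_cong_sets[OF sets_world refl] using measurable_compose[OF measurable_Pair1' event_limit_measurable, of y] by simp
    show ?thesis
      unfolding H_def h_def mean_def fst_conv snd_conv
      using e by (subst nn_integral_add[OF d]) (auto simp: nn_integral_cmult intro!: borel_measurable_times_ennreal)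
  qed
  have hm: "(%p. h (fst p) (snd p) k) \<in> borel_measurable (borel \<Otimes>\<^sub>M borel)" for k
  proof -
    have "H \<in> borel_measurable ((borel \<Otimes>\<^sub>M borel) \<Otimes>\<^sub>M world k)"
      unfolding measurable_cong_sets[OF sets_pair_measure_cong[OF refl sets_world] refl] by (rule H)
    from world.borel_measurable_nn_integral_fst[OF this] show ?thesis unfolding hH[symmetric] by simp
  qed
  have int_m: "(%u. \<integral>\<^sup>+m. h u m k \<partial>M) \<in> borel_measurable borel" if M: "prob_space M" "sets M = sets borel" for M k
  proof -
    interpret M: prob_space M by (rule M)
    have "(%p. h (fst p) (snd p) k) \<in> borel_measurable (borel \<Otimes>\<^sub>M M)"
      unfolding measurable_cong_sets[OF sets_pair_measure_cong[OF refl M(2)] refl] by (rule hm)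
    from M.borel_measurable_nn_integral_fst[OF this] show ?thesis by simp
  qed
  have mB [measurable]: "(%u. \<integral>\<^sup>+m. h u m i \<partial>B i) \<in> borel_measurable borel"
    by (rule int_m[OF renewal.prob_B renewal.sets_B])
  have mC: "(%u. \<integral>\<^sup>+m. h u m k \<partial>C i k) \<in> borel_measurable borel" if "k \<noteq> i" for k
    using that by (intro int_m prob_C sets_C) auto
  have Af: "(%u. A i x u) \<in> borel_measurable borel"
    using measurable_compose[OF measurable_Pair1' A_meas, of x] by simp
  let ?e = "%u. ennreal (exp (- total_rate i * u)) * indicator {0<..} u :: ennreal"
  let ?I0 = "%w. indicator {ennreal (clock w)<..} (first_event w) * A i x (clock w)"
  let ?I1 = "%w. indicator {..ennreal (clock w)} (first_event w) * H ((enn2real (first_event w), first_mark w), shift (enn2real (first_event w)) w)"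
  have I1m: "?I1 \<in> borel_measurable (world i)"
  proof -
    have "(%w. (enn2real (first_event w), w)) \<in> measurable world_space (borel \<Otimes>\<^sub>M (world_space :: 'd world measure))"
      by measurable
    from measurable_compose[OF this measurable_shift]
    have s: "(%w. shift (enn2real (first_event w)) w) \<in> measurable world_space (world_space :: 'd world measure)" by simp
    have 1: "(%w. H ((enn2real (first_event w), first_mark w), shift (enn2real (first_event w)) w)) \<in> borel_measurable (world_space :: 'd world measure)"
      by (rule measurable_compose[OF measurable_Pair[OF _ s] H]) measurable
    have "(%w :: 'd world. indicator {..ennreal (clock w)} (first_event w) :: ennreal) = (%w. if first_event w \<le> ennreal (clock w) then 1 else 0)"
      by (auto simp: indicator_def)
    moreover have "(%w :: 'd world. if first_event w \<le> ennreal (clock w) then 1 else 0 :: ennreal) \<in> borel_measurable world_space"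
      by measurable
    ultimately show ?thesis
      unfolding measurable_cong_sets[OF sets_world refl] by (intro borel_measurable_times_ennreal 1) (simp only:)
  qed
  have I0m: "?I0 \<in> borel_measurable (world i)"
  proof -
    have "(%w :: 'd world. indicator {ennreal (clock w)<..} (first_event w) :: ennreal) = (%w. if ennreal (clock w) < first_event w then 1 else 0)"
      by (auto simp: indicator_def)
    moreover have "(%w :: 'd world. if ennreal (clock w) < first_event w then 1 else 0 :: ennreal) \<in> borel_measurable world_space"
      by measurable
    ultimately show ?thesis
      unfolding measurable_cong_sets[OF sets_world refl]
      by (intro borel_measurable_times_ennreal measurable_compose[OF measurable_clock Af]) (simp only:)
  qed
  have "mean x i = (\<integral>\<^sup>+w. ?I0 w + ?I1 w \<partial>world i)"
    unfolding mean_def using AE_state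
  proof (intro nn_integral_cong_AE, eventually_elim)
    fix w assume "state 0 w = i"
    then show "event_limit A D W X x w = ?I0 w + ?I1 w"
      by (subst event_limit_rec) (auto simp: H_def indicator_def not_less)
  qed
  also have "\<dots> = (\<integral>\<^sup>+w. ?I0 w \<partial>world i) + (\<integral>\<^sup>+w. ?I1 w \<partial>world i)"
    by (rule nn_integral_add[OF I0m I1m])
  also have "(\<integral>\<^sup>+w. ?I0 w \<partial>world i) = (\<integral>\<^sup>+u. ?e u * (ennreal beta * A i x u) \<partial>lborel)"
    by (rule nn_integral_no_event[OF Af])
  also have "(\<integral>\<^sup>+w. ?I1 w \<partial>world i) = (\<integral>\<^sup>+u. ?e u * jump_integral i (h u) \<partial>lborel)"
  proof -
    have e: "ennreal (r * exp (- total_rate i * u)) * indicator {0<..} u * a = ?e u * (ennreal r * a)" if "0 \<le> r" for r u a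
      by (simp only: ennreal_mult'[OF that]) (simp only: mult_ac)
    have "(\<integral>\<^sup>+w. ?I1 w \<partial>world i) = (\<integral>\<^sup>+u. ?e u * (ennreal (lam i) * (\<integral>\<^sup>+m. h u m i \<partial>B i)) \<partial>lborel)
      + (\<Sum>k\<in>UNIV - {i}. \<integral>\<^sup>+u. ?e u * (ennreal (Q $ i $ k) * (\<integral>\<^sup>+m. h u m k \<partial>C i k)) \<partial>lborel)"
      unfolding nn_integral_first_event[OF H] hH total_rate_def[symmetric]
      using renewal.lam Q_nonneg by (intro arg_cong2[where f = "(+)"] sum.cong nn_integral_cong e) auto
    also have "(\<Sum>k\<in>UNIV - {i}. \<integral>\<^sup>+u. ?e u * (ennreal (Q $ i $ k) * (\<integral>\<^sup>+m. h u m k \<partial>C i k)) \<partial>lborel)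
      = (\<integral>\<^sup>+u. (\<Sum>k\<in>UNIV - {i}. ?e u * (ennreal (Q $ i $ k) * (\<integral>\<^sup>+m. h u m k \<partial>C i k))) \<partial>lborel)"
      using mC by (intro nn_integral_sum[symmetric]) (auto intro!: borel_measurable_times_ennreal)
    also have "(\<integral>\<^sup>+u. ?e u * (ennreal (lam i) * (\<integral>\<^sup>+m. h u m i \<partial>B i)) \<partial>lborel) + \<dots>
      = (\<integral>\<^sup>+u. ?e u * (ennreal (lam i) * (\<integral>\<^sup>+m. h u m i \<partial>B i)) + (\<Sum>k\<in>UNIV - {i}. ?e u * (ennreal (Q $ i $ k) * (\<integral>\<^sup>+m. h u m k \<partial>C i k))) \<partial>lborel)"
      using mB mC by (intro nn_integral_add[symmetric]) (auto intro!: borel_measurable_times_ennreal borel_measurable_sum)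
    finally show ?thesis by (simp add: jump_integral_def distrib_left sum_distrib_left)
  qed
  also have "(\<integral>\<^sup>+u. ?e u * (ennreal beta * A i x u) \<partial>lborel) + (\<integral>\<^sup>+u. ?e u * jump_integral i (h u) \<partial>lborel)
    = (\<integral>\<^sup>+u. ?e u * (ennreal beta * A i x u) + ?e u * jump_integral i (h u) \<partial>lborel)"
    using Af mB mC unfolding jump_integral_def
    by (intro nn_integral_add[symmetric]) (auto intro!: borel_measurable_times_ennreal borel_measurable_add borel_measurable_sum)
  finally show ?thesis by (simp add: distrib_left h_def[abs_def])
qed

end

section \<open>The law of the world under the modulated input\<close>

context modulated_input
begin

definition algebra_of :: "'d source => 'a set set" where
  "algebra_of s = sets (case s of
          Chain => vimage_algebra (space M) (%\<omega> n. (Z n \<omega>, S n \<omega>)) (PiM UNIV (%n. count_space UNIV \<Otimes>\<^sub>M borel))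
        | Gap k n => vimage_algebra (space M) (G k n) borel
        | Claim k n => vimage_algebra (space M) (b k n) borel
        | Transition_Jump i j n => vimage_algebra (space M) (c i j n) borel
        | Clock => vimage_algebra (space M) T borel)"

text \<open>Grouping sources lets independence pass from the single ingredients to whole streams,
  tables and their combinations.\<close>

definition information :: "'d source set => 'a measure" where
  "information A = sigma (space M) (\<Union>s\<in>A. algebra_of s)"

lemma indep_algebras: "indep_sets algebra_of sources"
  using independent unfolding algebra_of_def .

lemma algebra_of_sub: "algebra_of s \<subseteq> Pow (space M)"
  unfolding algebra_of_def using sets.sets_into_space by (fastforce split: source.splits)

lemma space_information [simp]: "space (information A) = space M"
  using algebra_of_sub by (simp add: information_def space_measure_of UN_subset_iff)

lemma sets_information: "sets (information A) = sigma_sets (space M) (\<Union>s\<in>A. algebra_of s)"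
  unfolding information_def using algebra_of_sub by (intro sets_measure_of) blast

lemma indep_information:
  assumes "\<And>j. j \<in> L ==> A j \<subseteq> sources" "disjoint_family_on A L"
  shows "indep_sets (%j. sets (information (A j))) L"
  unfolding sets_information
proof (rule indep_sets_collect_sigma)
  show "indep_sets algebra_of (\<Union>j\<in>L. A j)"
    by (rule indep_sets_mono_index[OF _ indep_algebras]) (use assms(1) in blast)
  show "Int_stable (algebra_of s)" for s
    unfolding algebra_of_def Int_stable_def by auto
qed fact

text \<open>\<open>indep_sets\<close> includes the measurability of its sets, so it can be read off
  from a family with one member.\<close>

lemma information_le:
  assumes "A \<subseteq> sources" "E \<in> sets (information A)"
  shows "E \<in> sets M"
proof -
  have "indep_sets (%j::unit. sets (information A)) {()}"
    using indep_information[of "{()}" "%_. A"] assms(1) by (simp add: disjoint_family_on_def)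
  then show ?thesis using assms(2) by (auto simp: indep_sets_def)
qed

lemma information_measurable:
  assumes "A \<subseteq> sources" "X \<in> measurable (information A) N"
  shows "X \<in> measurable M N"
proof (rule measurableI)
  show "X \<omega> \<in> space N" if "\<omega> \<in> space M" for \<omega> using measurable_space[OF assms(2)] that by simp
  show "X -` E \<inter> space M \<in> sets M" if "E \<in> sets N" for E
    using information_le[OF assms(1) measurable_sets[OF assms(2) that]] by simp
qed

lemma law_pair:
  assumes A: "A \<subseteq> sources" "A' \<subseteq> sources" "A \<inter> A' = {}"
    and X: "X \<in> measurable (information A) N" and X': "X' \<in> measurable (information A') N'"
  shows "distr M (N \<Otimes>\<^sub>M N') (%\<omega>. (X \<omega>, X' \<omega>)) = distr M N X \<Otimes>\<^sub>M distr M N' X'"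
proof -
  note [measurable] = information_measurable[OF A(1) X] information_measurable[OF A(2) X']
  interpret D: prob_space "distr M N X" by (rule prob_space_distr) simp
  interpret D': prob_space "distr M N' X'" by (rule prob_space_distr) simp
  have "indep_sets (%j. sets (information (case_bool A A' j))) UNIV"
    by (rule indep_information) (use A in \<open>auto simp: disjoint_family_on_def split: bool.splits\<close>)
  note ind = this
  have prod: "prob (E \<inter> E') = prob E * prob E'" if "E \<in> sets (information A)" "E' \<in> sets (information A')" for E E'
  proof -
    have "prob (\<Inter>j\<in>UNIV. case_bool E E' j) = (\<Prod>j\<in>UNIV. prob (case_bool E E' j))"
      by (rule indep_setsD[OF ind]) (use that in \<open>auto split: bool.splits\<close>)
    then show ?thesis by (simp add: UNIV_bool Int_commute mult.commute)
  qed
  show ?thesis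
  proof (rule pair_measure_eqI[symmetric])
    show "sets (distr M N X \<Otimes>\<^sub>M distr M N' X') = sets (distr M (N \<Otimes>\<^sub>M N') (%\<omega>. (X \<omega>, X' \<omega>)))"
      by (simp cong: sets_pair_measure_cong)
    fix E E' assume "E \<in> sets (distr M N X)" "E' \<in> sets (distr M N' X')"
    then have E [measurable]: "E \<in> sets N" "E' \<in> sets N'" by simp_all
    have pre: "X -` E \<inter> space M \<in> sets (information A)" "X' -` E' \<inter> space M \<in> sets (information A')"
      using measurable_sets[OF X E(1)] measurable_sets[OF X' E(2)] by simp_all
    have "(%\<omega>. (X \<omega>, X' \<omega>)) -` (E \<times> E') \<inter> space M = (X -` E \<inter> space M) \<inter> (X' -` E' \<inter> space M)" by auto
    then have "emeasure (distr M (N \<Otimes>\<^sub>M N') (%\<omega>. (X \<omega>, X' \<omega>))) (E \<times> E')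
        = ennreal (prob ((X -` E \<inter> space M) \<inter> (X' -` E' \<inter> space M)))"
      by (subst emeasure_distr) (simp_all add: emeasure_eq_measure)
    also have "\<dots> = emeasure (distr M N X) E * emeasure (distr M N' X') E'"
      unfolding prod[OF pre] by (simp add: emeasure_distr emeasure_eq_measure ennreal_mult)
    finally show "emeasure (distr M N X) E * emeasure (distr M N' X') E' = emeasure (distr M (N \<Otimes>\<^sub>M N') (%\<omega>. (X \<omega>, X' \<omega>))) (E \<times> E')" ..
  qed (rule D.sigma_finite_measure_axioms D'.sigma_finite_measure_axioms)+
qed

lemma law_PiM:
  fixes A :: "'i => 'd source set"
  assumes A: "\<And>j. A j \<subseteq> sources" "disjoint_family_on A UNIV"
    and X: "\<And>j. X j \<in> measurable (information (A j)) N"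
  shows "distr M (PiM UNIV (%_. N)) (%\<omega> j. X j \<omega>) = PiM UNIV (%j. distr M N (X j))"
proof -
  have rv: "random_variable N (X j)" for j by (rule information_measurable[OF A(1) X])
  have "indep_sets (%j. sets (information (A j))) UNIV" by (rule indep_information[OF A])
  then have "indep_sets (%j. {X j -` E \<inter> space M |E. E \<in> sets N}) UNIV"
  proof (rule indep_sets_mono_sets)
    fix j show "{X j -` E \<inter> space M |E. E \<in> sets N} \<subseteq> sets (information (A j))"
      using measurable_sets[OF X[of j]] by auto
  qed
  then have "indep_vars (%_. N) X UNIV" unfolding indep_vars_def2 using rv by simp
  then show ?thesis
    using indep_vars_iff_distr_eq_PiM[of UNIV X "%_. N"] rv by (simp add: restrict_def)
qed

lemma source_information:
  "Gap k n \<in> A ==> G k n \<in> borel_measurable (information A)"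
  "Claim k n \<in> A ==> b k n \<in> borel_measurable (information A)"
  "Transition_Jump i j n \<in> A ==> c i j n \<in> borel_measurable (information A)"
  "Clock \<in> A ==> T \<in> borel_measurable (information A)"
  "Chain \<in> A ==> (%\<omega> n. (Z n \<omega>, S n \<omega>)) \<in> measurable (information A) chain_space"
proof -
  have main: "f \<in> measurable (information A) N"
    if "s \<in> A" "algebra_of s = sets (vimage_algebra (space M) f N)" "f \<in> space M \<rightarrow> space N" for s f N
  proof (rule measurableI)
    fix E assume "E \<in> sets N"
    then have "f -` E \<inter> space M \<in> algebra_of s"
      unfolding that(2) by (rule in_vimage_algebra)
    then show "f -` E \<inter> space (information A) \<in> sets (information A)"
      using that(1) unfolding sets_information by auto
  qed (use that(3) in auto)
  show "Gap k n \<in> A ==> G k n \<in> borel_measurable (information A)"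
    by (rule main[of "Gap k n"]) (auto simp: algebra_of_def)
  show "Claim k n \<in> A ==> b k n \<in> borel_measurable (information A)"
    by (rule main[of "Claim k n"]) (auto simp: algebra_of_def)
  show "Transition_Jump i j n \<in> A ==> c i j n \<in> borel_measurable (information A)"
    by (rule main[of "Transition_Jump i j n"]) (auto simp: algebra_of_def)
  show "Clock \<in> A ==> T \<in> borel_measurable (information A)"
    by (rule main[of Clock]) (auto simp: algebra_of_def)
  show "Chain \<in> A ==> (%\<omega> n. (Z n \<omega>, S n \<omega>)) \<in> measurable (information A) chain_space"
    by (rule main[of Chain]) (auto simp: algebra_of_def space_PiM space_pair_measure)
qed

lemma gap_law:
  assumes "0 \<le> lam k"
  shows "distr M borel (G k n) = waiting (lam k)"
proof (rule waiting_unique[OF _ _ assms])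
  show "prob_space (distr M borel (G k n))" by (rule prob_space_distr[OF G_measurable])
  fix t :: real assume "0 \<le> t"
  then show "emeasure (distr M borel (G k n)) {ennreal t<..} = ennreal (exp (- lam k * t))"
    using G_law[of t k n] G_measurable[of k n]
    by (subst emeasure_distr) (auto simp: emeasure_eq_measure vimage_def Int_def conj_commute)
qed simp

definition stream :: "'d => 'a => nat => ennreal \<times> real" where
  "stream k \<omega> = (%n. (G k n \<omega>, b k n \<omega>))"

definition vector :: "nat => 'a => 'd \<times> 'd => real" where
  "vector n \<omega> = (%p. if fst p = snd p then 0 else c (fst p) (snd p) n \<omega>)"

definition world_of :: "'a => 'd world" where
  "world_of \<omega> = (%n. (Z n \<omega>, S n \<omega>), %k. stream k \<omega>, %n. vector n \<omega>, T \<omega>)"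

lemma stream_information: "(\<And>n. Gap k n \<in> A \<and> Claim k n \<in> A) ==> stream k \<in> measurable (information A) mark_space"
  unfolding stream_def[abs_def] by (intro measurable_PiM_UNIV measurable_Pair source_information) auto

lemma vector_information:
  assumes "\<And>i j. i \<noteq> j ==> Transition_Jump i j n \<in> A"
  shows "vector n \<in> measurable (information A) (PiM UNIV (%_. borel))"
  unfolding vector_def[abs_def]
proof (rule measurable_PiM_UNIV)
  fix p :: "'d \<times> 'd"
  show "(%\<omega>. if fst p = snd p then 0 else c (fst p) (snd p) n \<omega>) \<in> borel_measurable (information A)"
    by (cases "fst p = snd p") (simp_all add: source_information assms)
qed

lemma stream_law:
  assumes "0 \<le> lam k"
  shows "distr M mark_space (stream k) = PiM UNIV (%_. waiting (lam k) \<Otimes>\<^sub>M B k)"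
proof -
  let ?A = "%n. {Gap k n, Claim k n}"
  have pair: "distr M (borel \<Otimes>\<^sub>M borel) (%\<omega>. (G k n \<omega>, b k n \<omega>)) = waiting (lam k) \<Otimes>\<^sub>M B k" for n
    using law_pair[of "{Gap k n}" "{Claim k n}" "G k n" borel "b k n" borel] gap_law[OF assms, of n] b_law[of k n]
    by (simp add: source_information sources_def)
  have "(%\<omega>. (G k n \<omega>, b k n \<omega>)) \<in> measurable (information (?A n)) (borel \<Otimes>\<^sub>M borel)" for n
    by (intro measurable_Pair source_information) auto
  from law_PiM[of ?A "%n \<omega>. (G k n \<omega>, b k n \<omega>)", OF _ _ this]
  show ?thesis unfolding stream_def[abs_def] pair by (auto simp: sources_def disjoint_family_on_def)
qed

lemma vector_law:
  "distr M (PiM UNIV (%_. borel)) (vector n) = PiM UNIV (%(i, j). if i = j then return borel 0 else C i j)"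
proof -
  let ?A = "%p. if fst p = snd p then {} else {Transition_Jump (fst p) (snd p) n} :: 'd source set"
  let ?X = "%p \<omega>. if fst p = snd p then 0 else c (fst p) (snd p) n \<omega> :: real"
  have "?X p \<in> borel_measurable (information (?A p))" for p
    by (cases "fst p = snd p") (simp_all add: source_information)
  from law_PiM[of ?A ?X, OF _ _ this]
  have "distr M (PiM UNIV (%_. borel)) (%\<omega> p. ?X p \<omega>) = PiM UNIV (%p. distr M borel (?X p))"
    by (auto simp: sources_def disjoint_family_on_def split: if_splits)
  moreover have "distr M borel (?X p) = (case p of (i, j) => if i = j then return borel 0 else C i j)" for p
    using c_law by (cases p) (auto simp: distr_const)
  ultimately show ?thesis unfolding vector_def[abs_def] by simp
qed

lemma clock_law: "distr M borel T = killing beta"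
proof -
  have "distr M borel T = distr M lborel T" by (rule distr_cong) auto
  also have "\<dots> = killing beta" using T_law by (simp add: distributed_def killing_def)
  finally show ?thesis .
qed

text \<open>The sources split into chain, streams, tables and clock, which \<open>law_pair\<close>
  joins one after the other; \<open>law_PiM\<close> splits the streams by state and the tables by
  transition number.\<close>

lemma world_of_law:
  assumes lam: "\<And>k. 0 \<le> lam k"
  shows "distr M world_space world_of = distr M chain_space (%\<omega> n. (Z n \<omega>, S n \<omega>)) \<Otimes>\<^sub>M
    (PiM UNIV (%k. PiM UNIV (%_::nat. waiting (lam k) \<Otimes>\<^sub>M B k)) \<Otimes>\<^sub>M
      (PiM UNIV (%_::nat. PiM UNIV (%(i, j). if i = j then return borel 0 else C i j)) \<Otimes>\<^sub>M killing beta))"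
    "world_of \<in> measurable M world_space"
proof -
  let ?A1 = "{Chain} :: 'd source set" and ?A2 = "(\<Union>k. range (Gap k) \<union> range (Claim k)) :: 'd source set"
  let ?A3 = "{Transition_Jump i j n |i j n. i \<noteq> j} :: 'd source set" and ?A4 = "{Clock} :: 'd source set"
  have chain: "(%\<omega> n. (Z n \<omega>, S n \<omega>)) \<in> measurable (information ?A1) chain_space"
    by (rule source_information) simp
  have str: "(%\<omega> k. stream k \<omega>) \<in> measurable (information A) component_space" if "?A2 \<subseteq> A" for A
    by (rule measurable_PiM_UNIV, rule stream_information) (use that in blast)
  have vec: "(%\<omega> n. vector n \<omega>) \<in> measurable (information A) transit_space" if "?A3 \<subseteq> A" for A
    by (rule measurable_PiM_UNIV, rule vector_information) (use that in blast)
  have clk: "T \<in> borel_measurable (information A)" if "?A4 \<subseteq> A" for A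
    using that by (intro source_information) auto
  have 1: "distr M (transit_space \<Otimes>\<^sub>M borel) (%\<omega>. (%n. vector n \<omega>, T \<omega>)) = distr M transit_space (%\<omega> n. vector n \<omega>) \<Otimes>\<^sub>M distr M borel T"
    by (rule law_pair[of ?A3 ?A4]) (auto simp: sources_def vec clk)
  have m34: "(%\<omega>. (%n. vector n \<omega>, T \<omega>)) \<in> measurable (information (?A3 \<union> ?A4)) (transit_space \<Otimes>\<^sub>M borel)"
    by (intro measurable_Pair vec clk) auto
  have 2: "distr M rest_space (%\<omega>. (%k. stream k \<omega>, %n. vector n \<omega>, T \<omega>))
      = distr M component_space (%\<omega> k. stream k \<omega>) \<Otimes>\<^sub>M distr M (transit_space \<Otimes>\<^sub>M borel) (%\<omega>. (%n. vector n \<omega>, T \<omega>))"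
    by (rule law_pair[of ?A2 "?A3 \<union> ?A4", OF _ _ _ str m34]) (auto simp: sources_def)
  have m234: "(%\<omega>. (%k. stream k \<omega>, %n. vector n \<omega>, T \<omega>)) \<in> measurable (information (?A2 \<union> (?A3 \<union> ?A4))) rest_space"
    by (intro measurable_Pair str vec clk) auto
  have 3: "distr M world_space world_of = distr M chain_space (%\<omega> n. (Z n \<omega>, S n \<omega>)) \<Otimes>\<^sub>M
      distr M rest_space (%\<omega>. (%k. stream k \<omega>, %n. vector n \<omega>, T \<omega>))"
    unfolding world_of_def[abs_def]
    by (rule law_pair[of ?A1 "?A2 \<union> (?A3 \<union> ?A4)", OF _ _ _ chain m234]) (auto simp: sources_def)
  have 4: "distr M component_space (%\<omega> k. stream k \<omega>) = PiM UNIV (%k. PiM UNIV (%_. waiting (lam k) \<Otimes>\<^sub>M B k))"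
    using law_PiM[of "%k. range (Gap k) \<union> range (Claim k)" stream mark_space] stream_law[OF lam]
    by (auto simp: sources_def disjoint_family_on_def stream_information)
  have 5: "distr M transit_space (%\<omega> n. vector n \<omega>) = PiM UNIV (%_. PiM UNIV (%(i, j). if i = j then return borel 0 else C i j))"
    using law_PiM[of "%n. {Transition_Jump i j n |i j. i \<noteq> j}" vector "PiM UNIV (%_. borel)"] vector_law
    by (auto simp: sources_def disjoint_family_on_def vector_information)
  show "distr M world_space world_of = distr M chain_space (%\<omega> n. (Z n \<omega>, S n \<omega>)) \<Otimes>\<^sub>M
    (PiM UNIV (%k. PiM UNIV (%_::nat. waiting (lam k) \<Otimes>\<^sub>M B k)) \<Otimes>\<^sub>M
      (PiM UNIV (%_::nat. PiM UNIV (%(i, j). if i = j then return borel 0 else C i j)) \<Otimes>\<^sub>M killing beta))"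
    unfolding 3 2 1 4 5 clock_law ..
  have "world_of \<in> measurable (information sources) world_space"
    unfolding world_of_def[abs_def]
    by (intro measurable_Pair source_information(5) str vec clk) (auto simp: sources_def)
  then show "world_of \<in> measurable M world_space" by (rule information_measurable[OF order_refl])
qed

lemma world_of_simps:
  "state n (world_of \<omega>) = Z n \<omega>" "sojourn n (world_of \<omega>) = S n \<omega>" "gap k n (world_of \<omega>) = G k n \<omega>"
  "claim k n (world_of \<omega>) = b k n \<omega>" "i \<noteq> j ==> transit i j n (world_of \<omega>) = c i j n \<omega>" "clock (world_of \<omega>) = T \<omega>"
  by (simp_all add: world_of_def state_def sojourn_def gap_def claim_def transit_def clock_def stream_def vector_def)

text \<open>The tables agree with \<open>c\<close> off the diagonal, and the jump sum of
  \<open>modulated_process\<close> runs over genuine changes of state.\<close>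

lemma free_world_of: "free r t (world_of \<omega>) = modulated_process Z S (%k. compound_poisson (r k) (G k) (b k)) c t \<omega>"
  unfolding free_def modulated_process_def compound_poisson_def epoch_def world_of_simps
  by (auto simp: world_of_simps intro!: sum.cong)

lemma phase_world_of: "phase t (world_of \<omega>) = chain_process Z S t \<omega>"
  unfolding phase_def chain_process_def epoch_def world_of_simps ..

end

section \<open>Renewal equations of the functionals\<close>

locale workload_law = world_law Q N lam B C beta
  for Q :: "real^'d^'d::finite" and N lam B C beta +
  fixes r :: "'d => real" and K :: real
  assumes drift: "\<And>i. r i < 0" and K: "0 < K"
    and B_nonneg: "\<And>i. AE m in B i. 0 \<le> m" and C_nonneg: "\<And>i k. i \<noteq> k ==> AE m in C i k. 0 \<le> m"
begin

definition out_rate :: "'d => real" where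
  "out_rate i = lam i - Q $ i $ i"

lemma out_rate: "0 \<le> out_rate i" "total_rate i = beta + out_rate i" "0 < total_rate i" "out_rate i < total_rate i"
  using renewal.lam[of i] Q_diag_nonpos[of i] beta by (auto simp: out_rate_def total_rate_def)

section \<open>Linear operations on the jump kernel and on integrals up to the hitting time of
  0\<close>

lemma jump_integral_mono:
  assumes "\<And>m k. 0 \<le> m ==> h m k \<le> h' m k"
  shows "jump_integral i h \<le> jump_integral i h'"
proof -
  have "(\<integral>\<^sup>+m. h m i \<partial>B i) \<le> (\<integral>\<^sup>+m. h' m i \<partial>B i)"
    using B_nonneg[of i] by (intro nn_integral_mono_AE) (auto elim!: eventually_mono intro: assms)
  moreover have "(\<integral>\<^sup>+m. h m k \<partial>C i k) \<le> (\<integral>\<^sup>+m. h' m k \<partial>C i k)" if "k \<noteq> i" for k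
    using C_nonneg[of i k] that by (intro nn_integral_mono_AE) (auto elim!: eventually_mono intro: assms)
  ultimately show ?thesis
    unfolding jump_integral_def by (intro add_mono mult_left_mono sum_mono) auto
qed

lemma jump_integral_cong:
  assumes "\<And>m k. 0 \<le> m ==> h m k = h' m k"
  shows "jump_integral i h = jump_integral i h'"
  by (intro antisym jump_integral_mono) (simp_all add: assms)

lemma borel_measurable_jump:
  "f \<in> borel_measurable borel ==> f \<in> borel_measurable (B i)"
  "f \<in> borel_measurable borel ==> i \<noteq> k ==> f \<in> borel_measurable (C i k)"
  using renewal.sets_B[of i] sets_C[of i k] by (auto cong: measurable_cong_sets)

lemma jump_integral_add:
  assumes "\<And>k. (%m. h m k) \<in> borel_measurable borel" "\<And>k. (%m. h' m k) \<in> borel_measurable borel"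
  shows "jump_integral i (%m k. h m k + h' m k) = jump_integral i h + jump_integral i h'"
proof -
  have "(\<integral>\<^sup>+m. h m i + h' m i \<partial>B i) = (\<integral>\<^sup>+m. h m i \<partial>B i) + (\<integral>\<^sup>+m. h' m i \<partial>B i)"
    by (intro nn_integral_add borel_measurable_jump assms)
  moreover have "(\<Sum>k\<in>UNIV - {i}. ennreal (Q $ i $ k) * (\<integral>\<^sup>+m. h m k + h' m k \<partial>C i k))
    = (\<Sum>k\<in>UNIV - {i}. ennreal (Q $ i $ k) * ((\<integral>\<^sup>+m. h m k \<partial>C i k) + (\<integral>\<^sup>+m. h' m k \<partial>C i k)))"
    by (intro sum.cong refl arg_cong2[where f = "(*)"] nn_integral_add borel_measurable_jump assms) auto
  ultimately show ?thesis
    by (simp add: jump_integral_def distrib_left sum.distrib add_ac)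
qed

lemma jump_integral_cmult:
  assumes "\<And>k. (%m. h m k) \<in> borel_measurable borel"
  shows "jump_integral i (%m k. a * h m k) = a * jump_integral i h"
proof -
  have "(\<integral>\<^sup>+m. a * h m i \<partial>B i) = a * (\<integral>\<^sup>+m. h m i \<partial>B i)"
    by (intro nn_integral_cmult borel_measurable_jump assms)
  moreover have "(\<Sum>k\<in>UNIV - {i}. ennreal (Q $ i $ k) * (\<integral>\<^sup>+m. a * h m k \<partial>C i k))
    = (\<Sum>k\<in>UNIV - {i}. ennreal (Q $ i $ k) * (a * (\<integral>\<^sup>+m. h m k \<partial>C i k)))"
    by (intro sum.cong refl arg_cong2[where f = "(*)"] nn_integral_cmult borel_measurable_jump assms) auto
  ultimately show ?thesis
    by (simp add: jump_integral_def distrib_left sum_distrib_left mult.left_commute)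
qed

lemma jump_integral_sum:
  assumes "finite A" "\<And>l k. (%m. h l m k) \<in> borel_measurable borel"
  shows "jump_integral i (%m k. \<Sum>l\<in>A. h l m k) = (\<Sum>l\<in>A. jump_integral i (h l))"
  using assms(1)
proof induction
  case empty
  then show ?case by (simp add: jump_integral_def)
next
  case (insert l A)
  then show ?case
    using jump_integral_add[of "h l" "%m k. \<Sum>l\<in>A. h l m k" i] assms(2) by simp
qed

lemma jump_integral_const: "jump_integral i (%_ _. a) = a * ennreal (out_rate i)"
proof -
  have "emeasure (B i) (space (B i)) = 1" by (rule prob_space.emeasure_space_1[OF renewal.prob_B])
  moreover have "emeasure (C i k) (space (C i k)) = 1" if "k \<noteq> i" for k
    using that by (intro prob_space.emeasure_space_1[OF prob_C]) auto
  ultimately have "jump_integral i (%_ _. a) = ennreal (lam i) * a + (\<Sum>k\<in>UNIV - {i}. ennreal (Q $ i $ k) * a)"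
    by (simp add: jump_integral_def)
  also have "(\<Sum>k\<in>UNIV - {i}. ennreal (Q $ i $ k) * a) = ennreal (\<Sum>k\<in>UNIV - {i}. Q $ i $ k) * a"
    using Q_nonneg[of i] by (subst sum_ennreal[symmetric]) (auto simp: sum_distrib_right)
  also have "ennreal (lam i) * a + \<dots> = a * ennreal (lam i + (\<Sum>k\<in>UNIV - {i}. Q $ i $ k))"
    using renewal.lam[of i] by (subst ennreal_plus) (auto intro!: sum_nonneg Q_nonneg simp: distrib_left mult.commute)
  finally show ?thesis by (simp add: out_rate_def Q_diag[symmetric])
qed

lemma jump_integral_measurable:
  assumes "\<And>k. (%p. h (fst p) (snd p) k) \<in> borel_measurable (borel \<Otimes>\<^sub>M borel)"
  shows "(%u :: real. jump_integral i (h u)) \<in> borel_measurable borel"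
proof -
  have int: "(%u :: real. \<integral>\<^sup>+m. h u m k \<partial>M) \<in> borel_measurable borel" if M: "prob_space M" "sets M = sets borel" for M k
  proof -
    interpret M: prob_space M by (rule M)
    have "(%p. h (fst p) (snd p) k) \<in> borel_measurable (borel \<Otimes>\<^sub>M M)"
      unfolding measurable_cong_sets[OF sets_pair_measure_cong[OF refl M(2)] refl] by (rule assms)
    from M.borel_measurable_nn_integral_fst[OF this] show ?thesis by simp
  qed
  have "(%u :: real. \<integral>\<^sup>+m. h u m i \<partial>B i) \<in> borel_measurable borel"
    by (rule int[OF renewal.prob_B renewal.sets_B])
  moreover have "(%u :: real. \<integral>\<^sup>+m. h u m k \<partial>C i k) \<in> borel_measurable borel" if "k \<in> UNIV - {i}" for k
    using that by (intro int prob_C sets_C) auto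
  ultimately show ?thesis
    unfolding jump_integral_def
    by (intro borel_measurable_add borel_measurable_sum borel_measurable_times_ennreal borel_measurable_const)
qed

definition before :: "'d => real => (real => ennreal) => ennreal" where
  "before i c g = (\<integral>\<^sup>+u. ennreal (exp (- total_rate i * u)) * indicator {0<..c} u * g u \<partial>lborel)"

lemma before_mono:
  assumes "\<And>u. 0 < u ==> u \<le> c ==> g u \<le> g' u"
  shows "before i c g \<le> before i c g'"
  unfolding before_def by (intro nn_integral_mono) (auto simp: indicator_def intro!: mult_left_mono assms)

lemma before_cong:
  assumes "\<And>u. 0 < u ==> u < c ==> g u = g' u"
  shows "before i c g = before i c g'"
  unfolding before_def using AE_lborel_singleton[of c]
  by (intro nn_integral_cong_AE) (auto elim!: eventually_mono simp: indicator_def assms)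

lemma before_add:
  assumes [measurable]: "g \<in> borel_measurable borel" "g' \<in> borel_measurable borel"
  shows "before i c (%u. g u + g' u) = before i c g + before i c g'"
  unfolding before_def distrib_left by (rule nn_integral_add) measurable

lemma before_cmult:
  assumes [measurable]: "g \<in> borel_measurable borel"
  shows "before i c (%u. a * g u) = a * before i c g"
  unfolding before_def mult.left_commute[of _ a] by (rule nn_integral_cmult) measurable

lemma before_sum:
  assumes "finite A" "\<And>l. g l \<in> borel_measurable borel"
  shows "before i c (%u. \<Sum>l\<in>A. g l u) = (\<Sum>l\<in>A. before i c (g l))"
  using assms(1)
proof induction
  case empty
  then show ?case by (simp add: before_def)
next
  case (insert l A)
  then show ?case using before_add[of "g l" "%u. \<Sum>l\<in>A. g l u" i c] assms(2) by simp
qed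

lemma nn_integral_exp:
  assumes "0 < a"
  shows "(\<integral>\<^sup>+u. ennreal (exp (- a * u)) * indicator {0<..} u \<partial>lborel) = ennreal (1 / a)"
proof -
  have "(\<integral>\<^sup>+u. ennreal (exp (- a * u)) * indicator {0<..} u \<partial>lborel) = (\<integral>\<^sup>+u. ennreal (exp (- a * u)) * indicator {0..} u \<partial>lborel)"
    using AE_lborel_singleton[of 0] by (intro nn_integral_cong_AE) (auto elim!: eventually_mono simp: indicator_def)
  also have "\<dots> = ennreal (0 - (- exp (- a * 0) / a))"
  proof (rule nn_integral_FTC_atLeast)
    fix u :: real
    show "DERIV (%u. - exp (- a * u) / a) u :> exp (- a * u)"
      using assms by (auto intro!: derivative_eq_intros)
    have "((%u. - exp (- (a * u)) / a) \<longlongrightarrow> - 0 / a) at_top"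
      by (intro tendsto_intros filterlim_compose[OF exp_at_bot])
        (use assms in \<open>auto intro!: filterlim_uminus_at_bot_at_top[THEN filterlim_compose] filterlim_tendsto_pos_mult_at_top[OF tendsto_const] filterlim_ident\<close>)
    then show "((%u. - exp (- a * u) / a) \<longlongrightarrow> 0) at_top" by simp
  qed simp_all
  finally show ?thesis by simp
qed

text \<open>Translation by \<open>c\<close> in the second part: an exponential factor comes out, and
  the same integral reappears with \<open>g\<close> started at \<open>c\<close>.\<close>

lemma split_before:
  assumes [measurable]: "g \<in> borel_measurable borel" and c: "0 \<le> c"
  shows "(\<integral>\<^sup>+u. ennreal (exp (- total_rate i * u)) * indicator {0<..} u * g u \<partial>lborel)
    = before i c g + ennreal (exp (- total_rate i * c)) *
      (\<integral>\<^sup>+v. ennreal (exp (- total_rate i * v)) * indicator {0<..} v * g (c + v) \<partial>lborel)"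
proof -
  let ?f = "%u. ennreal (exp (- total_rate i * u)) * indicator {c<..} u * g u"
  have "(\<integral>\<^sup>+u. ennreal (exp (- total_rate i * u)) * indicator {0<..} u * g u \<partial>lborel)
    = (\<integral>\<^sup>+u. ennreal (exp (- total_rate i * u)) * indicator {0<..c} u * g u + ?f u \<partial>lborel)"
    using c by (intro nn_integral_cong) (auto simp: indicator_def)
  also have "\<dots> = before i c g + (\<integral>\<^sup>+u. ?f u \<partial>lborel)"
    unfolding before_def by (rule nn_integral_add) measurable
  also have "(\<integral>\<^sup>+u. ?f u \<partial>lborel) = (\<integral>\<^sup>+v. ?f (c + 1 * v) \<partial>lborel)"
    by (subst nn_integral_real_affine[of ?f 1 c]) simp_all
  also have "\<dots> = (\<integral>\<^sup>+v. ennreal (exp (- total_rate i * c)) * (ennreal (exp (- total_rate i * v)) * indicator {0<..} v * g (c + v)) \<partial>lborel)"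
  proof (rule nn_integral_cong)
    fix v :: real
    have "exp (- total_rate i * (c + 1 * v)) = exp (- total_rate i * c) * exp (- total_rate i * v)"
      by (subst exp_add[symmetric]) (simp add: algebra_simps)
    moreover have "indicator {c<..} (c + 1 * v) = (indicator {0<..} v :: ennreal)" by (simp add: indicator_def)
    ultimately show "?f (c + 1 * v) = ennreal (exp (- total_rate i * c)) * (ennreal (exp (- total_rate i * v)) * indicator {0<..} v * g (c + v))"
      by (simp only: ennreal_mult'[OF exp_ge_zero] mult_1 mult.assoc)
  qed
  also have "\<dots> = ennreal (exp (- total_rate i * c)) * (\<integral>\<^sup>+v. ennreal (exp (- total_rate i * v)) * indicator {0<..} v * g (c + v) \<partial>lborel)"
    by (rule nn_integral_cmult) measurable
  finally show ?thesis .
qed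

lemma before_const:
  assumes "0 \<le> c"
  shows "before i c (%_. ennreal a) = ennreal ((1 - exp (- total_rate i * c)) / total_rate i) * ennreal a"
proof -
  have e: "exp (- total_rate i * c) \<le> 1" using assms out_rate(3)[of i] by simp
  have I: "(\<integral>\<^sup>+u. ennreal (exp (- total_rate i * u)) * indicator {0<..} u * 1 \<partial>lborel) = ennreal (1 / total_rate i)"
    using nn_integral_exp[OF out_rate(3)] by simp
  \<comment> \<open>The splitting identity for the constant 1 determines the integral up to
    \<open>c\<close>, which is then isolated by subtraction.\<close>
  have "ennreal (1 / total_rate i) = before i c (%_. 1) + ennreal (exp (- total_rate i * c)) * ennreal (1 / total_rate i)"
    using split_before[of "%_. 1" c i] assms unfolding I by simp
  also have "ennreal (exp (- total_rate i * c)) * ennreal (1 / total_rate i) = ennreal (exp (- total_rate i * c) / total_rate i)"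
    using out_rate(3)[of i] by (simp add: ennreal_mult[symmetric])
  finally have "before i c (%_. 1) = ennreal (1 / total_rate i) - ennreal (exp (- total_rate i * c) / total_rate i)"
    by simp
  also have "\<dots> = ennreal ((1 - exp (- total_rate i * c)) / total_rate i)"
    using out_rate(3)[of i] by (subst ennreal_minus) (auto simp: diff_divide_distrib)
  finally show ?thesis using before_cmult[of "%_. 1" i c "ennreal a"] by (simp add: mult.commute)
qed

definition hit :: "'d => real => real" where
  "hit i x = x / - r i"

lemma hit_iff: "hit i x \<le> u \<longleftrightarrow> x + r i * u \<le> 0" "u \<le> hit i x \<longleftrightarrow> 0 \<le> x + r i * u"
  using drift_iff[OF drift] unfolding hit_def by blast+

lemma hit_nonneg: "0 \<le> x ==> 0 \<le> hit i x" and hit_0 [simp]: "hit i 0 = 0" and at_hit [simp]: "x + r i * hit i x = 0"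
  using drift[of i] by (auto simp: hit_def divide_nonneg_neg)

text \<open>The expectation of \<open>F\<close> after the first event, on the event that this
  precedes both the clock and the hitting time of 0 and does not carry the level above
  \<open>K\<close>.\<close>

definition pass :: "'d => real => (real => 'd => ennreal) => ennreal" where
  "pass i x F = before i (hit i x) (%u. jump_integral i (%m k. of_bool (x + r i * u + m \<le> K) * F (x + r i * u + m) k))"

lemma pass_measurable:
  assumes F: "\<And>k. (%y. F y k) \<in> borel_measurable borel"
  shows "(%m. of_bool (x + r i * u + m \<le> K) * F (x + r i * u + m) k) \<in> borel_measurable borel"
    and "(%u. jump_integral i (%m k. of_bool (x + r i * u + m \<le> K) * F (x + r i * u + m) k)) \<in> borel_measurable borel"
proof -
  note [measurable] = F
  show "(%m. of_bool (x + r i * u + m \<le> K) * F (x + r i * u + m) k) \<in> borel_measurable borel"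
    unfolding of_bool_def by measurable
  have "(%p. (if x + r i * fst p + snd p \<le> K then 1 else 0) * F (x + r i * fst p + snd p) k) \<in> borel_measurable (borel \<Otimes>\<^sub>M borel)" for k
    by measurable
  then show "(%u. jump_integral i (%m k. of_bool (x + r i * u + m \<le> K) * F (x + r i * u + m) k)) \<in> borel_measurable borel"
    unfolding of_bool_def by (intro jump_integral_measurable) simp
qed

lemma pass_mono:
  assumes "\<And>y k. 0 \<le> y ==> y \<le> K ==> F y k \<le> G y k"
  shows "pass i x F \<le> pass i x G"
  unfolding pass_def
proof (intro before_mono jump_integral_mono)
  fix u m k assume "u \<le> hit i x" "0 \<le> (m :: real)"
  then have "0 \<le> x + r i * u + m" unfolding hit_iff by simp
  then show "of_bool (x + r i * u + m \<le> K) * F (x + r i * u + m) k \<le> of_bool (x + r i * u + m \<le> K) * G (x + r i * u + m) k"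
    using assms by (cases "x + r i * u + m \<le> K") auto
qed

lemma pass_add:
  assumes "\<And>k. (%y. F y k) \<in> borel_measurable borel" "\<And>k. (%y. G y k) \<in> borel_measurable borel"
  shows "pass i x (%y k. F y k + G y k) = pass i x F + pass i x G"
  unfolding pass_def distrib_left
  by (subst jump_integral_add; (subst before_add)?; intro pass_measurable assms refl)

lemma pass_cmult:
  assumes "\<And>k. (%y. F y k) \<in> borel_measurable borel"
  shows "pass i x (%y k. a * F y k) = a * pass i x F"
  unfolding pass_def mult.left_commute[of _ a]
  by (subst jump_integral_cmult; (subst before_cmult)?; intro pass_measurable assms refl)

lemma pass_sum:
  assumes "finite A" "\<And>l k. (%y. F l y k) \<in> borel_measurable borel"
  shows "pass i x (%y k. \<Sum>l\<in>A. F l y k) = (\<Sum>l\<in>A. pass i x (F l))"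
  using assms(1)
proof induction
  case empty
  then show ?case by (simp add: pass_def before_def jump_integral_def)
next
  case (insert l A)
  then show ?case using pass_add[of "F l" "%y k. \<Sum>l\<in>A. F l y k" i x] assms(2) by simp
qed

lemma pass_const_le:
  assumes "0 \<le> x" "0 \<le> a"
  shows "pass i x (%_ _. ennreal a) \<le> ennreal (out_rate i / total_rate i * (1 - exp (- total_rate i * hit i x)) * a)"
proof -
  have e: "exp (- total_rate i * hit i x) \<le> 1" using hit_nonneg[OF assms(1)] out_rate(3)[of i] by simp
  have "pass i x (%_ _. ennreal a) \<le> before i (hit i x) (%_. jump_integral i (%_ _. ennreal a))"
    unfolding pass_def by (intro before_mono jump_integral_mono) (auto split: split_of_bool)
  also have "jump_integral i (%_ _. ennreal a) = ennreal (a * out_rate i)"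
    using assms out_rate(1) by (simp add: jump_integral_const ennreal_mult)
  also have "before i (hit i x) (%_. ennreal (a * out_rate i)) =
    ennreal ((1 - exp (- total_rate i * hit i x)) / total_rate i * (a * out_rate i))"
    using e out_rate(1,3)[of i] assms by (simp add: before_const hit_nonneg ennreal_mult[symmetric])
  finally show ?thesis by (simp add: mult_ac)
qed

text \<open>Monotonicity of \<open>pass\<close> and its contraction of constants shrink any bound on
  the excess of \<open>F\<close> over \<open>G\<close> by a fixed factor below 1. It suffices to
  have the inequalities on [0, K], since \<open>pass\<close> evaluates its argument there
  only.\<close>

lemma comparison:
  assumes F: "\<And>k. (%y. F y k) \<in> borel_measurable borel" and G: "\<And>k. (%y. G y k) \<in> borel_measurable borel"
    and bound: "\<And>y k. 0 \<le> y ==> y \<le> K ==> F y k \<le> ennreal M" and M: "0 \<le> M"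
    and sub: "\<And>y k. 0 \<le> y ==> y \<le> K ==> F y k \<le> a y k + pass k y F"
    and super: "\<And>y k. 0 \<le> y ==> y \<le> K ==> a y k + pass k y G \<le> G y k"
    and x: "0 \<le> x" "x \<le> K"
  shows "F x i \<le> G x i"
proof -
  \<comment> \<open>The largest probability, over the finitely many states, that an event precedes
    the clock; it is below 1 because \<open>beta\<close> is positive.\<close>
  define \<kappa> where "\<kappa> = Max (range (%i. out_rate i / total_rate i))"
  have ratio: "0 \<le> out_rate i / total_rate i" "out_rate i / total_rate i < 1" for i
    using out_rate[of i] by (auto simp: divide_simps)
  have \<kappa>_ge: "out_rate i / total_rate i \<le> \<kappa>" for i unfolding \<kappa>_def by (intro Max_ge) auto
  have "\<kappa> \<in> range (%i. out_rate i / total_rate i)" unfolding \<kappa>_def by (intro Max_in) auto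
  then have \<kappa>: "0 \<le> \<kappa>" "\<kappa> < 1" using ratio by auto
  have "\<forall>y k. 0 \<le> y \<longrightarrow> y \<le> K \<longrightarrow> F y k \<le> G y k + ennreal (\<kappa> ^ n * M)" for n
  proof (induction n)
    case 0
    then show ?case using bound by (auto intro: add_increasing)
  next
    case (Suc n)
    show ?case
    proof (intro allI impI)
      fix y k assume y: "0 \<le> y" "y \<le> K"
      have "F y k \<le> a y k + pass k y (%y k. G y k + ennreal (\<kappa> ^ n * M))"
        using Suc by (intro order_trans[OF sub[OF y]] add_left_mono pass_mono) auto
      also have "\<dots> = (a y k + pass k y G) + pass k y (%_ _. ennreal (\<kappa> ^ n * M))"
        by (subst pass_add[OF G]) (simp_all add: add.assoc)
      also have "\<dots> \<le> G y k + ennreal (\<kappa> ^ Suc n * M)"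
      proof (intro add_mono super[OF y])
        have "0 \<le> exp (- total_rate k * hit k y)" "exp (- total_rate k * hit k y) \<le> 1"
          using hit_nonneg[OF y(1), of k] out_rate(3)[of k] by auto
        then have "out_rate k / total_rate k * (1 - exp (- total_rate k * hit k y)) \<le> \<kappa> * 1"
          using \<kappa>_ge[of k] \<kappa> by (intro mult_mono) auto
        from mult_right_mono[OF this, of "\<kappa> ^ n * M"]
        show "pass k y (%_ _. ennreal (\<kappa> ^ n * M)) \<le> ennreal (\<kappa> ^ Suc n * M)"
          using \<kappa> M y by (intro order_trans[OF pass_const_le] ennreal_leI) (auto simp: mult_ac)
      qed
      finally show "F y k \<le> G y k + ennreal (\<kappa> ^ Suc n * M)" .
    qed
  qed
  then have le: "F x i \<le> G x i + ennreal (\<kappa> ^ n * M)" for n using x by blast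
  have "(%n. \<kappa> ^ n * M) \<longlonglongrightarrow> 0 * M"
    using \<kappa> by (intro tendsto_mult LIMSEQ_power_zero tendsto_const) auto
  then have "(%n. G x i + ennreal (\<kappa> ^ n * M)) \<longlonglongrightarrow> G x i + ennreal 0"
    by (intro tendsto_add tendsto_const tendsto_ennrealI) simp
  then show ?thesis using le by (intro LIMSEQ_le_const[of _ "G x i"]) auto
qed

lemma uniqueness:
  assumes "\<And>k. (%y. F y k) \<in> borel_measurable borel" "\<And>k. (%y. G y k) \<in> borel_measurable borel"
    and "\<And>y k. 0 \<le> y ==> y \<le> K ==> F y k \<le> ennreal M" "\<And>y k. 0 \<le> y ==> y \<le> K ==> G y k \<le> ennreal M" "0 \<le> M"
    and "\<And>y k. 0 \<le> y ==> y \<le> K ==> F y k = a y k + pass k y F" "\<And>y k. 0 \<le> y ==> y \<le> K ==> G y k = a y k + pass k y G"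
    and "0 \<le> x" "x \<le> K"
  shows "F x i = G x i"
proof (rule antisym)
  show "F x i \<le> G x i"
    by (rule comparison[of F G M a])
      (fact assms | rule eq_refl[OF assms(6)] eq_refl[OF sym[OF assms(7)]]; assumption)+
  show "G x i \<le> F x i"
    by (rule comparison[of G F M a])
      (fact assms | rule eq_refl[OF assms(7)] eq_refl[OF sym[OF assms(6)]]; assumption)+
qed

end

section \<open>The renewal equations of the five functionals\<close>

context workload_law
begin

lemma tail_const: "(\<integral>\<^sup>+v. ennreal (exp (- total_rate i * v)) * indicator {0<..} v * a \<partial>lborel) = ennreal (1 / total_rate i) * a"
  using nn_integral_exp[OF out_rate(3), of i] by (subst nn_integral_multc) simp_all

text \<open>\<open>mean_eq\<close> with the time integral cut at \<open>hit i x\<close>: before the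
  cut the functionals share the term \<open>pass\<close>, after it each behaves in its own
  way.\<close>

lemma mean_split:
  fixes A :: "'d => real => real => ennreal" and D :: "'d => real => real => real => 'd world => ennreal"
    and W :: "'d => real => real => real => ennreal" and X :: "'d => real => real => real => real"
  assumes E: "event_functional Q N lam B C beta A D W X" and x: "0 \<le> x"
  defines "F \<equiv> %x i. \<integral>\<^sup>+w. event_limit A D W X x w \<partial>world i"
  defines "g \<equiv> %i x u. ennreal beta * A i x u + jump_integral i (%m k. (\<integral>\<^sup>+w. D i x u m w \<partial>world k) + W i x u m * F (X i x u m) k)"
  shows "F x i = before i (hit i x) (g i x) + ennreal (exp (- total_rate i * hit i x)) *
      (\<integral>\<^sup>+v. ennreal (exp (- total_rate i * v)) * indicator {0<..} v * g i x (hit i x + v) \<partial>lborel)"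
    and "F x i = (\<integral>\<^sup>+v. ennreal (exp (- total_rate i * v)) * indicator {0<..} v * g i x v \<partial>lborel)"
    and "(%x. F x i) \<in> borel_measurable borel"
proof -
  interpret event_functional Q N lam B C beta A D W X by (rule E)
  have F: "F = mean" unfolding F_def mean_def by (rule refl)
  show "(%x. F x i) \<in> borel_measurable borel" unfolding F by (rule mean_measurable)
  show eq: "F x i = (\<integral>\<^sup>+v. ennreal (exp (- total_rate i * v)) * indicator {0<..} v * g i x v \<partial>lborel)"
    unfolding F g_def by (rule mean_eq)
  have xp: "(%p :: real \<times> real. (x, p)) \<in> measurable (borel \<Otimes>\<^sub>M borel) (borel \<Otimes>\<^sub>M (borel \<Otimes>\<^sub>M borel))"
    by (intro measurable_Pair measurable_const) simp_all
  have "(%p. D i x (fst (fst p)) (snd (fst p)) (snd p)) \<in> borel_measurable ((borel \<Otimes>\<^sub>M borel) \<Otimes>\<^sub>M (world_space :: 'd world measure))"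
    using measurable_compose[OF measurable_Pair[OF measurable_compose[OF measurable_fst xp] measurable_snd] D_meas] by simp
  then have "(%p. D i x (fst (fst p)) (snd (fst p)) (snd p)) \<in> borel_measurable ((borel \<Otimes>\<^sub>M borel) \<Otimes>\<^sub>M world k)" for k
    unfolding measurable_cong_sets[OF sets_pair_measure_cong[OF refl sets_world] refl] .
  from world.borel_measurable_nn_integral_fst[OF this]
  have 1: "(%p. \<integral>\<^sup>+w. D i x (fst p) (snd p) w \<partial>world k) \<in> borel_measurable (borel \<Otimes>\<^sub>M borel)" for k by simp
  have 2: "(%p. W i x (fst p) (snd p)) \<in> borel_measurable (borel \<Otimes>\<^sub>M borel)"
    using measurable_compose[OF xp W_meas] by simp
  have "(%p. X i x (fst p) (snd p)) \<in> borel_measurable (borel \<Otimes>\<^sub>M borel)"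
    using measurable_compose[OF xp X_meas] by simp
  from measurable_compose[OF this mean_measurable]
  have 3: "(%p. F (X i x (fst p) (snd p)) k) \<in> borel_measurable (borel \<Otimes>\<^sub>M borel)" for k unfolding F .
  have A: "(%u. A i x u) \<in> borel_measurable borel"
    using measurable_compose[OF measurable_Pair1' A_meas, of x] by simp
  have "g i x \<in> borel_measurable borel"
    unfolding g_def
    by (intro borel_measurable_add borel_measurable_times_ennreal borel_measurable_const A jump_integral_measurable 1 2 3)
  from split_before[OF this hit_nonneg[OF x], of i] eq
  show "F x i = before i (hit i x) (g i x) + ennreal (exp (- total_rate i * hit i x)) *
      (\<integral>\<^sup>+v. ennreal (exp (- total_rate i * v)) * indicator {0<..} v * g i x (hit i x + v) \<partial>lborel)"
    by simp
qed

lemma AE_clock: "AE w in world i. clock w \<noteq> 0"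
proof -
  let ?f = "%w :: 'd world. if clock w = 0 then 1 else 0 :: ennreal"
  have f: "?f \<in> borel_measurable world_space" by measurable
  have k0: "(\<integral>\<^sup>+t. (if t = 0 then 1 else 0) \<partial>killing beta) = 0"
  proof -
    have "(\<integral>\<^sup>+t. (if t = 0 then 1 else 0) \<partial>killing beta) = (\<integral>\<^sup>+t. ennreal (exponential_density beta t) * (if t = 0 then 1 else 0) \<partial>lborel)"
      unfolding killing_def by (rule nn_integral_density) measurable
    also have "\<dots> = (\<integral>\<^sup>+t. 0 \<partial>(lborel :: real measure))"
    proof (rule nn_integral_cong_AE)
      show "AE t in lborel. ennreal (exponential_density beta t) * (if t = 0 then 1 else 0) = 0"
        using AE_lborel_singleton[of 0] by eventually_elim simp
    qed
    finally show ?thesis by simp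
  qed
  have "(\<integral>\<^sup>+w. ?f w \<partial>world i) = (\<integral>\<^sup>+\<xi>. \<integral>\<^sup>+v. ?f (\<xi>, v) \<partial>rest \<partial>N i)"
    unfolding world_def
    by (rule rest.nn_integral_fst[symmetric]) (use f measurable_cong_sets[OF sets_world refl] in \<open>auto simp: world_def\<close>)
  also have "\<dots> = (\<integral>\<^sup>+\<xi>. 0 \<partial>N i)"
  proof (rule nn_integral_cong)
    fix \<xi> :: "nat => 'd \<times> ennreal"
    have "(%v. ?f (\<xi>, v)) \<in> borel_measurable rest_space"
      by (rule measurable_compose[OF _ f]) (simp add: space_PiM space_pair_measure)
    from nn_integral_rest[OF this] show "(\<integral>\<^sup>+v. ?f (\<xi>, v) \<partial>rest) = 0"
      by (simp add: clock_def k0)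
  qed
  finally have "(\<integral>\<^sup>+w. ?f w \<partial>world i) = 0" by simp
  then have "AE w in world i. ?f w = 0"
    using f measurable_cong_sets[OF sets_world refl] by (subst (asm) nn_integral_0_iff_AE) auto
  then show ?thesis by eventually_elim (auto split: if_splits)
qed

lemma minus_functional: "event_functional Q N lam B C beta (minus_early r l) (minus_late r l) (inside r K) (move r)"
  by (unfold_locales; (unfold minus_early_def minus_late_def inside_def move_def of_bool_def)?; measurable)

lemma star_functional: "event_functional Q N lam B C beta (star_early r a j) (star_late r K a j) (inside r K) (move r)"
  by (unfold_locales; (unfold star_early_def star_late_def inside_def move_def of_bool_def)?; measurable)

lemma tilde_functional: "event_functional Q N lam B C beta (%_ _ _. 0) (tilde_late r K a l) (inside r K) (move r)"
  by (unfold_locales; (unfold tilde_late_def inside_def move_def of_bool_def)?; measurable)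

lemma eta_functional: "event_functional Q N lam B C beta (%_ _ _. 0) (eta_late r K a l) (inside_top r K) (move r)"
  by (unfold_locales; (unfold eta_late_def inside_top_def move_def of_bool_def)?; measurable)

lemma chi_functional: "event_functional Q N lam B C beta (chi_early r a1 a2 j) (%_ _ _ _ _. 0) (chi_weight r K a2 a3) (chi_move r K)"
  by (unfold_locales; (unfold chi_early_def chi_weight_def chi_move_def of_bool_def)?; measurable)

definition "minus_mean l x i = (\<integral>\<^sup>+w. event_limit (minus_early r l) (minus_late r l) (inside r K) (move r) x w \<partial>world i)"
definition "star_mean a j x i = (\<integral>\<^sup>+w. event_limit (star_early r a j) (star_late r K a j) (inside r K) (move r) x w \<partial>world i)"
definition "tilde_mean a l x i = (\<integral>\<^sup>+w. event_limit (%_ _ _. 0) (tilde_late r K a l) (inside r K) (move r) x w \<partial>world i)"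
definition "eta_mean a l x i = (\<integral>\<^sup>+w. event_limit (%_ _ _. 0) (eta_late r K a l) (inside_top r K) (move r) x w \<partial>world i)"
definition "chi_mean a1 a2 a3 j x i = (\<integral>\<^sup>+w. event_limit (chi_early r a1 a2 j) (%_ _ _ _ _. 0) (chi_weight r K a2 a3) (chi_move r K) x w \<partial>world i)"

lemmas mean_defs = minus_mean_def star_mean_def tilde_mean_def eta_mean_def chi_mean_def

lemma means_measurable:
  "(%x. minus_mean l x i) \<in> borel_measurable borel" "(%x. star_mean a j x i) \<in> borel_measurable borel"
  "(%x. tilde_mean a l x i) \<in> borel_measurable borel" "(%x. eta_mean a l x i) \<in> borel_measurable borel"
  "(%x. chi_mean a1 a2 a3 j x i) \<in> borel_measurable borel"
  unfolding mean_defs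
  by (rule mean_split(3)[OF minus_functional order_refl] mean_split(3)[OF star_functional order_refl]
      mean_split(3)[OF tilde_functional order_refl] mean_split(3)[OF eta_functional order_refl] mean_split(3)[OF chi_functional order_refl])+

lemma before_hit: "u < hit i x ==> 0 < x + r i * u" and after_hit: "x + r i * (hit i x + v) = r i * v"
  using hit_iff[where i = i and x = x and u = u] drift[of i] by (auto simp: hit_def field_simps not_le)

text \<open>With probability \<open>exp (- total_rate i * hit i x)\<close> the line reaches 0 before
  clock and events, and then only \<open>i = l\<close> counts. Otherwise the path has to survive the
  first event inside the strip.\<close>

lemma minus_mean_eq:
  assumes x: "0 \<le> x"
  shows "minus_mean l x i = ennreal (exp (- total_rate i * hit i x)) * of_bool (i = l) + pass i x (minus_mean l)"
proof -
  let ?t = "\<integral>\<^sup>+v. ennreal (exp (- total_rate i * v)) * indicator {0<..} v *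
    (ennreal beta * minus_early r l i x (hit i x + v) + jump_integral i (%m k. (\<integral>\<^sup>+w. minus_late r l i x (hit i x + v) m w \<partial>world k)
      + inside r K i x (hit i x + v) m * minus_mean l (move r i x (hit i x + v) m) k)) \<partial>lborel"
  \<comment> \<open>Beyond the hitting time clock and event give the same value; their rates
    \<open>beta\<close> and \<open>out_rate i\<close> add up to \<open>total_rate i\<close>, which
    cancels against the integral of the exponential.\<close>
  have "?t = (\<integral>\<^sup>+v. ennreal (exp (- total_rate i * v)) * indicator {0<..} v * (ennreal (total_rate i) * of_bool (i = l)) \<partial>lborel)"
  proof (rule nn_integral_cong, goal_cases)
    case (1 v)
    have *: "r i * v < 0" if "0 < v" using drift[of i] that by (rule mult_neg_pos)
    have "ennreal beta + ennreal (out_rate i) = ennreal (total_rate i)"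
      unfolding out_rate(2) using beta out_rate(1)[of i] by (subst ennreal_plus) auto
    then show ?case
      using * by (cases "0 < v"; cases "i = l")
        (simp_all add: minus_early_def minus_late_def inside_def after_hit world.emeasure_space_1 jump_integral_const less_imp_le not_le)
  qed
  also have "\<dots> = ennreal (1 / total_rate i) * (ennreal (total_rate i) * of_bool (i = l))" by (rule tail_const)
  also have "\<dots> = of_bool (i = l)"
    using out_rate(3)[of i] by (simp add: mult.assoc[symmetric] ennreal_mult[symmetric])
  finally have t: "?t = of_bool (i = l)" .
  have "before i (hit i x) (%u. ennreal beta * minus_early r l i x u + jump_integral i (%m k. (\<integral>\<^sup>+w. minus_late r l i x u m w \<partial>world k)
      + inside r K i x u m * minus_mean l (move r i x u m) k)) = pass i x (minus_mean l)"
    unfolding pass_def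
  proof (rule before_cong)
    fix u assume u: "u < hit i x"
    show "ennreal beta * minus_early r l i x u + jump_integral i (%m k. (\<integral>\<^sup>+w. minus_late r l i x u m w \<partial>world k)
      + inside r K i x u m * minus_mean l (move r i x u m) k) = jump_integral i (%m k. of_bool (x + r i * u + m \<le> K) * minus_mean l (x + r i * u + m) k)"
      using before_hit[OF u] by (simp add: minus_early_def minus_late_def inside_def move_def less_imp_le)
  qed
  then show ?thesis
    using mean_split(1)[OF minus_functional[of l] x, of i] t unfolding minus_mean_def[symmetric] by (simp add: add.commute)
qed

text \<open>The contribution of the clock ringing while the line is still above 0;
  \<open>over\<close> below is that of a jump above \<open>K\<close> into state \<open>l\<close>,
  discounted by the overshoot.\<close>

definition ring :: "real => 'd => 'd => real => ennreal" where
  "ring a j i x = before i (hit i x) (%u. ennreal beta * (ennreal (exp (- a * (x + r i * u))) * of_bool (i = j)))"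

definition over :: "real => 'd => 'd => real => ennreal" where
  "over a l i x = before i (hit i x) (%u. jump_integral i (%m k. ennreal (exp (- a * (x + r i * u + m - K))) * of_bool (K < x + r i * u + m \<and> k = l)))"

lemma over_measurable:
  "(%m. ennreal (exp (- a * (x + r i * u + m - K))) * of_bool (K < x + r i * u + m \<and> k = l)) \<in> borel_measurable borel"
  "(%u. jump_integral i (%m k. ennreal (exp (- a * (x + r i * u + m - K))) * of_bool (K < x + r i * u + m \<and> k = l))) \<in> borel_measurable borel"
proof -
  show "(%m. ennreal (exp (- a * (x + r i * u + m - K))) * of_bool (K < x + r i * u + m \<and> k = l)) \<in> borel_measurable borel"
    unfolding of_bool_def by measurable
  have "(%p. ennreal (exp (- a * (x + r i * fst p + snd p - K))) * (if K < x + r i * fst p + snd p \<and> k = l then 1 else 0)) \<in> borel_measurable (borel \<Otimes>\<^sub>M borel)" for k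
    by measurable
  then show "(%u. jump_integral i (%m k. ennreal (exp (- a * (x + r i * u + m - K))) * of_bool (K < x + r i * u + m \<and> k = l))) \<in> borel_measurable borel"
    unfolding of_bool_def by (intro jump_integral_measurable) simp
qed

lemma pass_add_term:
  assumes "g \<in> borel_measurable borel" "\<And>k. (%y. F y k) \<in> borel_measurable borel"
  shows "before i (hit i x) (%u. g u + jump_integral i (%m k. of_bool (x + r i * u + m \<le> K) * F (x + r i * u + m) k))
    = before i (hit i x) g + pass i x F"
  unfolding pass_def by (intro before_add pass_measurable assms)

lemma star_mean_eq:
  assumes x: "0 \<le> x"
  shows "star_mean a j x i = ring a j i x + pass i x (star_mean a j)"
proof -
  \<comment> \<open>The correction term of \<open>star_late\<close> lives on the null event that the
    clock rings at the instant of the jump.\<close>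
  have late: "(\<integral>\<^sup>+w. star_late r K a j i x u m w \<partial>world k) = 0" for u m k
  proof -
    have "(\<integral>\<^sup>+w. star_late r K a j i x u m w \<partial>world k) = (\<integral>\<^sup>+w. 0 \<partial>world k)"
      using AE_clock[of k] by (intro nn_integral_cong_AE) (auto elim!: eventually_mono simp: star_late_def)
    then show ?thesis by simp
  qed
  let ?g = "%u. ennreal beta * star_early r a j i x u + jump_integral i (%m k. (\<integral>\<^sup>+w. star_late r K a j i x u m w \<partial>world k)
      + inside r K i x u m * star_mean a j (move r i x u m) k)"
  have "(\<integral>\<^sup>+v. ennreal (exp (- total_rate i * v)) * indicator {0<..} v * ?g (hit i x + v) \<partial>lborel) = (\<integral>\<^sup>+v. 0 \<partial>(lborel :: real measure))"
  proof (rule nn_integral_cong, goal_cases)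
    case (1 v)
    have *: "r i * v < 0" if "0 < v" using drift[of i] that by (rule mult_neg_pos)
    then show ?case
      by (cases "0 < v") (simp_all add: star_early_def late inside_def after_hit jump_integral_const not_le)
  qed
  moreover have "before i (hit i x) ?g = before i (hit i x) (%u. ennreal beta * (ennreal (exp (- a * (x + r i * u))) * of_bool (i = j))
     + jump_integral i (%m k. of_bool (x + r i * u + m \<le> K) * star_mean a j (x + r i * u + m) k))"
  proof (rule before_cong)
    fix u assume u: "u < hit i x"
    show "?g u = ennreal beta * (ennreal (exp (- a * (x + r i * u))) * of_bool (i = j))
     + jump_integral i (%m k. of_bool (x + r i * u + m \<le> K) * star_mean a j (x + r i * u + m) k)"
      using before_hit[OF u] by (simp add: star_early_def late inside_def move_def less_imp_le)
  qed
  moreover have "\<dots> = ring a j i x + pass i x (star_mean a j)"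
    unfolding ring_def by (intro pass_add_term means_measurable) measurable
  ultimately show ?thesis
    using mean_split(1)[OF star_functional[of a j] x, of i] unfolding star_mean_def[symmetric] by simp
qed

lemma overshoot:
  "(\<integral>\<^sup>+w. b * of_bool (p \<and> state 0 w = l) \<partial>world k) = b * of_bool (p \<and> k = l)"
proof -
  have "(\<integral>\<^sup>+w. b * of_bool (p \<and> state 0 w = l) \<partial>world k) = (\<integral>\<^sup>+w. b * of_bool (p \<and> k = l) \<partial>world k)"
  proof (rule nn_integral_cong_AE)
    show "AE w in world k. b * of_bool (p \<and> state 0 w = l) = b * of_bool (p \<and> k = l)"
      using AE_state[of k] by eventually_elim simp
  qed
  then show ?thesis by (simp add: world.emeasure_space_1)
qed

lemma jump_integral_over:
  assumes "\<And>k. (%y. F y k) \<in> borel_measurable borel"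
  shows "jump_integral i (%m k. ennreal (exp (- a * (x + r i * u + m - K))) * of_bool (K < x + r i * u + m \<and> k = l)
        + of_bool (x + r i * u + m \<le> K) * F (x + r i * u + m) k)
    = jump_integral i (%m k. ennreal (exp (- a * (x + r i * u + m - K))) * of_bool (K < x + r i * u + m \<and> k = l))
      + jump_integral i (%m k. of_bool (x + r i * u + m \<le> K) * F (x + r i * u + m) k)"
  by (intro jump_integral_add over_measurable pass_measurable assms)

lemma tilde_mean_eq:
  assumes x: "0 \<le> x"
  shows "tilde_mean a l x i = over a l i x + pass i x (tilde_mean a l)"
proof -
  let ?g = "%u. ennreal beta * 0 + jump_integral i (%m k. (\<integral>\<^sup>+w. tilde_late r K a l i x u m w \<partial>world k)
      + inside r K i x u m * tilde_mean a l (move r i x u m) k)"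
  have "(\<integral>\<^sup>+v. ennreal (exp (- total_rate i * v)) * indicator {0<..} v * ?g (hit i x + v) \<partial>lborel) = (\<integral>\<^sup>+v. 0 \<partial>(lborel :: real measure))"
  proof (rule nn_integral_cong, goal_cases)
    case (1 v)
    have *: "r i * v < 0" if "0 < v" using drift[of i] that by (rule mult_neg_pos)
    then show ?case
      by (cases "0 < v") (simp_all add: tilde_late_def inside_def after_hit jump_integral_const not_le)
  qed
  moreover have "before i (hit i x) ?g = before i (hit i x) (%u. jump_integral i (%m k. ennreal (exp (- a * (x + r i * u + m - K))) * of_bool (K < x + r i * u + m \<and> k = l))
     + jump_integral i (%m k. of_bool (x + r i * u + m \<le> K) * tilde_mean a l (x + r i * u + m) k))"
  proof (rule before_cong)
    fix u assume u: "u < hit i x"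
    show "?g u = jump_integral i (%m k. ennreal (exp (- a * (x + r i * u + m - K))) * of_bool (K < x + r i * u + m \<and> k = l))
     + jump_integral i (%m k. of_bool (x + r i * u + m \<le> K) * tilde_mean a l (x + r i * u + m) k)"
      using before_hit[OF u] unfolding jump_integral_over[OF means_measurable(3), symmetric]
      by (simp add: tilde_late_def overshoot inside_def move_def less_imp_le)
  qed
  moreover have "\<dots> = over a l i x + pass i x (tilde_mean a l)"
    unfolding over_def by (intro pass_add_term means_measurable over_measurable)
  ultimately show ?thesis
    using mean_split(1)[OF tilde_functional[of a l] x, of i] unfolding tilde_mean_def[symmetric] by simp
qed

text \<open>The free path is not stopped at 0, but if the line reaches 0 without an event the
  situation is that of a start from level 0 in the same state: beyond the hitting time the integrand
  for \<open>x\<close> is the one for 0, by \<open>after_hit\<close>.\<close>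

lemma eta_mean_eq:
  assumes x: "0 \<le> x"
  shows "eta_mean a l x i = over a l i x + ennreal (exp (- total_rate i * hit i x)) * eta_mean a l 0 i + pass i x (eta_mean a l)"
proof -
  let ?g = "%x u. ennreal beta * 0 + jump_integral i (%m k. (\<integral>\<^sup>+w. eta_late r K a l i x u m w \<partial>world k)
      + inside_top r K i x u m * eta_mean a l (move r i x u m) k)"
  have "?g x (hit i x + v) = ?g 0 v" for v
    unfolding eta_late_def inside_top_def move_def after_hit by simp
  then have "(\<integral>\<^sup>+v. ennreal (exp (- total_rate i * v)) * indicator {0<..} v * ?g x (hit i x + v) \<partial>lborel) = eta_mean a l 0 i"
    using mean_split(2)[OF eta_functional[of a l] order_refl, of i] unfolding eta_mean_def[symmetric] by simp
  moreover have "before i (hit i x) (?g x) = before i (hit i x) (%u. jump_integral i (%m k. ennreal (exp (- a * (x + r i * u + m - K))) * of_bool (K < x + r i * u + m \<and> k = l))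
     + jump_integral i (%m k. of_bool (x + r i * u + m \<le> K) * eta_mean a l (x + r i * u + m) k))"
  proof (rule before_cong)
    fix u assume u: "u < hit i x"
    show "?g x u = jump_integral i (%m k. ennreal (exp (- a * (x + r i * u + m - K))) * of_bool (K < x + r i * u + m \<and> k = l))
     + jump_integral i (%m k. of_bool (x + r i * u + m \<le> K) * eta_mean a l (x + r i * u + m) k)"
      unfolding jump_integral_over[OF means_measurable(4), symmetric]
      by (simp add: eta_late_def overshoot inside_top_def move_def)
  qed
  moreover have "\<dots> = over a l i x + pass i x (eta_mean a l)"
    unfolding over_def by (intro pass_add_term means_measurable over_measurable)
  ultimately show ?thesis
    using mean_split(1)[OF eta_functional[of a l] x, of i] unfolding eta_mean_def[symmetric] by (simp add: add_ac)
qed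

text \<open>From level 0 the workload is idle until the clock or an event, so idle time equals
  elapsed time and \<open>a2\<close> joins the exponential rate; what remains of the integrand does
  not depend on time.\<close>

lemma chi_mean_0:
  assumes a2: "0 \<le> a2"
  shows "chi_mean a1 a2 a3 j 0 i = ennreal (1 / (total_rate i + a2)) * (ennreal beta * of_bool (i = j)
    + jump_integral i (%m k. ennreal (exp (- a3 * max 0 (m - K))) * chi_mean a1 a2 a3 j (min K m) k))"
proof -
  let ?c = "ennreal beta * of_bool (i = j) + jump_integral i (%m k. ennreal (exp (- a3 * max 0 (m - K))) * chi_mean a1 a2 a3 j (min K m) k)"
  let ?h = "%m k. ennreal (exp (- a3 * max 0 (m - K))) * chi_mean a1 a2 a3 j (min K m) k"
  have hm: "(%m. ?h m k) \<in> borel_measurable borel" for k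
    by (intro borel_measurable_times_ennreal measurable_compose[OF _ means_measurable(5)]) measurable
  have "chi_mean a1 a2 a3 j 0 i = (\<integral>\<^sup>+v. ennreal (exp (- (total_rate i + a2) * v)) * indicator {0<..} v * ?c \<partial>lborel)"
    unfolding mean_split(2)[OF chi_functional[where j = j and ?a1.0 = a1 and ?a2.0 = a2 and ?a3.0 = a3] order_refl, of i, folded chi_mean_def]
  proof (rule nn_integral_cong, goal_cases)
    case (1 v)
    show ?case
    proof (cases "0 < v")
      case True
      then have rv: "max (r i * v) 0 = 0" using mult_neg_pos[OF drift[of i] True] by simp
      let ?e = "ennreal (exp (- a2 * v))"
      have A: "chi_early r a1 a2 j i 0 v = ?e * of_bool (i = j)" using rv True by (simp add: chi_early_def)
      have "chi_weight r K a2 a3 i 0 v m = ?e * ennreal (exp (- a3 * max 0 (m - K)))" for m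
        using rv True by (simp add: chi_weight_def ennreal_mult'[symmetric] exp_add[symmetric])
      then have wx: "chi_weight r K a2 a3 i 0 v m * chi_mean a1 a2 a3 j (chi_move r K i 0 v m) k = ?e * ?h m k" for m k
        using rv by (simp add: chi_move_def mult.assoc)
      have J: "jump_integral i (%m k. (\<integral>\<^sup>+w. 0 \<partial>world k)
          + chi_weight r K a2 a3 i 0 v m * chi_mean a1 a2 a3 j (chi_move r K i 0 v m) k) = ?e * jump_integral i ?h"
        by (simp only: wx nn_integral_const mult_zero_left add_0 jump_integral_cmult[OF hm])
      have "ennreal beta * chi_early r a1 a2 j i 0 v + jump_integral i (%m k. (\<integral>\<^sup>+w. 0 \<partial>world k)
          + chi_weight r K a2 a3 i 0 v m * chi_mean a1 a2 a3 j (chi_move r K i 0 v m) k) = ?e * ?c"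
        by (simp only: A J distrib_left mult.left_commute)
      moreover have "ennreal (exp (- (total_rate i + a2) * v)) = ennreal (exp (- total_rate i * v)) * ?e"
        by (simp add: ennreal_mult'[symmetric] exp_add[symmetric] algebra_simps)
      ultimately show ?thesis using True by (simp only: indicator_def) (simp add: mult.assoc)
    qed simp
  qed
  also have "\<dots> = ennreal (1 / (total_rate i + a2)) * ?c"
    using nn_integral_exp[of "total_rate i + a2"] out_rate(3)[of i] a2 by (subst nn_integral_multc) simp_all
  finally show ?thesis .
qed

text \<open>Four continuations from \<open>x\<close>: the clock rings while the line is positive; a
  jump overflows, and the workload continues from \<open>K\<close> with a discount; the line reaches
  0, and the workload continues as from 0; or the jump stays in the strip.\<close>

lemma chi_mean_eq:
  fixes a1 a2 a3 x :: real and i j :: 'd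
  assumes x: "0 \<le> x"
  defines "\<xi> \<equiv> chi_mean a1 a2 a3 j"
  shows "\<xi> x i = ring a1 j i x + (\<Sum>l\<in>UNIV. over a3 l i x * \<xi> K l) + ennreal (exp (- total_rate i * hit i x)) * \<xi> 0 i + pass i x \<xi>"
proof -
  note \<xi>m = means_measurable(5)[where ?a1.0 = a1 and ?a2.0 = a2 and ?a3.0 = a3 and j = j, folded \<xi>_def]
  let ?g = "%x u. ennreal beta * chi_early r a1 a2 j i x u + jump_integral i (%m k. (\<integral>\<^sup>+w. 0 \<partial>world k)
      + chi_weight r K a2 a3 i x u m * \<xi> (chi_move r K i x u m) k)"
  let ?o = "%l u. jump_integral i (%m k. ennreal (exp (- a3 * (x + r i * u + m - K))) * of_bool (K < x + r i * u + m \<and> k = l))"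
  let ?p = "%u. jump_integral i (%m k. of_bool (x + r i * u + m \<le> K) * \<xi> (x + r i * u + m) k)"
  let ?b = "%u. ennreal beta * (ennreal (exp (- a1 * (x + r i * u))) * of_bool (i = j))"
  \<comment> \<open>Idle time starts at the hitting time, so the integrand at
    \<open>hit i x + v\<close> is the one for a start from 0 at time \<open>v\<close>.\<close>
  have "x / r i = - hit i x" by (simp add: hit_def)
  then have "?g x (hit i x + v) = ?g 0 v" for v
    unfolding chi_early_def chi_weight_def chi_move_def after_hit by simp
  then have "(\<integral>\<^sup>+v. ennreal (exp (- total_rate i * v)) * indicator {0<..} v * ?g x (hit i x + v) \<partial>lborel) = \<xi> 0 i"
    using mean_split(2)[OF chi_functional[where j = j and ?a1.0 = a1 and ?a2.0 = a2 and ?a3.0 = a3] order_refl, of i, folded chi_mean_def, folded \<xi>_def] by simp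
  moreover have "before i (hit i x) (?g x) = before i (hit i x) (%u. (?b u + (\<Sum>l\<in>UNIV. \<xi> K l * ?o l u)) + ?p u)"
  proof (rule before_cong)
    fix u assume u: "0 < u" "u < hit i x"
    have pos: "0 < x + r i * u" by (rule before_hit[OF u(2)])
    have mx: "max 0 (u - x / - r i) = 0" using u(2) by (simp add: hit_def)
    have "chi_weight r K a2 a3 i x u m * \<xi> (chi_move r K i x u m) k
      = (\<Sum>l\<in>UNIV. \<xi> K l * (ennreal (exp (- a3 * (x + r i * u + m - K))) * of_bool (K < x + r i * u + m \<and> k = l)))
        + of_bool (x + r i * u + m \<le> K) * \<xi> (x + r i * u + m) k" for m k
    proof -
      have "(\<Sum>l\<in>UNIV. \<xi> K l * (ennreal (exp (- a3 * (x + r i * u + m - K))) * of_bool (K < x + r i * u + m \<and> k = l)))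
        = (\<Sum>l\<in>{k}. \<xi> K l * (ennreal (exp (- a3 * (x + r i * u + m - K))) * of_bool (K < x + r i * u + m \<and> k = l)))"
        by (rule sum.mono_neutral_right) auto
      then show ?thesis
        unfolding chi_weight_def chi_move_def mx using pos
        by (cases "x + r i * u + m \<le> K") (simp_all add: not_le max_def min_def mult.commute)
    qed
    then have "?g x u = ?b u + jump_integral i (%m k. (\<Sum>l\<in>UNIV. \<xi> K l * (ennreal (exp (- a3 * (x + r i * u + m - K))) * of_bool (K < x + r i * u + m \<and> k = l)))
        + of_bool (x + r i * u + m \<le> K) * \<xi> (x + r i * u + m) k)"
      unfolding chi_early_def mx using pos by simp
    also have "\<dots> = ?b u + ((\<Sum>l\<in>UNIV. \<xi> K l * ?o l u) + ?p u)"
      by (subst jump_integral_add[OF borel_measurable_sum pass_measurable(1)[OF \<xi>m]])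
        (simp_all add: jump_integral_sum jump_integral_cmult over_measurable borel_measurable_times_ennreal)
    finally show "?g x u = (?b u + (\<Sum>l\<in>UNIV. \<xi> K l * ?o l u)) + ?p u" by (simp add: add.assoc)
  qed
  moreover have "\<dots> = (ring a1 j i x + (\<Sum>l\<in>UNIV. \<xi> K l * over a3 l i x)) + pass i x \<xi>"
  proof -
    have om: "(%u. \<xi> K l * ?o l u) \<in> borel_measurable borel" for l
      by (intro borel_measurable_times_ennreal borel_measurable_const over_measurable)
    have bm: "?b \<in> borel_measurable borel" by measurable
    have sm: "(%u. \<Sum>l\<in>UNIV. \<xi> K l * ?o l u) \<in> borel_measurable borel" by (intro borel_measurable_sum om)
    have "before i (hit i x) (%u. \<Sum>l\<in>UNIV. \<xi> K l * ?o l u) = (\<Sum>l\<in>UNIV. \<xi> K l * over a3 l i x)"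
      unfolding over_def before_cmult[OF over_measurable(2), symmetric] by (rule before_sum[OF finite om])
    then show ?thesis
      by (simp only: pass_add_term[OF borel_measurable_add[OF bm sm] \<xi>m] before_add[OF bm sm] ring_def)
  qed
  ultimately show ?thesis
    using mean_split(1)[OF chi_functional[where j = j and ?a1.0 = a1 and ?a2.0 = a2 and ?a3.0 = a3] x, of i, folded chi_mean_def, folded \<xi>_def] by (simp add: add_ac mult.commute)
qed

end

section \<open>Decomposition at the boundaries\<close>

text \<open>Direct contribution and weight of the continuation together are at most 1 in each step,
  hence over any number of steps.\<close>

lemma event_limit_le_1:
  assumes "\<And>i x u. A i x u \<le> 1" "\<And>i x u m w. D i x u m w + W i x u m \<le> 1"
  shows "event_limit A D W X x w \<le> 1"
  unfolding event_limit_def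
proof (rule SUP_least)
  fix n
  have s: "D i x u m w' + W i x u m * e \<le> 1" if "e \<le> 1" for i x u m w' e
  proof -
    have "D i x u m w' + W i x u m * e \<le> D i x u m w' + W i x u m * 1"
      using that by (intro add_left_mono mult_left_mono) auto
    also have "\<dots> \<le> 1" using assms(2)[of i x u m w'] by simp
    finally show ?thesis .
  qed
  show "event_value A D W X n x w \<le> 1"
  proof (induction n arbitrary: x w)
    case (Suc n)
    then show ?case using assms(1) by (simp add: s)
  qed simp
qed

locale killed_workload = workload_law Q N lam B C beta r K
  for Q :: "real^'d^'d::finite" and N lam B C beta r K +
  fixes a1 a2 a3 :: real
  assumes a1: "0 \<le> a1" and a2: "0 \<le> a2" and a3: "0 \<le> a3"
begin

lemma limits_le_1:
  "event_limit (minus_early r l) (minus_late r l) (inside r K) (move r) x w \<le> 1"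
  "event_limit (star_early r a1 l) (star_late r K a1 l) (inside r K) (move r) x w \<le> 1"
  "event_limit (%_ _ _. 0) (tilde_late r K a3 l) (inside r K) (move r) x w \<le> 1"
  "event_limit (%_ _ _. 0) (eta_late r K a3 l) (inside_top r K) (move r) x w \<le> 1"
  "event_limit (chi_early r a1 a2 l) (%_ _ _ _ _. 0) (chi_weight r K a2 a3) (chi_move r K) x w \<le> 1"
proof -
  have e: "exp (- a * y) \<le> 1" if "0 \<le> a" "0 \<le> y" for a y :: real using that by simp
  have e2: "exp (- a * y - a' * y') \<le> 1" if "0 \<le> a" "0 \<le> y" "0 \<le> a'" "0 \<le> y'" for a y a' y' :: real
  proof -
    have "0 \<le> a * y" "0 \<le> a' * y'" using that by auto
    then have "- a * y - a' * y' \<le> 0" unfolding mult_minus_left by linarith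
    then show ?thesis by simp
  qed
  show "event_limit (minus_early r l) (minus_late r l) (inside r K) (move r) x w \<le> 1"
    by (rule event_limit_le_1) (auto simp: minus_early_def minus_late_def inside_def of_bool_def)
  show "event_limit (star_early r a1 l) (star_late r K a1 l) (inside r K) (move r) x w \<le> 1"
    using K a1 by (intro event_limit_le_1)
      (auto simp: star_early_def star_late_def inside_def of_bool_def ennreal_le_1 simp del: exp_le_one_iff intro!: e[unfolded mult_minus_left] e)
  show "event_limit (%_ _ _. 0) (tilde_late r K a3 l) (inside r K) (move r) x w \<le> 1"
    using a3 by (intro event_limit_le_1)
      (auto simp: tilde_late_def inside_def of_bool_def ennreal_le_1 simp del: exp_le_one_iff intro!: e[unfolded mult_minus_left] e)
  show "event_limit (%_ _ _. 0) (eta_late r K a3 l) (inside_top r K) (move r) x w \<le> 1"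
    using a3 by (intro event_limit_le_1)
      (auto simp: eta_late_def inside_top_def of_bool_def ennreal_le_1 simp del: exp_le_one_iff intro!: e[unfolded mult_minus_left] e)
  show "event_limit (chi_early r a1 a2 l) (%_ _ _ _ _. 0) (chi_weight r K a2 a3) (chi_move r K) x w \<le> 1"
    using a1 a2 a3 by (intro event_limit_le_1)
      (auto simp: chi_early_def chi_weight_def of_bool_def ennreal_le_1 simp del: exp_le_one_iff intro!: e2[unfolded mult_minus_left] e2)
qed

lemma le_1:
  "minus_mean l x i \<le> 1" "star_mean a1 l x i \<le> 1" "tilde_mean a3 l x i \<le> 1"
  "eta_mean a3 l x i \<le> 1" "chi_mean a1 a2 a3 l x i \<le> 1"
proof -
  have int: "(\<integral>\<^sup>+w. F w \<partial>world i) \<le> 1" if "\<And>w. F w \<le> 1" for F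
    using nn_integral_mono[of "world i" F "%_. 1"] that by (simp add: world.emeasure_space_1)
  show "minus_mean l x i \<le> 1" "star_mean a1 l x i \<le> 1" "tilde_mean a3 l x i \<le> 1"
    "eta_mean a3 l x i \<le> 1" "chi_mean a1 a2 a3 l x i \<le> 1"
    unfolding mean_defs by (rule int, rule limits_le_1)+
qed

abbreviation "\<xi> \<equiv> chi_mean a1 a2 a3"

lemma sum_indicator: "(\<Sum>l\<in>UNIV. c l * (e * of_bool (k = l))) = c k * (e :: ennreal)" for k :: 'd
proof -
  have "(\<Sum>l\<in>UNIV. c l * (e * of_bool (k = l))) = (\<Sum>l\<in>{k}. c l * (e * of_bool (k = l)))"
    by (rule sum.mono_neutral_right) auto
  then show ?thesis by simp
qed

lemma mixture_le:
  fixes c :: "'d => ennreal"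
  assumes "\<And>l. c l \<le> 1" "\<And>l. F l \<le> (1 :: ennreal)"
  shows "(\<Sum>l\<in>UNIV. c l * F l) \<le> ennreal (real CARD('d))"
proof -
  have "(\<Sum>l\<in>UNIV. c l * F l) \<le> (\<Sum>l\<in>(UNIV :: 'd set). 1)"
    using assms mult_mono[of "c _" 1 "F _" 1] by (intro sum_mono) simp
  then show ?thesis by (simp add: ennreal_of_nat_eq_real_of_nat)
qed

lemma mixture_measurable:
  assumes "\<And>l k. (%y. F l y k) \<in> borel_measurable borel"
  shows "(%y. \<Sum>l\<in>(UNIV :: 'd set). c l * F l y k :: ennreal) \<in> borel_measurable borel"
  by (intro borel_measurable_sum borel_measurable_times_ennreal borel_measurable_const assms)

lemma pass_mixture:
  assumes F: "\<And>l k. (%y. F l y k) \<in> borel_measurable borel"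
  shows "pass i x (%y k. \<Sum>l\<in>(UNIV :: 'd set). c l * F l y k) = (\<Sum>l\<in>UNIV. c l * pass i x (F l))"
proof -
  have "pass i x (%y k. \<Sum>l\<in>(UNIV :: 'd set). c l * F l y k) = (\<Sum>l\<in>UNIV. pass i x (%y k. c l * F l y k))"
    by (intro pass_sum finite borel_measurable_times_ennreal borel_measurable_const F)
  then show ?thesis by (simp only: pass_cmult[OF F])
qed

text \<open>Both sides are bounded and solve the renewal equation with the same inhomogeneity: the
  terms of \<open>minus_mean_eq\<close>, \<open>tilde_mean_eq\<close> and
  \<open>star_mean_eq\<close> enter with exactly the coefficients that occur in
  \<open>chi_mean_eq\<close>. Hence \<open>uniqueness\<close> identifies them.\<close>

lemma decomposition:
  assumes x: "0 \<le> x" "x \<le> K"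
  shows "\<xi> j x i = (\<Sum>l\<in>UNIV. \<xi> j 0 l * minus_mean l x i) + (\<Sum>l\<in>UNIV. \<xi> j K l * tilde_mean a3 l x i) + star_mean a1 j x i"
proof -
  let ?M = "%y k. \<Sum>l\<in>UNIV. \<xi> j 0 l * minus_mean l y k" and ?T = "%y k. \<Sum>l\<in>UNIV. \<xi> j K l * tilde_mean a3 l y k"
  let ?a = "%y k. ring a1 j k y + (\<Sum>l\<in>UNIV. \<xi> j K l * over a3 l k y) + \<xi> j 0 k * ennreal (exp (- total_rate k * hit k y))"
  let ?G = "%y k. ?M y k + ?T y k + star_mean a1 j y k"
  have M: "(%y. ?M y k) \<in> borel_measurable borel" and T: "(%y. ?T y k) \<in> borel_measurable borel" for k
    by (intro mixture_measurable means_measurable)+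
  have bd: "?G y k \<le> ennreal (2 * real CARD('d) + 1)" if y: "0 \<le> y" "y \<le> K" for y k
  proof -
    have "?G y k \<le> ennreal (real CARD('d)) + ennreal (real CARD('d)) + ennreal 1"
      using K y by (intro add_mono mixture_le) (auto simp: le_1)
    also have "\<dots> = ennreal (real CARD('d) + real CARD('d) + 1)"
      by (simp only: ennreal_plus of_nat_0_le_iff add_nonneg_nonneg zero_le_one)
    also have "real CARD('d) + real CARD('d) + 1 = 2 * real CARD('d) + 1" by simp
    finally show ?thesis .
  qed
  have "\<xi> j x i = ?G x i"
  proof (rule uniqueness[where M = "2 * real CARD('d) + 1" and a = ?a])
    show "(%y. ?G y k) \<in> borel_measurable borel" for k
      by (intro borel_measurable_add M T means_measurable)
    fix y k assume y: "0 \<le> y" "y \<le> K"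
    show "?G y k \<le> ennreal (2 * real CARD('d) + 1)" by (rule bd[OF y])
    have "\<xi> j y k \<le> ennreal 1" using le_1(5)[of j y k] by simp
    also have "\<dots> \<le> ennreal (2 * real CARD('d) + 1)" by (rule ennreal_leI) simp
    finally show "\<xi> j y k \<le> ennreal (2 * real CARD('d) + 1)" .
    show "\<xi> j y k = ?a y k + pass k y (\<xi> j)"
      using chi_mean_eq[OF y(1)] by (simp add: mult.commute add_ac)
    have "pass k y ?G = (pass k y ?M + pass k y ?T) + pass k y (star_mean a1 j)"
      by (subst pass_add[OF borel_measurable_add[OF M T] means_measurable(2)]) (simp add: pass_add[OF M T])
    also have "\<dots> = (\<Sum>l\<in>UNIV. \<xi> j 0 l * pass k y (minus_mean l)) + (\<Sum>l\<in>UNIV. \<xi> j K l * pass k y (tilde_mean a3 l)) + pass k y (star_mean a1 j)"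
      by (simp only: pass_mixture[OF means_measurable(1)] pass_mixture[OF means_measurable(3)])
    finally have p: "pass k y ?G = \<dots>" .
    have m: "?M y k = \<xi> j 0 k * ennreal (exp (- total_rate k * hit k y)) + (\<Sum>l\<in>UNIV. \<xi> j 0 l * pass k y (minus_mean l))"
      unfolding minus_mean_eq[OF y(1)] distrib_left sum.distrib sum_indicator ..
    have t: "?T y k = (\<Sum>l\<in>UNIV. \<xi> j K l * over a3 l k y) + (\<Sum>l\<in>UNIV. \<xi> j K l * pass k y (tilde_mean a3 l))"
      unfolding distrib_left[symmetric] sum.distrib[symmetric] tilde_mean_eq[OF y(1), symmetric] ..
    show "?G y k = ?a y k + pass k y ?G"
      unfolding p m t star_mean_eq[OF y(1)] by (simp only: add_ac)
  qed (use x in \<open>auto intro: means_measurable\<close>)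
  then show ?thesis .
qed

text \<open>The same argument: a passage above \<open>K\<close> either precedes the passage below 0
  or, by \<open>eta_mean_eq\<close>, follows a restart from level 0.\<close>

lemma eta_decomposition:
  assumes x: "0 \<le> x" "x \<le> K"
  shows "eta_mean a3 l x i = (\<Sum>m\<in>UNIV. eta_mean a3 l 0 m * minus_mean m x i) + tilde_mean a3 l x i"
proof -
  let ?M = "%y k. \<Sum>m\<in>UNIV. eta_mean a3 l 0 m * minus_mean m y k"
  let ?a = "%y k. over a3 l k y + eta_mean a3 l 0 k * ennreal (exp (- total_rate k * hit k y))"
  let ?G = "%y k. ?M y k + tilde_mean a3 l y k"
  have M: "(%y. ?M y k) \<in> borel_measurable borel" for k
    by (intro mixture_measurable means_measurable)
  have bd: "?G y k \<le> ennreal (real CARD('d) + 1)" if y: "0 \<le> y" "y \<le> K" for y k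
  proof -
    have "?G y k \<le> ennreal (real CARD('d)) + ennreal 1"
      using K y by (intro add_mono mixture_le) (auto simp: le_1)
    also have "\<dots> = ennreal (real CARD('d) + 1)"
      by (simp only: ennreal_plus of_nat_0_le_iff zero_le_one)
    finally show ?thesis .
  qed
  have "eta_mean a3 l x i = ?G x i"
  proof (rule uniqueness[where M = "real CARD('d) + 1" and a = ?a])
    show "(%y. ?G y k) \<in> borel_measurable borel" for k
      by (intro borel_measurable_add M means_measurable)
    fix y k assume y: "0 \<le> y" "y \<le> K"
    show "?G y k \<le> ennreal (real CARD('d) + 1)" by (rule bd[OF y])
    have "eta_mean a3 l y k \<le> ennreal 1" using le_1(4)[of l y k] by simp
    also have "\<dots> \<le> ennreal (real CARD('d) + 1)" by (rule ennreal_leI) simp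
    finally show "eta_mean a3 l y k \<le> ennreal (real CARD('d) + 1)" .
    show "eta_mean a3 l y k = ?a y k + pass k y (eta_mean a3 l)"
      using eta_mean_eq[OF y(1)] by (simp add: mult.commute add_ac)
    have p: "pass k y ?G = (\<Sum>m\<in>UNIV. eta_mean a3 l 0 m * pass k y (minus_mean m)) + pass k y (tilde_mean a3 l)"
      unfolding pass_add[OF M means_measurable(3)] pass_mixture[OF means_measurable(1)] ..
    have m: "?M y k = eta_mean a3 l 0 k * ennreal (exp (- total_rate k * hit k y)) + (\<Sum>m\<in>UNIV. eta_mean a3 l 0 m * pass k y (minus_mean m))"
      unfolding minus_mean_eq[OF y(1)] distrib_left sum.distrib sum_indicator ..
    show "?G y k = ?a y k + pass k y ?G"
      unfolding p m unfolding tilde_mean_eq[OF y(1), of a3 l k] by (simp only: add_ac)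
  qed (use x in \<open>auto intro: means_measurable\<close>)
  then show ?thesis .
qed

section \<open>Total mass of leaving the strip through either barrier\<close>

definition "exit_sum x i = (\<Sum>l\<in>UNIV. minus_mean l x i) + (\<Sum>l\<in>UNIV. tilde_mean a3 l x i)"

lemma exit_sum_eq:
  assumes "0 \<le> x"
  shows "exit_sum x i = (ennreal (exp (- total_rate i * hit i x)) + (\<Sum>l\<in>UNIV. over a3 l i x)) + pass i x exit_sum"
proof -
  have "pass i x exit_sum = (\<Sum>l\<in>UNIV. pass i x (minus_mean l)) + (\<Sum>l\<in>UNIV. pass i x (tilde_mean a3 l))"
    unfolding exit_sum_def[abs_def]
    by (subst pass_add) (auto intro!: borel_measurable_sum means_measurable simp: pass_sum means_measurable)
  moreover have "(\<Sum>l\<in>UNIV. minus_mean l x i) = ennreal (exp (- total_rate i * hit i x)) + (\<Sum>l\<in>UNIV. pass i x (minus_mean l))"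
    unfolding minus_mean_eq[OF assms] sum.distrib using sum_indicator[of "%_. 1" _ i] by simp
  moreover have "(\<Sum>l\<in>UNIV. tilde_mean a3 l x i) = (\<Sum>l\<in>UNIV. over a3 l i x) + (\<Sum>l\<in>UNIV. pass i x (tilde_mean a3 l))"
    unfolding sum.distrib[symmetric] tilde_mean_eq[OF assms, symmetric] ..
  ultimately show ?thesis unfolding exit_sum_def[of x i] by (simp only: add_ac)
qed

text \<open>The overshoot terms and \<open>pass\<close> of 1 integrate over disjoint ranges of jump
  sizes with integrands at most 1, so together they are bounded by the mass
  \<open>out_rate i\<close> of the jump kernel, integrated up to the hitting time.\<close>

lemma over_pass_le:
  assumes x: "0 \<le> x"
  shows "(\<Sum>l\<in>UNIV. over a3 l i x) + pass i x (%_ _. 1) \<le> ennreal (out_rate i / total_rate i * (1 - exp (- total_rate i * hit i x)))"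
proof -
  let ?f = "%u l m k. ennreal (exp (- a3 * (x + r i * u + m - K))) * of_bool (K < x + r i * u + m \<and> k = l)"
  let ?h = "%u m k. of_bool (x + r i * u + m \<le> K) * 1 :: ennreal"
  have sm: "(%u. \<Sum>l\<in>UNIV. jump_integral i (?f u l)) \<in> borel_measurable borel"
    by (intro borel_measurable_sum over_measurable)
  have hm: "(%u. jump_integral i (?h u)) \<in> borel_measurable borel" by (rule pass_measurable(2)) simp
  have s1: "(\<Sum>l\<in>UNIV. over a3 l i x) = before i (hit i x) (%u. \<Sum>l\<in>UNIV. jump_integral i (?f u l))"
    unfolding over_def by (rule before_sum[OF finite over_measurable(2), symmetric])
  have "(\<Sum>l\<in>UNIV. over a3 l i x) + pass i x (%_ _. 1)
    = before i (hit i x) (%u. (\<Sum>l\<in>UNIV. jump_integral i (?f u l)) + jump_integral i (?h u))"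
    unfolding s1 pass_def before_add[OF sm hm] ..
  also have "\<dots> \<le> before i (hit i x) (%_. ennreal (out_rate i))"
  proof (rule before_mono)
    fix u
    have "(\<Sum>l\<in>UNIV. jump_integral i (?f u l)) + jump_integral i (?h u) = jump_integral i (%m k. (\<Sum>l\<in>UNIV. ?f u l m k) + ?h u m k)"
    proof -
      have sm: "(%m. \<Sum>l\<in>UNIV. ?f u l m k) \<in> borel_measurable borel" for k :: 'd
        by (intro borel_measurable_sum over_measurable)
      have hm: "(%m. ?h u m k) \<in> borel_measurable borel" for k :: 'd by (rule pass_measurable(1)) simp
      show ?thesis unfolding jump_integral_add[OF sm hm] jump_integral_sum[OF finite over_measurable(1)] ..
    qed
    also have "\<dots> \<le> jump_integral i (%_ _. 1)"
    proof (rule jump_integral_mono)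
      fix m :: real and k :: 'd
      have "(\<Sum>l\<in>UNIV. ?f u l m k) = ennreal (exp (- a3 * (x + r i * u + m - K))) * of_bool (K < x + r i * u + m)"
        using sum_indicator[of "%_. 1" "ennreal (exp (- a3 * (x + r i * u + m - K)))" k]
        by (cases "K < x + r i * u + m") simp_all
      then show "(\<Sum>l\<in>UNIV. ?f u l m k) + ?h u m k \<le> 1"
        using a3 by (cases "K < x + r i * u + m") (auto simp: ennreal_le_1 not_less intro!: mult_nonneg_nonneg)
    qed
    finally show "(\<Sum>l\<in>UNIV. jump_integral i (?f u l)) + jump_integral i (?h u) \<le> ennreal (out_rate i)"
      by (simp add: jump_integral_const)
  qed
  also have "\<dots> = ennreal ((1 - exp (- total_rate i * hit i x)) / total_rate i * out_rate i)"
    using hit_nonneg[OF x, of i] out_rate(1,3)[of i] by (subst before_const) (auto simp: ennreal_mult[symmetric])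
  finally show ?thesis by (simp add: mult_ac)
qed

lemma exit_sum_measurable: "(%y. exit_sum y k) \<in> borel_measurable borel"
  unfolding exit_sum_def by (intro borel_measurable_add borel_measurable_sum means_measurable)

lemma hit_factor:
  assumes "0 \<le> x"
  shows "0 \<le> exp (- total_rate i * hit i x)" "exp (- total_rate i * hit i x) \<le> 1"
  using hit_nonneg[OF assms, of i] out_rate(3)[of i] by auto

lemma exit_super:
  assumes "0 \<le> y"
  shows "(ennreal (exp (- total_rate k * hit k y)) + (\<Sum>l\<in>UNIV. over a3 l k y)) + pass k y (%_ _. 1)
    \<le> ennreal (exp (- total_rate k * hit k y) + out_rate k / total_rate k * (1 - exp (- total_rate k * hit k y)))"
  using add_left_mono[OF over_pass_le[OF assms, of k], of "ennreal (exp (- total_rate k * hit k y))"]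
    hit_factor[OF assms, of k] out_rate(1,3)[of k]
  by (subst ennreal_plus) (auto simp: add.assoc)

text \<open>The constant 1 is a supersolution of the equation that \<open>exit_sum\<close> solves,
  so \<open>comparison\<close> applies.\<close>

lemma exit_sum_le_1:
  assumes x: "0 \<le> x" "x \<le> K"
  shows "exit_sum x i \<le> 1"
proof (rule comparison[where F = exit_sum and G = "%_ _. 1" and M = "2 * real CARD('d)"
      and a = "%y k. ennreal (exp (- total_rate k * hit k y)) + (\<Sum>l\<in>UNIV. over a3 l k y)"])
  fix y k assume y: "0 \<le> y" "y \<le> K"
  have "exit_sum y k \<le> (\<Sum>l\<in>(UNIV :: 'd set). 1) + (\<Sum>l\<in>(UNIV :: 'd set). 1)"
    unfolding exit_sum_def using y by (intro add_mono sum_mono le_1)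
  also have "\<dots> = ennreal (2 * real CARD('d))"
    by (simp add: ennreal_of_nat_eq_real_of_nat ennreal_plus[symmetric] del: ennreal_plus)
  finally show "exit_sum y k \<le> ennreal (2 * real CARD('d))" .
  show "exit_sum y k \<le> ennreal (exp (- total_rate k * hit k y)) + (\<Sum>l\<in>UNIV. over a3 l k y) + pass k y exit_sum"
    using exit_sum_eq[OF y(1)] by simp
  have "exp (- total_rate k * hit k y) + out_rate k / total_rate k * (1 - exp (- total_rate k * hit k y)) \<le> exp (- total_rate k * hit k y) + 1 * (1 - exp (- total_rate k * hit k y))"
    using hit_factor[OF y(1), of k] out_rate[of k] by (intro add_left_mono mult_right_mono) (auto simp: divide_simps)
  then show "ennreal (exp (- total_rate k * hit k y)) + (\<Sum>l\<in>UNIV. over a3 l k y) + pass k y (%_ _. 1) \<le> 1"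
    using order_trans[OF exit_super[OF y(1)]] ennreal_leI by fastforce
qed (use x exit_sum_measurable in auto)

text \<open>From \<open>K\<close> the line needs a positive time to reach 0, during which the clock
  rings with positive probability; this makes the constant of \<open>exit_super\<close> strictly
  smaller than 1.\<close>

lemma exit_sum_top: "exit_sum K i < 1"
proof -
  let ?e = "exp (- total_rate i * hit i K)"
  have "0 < total_rate i * hit i K"
    using K drift[of i] out_rate(3)[of i] by (simp add: hit_def divide_pos_neg)
  then have e: "?e < 1" by simp
  have "exit_sum K i \<le> ennreal ?e + (\<Sum>l\<in>UNIV. over a3 l i K) + pass i K (%_ _. 1)"
    using K by (subst exit_sum_eq) (auto intro!: add_left_mono pass_mono exit_sum_le_1)
  also have "\<dots> \<le> ennreal (?e + out_rate i / total_rate i * (1 - ?e))"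
    using K by (intro exit_super) simp
  also have "\<dots> < ennreal 1"
  proof (rule ennreal_lessI)
    have "out_rate i / total_rate i * (1 - ?e) < 1 * (1 - ?e)"
      using e out_rate[of i] by (intro mult_strict_right_mono) (auto simp: divide_simps)
    then show "?e + out_rate i / total_rate i * (1 - ?e) < 1" by simp
  qed simp
  finally show ?thesis by simp
qed

section \<open>The first jump out of the empty state\<close>

definition "below_top m = (indicator {0..K} m :: ennreal)"
definition "jump_minus l m k = below_top m * minus_mean l m k"
definition "jump_tilde l m k = below_top m * tilde_mean a3 l m k + of_bool (k = l) * (indicator {K<..} m * ennreal (exp (- a3 * (m - K))))"
definition "jump_star j m k = below_top m * star_mean a1 j m k"

lemma jump_terms_measurable:
  "(%m. jump_minus l m k) \<in> borel_measurable borel" "(%m. jump_tilde l m k) \<in> borel_measurable borel"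
  "(%m. jump_star j m k) \<in> borel_measurable borel"
  unfolding jump_minus_def jump_tilde_def jump_star_def below_top_def
  by (intro borel_measurable_add borel_measurable_times_ennreal means_measurable; measurable)+

text \<open>In \<open>chi_mean_0\<close> a jump of size \<open>m <= K\<close> leads to level
  \<open>m\<close>, where \<open>decomposition\<close> applies, and a larger one to level
  \<open>K\<close> with a discount; the result is sorted by the values at 0 and at
  \<open>K\<close>.\<close>

lemma empty_state:
  "\<xi> j 0 i = ennreal (1 / (total_rate i + a2)) * (ennreal beta * of_bool (i = j) + (\<Sum>l\<in>UNIV. \<xi> j 0 l * jump_integral i (jump_minus l))
    + (\<Sum>l\<in>UNIV. \<xi> j K l * jump_integral i (jump_tilde l)) + jump_integral i (jump_star j))"
proof -
  let ?M = "%m k. \<Sum>l\<in>UNIV. \<xi> j 0 l * jump_minus l m k" and ?T = "%m k. \<Sum>l\<in>UNIV. \<xi> j K l * jump_tilde l m k"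
  have M: "(%m. ?M m k) \<in> borel_measurable borel" and T: "(%m. ?T m k) \<in> borel_measurable borel" for k
    by (intro mixture_measurable jump_terms_measurable)+
  have "ennreal (exp (- a3 * max 0 (m - K))) * \<xi> j (min K m) k = (?M m k + ?T m k) + jump_star j m k" if m: "0 \<le> m" for m k
  proof (cases "m \<le> K")
    case True
    then have "min K m = m" "max 0 (m - K) = 0" by auto
    then show ?thesis
      using m True decomposition[OF m True, of j k]
      by (simp add: below_top_def jump_minus_def jump_tilde_def jump_star_def indicator_def)
  next
    case False
    then have "?T m k = (\<Sum>l\<in>UNIV. \<xi> j K l * (ennreal (exp (- a3 * (m - K))) * of_bool (k = l)))"
      by (simp add: below_top_def jump_tilde_def indicator_def mult.commute)
    also have "\<dots> = \<xi> j K k * ennreal (exp (- a3 * (m - K)))" by (rule sum_indicator)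
    finally show ?thesis
      using False by (simp add: below_top_def jump_minus_def jump_star_def min_def max_def indicator_def mult.commute)
  qed
  then have "jump_integral i (%m k. ennreal (exp (- a3 * max 0 (m - K))) * \<xi> j (min K m) k)
      = jump_integral i (%m k. (?M m k + ?T m k) + jump_star j m k)"
    by (rule jump_integral_cong)
  also have "\<dots> = jump_integral i ?M + jump_integral i ?T + jump_integral i (jump_star j)"
    by (simp only: jump_integral_add[OF borel_measurable_add[OF M T] jump_terms_measurable(3)] jump_integral_add[OF M T])
  also have "jump_integral i ?M = (\<Sum>l\<in>UNIV. \<xi> j 0 l * jump_integral i (jump_minus l))"
    by (subst jump_integral_sum) (auto intro!: sum.cong borel_measurable_times_ennreal jump_terms_measurable simp: jump_integral_cmult jump_terms_measurable)
  also have "jump_integral i ?T = (\<Sum>l\<in>UNIV. \<xi> j K l * jump_integral i (jump_tilde l))"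
    by (subst jump_integral_sum) (auto intro!: sum.cong borel_measurable_times_ennreal jump_terms_measurable simp: jump_integral_cmult jump_terms_measurable)
  finally show ?thesis unfolding chi_mean_0[OF a2] by (simp only: add.assoc)
qed

text \<open>For a jump of size at most \<open>K\<close> the integrand is \<open>exit_sum\<close>,
  for a larger one a single discount. Both are at most 1, and the kernel has mass
  \<open>out_rate i\<close>.\<close>

lemma empty_exit_sum:
  "(\<Sum>l\<in>UNIV. jump_integral i (jump_minus l)) + (\<Sum>l\<in>UNIV. jump_integral i (jump_tilde l)) \<le> ennreal (out_rate i)"
proof -
  have "(\<Sum>l\<in>UNIV. jump_integral i (jump_minus l)) + (\<Sum>l\<in>UNIV. jump_integral i (jump_tilde l))
    = jump_integral i (%m k. (\<Sum>l\<in>UNIV. jump_minus l m k) + (\<Sum>l\<in>UNIV. jump_tilde l m k))"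
    by (subst jump_integral_add) (auto intro!: borel_measurable_sum jump_terms_measurable simp: jump_integral_sum jump_terms_measurable)
  also have "\<dots> \<le> jump_integral i (%_ _. 1)"
  proof (rule jump_integral_mono)
    fix m :: real and k assume m: "0 \<le> m"
    show "(\<Sum>l\<in>UNIV. jump_minus l m k) + (\<Sum>l\<in>UNIV. jump_tilde l m k) \<le> 1"
    proof (cases "m \<le> K")
      case True
      then show ?thesis
        using m exit_sum_le_1[OF m True, of k]
        by (simp add: below_top_def jump_minus_def jump_tilde_def indicator_def exit_sum_def)
    next
      case False
      then have "(\<Sum>l\<in>UNIV. jump_tilde l m k) = (\<Sum>l\<in>UNIV. 1 * (ennreal (exp (- a3 * (m - K))) * of_bool (k = l)))"
        by (simp add: below_top_def jump_tilde_def indicator_def mult.commute)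
      also have "\<dots> = 1 * ennreal (exp (- a3 * (m - K)))" by (rule sum_indicator)
      finally show ?thesis
        using False a3 by (simp add: below_top_def jump_minus_def indicator_def ennreal_le_1)
    qed
  qed
  finally show ?thesis by (simp add: jump_integral_const)
qed

end

section \<open>The functionals of the modulated input\<close>

locale reflected_input =
  fixes P :: "'d::finite => 'a measure" and Q :: "real^'d^'d"
    and lam r :: "'d => real" and B :: "'d => real measure" and C :: "'d => 'd => real measure"
    and Z :: "nat => 'a => 'd" and S :: "nat => 'a => ennreal"
    and G :: "'d => nat => 'a => ennreal" and b :: "'d => nat => 'a => real"
    and c :: "'d => 'd => nat => 'a => real" and T :: "'a => real"
    and J :: "real => 'a => 'd" and Y :: "real => 'a => real"
    and V R L :: "real => 'a => real => real"
    and K a1 a2 a3 \<beta> :: real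
  assumes gen: "generator Q"
    and rates: "\<And>i. 0 \<le> lam i"
    and drifts: "\<And>i. r i < 0"
    and input: "\<And>i. modulated_input (P i) Q lam B C \<beta> i Z S G b c T"
    and J_eq: "J = chain_process Z S"
    and Y_eq: "Y = modulated_process Z S (%k. compound_poisson (r k) (G k) (b k)) c"
    and reflection: "\<And>i v \<omega>. v \<in> {0..K} ==> \<omega> \<in> space (P i) ==>
      double_reflection K (%t. v + Y t \<omega>) (V v \<omega>) (R v \<omega>) (L v \<omega>)"
    and K: "0 < K"
    and a: "0 \<le> a1" "0 \<le> a2" "0 \<le> a3"
    and \<beta>: "0 < \<beta>"
begin

sublocale I: modulated_input "P i" Q lam B C \<beta> i Z S G b c T for i by (rule input)

abbreviation "N i \<equiv> distr (P i) (chain_space :: (nat => 'd \<times> ennreal) measure) (%\<omega> n. (Z n \<omega>, S n \<omega>))"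
abbreviation "sample \<equiv> modulated_input.world_of Z S G b c T"

lemma chain_measurable: "(%\<omega> n. (Z n \<omega>, S n \<omega>)) \<in> measurable (P i) chain_space"
  by (rule measurable_PiM_UNIV) (intro measurable_Pair I.Z_measurable I.S_measurable)

lemma chain_law_N: "chain_law Q N"
proof (rule chain_law.intro)
  show "generator Q" by (rule gen)
  show "prob_space (N i)" for i by (rule I.prob_space_distr[OF chain_measurable])
  show "sets (N i) = sets chain_space" for i by simp
  fix i n z and t :: "nat => real" assume t: "\<And>k. k \<le> n ==> 0 \<le> t k"
  have nt: "\<not> t k < 0" if "k \<le> n" for k using t[OF that] by simp
  have "(%\<omega> n. (Z n \<omega>, S n \<omega>)) -` cylinder n z t \<inter> space (P i) = {\<omega> \<in> space (P i). \<forall>k\<le>n. Z k \<omega> = z k \<and> ennreal (t k) < S k \<omega>}"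
    using nt by (auto simp: cylinder_def)
  note pre = this
  have "measure (P i) {\<omega> \<in> space (P i). \<forall>k\<le>n. Z k \<omega> = z k \<and> ennreal (t k) < S k \<omega>}
      = of_bool (z 0 = i) * (\<Prod>k<n. jump_matrix Q $ z k $ z (Suc k)) * (\<Prod>k\<le>n. exp (Q $ z k $ z k * t k))"
    by (rule I.chain_law) (rule t)
  then show "measure (N i) (cylinder n z t) = of_bool (z 0 = i) * (\<Prod>k<n. jump_matrix Q $ z k $ z (Suc k)) * (\<Prod>k\<le>n. exp (Q $ z k $ z k * t k))"
    unfolding measure_distr[OF chain_measurable cylinder_sets] pre .
qed

lemma regular_sets:
  assumes "\<And>n. (%g. h n g) \<in> borel_measurable D"
  shows "{g \<in> space D. renewal_sequence (%n. h n g)} \<in> sets D"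
proof -
  have "(%g. \<Sum>n. h n g) \<in> borel_measurable D" by (intro borel_measurable_suminf_order assms)
  from measurable_sets[OF this, of "{\<infinity>}"] show ?thesis
    by (simp add: renewal_sequence_def vimage_def Int_def conj_commute)
qed

text \<open>Almost sure divergence under the product law is inherited from the given stream, which
  has this law and diverges for every outcome.\<close>

lemma renewal: "renewal_law (lam k) (B k)"
proof (rule renewal_law.intro)
  have Bk: "B k = distr (P k) borel (b k 0)" by (rule I.b_law[symmetric])
  show "0 \<le> lam k" by (rule rates)
  show "prob_space (B k)" unfolding Bk by (rule I.prob_space_distr[OF I.b_measurable])
  show "sets (B k) = sets borel" unfolding Bk by simp
  have st: "modulated_input.stream G b k \<in> measurable (P k) mark_space"
    by (rule I.information_measurable[where A = sources], simp, rule I.stream_information) (auto simp: sources_def)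
  have law: "distr (P k) mark_space (modulated_input.stream G b k) = PiM UNIV (%_. waiting (lam k) \<Otimes>\<^sub>M B k)"
    by (rule I.stream_law[OF rates])
  have "AE g in distr (P k) mark_space (modulated_input.stream G b k). renewal_sequence (%n. fst (g n))"
  proof (subst AE_distr_iff[OF st])
    show "{g \<in> space mark_space. renewal_sequence (%n. fst (g n))} \<in> sets (mark_space :: (nat => ennreal \<times> real) measure)"
    proof (rule regular_sets)
      show "(%g. fst (g n)) \<in> borel_measurable (mark_space :: (nat => ennreal \<times> real) measure)" for n
        by measurable
    qed
    show "AE \<omega> in P k. renewal_sequence (%n. fst (modulated_input.stream G b k \<omega> n))"
      by (rule AE_I2) (simp add: I.stream_def renewal_sequence_def I.G_regular)
  qed
  then show "AE g in PiM UNIV (%_::nat. waiting (lam k) \<Otimes>\<^sub>M B k). renewal_sequence (gaps g)"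
    unfolding law by simp
qed

lemma regular_N: "AE \<xi> in N i. renewal_sequence (%n. snd (\<xi> n))"
proof (subst AE_distr_iff[OF chain_measurable])
  show "{\<xi> \<in> space chain_space. renewal_sequence (%n. snd (\<xi> n))} \<in> sets (chain_space :: (nat => 'd \<times> ennreal) measure)"
  proof (rule regular_sets)
    show "(%\<xi>. snd (\<xi> n)) \<in> borel_measurable (chain_space :: (nat => 'd \<times> ennreal) measure)" for n
      by measurable
  qed
  show "AE \<omega> in P i. renewal_sequence (%n. snd (Z n \<omega>, S n \<omega>))"
    by (rule AE_I2) (simp add: renewal_sequence_def I.chain_regular)
qed

lemma jump_laws:
  "AE m in B i. 0 \<le> m" "i \<noteq> k ==> prob_space (C i k)" "i \<noteq> k ==> sets (C i k) = sets borel" "i \<noteq> k ==> AE m in C i k. 0 \<le> m"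
proof -
  have m: "{m \<in> space borel. 0 \<le> m} \<in> sets (borel :: real measure)" by measurable
  have Bi: "B i = distr (P i) borel (b i 0)" by (rule I.b_law[symmetric])
  show "AE m in B i. 0 \<le> m"
    unfolding Bi AE_distr_iff[OF I.b_measurable m] by (rule AE_I2) (rule I.b_nonneg)
  assume ik: "i \<noteq> k"
  have Ci: "C i k = distr (P i) borel (c i k 0)" by (rule I.c_law[OF ik, symmetric])
  show "prob_space (C i k)" unfolding Ci by (rule I.prob_space_distr[OF I.c_measurable[OF ik]])
  show "sets (C i k) = sets borel" unfolding Ci by simp
  show "AE m in C i k. 0 \<le> m"
    unfolding Ci AE_distr_iff[OF I.c_measurable[OF ik] m] by (rule AE_I2) (rule I.c_nonneg[OF ik])
qed

sublocale W: killed_workload Q N lam B C \<beta> r K a1 a2 a3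
  by (intro killed_workload.intro workload_law.intro world_law.intro chain_law_N world_law_axioms.intro
      workload_law_axioms.intro killed_workload_axioms.intro renewal regular_N jump_laws drifts K a \<beta>)

lemma world_distr: "distr (P i) world_space sample = W.world i"
  unfolding W.world_def W.rest_def W.claims_def W.transits_def W.jump_vector_def by (rule I.world_of_law(1)[OF rates])

lemma sample_measurable: "sample \<in> measurable (P i) world_space"
  by (rule I.world_of_law(2)[OF rates])

lemma sample_simps:
  "free r t (sample \<omega>) = Y t \<omega>" "phase t (sample \<omega>) = J t \<omega>" "clock (sample \<omega>) = T \<omega>"
  by (simp_all add: Y_eq J_eq I.free_world_of I.phase_world_of I.world_of_simps)

lemma passage_sample:
  "passage_below (free r) u (sample \<omega>) = passage_below Y u \<omega>" "passage_above (free r) u (sample \<omega>) = passage_above Y u \<omega>"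
  by (simp_all add: passage_below_def passage_above_def sample_simps)

lemma good_sample:
  assumes \<omega>: "\<omega> \<in> space (P i)"
  shows "good (sample \<omega>)"
proof -
  have "0 \<le> transit j k n (sample \<omega>)" for j k n
    using I.c_nonneg[OF _ \<omega>, of j k n] by (cases "j = k") (simp_all add: transit_def I.world_of_def I.vector_def)
  then show ?thesis
    by (simp add: good_def I.world_of_simps I.chain_regular[OF \<omega>] I.G_regular[OF \<omega>] I.b_nonneg[OF \<omega>] I.T_nonneg[OF \<omega>])
qed

text \<open>Carries a pathwise identity over to means. The integrand is measurable because it is the
  real value of \<open>event_limit\<close> along \<open>sample\<close>; this stands in for direct
  measurability proofs for passage times and reflected paths.\<close>

lemma bridge:
  assumes E: "event_functional Q N lam B C \<beta> A D W X"
    and val: "\<And>\<omega>. \<omega> \<in> space (P i) ==> event_limit A D W X x (sample \<omega>) = ennreal (f \<omega>)"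
    and f: "\<And>\<omega>. 0 \<le> f \<omega>" and le: "\<And>w. event_limit A D W X x w \<le> 1"
  shows "ennreal (\<integral>\<omega>. f \<omega> \<partial>P i) = (\<integral>\<^sup>+w. event_limit A D W X x w \<partial>W.world i)"
proof -
  have m: "event_limit A D W X x \<in> borel_measurable world_space"
    using measurable_compose[OF measurable_Pair1' event_functional.event_limit_measurable[OF E], of x] by simp
  have v: "(%\<omega>. event_limit A D W X x (sample \<omega>)) \<in> borel_measurable (P i)"
    by (rule measurable_compose[OF sample_measurable m])
  have f_eq: "f \<omega> = enn2real (event_limit A D W X x (sample \<omega>))" if "\<omega> \<in> space (P i)" for \<omega>
    using val[OF that] f by simp
  have fm: "f \<in> borel_measurable (P i)"
  proof (rule iffD2[OF measurable_cong])
    show "f \<omega> = enn2real (event_limit A D W X x (sample \<omega>))" if "\<omega> \<in> space (P i)" for \<omega> by (rule f_eq[OF that])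
    show "(%\<omega>. enn2real (event_limit A D W X x (sample \<omega>))) \<in> borel_measurable (P i)" using v by measurable
  qed
  have f1: "f \<omega> \<le> 1" if "\<omega> \<in> space (P i)" for \<omega>
    using le[of "sample \<omega>"] unfolding val[OF that] by simp
  have int: "integrable (P i) f"
    by (rule I.integrable_const_bound[where B = 1]) (use f f1 fm in \<open>auto intro!: AE_I2\<close>)
  have "(\<integral>\<^sup>+w. event_limit A D W X x w \<partial>W.world i) = (\<integral>\<^sup>+\<omega>. event_limit A D W X x (sample \<omega>) \<partial>P i)"
    unfolding world_distr[symmetric] by (rule nn_integral_distr[OF sample_measurable]) (use m in simp)
  also have "\<dots> = (\<integral>\<^sup>+\<omega>. ennreal (f \<omega>) \<partial>P i)" by (intro nn_integral_cong val)
  also have "\<dots> = ennreal (\<integral>\<omega>. f \<omega> \<partial>P i)" by (rule nn_integral_eq_integral[OF int]) (use f in simp)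
  finally show ?thesis ..
qed

section \<open>The matrices as means of event functionals\<close>

context
  fixes x :: real
  assumes x: "0 \<le> x" "x \<le> K"
begin

lemma delta_minus_mean: "ennreal (delta_minus P J Y T K x $ i $ l) = W.minus_mean l x i"
proof -
  let ?f = "%\<omega>. minus_value r K l x (sample \<omega>)"
  let ?E = "{\<omega> \<in> space (P i). passage_below Y x \<omega> \<le> min (passage_above Y (K - x) \<omega>) (ennreal (T \<omega>)) \<and>
        J (enn2real (passage_below Y x \<omega>)) \<omega> = l}"
  have E: "?E \<inter> space (P i) = ?E" by auto
  have "delta_minus P J Y T K x $ i $ l = measure (P i) ?E" by (simp only: delta_minus_def vec_lambda_beta)
  also have "\<dots> = measure (P i) (?E \<inter> space (P i))" unfolding E ..
  also have "\<dots> = (\<integral>\<omega>. indicat_real ?E \<omega> \<partial>P i)" by simp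
  also have "\<dots> = (\<integral>\<omega>. ?f \<omega> \<partial>P i)"
    by (rule Bochner_Integration.integral_cong) (auto simp: minus_value_def passage_sample sample_simps indicator_def)
  finally have eq: "delta_minus P J Y T K x $ i $ l = (\<integral>\<omega>. ?f \<omega> \<partial>P i)" .
  show ?thesis
    unfolding eq W.minus_mean_def
  proof (rule bridge[OF W.minus_functional])
    fix \<omega> assume "\<omega> \<in> space (P i)"
    from minus_event_value[OF drifts good_sample[OF this] x]
    show "event_limit (minus_early r l) (minus_late r l) (inside r K) (move r) x (sample \<omega>) = ennreal (?f \<omega>)"
      by (rule event_limit_eqI)
  qed (simp_all add: W.limits_le_1 minus_value_def)
qed

lemma delta_star_mean: "ennreal (delta_star P J Y T K a1 x $ i $ j) = W.star_mean a1 j x i"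
proof -
  let ?f = "%\<omega>. star_value r K a1 j x (sample \<omega>)"
  have "delta_star P J Y T K a1 x $ i $ j = (\<integral>\<omega>. exp (- a1 * x) * (exp (- a1 * Y (T \<omega>) \<omega>) *
        of_bool (ennreal (T \<omega>) \<le> min (passage_below Y x \<omega>) (passage_above Y (K - x) \<omega>) \<and> J (T \<omega>) \<omega> = j)) \<partial>P i)"
    by (simp add: delta_star_def)
  also have "\<dots> = (\<integral>\<omega>. ?f \<omega> \<partial>P i)"
    unfolding star_value_def passage_sample sample_simps mult.assoc[symmetric] exp_add[symmetric] by (simp add: algebra_simps)
  finally have eq: "delta_star P J Y T K a1 x $ i $ j = (\<integral>\<omega>. ?f \<omega> \<partial>P i)" .
  show ?thesis
    unfolding eq W.star_mean_def
  proof (rule bridge[OF W.star_functional])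
    fix \<omega> assume "\<omega> \<in> space (P i)"
    from star_event_value[OF drifts good_sample[OF this] x]
    show "event_limit (star_early r a1 j) (star_late r K a1 j) (inside r K) (move r) x (sample \<omega>) = ennreal (?f \<omega>)"
      by (rule event_limit_eqI)
  qed (simp_all add: W.limits_le_1 star_value_def)
qed

lemma eta_tilde_mean: "ennreal (eta_tilde P J Y T K a3 (K - x) $ i $ l) = W.tilde_mean a3 l x i"
proof -
  let ?f = "%\<omega>. tilde_value r K a3 l x (sample \<omega>)"
  have eq: "eta_tilde P J Y T K a3 (K - x) $ i $ l = (\<integral>\<omega>. ?f \<omega> \<partial>P i)"
  proof -
    have "K - (K - x) = x" by simp
    then show ?thesis by (simp only: eta_tilde_def tilde_value_def passage_sample sample_simps vec_lambda_beta)
  qed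
  show ?thesis
    unfolding eq W.tilde_mean_def
  proof (rule bridge[OF W.tilde_functional])
    fix \<omega> assume "\<omega> \<in> space (P i)"
    from tilde_event_value[OF drifts good_sample[OF this] x]
    show "event_limit (%_ _ _. 0) (tilde_late r K a3 l) (inside r K) (move r) x (sample \<omega>) = ennreal (?f \<omega>)"
      by (rule event_limit_eqI)
  qed (simp_all add: W.limits_le_1 tilde_value_def)
qed

lemma eta_mean: "ennreal (eta P J Y T a3 (K - x) $ i $ l) = W.eta_mean a3 l x i"
proof -
  let ?f = "%\<omega>. eta_value r K a3 l x (sample \<omega>)"
  have eq: "eta P J Y T a3 (K - x) $ i $ l = (\<integral>\<omega>. ?f \<omega> \<partial>P i)"
    by (simp only: eta_def eta_value_def passage_sample sample_simps vec_lambda_beta)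
  show ?thesis
    unfolding eq W.eta_mean_def
  proof (rule bridge[OF W.eta_functional])
    fix \<omega> assume "\<omega> \<in> space (P i)"
    from eta_event_value[OF drifts good_sample[OF this] x(2)]
    show "event_limit (%_ _ _. 0) (eta_late r K a3 l) (inside_top r K) (move r) x (sample \<omega>) = ennreal (?f \<omega>)"
      by (rule event_limit_eqI)
  qed (simp_all add: W.limits_le_1 eta_value_def)
qed

lemma chi_tilde_mean: "ennreal (chi_tilde P J T V L a1 a2 a3 x $ i $ j) = W.chi_mean a1 a2 a3 j x i"
proof -
  let ?f = "%\<omega>. exp (- a1 * V x \<omega> (T \<omega>) - a2 * idle_time (V x \<omega>) (T \<omega>) - a3 * L x \<omega> (T \<omega>)) * of_bool (J (T \<omega>) \<omega> = j)"
  have eq: "chi_tilde P J T V L a1 a2 a3 x $ i $ j = (\<integral>\<omega>. ?f \<omega> \<partial>P i)"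
    by (simp add: chi_tilde_def)
  show ?thesis
    unfolding eq W.chi_mean_def
  proof (rule bridge[OF W.chi_functional])
    fix \<omega> assume \<omega>: "\<omega> \<in> space (P i)"
    have R: "double_reflection K (%t. x + free r t (sample \<omega>)) (V x \<omega>) (R x \<omega>) (L x \<omega>)"
      using reflection[OF _ \<omega>, of x] x by (simp add: sample_simps)
    from chi_event_value_double_reflection[OF good_sample[OF \<omega>] drifts K x R, where ?a1.0 = a1 and ?a2.0 = a2 and ?a3.0 = a3 and j = j]
    show "event_limit (chi_early r a1 a2 j) (%_ _ _ _ _. 0) (chi_weight r K a2 a3) (chi_move r K) x (sample \<omega>) = ennreal (?f \<omega>)"
      unfolding sample_simps by (rule event_limit_eqI)
  qed (simp_all add: W.limits_le_1)
qed

end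

lemma matrix_nonneg:
  "0 \<le> delta_minus P J Y T K x $ i $ l" "0 \<le> delta_star P J Y T K a1 x $ i $ l" "0 \<le> eta_tilde P J Y T K a3 x $ i $ l"
  "0 \<le> eta P J Y T a3 x $ i $ l" "0 \<le> chi_tilde P J T V L a1 a2 a3 x $ i $ l"
  unfolding delta_minus_def delta_star_def eta_tilde_def eta_def chi_tilde_def
  by (auto intro!: mult_nonneg_nonneg Bochner_Integration.integral_nonneg)

lemma ennreal_dot:
  fixes f g :: "'d => real"
  assumes "\<And>l. 0 \<le> f l" "\<And>l. 0 \<le> g l"
  shows "ennreal (\<Sum>l\<in>UNIV. f l * g l) = (\<Sum>l\<in>UNIV. ennreal (g l) * ennreal (f l))"
  using assms by (subst sum_ennreal[symmetric]) (auto simp: ennreal_mult mult.commute)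

text \<open>\<open>decomposition\<close> read in the reals: both sides are nonnegative, where
  \<open>ennreal\<close> is injective.\<close>

lemma chi_decomposition:
  assumes x: "0 \<le> x" "x \<le> K"
  shows "chi_tilde P J T V L a1 a2 a3 x =
        delta_minus P J Y T K x ** chi_tilde P J T V L a1 a2 a3 0
        + eta_tilde P J Y T K a3 (K - x) ** chi_tilde P J T V L a1 a2 a3 K + delta_star P J Y T K a1 x"
proof -
  have K0: "0 \<le> (0::real)" "0 \<le> K" "K \<le> K" using K by auto
  have "chi_tilde P J T V L a1 a2 a3 x $ i $ j =
      (\<Sum>l\<in>UNIV. delta_minus P J Y T K x $ i $ l * chi_tilde P J T V L a1 a2 a3 0 $ l $ j)
      + (\<Sum>l\<in>UNIV. eta_tilde P J Y T K a3 (K - x) $ i $ l * chi_tilde P J T V L a1 a2 a3 K $ l $ j) + delta_star P J Y T K a1 x $ i $ j"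
    (is "?c = ?d + ?e + ?s") for i j
  proof -
    have n: "0 \<le> ?d" "0 \<le> ?e" "0 \<le> ?s" "0 \<le> ?c" by (auto intro!: sum_nonneg mult_nonneg_nonneg matrix_nonneg)
    have "ennreal (?d + ?e + ?s) = ennreal ?d + ennreal ?e + ennreal ?s"
      unfolding ennreal_plus[OF add_nonneg_nonneg[OF n(1,2)] n(3)] ennreal_plus[OF n(1,2)] ..
    also have "\<dots> = ennreal ?c"
      unfolding ennreal_dot[of "%l. delta_minus P J Y T K x $ i $ l" "%l. chi_tilde P J T V L a1 a2 a3 0 $ l $ j", OF matrix_nonneg(1) matrix_nonneg(5)]
        ennreal_dot[of "%l. eta_tilde P J Y T K a3 (K - x) $ i $ l" "%l. chi_tilde P J T V L a1 a2 a3 K $ l $ j", OF matrix_nonneg(3) matrix_nonneg(5)]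
        delta_minus_mean[OF x] eta_tilde_mean[OF x] delta_star_mean[OF x] chi_tilde_mean[OF x] chi_tilde_mean[OF K0(1,2)] chi_tilde_mean[OF K0(2,3)]
      by (rule W.decomposition[OF x, symmetric])
    finally have "ennreal (?d + ?e + ?s) = ennreal ?c" .
    from iffD1[OF ennreal_inj[OF add_nonneg_nonneg[OF add_nonneg_nonneg[OF n(1,2)] n(3)] n(4)] this]
    show ?thesis by (rule sym)
  qed
  then show ?thesis by (simp add: vec_eq_iff matrix_matrix_mult_def)
qed

lemma eta_tilde_decomposition:
  assumes u: "0 \<le> u" "u \<le> K"
  shows "eta_tilde P J Y T K a3 u = eta P J Y T a3 u - delta_minus P J Y T K (K - u) ** eta P J Y T a3 K"
proof -
  define x where "x = K - u"
  have x: "0 \<le> x" "x \<le> K" and ux: "u = K - x" using u by (auto simp: x_def)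
  have K0: "0 \<le> (0::real)" "0 \<le> K" using K by auto
  \<comment> \<open>The distance \<open>K\<close> is written as \<open>K - 0\<close> so that
    \<open>eta_mean\<close> applies at level 0.\<close>
  have "eta P J Y T a3 (K - x) $ i $ j = (\<Sum>l\<in>UNIV. delta_minus P J Y T K x $ i $ l * eta P J Y T a3 (K - 0) $ l $ j)
      + eta_tilde P J Y T K a3 (K - x) $ i $ j" (is "?c = ?d + ?s") for i j
  proof -
    have n: "0 \<le> ?d" "0 \<le> ?s" "0 \<le> ?c" by (auto intro!: sum_nonneg mult_nonneg_nonneg matrix_nonneg)
    have "ennreal (?d + ?s) = ennreal ?d + ennreal ?s" by (rule ennreal_plus[OF n(1,2)])
    also have "\<dots> = ennreal ?c"
      unfolding ennreal_dot[of "%l. delta_minus P J Y T K x $ i $ l" "%l. eta P J Y T a3 (K - 0) $ l $ j", OF matrix_nonneg(1) matrix_nonneg(4)] delta_minus_mean[OF x] eta_tilde_mean[OF x] eta_mean[OF x] eta_mean[OF K0]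
      by (rule W.eta_decomposition[OF x, symmetric])
    finally have "ennreal (?d + ?s) = ennreal ?c" .
    from iffD1[OF ennreal_inj[OF add_nonneg_nonneg[OF n(1,2)] n(3)] this]
    show ?thesis by (rule sym)
  qed
  moreover have "K - (K - x) = x" by simp
  ultimately show ?thesis unfolding ux by (simp add: vec_eq_iff matrix_matrix_mult_def)
qed

text \<open>The integrands are bounded by 1, hence integrable under the jump laws, so the real
  integrals of \<open>first_jump\<close> agree with those of \<open>jump_integral\<close>.\<close>

lemma first_jump_mean:
  assumes F: "\<And>k. (%y. F y k) \<in> borel_measurable borel" "\<And>y k. F y k \<le> 1"
    and f: "\<And>\<mu> k. prob_space \<mu> ==> sets \<mu> = sets borel ==> f \<mu> k = (LINT y|\<mu>. enn2real (F y k))"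
  shows "ennreal (first_jump Q lam B C i f) = W.jump_integral i F" "0 \<le> first_jump Q lam B C i f"
proof -
  have *: "ennreal (f \<mu> k) = (\<integral>\<^sup>+y. F y k \<partial>\<mu>)" "0 \<le> f \<mu> k" if \<mu>: "prob_space \<mu>" "sets \<mu> = sets borel" for \<mu> k
  proof -
    interpret \<mu>: prob_space \<mu> by (rule \<mu>)
    have fin: "F y k < \<top>" for y using F(2)[of y k] by (rule le_less_trans) simp
    have m: "(%y. F y k) \<in> borel_measurable \<mu>" unfolding measurable_cong_sets[OF \<mu>(2) refl] by (rule F(1))
    have "enn2real (F y k) \<le> 1" for y using enn2real_mono[OF F(2)[of y k]] by simp
    then have int: "integrable \<mu> (%y. enn2real (F y k))"
      by (intro \<mu>.integrable_const_bound[where B = 1] AE_I2 borel_measurable_enn2real m) simp_all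
    have "ennreal (f \<mu> k) = (\<integral>\<^sup>+y. ennreal (enn2real (F y k)) \<partial>\<mu>)"
      unfolding f[OF \<mu>] by (rule nn_integral_eq_integral[symmetric, OF int]) simp
    then show "ennreal (f \<mu> k) = (\<integral>\<^sup>+y. F y k \<partial>\<mu>)" using fin by simp
    show "0 \<le> f \<mu> k" unfolding f[OF \<mu>] by (rule integral_nonneg_AE) simp
  qed
  note b = *[OF W.renewal.prob_B W.renewal.sets_B]
  have c: "ennreal (f (C i k) k) = (\<integral>\<^sup>+y. F y k \<partial>C i k)" "0 \<le> f (C i k) k" if "k \<in> UNIV - {i}" for k
  proof -
    have ik: "i \<noteq> k" using that by auto
    show "ennreal (f (C i k) k) = (\<integral>\<^sup>+y. F y k \<partial>C i k)" "0 \<le> f (C i k) k"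
      by (rule *[OF jump_laws(2)[OF ik] jump_laws(3)[OF ik]])+
  qed
  have q: "0 \<le> Q $ i $ k" if "k \<in> UNIV - {i}" for k using W.Q_nonneg that by auto
  have s: "0 \<le> (\<Sum>k\<in>UNIV - {i}. Q $ i $ k * f (C i k) k)" by (intro sum_nonneg mult_nonneg_nonneg q c)
  have l: "0 \<le> lam i * f (B i) i" using rates b by simp
  show "0 \<le> first_jump Q lam B C i f" unfolding first_jump_def using s l by simp
  have "ennreal (first_jump Q lam B C i f) = ennreal (lam i * f (B i) i) + ennreal (\<Sum>k\<in>UNIV - {i}. Q $ i $ k * f (C i k) k)"
    unfolding first_jump_def by (rule ennreal_plus[OF l s])
  also have "ennreal (\<Sum>k\<in>UNIV - {i}. Q $ i $ k * f (C i k) k) = (\<Sum>k\<in>UNIV - {i}. ennreal (Q $ i $ k * f (C i k) k))"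
    by (rule sum_ennreal[symmetric]) (intro mult_nonneg_nonneg q c)
  also have "\<dots> = (\<Sum>k\<in>UNIV - {i}. ennreal (Q $ i $ k) * (\<integral>\<^sup>+y. F y k \<partial>C i k))"
    by (intro sum.cong refl) (simp only: ennreal_mult[OF q c(2)] c(1))
  finally show "ennreal (first_jump Q lam B C i f) = W.jump_integral i F"
    unfolding W.jump_integral_def ennreal_mult[OF rates b(2)] b(1) .
qed

lemma jump_terms_le_1: "W.jump_minus l m k \<le> 1" "W.jump_tilde l m k \<le> 1" "W.jump_star l m k \<le> 1"
  unfolding W.jump_minus_def W.jump_tilde_def W.jump_star_def W.below_top_def
  using a(3) by (auto simp: indicator_def W.le_1 ennreal_le_1 of_bool_def intro!: mult_nonneg_nonneg)

lemma inner_mean: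
  assumes "\<And>y. 0 \<le> y ==> y \<le> K ==> ennreal (f y) = F y" "\<And>y. 0 \<le> f y"
  shows "indicat_real {0..K} y * f y = enn2real (W.below_top y * F y)"
  using assms(1)[of y, symmetric] assms(2)[of y] by (simp add: W.below_top_def indicator_def)

lemma empty_row_minus:
  "ennreal (first_jump Q lam B C i (%\<mu> k. LINT y:{0..K}|\<mu>. delta_minus P J Y T K y $ k $ l)) = W.jump_integral i (W.jump_minus l)"
  "0 \<le> first_jump Q lam B C i (%\<mu> k. LINT y:{0..K}|\<mu>. delta_minus P J Y T K y $ k $ l)"
proof -
  have "(LINT y:{0..K}|\<mu>. delta_minus P J Y T K y $ k $ l) = (LINT y|\<mu>. enn2real (W.jump_minus l y k))" for \<mu> k
    unfolding set_lebesgue_integral_def W.jump_minus_def real_scaleR_def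
    by (simp only: inner_mean[of "%y. delta_minus P J Y T K y $ k $ l" "%y. W.minus_mean l y k", OF delta_minus_mean matrix_nonneg(1)])
  note first_jump_mean[where F = "W.jump_minus l" and f = "%\<mu> k. LINT y:{0..K}|\<mu>. delta_minus P J Y T K y $ k $ l" and i = i, OF W.jump_terms_measurable(1) jump_terms_le_1(1) this]
  then show "ennreal (first_jump Q lam B C i (%\<mu> k. LINT y:{0..K}|\<mu>. delta_minus P J Y T K y $ k $ l)) = W.jump_integral i (W.jump_minus l)"
    "0 \<le> first_jump Q lam B C i (%\<mu> k. LINT y:{0..K}|\<mu>. delta_minus P J Y T K y $ k $ l)" by blast+
qed

lemma empty_row_star:
  "ennreal (first_jump Q lam B C i (%\<mu> k. LINT y:{0..K}|\<mu>. delta_star P J Y T K a1 y $ k $ l)) = W.jump_integral i (W.jump_star l)"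
  "0 \<le> first_jump Q lam B C i (%\<mu> k. LINT y:{0..K}|\<mu>. delta_star P J Y T K a1 y $ k $ l)"
proof -
  have "(LINT y:{0..K}|\<mu>. delta_star P J Y T K a1 y $ k $ l) = (LINT y|\<mu>. enn2real (W.jump_star l y k))" for \<mu> k
    unfolding set_lebesgue_integral_def W.jump_star_def real_scaleR_def
    by (simp only: inner_mean[of "%y. delta_star P J Y T K a1 y $ k $ l" "%y. W.star_mean a1 l y k", OF delta_star_mean matrix_nonneg(2)])
  note first_jump_mean[where F = "W.jump_star l" and f = "%\<mu> k. LINT y:{0..K}|\<mu>. delta_star P J Y T K a1 y $ k $ l" and i = i, OF W.jump_terms_measurable(3) jump_terms_le_1(3) this]
  then show "ennreal (first_jump Q lam B C i (%\<mu> k. LINT y:{0..K}|\<mu>. delta_star P J Y T K a1 y $ k $ l)) = W.jump_integral i (W.jump_star l)"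
    "0 \<le> first_jump Q lam B C i (%\<mu> k. LINT y:{0..K}|\<mu>. delta_star P J Y T K a1 y $ k $ l)" by blast+
qed

abbreviation "overflow \<mu> k l \<equiv> (LINT y:{0..K}|\<mu>. eta_tilde P J Y T K a3 (K - y) $ k $ l)
  + of_bool (k = l) * (LINT y:{K<..}|\<mu>. exp (- a3 * (y - K)))"

lemma empty_row_tilde:
  "ennreal (first_jump Q lam B C i (%\<mu> k. overflow \<mu> k l)) = W.jump_integral i (W.jump_tilde l)"
  "0 \<le> first_jump Q lam B C i (%\<mu> k. overflow \<mu> k l)"
proof -
  have ov: "overflow \<mu> k l = (LINT y|\<mu>. enn2real (W.jump_tilde l y k))" if \<mu>: "prob_space \<mu>" "sets \<mu> = sets borel" for \<mu> k
  proof -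
    interpret \<mu>: prob_space \<mu> by (rule \<mu>)
    let ?p = "%y. enn2real (W.below_top y * W.tilde_mean a3 l y k)" and ?q = "%y. indicat_real {K<..} y * exp (- a3 * (y - K))"
    have pm: "(%y. W.below_top y * W.tilde_mean a3 l y k) \<in> borel_measurable \<mu>"
      unfolding measurable_cong_sets[OF \<mu>(2) refl] W.below_top_def
      by (intro borel_measurable_times_ennreal W.means_measurable) measurable
    have qm: "?q \<in> borel_measurable \<mu>" unfolding measurable_cong_sets[OF \<mu>(2) refl] by measurable
    have fin: "W.below_top y * W.tilde_mean a3 l y k \<le> 1" for y
      using W.le_1(3)[of l y k] by (simp add: W.below_top_def indicator_def)
    have "?p y \<le> 1" for y using enn2real_mono[OF fin[of y]] by simp
    then have p: "integrable \<mu> ?p"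
      by (intro \<mu>.integrable_const_bound[where B = 1] AE_I2 borel_measurable_enn2real pm) simp_all
    have q: "integrable \<mu> ?q"
    proof (rule \<mu>.integrable_const_bound[where B = 1, OF AE_I2 qm])
      show "norm (?q y) \<le> 1" for y using a(3) by (auto simp: indicator_def intro!: mult_nonneg_nonneg)
    qed
    have pq: "(LINT y|\<mu>. ?p y + of_bool (k = l) * ?q y) = (LINT y|\<mu>. ?p y) + (LINT y|\<mu>. of_bool (k = l) * ?q y)"
      by (rule Bochner_Integration.integral_add[OF p]) (intro integrable_mult_right q)
    have "overflow \<mu> k l = (LINT y|\<mu>. ?p y) + of_bool (k = l) * (LINT y|\<mu>. ?q y)"
      unfolding set_lebesgue_integral_def real_scaleR_def
      by (simp only: inner_mean[of "%y. eta_tilde P J Y T K a3 (K - y) $ k $ l" "%y. W.tilde_mean a3 l y k", OF eta_tilde_mean matrix_nonneg(3)])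
    also have "\<dots> = (LINT y|\<mu>. ?p y + of_bool (k = l) * ?q y)"
      unfolding pq integral_mult_right_zero ..
    also have "\<dots> = (LINT y|\<mu>. enn2real (W.jump_tilde l y k))"
    proof (rule Bochner_Integration.integral_cong[OF refl])
      fix y
      \<comment> \<open>\<open>enn2real\<close> is additive on finite values only.\<close>
      have "W.below_top y * W.tilde_mean a3 l y k < \<top>" using fin[of y] by (rule le_less_trans) simp
      then show "?p y + of_bool (k = l) * ?q y = enn2real (W.jump_tilde l y k)"
        unfolding W.jump_tilde_def by (subst enn2real_plus) (auto simp: indicator_def ennreal_mult_less_top of_bool_def)
    qed
    finally show ?thesis .
  qed
  note first_jump_mean[where F = "W.jump_tilde l" and f = "%\<mu> k. overflow \<mu> k l" and i = i, OF W.jump_terms_measurable(2) jump_terms_le_1(2) ov]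
  then show "ennreal (first_jump Q lam B C i (%\<mu> k. overflow \<mu> k l)) = W.jump_integral i (W.jump_tilde l)"
    "0 \<le> first_jump Q lam B C i (%\<mu> k. overflow \<mu> k l)" by blast+
qed

end

text \<open>A kernel vector satisfies \<open>x = A *v x\<close>. At a coordinate of maximal modulus
  \<open>m\<close> this bounds \<open>m\<close> by the row sum times \<open>m\<close>, which forces
  \<open>m = 0\<close>.\<close>

lemma substochastic_invertible:
  fixes A :: "real^'n^'n"
  assumes nonneg: "\<And>i j. 0 \<le> A $ i $ j" and row: "\<And>i. (\<Sum>j\<in>UNIV. A $ i $ j) < 1"
  shows "invertible (mat 1 - A)"
proof -
  have "x = 0" if "(mat 1 - A) *v x = 0" for x
  proof -
    have "(mat 1 - A) *v x = x - A *v x"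
      by (simp add: matrix_vector_mult_diff_rdistrib)
    from trans[OF sym[OF this] that] have eq: "x = A *v x" by (rule iffD1[OF right_minus_eq])
    define m where "m = Max (range (%i. \<bar>x $ i\<bar>))"
    have le: "\<bar>x $ i\<bar> \<le> m" for i unfolding m_def by (intro Max_ge) auto
    have "m \<in> range (%i. \<bar>x $ i\<bar>)" unfolding m_def by (intro Max_in) auto
    then obtain i where i: "m = \<bar>x $ i\<bar>" by auto
    have "x $ i = (\<Sum>j\<in>UNIV. A $ i $ j * x $ j)"
      using arg_cong[OF eq, of "%v. v $ i"] by (simp add: matrix_vector_mult_def)
    then have "m \<le> (\<Sum>j\<in>UNIV. \<bar>A $ i $ j * x $ j\<bar>)" unfolding i by (simp only: sum_abs)
    also have "\<dots> \<le> (\<Sum>j\<in>UNIV. A $ i $ j * m)"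
      unfolding abs_mult abs_of_nonneg[OF nonneg] by (intro sum_mono mult_left_mono le nonneg)
    also have "\<dots> = (\<Sum>j\<in>UNIV. A $ i $ j) * m" by (simp only: sum_distrib_right)
    finally have m_le: "m \<le> (\<Sum>j\<in>UNIV. A $ i $ j) * m" .
    have "m \<le> 0"
    proof (rule ccontr)
      assume "\<not> m \<le> 0"
      then have "(\<Sum>j\<in>UNIV. A $ i $ j) * m < 1 * m" by (intro mult_strict_right_mono row) simp
      then show False using m_le by simp
    qed
    then have "x $ j = 0" for j using le[of j] by simp
    then show ?thesis by (simp add: vec_eq_iff)
  qed
  then have "\<exists>B. B ** (mat 1 - A) = mat 1" unfolding matrix_left_invertible_ker by blast
  then show ?thesis unfolding invertible_left_inverse .
qed

lemma sum_UNIV_Plus: "(\<Sum>r\<in>(UNIV :: ('d::finite + 'd) set). f r) = (\<Sum>l\<in>UNIV. f (Inl l)) + (\<Sum>l\<in>UNIV. f (Inr l))"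
proof -
  have "(\<Sum>r\<in>(UNIV :: ('d + 'd) set). f r) = (\<Sum>r\<in>UNIV <+> UNIV. f r)" by simp
  also have "\<dots> = (\<Sum>l\<in>UNIV. f (Inl l)) + (\<Sum>l\<in>UNIV. f (Inr l))"
    by (simp only: sum.Plus[OF finite finite] o_def)
  finally show ?thesis .
qed

section \<open>The linear system for the values at 0 and \<open>K\<close>\<close>

context reflected_input
begin

abbreviation "PT \<equiv> P_tilde P J Y T Q lam B C \<beta> K a2 a3"
abbreviation "BT \<equiv> b_tilde P J Y T Q lam B C \<beta> K a1 a2"
abbreviation "CT \<equiv> chi_tilde P J T V L a1 a2 a3"
abbreviation "jump_to_0 i l \<equiv> first_jump Q lam B C i (%\<mu> k. LINT y:{0..K}|\<mu>. delta_minus P J Y T K y $ k $ l)"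
abbreviation "jump_to_K i l \<equiv> first_jump Q lam B C i (%\<mu> k. overflow \<mu> k l)"
abbreviation "jump_kill i j \<equiv> first_jump Q lam B C i (%\<mu> k. LINT y:{0..K}|\<mu>. delta_star P J Y T K a1 y $ k $ j)"

lemma entries:
  "PT $ Inl i $ Inl l = 1 / (W.total_rate i + a2) * jump_to_0 i l"
  "PT $ Inl i $ Inr l = 1 / (W.total_rate i + a2) * jump_to_K i l"
  "PT $ Inr i $ Inl l = delta_minus P J Y T K K $ i $ l"
  "PT $ Inr i $ Inr l = eta_tilde P J Y T K a3 0 $ i $ l"
  "BT $ Inl i $ j = 1 / (W.total_rate i + a2) * (\<beta> * of_bool (i = j) + jump_kill i j)"
  "BT $ Inr i $ j = delta_star P J Y T K a1 K $ i $ j"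
  unfolding P_tilde_def b_tilde_def W.total_rate_def by simp_all

lemma K_range: "0 \<le> (0 :: real)" "0 \<le> K" "K \<le> K"
  using K by auto

lemma total_pos: "0 < W.total_rate i + a2" "0 \<le> 1 / (W.total_rate i + a2)"
  using W.out_rate(3)[of i] a(2) by (auto intro: add_pos_nonneg)

lemma jump_row:
  "CT 0 $ i $ j = 1 / (W.total_rate i + a2) * (\<beta> * of_bool (i = j) + (\<Sum>l\<in>UNIV. jump_to_0 i l * CT 0 $ l $ j)
    + (\<Sum>l\<in>UNIV. jump_to_K i l * CT K $ l $ j) + jump_kill i j)"
  (is "?c = ?q * (?b + ?d + ?e + ?f)")
proof -
  have b: "0 \<le> ?b" using \<beta> by simp
  have d: "0 \<le> ?d" and e: "0 \<le> ?e"
    by (intro sum_nonneg mult_nonneg_nonneg empty_row_minus(2) empty_row_tilde(2) matrix_nonneg)+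
  have f: "0 \<le> ?f" by (rule empty_row_star(2))
  have s: "0 \<le> ?b + ?d + ?e + ?f" by (intro add_nonneg_nonneg b d e f)
  have B: "ennreal ?b = ennreal \<beta> * of_bool (i = j)"
    using \<beta> by (cases "i = j") simp_all
  have D: "ennreal ?d = (\<Sum>l\<in>UNIV. W.chi_mean a1 a2 a3 j 0 l * W.jump_integral i (W.jump_minus l))"
    unfolding ennreal_dot[of "%l. jump_to_0 i l" "%l. CT 0 $ l $ j", OF empty_row_minus(2) matrix_nonneg(5)]
      empty_row_minus(1) chi_tilde_mean[OF K_range(1,2)] ..
  have E: "ennreal ?e = (\<Sum>l\<in>UNIV. W.chi_mean a1 a2 a3 j K l * W.jump_integral i (W.jump_tilde l))"
    unfolding ennreal_dot[of "%l. jump_to_K i l" "%l. CT K $ l $ j", OF empty_row_tilde(2) matrix_nonneg(5)]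
      empty_row_tilde(1) chi_tilde_mean[OF K_range(2,3)] ..
  have c: "0 \<le> ?c" by (rule matrix_nonneg)
  have "ennreal (?q * (?b + ?d + ?e + ?f)) = ennreal ?c"
    unfolding ennreal_mult[OF total_pos(2)[of i] s] ennreal_plus[OF add_nonneg_nonneg[OF add_nonneg_nonneg[OF b d] e] f]
      ennreal_plus[OF add_nonneg_nonneg[OF b d] e] ennreal_plus[OF b d] B D E empty_row_star(1) chi_tilde_mean[OF K_range(1,2)]
    by (rule W.empty_state[symmetric])
  from iffD1[OF ennreal_inj[OF mult_nonneg_nonneg[OF total_pos(2)[of i] s] c] this] show ?thesis by (rule sym)
qed

lemma invertible_P: "invertible (mat 1 - PT)"
proof (rule substochastic_invertible)
  fix row col :: "'d + 'd"
  show "0 \<le> PT $ row $ col"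
    by (cases row; cases col; simp only: entries; intro mult_nonneg_nonneg total_pos empty_row_minus(2) empty_row_tilde(2) matrix_nonneg)
  show "(\<Sum>col\<in>UNIV. PT $ row $ col) < 1"
  proof (cases row)
    case (Inl i)
    let ?d = "\<Sum>l\<in>UNIV. jump_to_0 i l" and ?e = "\<Sum>l\<in>UNIV. jump_to_K i l"
    have n: "0 \<le> ?d" "0 \<le> ?e" by (intro sum_nonneg empty_row_minus(2) empty_row_tilde(2))+
    have "ennreal (?d + ?e) = (\<Sum>l\<in>UNIV. ennreal (jump_to_0 i l)) + (\<Sum>l\<in>UNIV. ennreal (jump_to_K i l))"
      unfolding ennreal_plus[OF n] by (intro arg_cong2[where f = "(+)"] sum_ennreal[symmetric] empty_row_minus(2) empty_row_tilde(2))
    also have "\<dots> \<le> ennreal (W.out_rate i)"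
      unfolding empty_row_minus(1) empty_row_tilde(1) by (rule W.empty_exit_sum)
    finally have "?d + ?e \<le> W.out_rate i" using W.out_rate(1)[of i] by (simp only: ennreal_le_iff)
    \<comment> \<open>Strict because \<open>total_rate i\<close> exceeds \<open>out_rate i\<close>
      by the positive killing rate.\<close>
    then have "?d + ?e < W.total_rate i + a2" using W.out_rate(4)[of i] a(2) by linarith
    moreover have "1 / t * s < 1" if "s < t" "0 < t" for s t :: real using that by simp
    ultimately have "1 / (W.total_rate i + a2) * (?d + ?e) < 1" using total_pos(1)[of i] by blast
    then show ?thesis unfolding Inl sum_UNIV_Plus entries by (simp only: sum_distrib_left distrib_left)
  next
    case (Inr i)
    let ?d = "\<Sum>l\<in>UNIV. delta_minus P J Y T K K $ i $ l" and ?e = "\<Sum>l\<in>UNIV. eta_tilde P J Y T K a3 0 $ i $ l"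
    have n: "0 \<le> ?d" "0 \<le> ?e" by (intro sum_nonneg matrix_nonneg)+
    have "ennreal (?d + ?e) = (\<Sum>l\<in>UNIV. ennreal (delta_minus P J Y T K K $ i $ l)) + (\<Sum>l\<in>UNIV. ennreal (eta_tilde P J Y T K a3 (K - K) $ i $ l))"
      unfolding ennreal_plus[OF n] diff_self by (intro arg_cong2[where f = "(+)"] sum_ennreal[symmetric] matrix_nonneg)
    also have "\<dots> < 1"
      unfolding delta_minus_mean[OF K_range(2,3)] eta_tilde_mean[OF K_range(2,3)] using W.exit_sum_top[of i] by (simp only: W.exit_sum_def)
    finally have "?d + ?e < 1" using n by (simp only: ennreal_less_one_iff)
    then show ?thesis unfolding Inr sum_UNIV_Plus entries .
  qed
qed

text \<open>The rows of level 0 are \<open>jump_row\<close>, those of level \<open>K\<close> are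
  \<open>chi_decomposition\<close> at \<open>K\<close>; together they form a fixed point equation
  that the inverse solves.\<close>

lemma stack_solution: "stack (CT 0) (CT K) = matrix_inv (mat 1 - PT) ** BT"
proof -
  let ?X = "stack (CT 0) (CT K)" and ?M = "mat 1 - PT"
  have X: "?X $ Inl i $ j = CT 0 $ i $ j" "?X $ Inr i $ j = CT K $ i $ j" for i j
    by (simp_all add: stack_def)
  have eq: "?X = PT ** ?X + BT"
    unfolding vec_eq_iff
  proof (intro allI)
    fix row j
    have prod: "(PT ** ?X + BT) $ row $ j = (\<Sum>l\<in>UNIV. PT $ row $ Inl l * CT 0 $ l $ j) + (\<Sum>l\<in>UNIV. PT $ row $ Inr l * CT K $ l $ j) + BT $ row $ j"
      by (simp add: matrix_matrix_mult_def sum_UNIV_Plus X)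
    show "?X $ row $ j = (PT ** ?X + BT) $ row $ j"
    proof (cases row)
      case (Inl i)
      show ?thesis unfolding prod unfolding Inl X entries jump_row[of i j]
        by (simp only: sum_distrib_left distrib_left mult.assoc add_ac)
    next
      case (Inr i)
      have "CT K $ i $ j = (\<Sum>l\<in>UNIV. delta_minus P J Y T K K $ i $ l * CT 0 $ l $ j)
          + (\<Sum>l\<in>UNIV. eta_tilde P J Y T K a3 0 $ i $ l * CT K $ l $ j) + delta_star P J Y T K a1 K $ i $ j"
        using arg_cong[OF chi_decomposition[OF K_range(2,3)], of "%A. A $ i $ j"] by (simp add: matrix_matrix_mult_def)
      then show ?thesis unfolding prod unfolding Inr X entries .
    qed
  qed
  have m: "?M ** ?X = ?X - PT ** ?X"
  proof -
    have "?M ** ?X = mat 1 ** ?X - PT ** ?X"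
      unfolding vec_eq_iff matrix_matrix_mult_def by (simp add: left_diff_distrib sum_subtractf)
    then show ?thesis by simp
  qed
  have "BT = ?X - PT ** ?X"
    unfolding eq_diff_eq add.commute[of BT] by (rule eq[symmetric])
  with m have MX: "?M ** ?X = BT" by (rule trans[OF _ sym])
  \<comment> \<open>\<open>matrix_inv\<close> is a choice among two-sided inverses, and
    \<open>invertible_P\<close> provides one.\<close>
  have "matrix_inv ?M ** ?M = mat 1"
    using invertible_P unfolding invertible_def matrix_inv_def by (rule someI2_ex) blast
  then have "?X = (matrix_inv ?M ** ?M) ** ?X" by simp
  also have "\<dots> = matrix_inv ?M ** BT" unfolding matrix_mul_assoc[symmetric] MX ..
  finally show ?thesis .
qed

end

theorem proposition2:
  fixes P :: "'d::finite \<Rightarrow> 'a measure" and Q :: "real^'d^'d"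
    and lam r :: "'d \<Rightarrow> real" and B :: "'d \<Rightarrow> real measure" and C :: "'d \<Rightarrow> 'd \<Rightarrow> real measure"
    and Z :: "nat \<Rightarrow> 'a \<Rightarrow> 'd" and S :: "nat \<Rightarrow> 'a \<Rightarrow> ennreal"
    and G :: "'d \<Rightarrow> nat \<Rightarrow> 'a \<Rightarrow> ennreal" and b :: "'d \<Rightarrow> nat \<Rightarrow> 'a \<Rightarrow> real"
    and c :: "'d \<Rightarrow> 'd \<Rightarrow> nat \<Rightarrow> 'a \<Rightarrow> real" and T :: "'a \<Rightarrow> real"
    and J :: "real \<Rightarrow> 'a \<Rightarrow> 'd" and Y :: "real \<Rightarrow> 'a \<Rightarrow> real"
    and V R L :: "real \<Rightarrow> 'a \<Rightarrow> real \<Rightarrow> real"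
    and K \<alpha>\<^sub>1 \<alpha>\<^sub>2 \<alpha>\<^sub>3 \<beta> x :: real
  assumes gen: "generator Q"
    and rates: "\<And>i. 0 \<le> lam i"
    and drifts: "\<And>i. r i < 0"
    and input: "\<And>i. modulated_input (P i) Q lam B C \<beta> i Z S G b c T"
    and J_eq: "J = chain_process Z S"
    and Y_eq: "Y = modulated_process Z S (\<lambda>k. compound_poisson (r k) (G k) (b k)) c"
    and reflection: "\<And>i v \<omega>. v \<in> {0..K} \<Longrightarrow> \<omega> \<in> space (P i) \<Longrightarrow>
      double_reflection K (\<lambda>t. v + Y t \<omega>) (V v \<omega>) (R v \<omega>) (L v \<omega>)"
    and K: "0 < K"
    and \<alpha>: "0 \<le> \<alpha>\<^sub>1" "0 \<le> \<alpha>\<^sub>2" "0 \<le> \<alpha>\<^sub>3"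
    and \<beta>: "0 < \<beta>"
    and x: "x \<in> {0..K}"
  shows "chi_tilde P J T V L \<alpha>\<^sub>1 \<alpha>\<^sub>2 \<alpha>\<^sub>3 x =
        delta_minus P J Y T K x ** chi_tilde P J T V L \<alpha>\<^sub>1 \<alpha>\<^sub>2 \<alpha>\<^sub>3 0
        + eta_tilde P J Y T K \<alpha>\<^sub>3 (K - x) ** chi_tilde P J T V L \<alpha>\<^sub>1 \<alpha>\<^sub>2 \<alpha>\<^sub>3 K
        + delta_star P J Y T K \<alpha>\<^sub>1 x
    \<and> (\<forall>u\<in>{0..K}. eta_tilde P J Y T K \<alpha>\<^sub>3 u =
        eta P J Y T \<alpha>\<^sub>3 u - delta_minus P J Y T K (K - u) ** eta P J Y T \<alpha>\<^sub>3 K)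
    \<and> invertible (mat 1 - P_tilde P J Y T Q lam B C \<beta> K \<alpha>\<^sub>2 \<alpha>\<^sub>3)
    \<and> stack (chi_tilde P J T V L \<alpha>\<^sub>1 \<alpha>\<^sub>2 \<alpha>\<^sub>3 0) (chi_tilde P J T V L \<alpha>\<^sub>1 \<alpha>\<^sub>2 \<alpha>\<^sub>3 K) =
        matrix_inv (mat 1 - P_tilde P J Y T Q lam B C \<beta> K \<alpha>\<^sub>2 \<alpha>\<^sub>3)
          ** b_tilde P J Y T Q lam B C \<beta> K \<alpha>\<^sub>1 \<alpha>\<^sub>2"
proof -
  interpret reflected_input P Q lam r B C Z S G b c T J Y V R L K \<alpha>\<^sub>1 \<alpha>\<^sub>2 \<alpha>\<^sub>3 \<beta>
    by (intro reflected_input.intro assms)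
  show ?thesis
    using x by (intro conjI ballI chi_decomposition eta_tilde_decomposition invertible_P stack_solution) auto
qed

end
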